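(* Let $(T,\mathcal T,\lambda)$ be a complete atomless probability space and $\mathcal F$ a countably generated sub-$\sigma$-algebra of $\mathcal T$. Consider either of the following two cases. Bochner case: $X$ is an infinite-dimensional separable Banach space whose dual $X^*$ has the Radon–Nikodým property. Gel'fand case: $X=Y^*$ is the norm dual of an infinite-dimensional separable Banach space $Y$. In each case, with large games and Nash equilibria understood as defined in the context for that case, the following statements are equivalent: (1) $\mathcal T$ is nowhere equivalent to $\mathcal F$ under $\lambda$. (2) A Nash equilibrium exists for any large game.
   Context: Nowhere equivalence: $\mathcal T$ is nowhere equivalent to $\mathcal F$ (under $\lambda$) if for every $D\in\mathcal T$ with $\lambda(D)>0$ there is a $\mathcal T$-measurable set $D_0\subseteq D$ such that $\lambda(D_0\triangle D_1)>0$ for every $D_1\in\mathcal F^D:=\{D\cap D':D'\in\mathcal F\}$. Large game (over the fixed player space $(T,\mathcal T,\lambda)$, sub-$\sigma$-algebra $\mathcal F$ and space $X$). It consists of a nonempty common action set $A\subseteq X$ and a payoff assignment $G$, as follows. In the Bochner case, $A$ is weakly compact and carries the weak topology; $\overline{co}(A)$ is the weak closure of the convex hull of $A$; $\Gamma$ is the set of all $\mathcal F$-measurable mappings from $T$ to $\overline{co}(A)$ (modulo $\lambda$-a.e. equality), viewed as a subset of $L_1^{\mathcal F}(T,X)$ (the Banach space of $\mathcal F$-measurable Bochner integrable mappings) with the weak topology; conditional expectations are Bochner conditional expectations. In the Gel'fand case, $A$ is weak$^*$ compact and carries the weak$^*$ topology; $\overline{co}(A)$ is the weak$^*$ closure of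 the convex hull of $A$; $\Gamma$ is the set of all (weak$^*$) $\mathcal F$-measurable mappings from $T$ to $\overline{co}(A)$ (modulo $\lambda$-a.e. equality), viewed as a subset of $L_\infty^{\mathcal F}(T,Y^* )$ with the weak$^*$ topology, i.e. the topology induced by the functionals $\gamma\mapsto\int_T\gamma(t)(\varphi(t))\,d\lambda(t)$, $\varphi\in L_1^{\mathcal F}(T,Y)$; conditional expectations are Gel'fand conditional expectations. In both cases, $\mathcal U$ is the set of continuous real-valued mappings on $A\times\Gamma$ with the supremum norm topology, and $G$ is an $\mathcal F$-measurable mapping from $T$ to $\mathcal U$. A strategy profile is a $\mathcal T$-measurable mapping $g:T\to A$; the payoff of player $t$ is $G(t)(g(t),E(g|\mathcal F))$. A Nash equilibrium of $G$ is a $\mathcal T$-measurable mapping $g:T\to A$ such that for $\lambda$-almost all $t\in T$, $G(t)(g(t),E(g|\mathcal F))\ge G(t)(a,E(g|\mathcal F))$ for every $a\in A$. Conditional expectations: for Bochner integrable $f:T\to X$, the Bochner conditional expectation $E(f|\mathcal F)$ is the $\mathcal F$-measurable Bochner integrable $h$ with $\int_D f\,d\lambda=\int_D h\,d\lambda$ for all $D\in\mathcal F$. A mapping $f:T\to Y^*$ is Gel'fand integrable if $t\mapsto f(t)(y)$ is integrable for each $y\in Y$; its Gel'fand integral over $D$ is the functional $y\mapsto\int_D f(t)(y)\,d\lambda(t)$, and its Gel'fand conditional expectation $E(f|\mathcal F)$ is the $\mathcal F$-measurable Gel'fand integrable $h:T\to Y^*$ with the same Gel'fand integrals as $f$ over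 all $D\in\mathcal F$. *)

theory Defs
  imports "HOL-Probability.Probability"
begin

section \<open>Probability spaces and sub-\<open>\<sigma>\<close>-algebras\<close>

definition atomless :: "'t measure \<Rightarrow> bool" where
  "atomless M \<longleftrightarrow> (\<forall>D\<in>sets M. measure M D > 0 \<longrightarrow>
     (\<exists>E\<in>sets M. E \<subseteq> D \<and> 0 < measure M E \<and> measure M E < measure M D))"

definition countably_generated :: "'t measure \<Rightarrow> bool" where
  "countably_generated F \<longleftrightarrow>
     (\<exists>C. countable C \<and> C \<subseteq> Pow (space F) \<and> sets F = sigma_sets (space F) C)"

text \<open>As in \<^const>\<open>subalgebra\<close>, only the space and the measurable sets of the second argument
  matter; the measure on it is always the restriction \<^term>\<open>restr_to_subalg M F\<close>.\<close>

definition nowhere_equivalent :: "'t measure \<Rightarrow> 't measure \<Rightarrow> bool" where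
  "nowhere_equivalent M F \<longleftrightarrow> (\<forall>D\<in>sets M. measure M D > 0 \<longrightarrow>
     (\<exists>D\<^sub>0\<in>sets M. D\<^sub>0 \<subseteq> D \<and>
        (\<forall>D\<^sub>1\<in>{D \<inter> D' |D'. D' \<in> sets F}. measure M (sym_diff D\<^sub>0 D\<^sub>1) > 0)))"


section \<open>Banach spaces\<close>

definition infinite_dimensional :: "'x::real_vector itself \<Rightarrow> bool" where
  "infinite_dimensional _ \<longleftrightarrow> \<not> (\<exists>B::'x set. finite B \<and> span B = UNIV)"

text \<open>The library's \<^const>\<open>has_bochner_integral\<close> is restricted to second countable spaces. The
  following is the same definition without this restriction; it is needed because the dual of a
  separable space need not be separable. The approximation by simple functions makes the integrand
  strongly measurable.\<close>

definition has_bochner_integral_banach ::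
    "'a measure \<Rightarrow> ('a \<Rightarrow> 'z) \<Rightarrow> 'z::banach \<Rightarrow> bool" where
  "has_bochner_integral_banach \<mu> f z \<longleftrightarrow> f \<in> borel_measurable \<mu> \<and>
     (\<exists>s. (\<forall>i. Bochner_Integration.simple_bochner_integrable \<mu> (s i)) \<and>
          (\<lambda>i. \<integral>\<^sup>+x. norm (f x - s i x) \<partial>\<mu>) \<longlonglongrightarrow> 0 \<and>
          (\<lambda>i::nat. Bochner_Integration.simple_bochner_integral \<mu> (s i)) \<longlonglongrightarrow> z)"

lemma has_bochner_integral_banach_iff:
  fixes f :: "'a \<Rightarrow> 'z::{banach, second_countable_topology}"
  shows "has_bochner_integral_banach \<mu> f z \<longleftrightarrow> has_bochner_integral \<mu> f z"
  unfolding has_bochner_integral_banach_def has_bochner_integral.simps by auto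

definition vector_measure :: "'a measure \<Rightarrow> ('a set \<Rightarrow> 'z::real_normed_vector) \<Rightarrow> bool" where
  "vector_measure \<mu> \<nu> \<longleftrightarrow> (\<forall>A::nat \<Rightarrow> 'a set. range A \<subseteq> sets \<mu> \<longrightarrow> disjoint_family A \<longrightarrow>
     (\<lambda>n. \<nu> (A n)) sums \<nu> (\<Union>n. A n))"

definition bounded_variation :: "'a measure \<Rightarrow> ('a set \<Rightarrow> 'z::real_normed_vector) \<Rightarrow> bool" where
  "bounded_variation \<mu> \<nu> \<longleftrightarrow> (\<exists>K::real. \<forall>P. finite P \<longrightarrow> P \<subseteq> sets \<mu> \<longrightarrow> disjoint P \<longrightarrow>
     (\<Sum>E\<in>P. norm (\<nu> E)) \<le> K)"

text \<open>The finite measure spaces range over all those whose points are real numbers, with arbitrary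
  \<open>\<sigma>\<close>-algebras: one cannot quantify over types, and the property for Lebesgue measure on the unit
  interval already gives it for every finite measure space.\<close>

definition radon_nikodym_property :: "'z::banach itself \<Rightarrow> bool" where
  "radon_nikodym_property _ \<longleftrightarrow>
     (\<forall>(\<mu>::real measure) (\<nu>::real set \<Rightarrow> 'z).
        finite_measure \<mu> \<longrightarrow> vector_measure \<mu> \<nu> \<longrightarrow> bounded_variation \<mu> \<nu> \<longrightarrow>
        (\<forall>E\<in>null_sets \<mu>. \<nu> E = 0) \<longrightarrow>
        (\<exists>g. \<forall>E\<in>sets \<mu>. has_bochner_integral_banach \<mu> (\<lambda>x. indicator E x *\<^sub>R g x) (\<nu> E)))"

definition initial_topology :: "'p set \<Rightarrow> ('p \<Rightarrow> real) set \<Rightarrow> 'p topology" where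
  "initial_topology S \<Phi> = topology_generated_by {{p\<in>S. \<phi> p \<in> U} |\<phi> U. \<phi> \<in> \<Phi> \<and> open U}"

definition weak_topology :: "'x::real_normed_vector topology" where
  "weak_topology = initial_topology UNIV (range (blinfun_apply :: ('x \<Rightarrow>\<^sub>L real) \<Rightarrow> 'x \<Rightarrow> real))"

text \<open>For real functionals the strong operator topology is pointwise convergence, which is the
  weak* topology.\<close>

abbreviation weak_star_topology :: "('y::real_normed_vector \<Rightarrow>\<^sub>L real) topology" where
  "weak_star_topology \<equiv> strong_operator_topology"

definition borel_of :: "'p topology \<Rightarrow> 'p measure" where
  "borel_of X = sigma (topspace X) {U. openin X U}"


section \<open>Games with payoffs depending on the own action and an aggregate\<close>

text \<open>Here \<open>XA\<close> is the action space, \<open>X\<Gamma>\<close> the topological space of aggregates, and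
  \<open>E\<close> the aggregation operator. All spaces of the form \<open>A \<times> \<Gamma>\<close> below are compact, so
  boundedness, which \<^const>\<open>cfunspace\<close> includes, holds for all continuous functions.
  The metric of \<^const>\<open>cfunspace\<close> is the supremum distance.\<close>

definition payoff_functions :: "'p topology \<Rightarrow> 'c topology \<Rightarrow> ('p \<times> 'c \<Rightarrow> real) metric" where
  "payoff_functions XA X\<Gamma> = cfunspace (prod_topology XA X\<Gamma>) euclidean_metric"

definition payoff_assignment ::
    "'t measure \<Rightarrow> 'p topology \<Rightarrow> 'c topology \<Rightarrow> ('t \<Rightarrow> 'p \<times> 'c \<Rightarrow> real) \<Rightarrow> bool" where
  "payoff_assignment F XA X\<Gamma> G \<longleftrightarrow>
     G \<in> F \<rightarrow>\<^sub>M borel_of (mtopology_of (payoff_functions XA X\<Gamma>))"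

definition nash_equilibrium ::
    "'t measure \<Rightarrow> 'p topology \<Rightarrow> (('t \<Rightarrow> 'p) \<Rightarrow> 'c) \<Rightarrow> ('t \<Rightarrow> 'p \<times> 'c \<Rightarrow> real) \<Rightarrow> ('t \<Rightarrow> 'p) \<Rightarrow> bool" where
  "nash_equilibrium M XA E G g \<longleftrightarrow>
     g \<in> M \<rightarrow>\<^sub>M borel_of XA \<and>
     (AE t in M. \<forall>a\<in>topspace XA. G t (g t, E g) \<ge> G t (a, E g))"


section \<open>The Bochner case\<close>

text \<open>Elements of \<open>L\<^sub>1\<close> are equivalence classes, represented as sets of functions.\<close>

definition L1_class :: "'t measure \<Rightarrow> ('t \<Rightarrow> 'x::{banach, second_countable_topology}) \<Rightarrow> ('t \<Rightarrow> 'x) set" where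
  "L1_class N f = {h. integrable N h \<and> (AE t in N. h t = f t)}"

definition L1_space :: "'t measure \<Rightarrow> ('t \<Rightarrow> 'x::{banach, second_countable_topology}) set set" where
  "L1_space N = {L1_class N f |f. integrable N f}"

text \<open>The norm dual of \<open>L\<^sub>1\<close>, as bounded linear functionals of representatives; boundedness
  makes them constant on every class.\<close>

definition L1_dual :: "'t measure \<Rightarrow> (('t \<Rightarrow> 'x::{banach, second_countable_topology}) \<Rightarrow> real) set" where
  "L1_dual N = {\<Phi>.
     (\<forall>f h. integrable N f \<longrightarrow> integrable N h \<longrightarrow> \<Phi> (\<lambda>t. f t + h t) = \<Phi> f + \<Phi> h) \<and>
     (\<forall>r f. integrable N f \<longrightarrow> \<Phi> (\<lambda>t. r *\<^sub>R f t) = r * \<Phi> f) \<and>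
     (\<exists>K. \<forall>f. integrable N f \<longrightarrow> \<bar>\<Phi> f\<bar> \<le> K * (LINT t|N. norm (f t)))}"

lemma L1_dual_constant_on_class:
  assumes \<Phi>: "\<Phi> \<in> L1_dual N" and f: "integrable N f" and h: "h \<in> L1_class N f"
  shows "\<Phi> h = \<Phi> f"
proof -
  have h': "integrable N h" "AE t in N. h t = f t"
    using h by (auto simp: L1_class_def)
  have m: "integrable N (\<lambda>t. (-1) *\<^sub>R f t)"
    using f by simp
  have d: "integrable N (\<lambda>t. h t + (-1) *\<^sub>R f t)"
    using h'(1) f by simp
  obtain K where K: "\<And>f. integrable N f \<Longrightarrow> \<bar>\<Phi> f\<bar> \<le> K * (LINT t|N. norm (f t))"
    using \<Phi> unfolding L1_dual_def by blast
  have "(LINT t|N. norm (h t + (-1) *\<^sub>R f t)) = (LINT t|N. 0)"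
    using h' d f by (intro integral_cong_AE) auto
  then have "\<Phi> (\<lambda>t. h t + (-1) *\<^sub>R f t) = 0"
    using K[OF d] by simp
  moreover have "\<Phi> (\<lambda>t. h t + (-1) *\<^sub>R f t) = \<Phi> h + \<Phi> (\<lambda>t. (-1) *\<^sub>R f t)"
    using \<Phi> h'(1) m unfolding L1_dual_def by blast
  moreover have "\<Phi> (\<lambda>t. (-1) *\<^sub>R f t) = -1 * \<Phi> f"
    using \<Phi> f unfolding L1_dual_def by blast
  ultimately show ?thesis by simp
qed

definition L1_weak_topology ::
    "'t measure \<Rightarrow> ('t \<Rightarrow> 'x::{banach, second_countable_topology}) set topology" where
  "L1_weak_topology N = initial_topology (L1_space N) {\<lambda>c. \<Phi> (SOME f. f \<in> c) |\<Phi>. \<Phi> \<in> L1_dual N}"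

text \<open>The set of all versions of the conditional expectation, which is an element of
  \<open>L\<^sub>1\<close> over the sub-\<open>\<sigma>\<close>-algebra.\<close>

definition bochner_cond_exp ::
    "'t measure \<Rightarrow> 't measure \<Rightarrow> ('t \<Rightarrow> 'x::{banach, second_countable_topology}) \<Rightarrow> ('t \<Rightarrow> 'x) set" where
  "bochner_cond_exp M F f = {h. integrable (restr_to_subalg M F) h \<and>
     (\<forall>D\<in>sets F. (LINT t:D|M. f t) = (LINT t:D|M. h t))}"

definition bochner_actions :: "'x::real_normed_vector set \<Rightarrow> 'x topology" where
  "bochner_actions A = subtopology weak_topology A"

definition bochner_aggregates ::
    "'t measure \<Rightarrow> 't measure \<Rightarrow> 'x::{banach, second_countable_topology} set \<Rightarrow> ('t \<Rightarrow> 'x) set topology" where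
  "bochner_aggregates M F A = subtopology (L1_weak_topology (restr_to_subalg M F))
     {c \<in> L1_space (restr_to_subalg M F).
        \<exists>\<gamma>\<in>c. \<gamma> \<in> space M \<rightarrow> weak_topology closure_of (convex hull A)}"

definition bochner_large_game ::
    "'t measure \<Rightarrow> 't measure \<Rightarrow> 'x::{banach, second_countable_topology} set \<Rightarrow>
     ('t \<Rightarrow> 'x \<times> ('t \<Rightarrow> 'x) set \<Rightarrow> real) \<Rightarrow> bool" where
  "bochner_large_game M F A G \<longleftrightarrow> A \<noteq> {} \<and> compactin weak_topology A \<and>
     payoff_assignment F (bochner_actions A) (bochner_aggregates M F A) G"

definition bochner_nash_equilibrium ::
    "'t measure \<Rightarrow> 't measure \<Rightarrow> 'x::{banach, second_countable_topology} set \<Rightarrow>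
     ('t \<Rightarrow> 'x \<times> ('t \<Rightarrow> 'x) set \<Rightarrow> real) \<Rightarrow> ('t \<Rightarrow> 'x) \<Rightarrow> bool" where
  "bochner_nash_equilibrium M F A =
     nash_equilibrium M (bochner_actions A) (bochner_cond_exp M F)"


section \<open>The Gel'fand case\<close>

definition weak_star_measurable ::
    "'t measure \<Rightarrow> ('t \<Rightarrow> 'y::{banach, second_countable_topology} \<Rightarrow>\<^sub>L real) \<Rightarrow> bool" where
  "weak_star_measurable N f \<longleftrightarrow> (\<forall>y. (\<lambda>t. blinfun_apply (f t) y) \<in> borel_measurable N)"

definition gelfand_integrable ::
    "'t measure \<Rightarrow> ('t \<Rightarrow> 'y::{banach, second_countable_topology} \<Rightarrow>\<^sub>L real) \<Rightarrow> bool" where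
  "gelfand_integrable N f \<longleftrightarrow> (\<forall>y. integrable N (\<lambda>t. blinfun_apply (f t) y))"

definition gelfand_integral ::
    "'t measure \<Rightarrow> 't set \<Rightarrow> ('t \<Rightarrow> 'y::{banach, second_countable_topology} \<Rightarrow>\<^sub>L real) \<Rightarrow> 'y \<Rightarrow> real" where
  "gelfand_integral M D f = (\<lambda>y. LINT t:D|M. blinfun_apply (f t) y)"

definition Linf_star_class ::
    "'t measure \<Rightarrow> ('t \<Rightarrow> 'y::{banach, second_countable_topology} \<Rightarrow>\<^sub>L real) \<Rightarrow> ('t \<Rightarrow> 'y \<Rightarrow>\<^sub>L real) set" where
  "Linf_star_class N f = {h. weak_star_measurable N h \<and> (AE t in N. h t = f t)}"

definition Linf_star_space ::
    "'t measure \<Rightarrow> ('t \<Rightarrow> 'y::{banach, second_countable_topology} \<Rightarrow>\<^sub>L real) set set" where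
  "Linf_star_space N = {Linf_star_class N f |f.
     weak_star_measurable N f \<and> (\<exists>K. AE t in N. norm (f t) \<le> K)}"

definition Linf_weak_star_topology ::
    "'t measure \<Rightarrow> ('t \<Rightarrow> 'y::{banach, second_countable_topology} \<Rightarrow>\<^sub>L real) set topology" where
  "Linf_weak_star_topology N = initial_topology (Linf_star_space N)
     {\<lambda>c. LINT t|N. blinfun_apply ((SOME f. f \<in> c) t) (\<phi> t) |\<phi>::'t \<Rightarrow> 'y. integrable N \<phi>}"

text \<open>Again the set of all versions.\<close>

definition gelfand_cond_exp ::
    "'t measure \<Rightarrow> 't measure \<Rightarrow> ('t \<Rightarrow> 'y::{banach, second_countable_topology} \<Rightarrow>\<^sub>L real) \<Rightarrow>
     ('t \<Rightarrow> 'y \<Rightarrow>\<^sub>L real) set" where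
  "gelfand_cond_exp M F f = {h. gelfand_integrable (restr_to_subalg M F) h \<and>
     (\<forall>D\<in>sets F. gelfand_integral M D f = gelfand_integral M D h)}"

definition gelfand_actions :: "('y::real_normed_vector \<Rightarrow>\<^sub>L real) set \<Rightarrow> ('y \<Rightarrow>\<^sub>L real) topology" where
  "gelfand_actions A = subtopology weak_star_topology A"

definition gelfand_aggregates ::
    "'t measure \<Rightarrow> 't measure \<Rightarrow> ('y::{banach, second_countable_topology} \<Rightarrow>\<^sub>L real) set \<Rightarrow>
     ('t \<Rightarrow> 'y \<Rightarrow>\<^sub>L real) set topology" where
  "gelfand_aggregates M F A = subtopology (Linf_weak_star_topology (restr_to_subalg M F))
     {c \<in> Linf_star_space (restr_to_subalg M F).
        \<exists>\<gamma>\<in>c. \<gamma> \<in> space M \<rightarrow> weak_star_topology closure_of (convex hull A)}"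

definition gelfand_large_game ::
    "'t measure \<Rightarrow> 't measure \<Rightarrow> ('y::{banach, second_countable_topology} \<Rightarrow>\<^sub>L real) set \<Rightarrow>
     ('t \<Rightarrow> ('y \<Rightarrow>\<^sub>L real) \<times> ('t \<Rightarrow> 'y \<Rightarrow>\<^sub>L real) set \<Rightarrow> real) \<Rightarrow> bool" where
  "gelfand_large_game M F A G \<longleftrightarrow> A \<noteq> {} \<and> compactin weak_star_topology A \<and>
     payoff_assignment F (gelfand_actions A) (gelfand_aggregates M F A) G"

definition gelfand_nash_equilibrium ::
    "'t measure \<Rightarrow> 't measure \<Rightarrow> ('y::{banach, second_countable_topology} \<Rightarrow>\<^sub>L real) set \<Rightarrow>
     ('t \<Rightarrow> ('y \<Rightarrow>\<^sub>L real) \<times> ('t \<Rightarrow> 'y \<Rightarrow>\<^sub>L real) set \<Rightarrow> real) \<Rightarrow> ('t \<Rightarrow> 'y \<Rightarrow>\<^sub>L real) \<Rightarrow> bool" where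
  "gelfand_nash_equilibrium M F A =
     nash_equilibrium M (gelfand_actions A) (gelfand_cond_exp M F)"

end

theory Submission
  imports Defs "HOL-Library.Diagonal_Subsequence"
begin

text \<open>
  If \<open>M\<close> is nowhere equivalent to \<open>F\<close>, a halving and exhaustion argument splits every set conditionally on
  \<open>F\<close> in any prescribed \<open>F\<close>-measurable proportion. Hence every conditional distribution on finitely many
  actions is the conditional law of a pure profile, and the set of conditional laws of profiles is
  sequentially compact: a profile is coded by binary questions about the action, and the weak limits
  of the conditional frequencies of the answers are realized one question after another. Replacing
  \<open>F\<close> by the finite algebras of a generating sequence and the action set by finite subsets gives games
  that have equilibria by Brouwer's theorem applied to Nash's map, and any limit in conditional law of these is an
  equilibrium of the given game. Convergence in conditional law implies weak convergence of the conditional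
  expectations, because a functional on \<open>L\<^sub>1\<close> is given by an \<open>F\<close>-measurable field of functionals on \<open>X\<close>.

  Conversely, if every part of some \<open>D\<close> agrees with \<open>F\<close> up to null sets, take \<open>S \<in> F\<close> on which the conditional
  probability of \<open>D\<close> is at least \<open>\<delta> > 0\<close>, a number \<open>N > 1 / \<delta>\<close> of actions \<open>a\<^sub>i\<close> biorthogonal to functionals \<open>f\<^sub>i\<close>, and a real
  function \<open>\<theta>\<close> generating \<open>F\<close>. With the payoff of action \<open>a\<^sub>i\<close> for player \<open>t\<close> being minus the integral of \<open>f\<^sub>i\<close> of
  the aggregate over \<open>S \<inter> {\<theta> \<le> \<theta> t}\<close>, an equilibrium distributes \<open>S\<close> over the \<open>N\<close> actions in equal parts
  conditionally on \<open>F\<close>. On \<open>D\<close> the players of one action form, up to null sets, a trace of an \<open>F\<close>-set, so that these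
  parts would have conditional probability at least \<open>\<delta> > 1 / N\<close> there.
\<close>

section \<open>Splitting sets conditionally on a sub-\<open>\<sigma>\<close>-algebra\<close>

text \<open>A limit of pure profiles is in general only a randomized one. It is never formed as
  such: only the limits of the conditional frequencies are kept, as set functions, and these are
  turned back into sets. The equilibrium condition is carried along in averaged form: over every
  \<open>F\<close>-set the integral of the payoff of any fixed action does not exceed that of the
  payoff obtained. This form survives limits and the passage to finite algebras. It gives back the
  pointwise condition because payoff functions are \<open>F\<close>-measurable in the player: the
  conditional mean of the payoff obtained dominates the best payoff, which dominates the payoff
  obtained, and both ends have the same integral. In the converse, equal shares are needed on all of
  \<open>F\<close>, while one payoff function tests the aggregate on few sets only. Therefore the
  players are ordered by \<open>\<theta>\<close> and each tests one initial segment. The segments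
  determine a measure on \<open>F\<close>, and since the fibres of \<open>\<theta>\<close> in
  \<open>S\<close> are null, the payoffs vary continuously with \<open>\<theta>\<close>, so that the
  assignment is measurable for the supremum norm.\<close>

context finite_measure_subalgebra
begin

lemma sets_F [measurable_dest]: "A \<in> sets F \<Longrightarrow> A \<in> sets M"
  using subalg by (auto simp: subalgebra_def)

lemma space_F: "space F = space M"
  using subalg by (auto simp: subalgebra_def)

lemma meas_F: "f \<in> measurable F N \<Longrightarrow> f \<in> measurable M N"
  by (rule measurable_from_subalg[OF subalg])

lemma integrable_indicator_finite [simp]: "B \<in> sets M \<Longrightarrow> integrable M (indicator B :: 'a \<Rightarrow> real)"
  by (simp add: emeasure_eq_measure)

lemma cond_exp_indicator:
  assumes "A \<in> sets F" "B \<in> sets M"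
  shows "(LINT t:A|M. real_cond_exp M F (indicator B) t) = measure M (A \<inter> B)"
proof -
  have "(LINT t:A|M. real_cond_exp M F (indicator B) t) = (LINT t:A|M. indicator B t)"
    using assms real_cond_exp_intA[of "indicator B" A] by simp
  also have "\<dots> = (LINT t|M. indicator (A \<inter> B) t)"
    unfolding set_lebesgue_integral_def by (intro Bochner_Integration.integral_cong) (auto simp: indicator_def)
  finally show ?thesis
    using sets.Int[OF sets_F[OF assms(1)] assms(2)] by simp
qed

lemma set_integral_const_real:
  fixes c :: real
  shows "A \<in> sets M \<Longrightarrow> (LINT t:A|M. c) = c * measure M A"
  by (simp add: set_lebesgue_integral_def emeasure_eq_measure)

lemma set_integrable_F:
  fixes f :: "'a \<Rightarrow> 'b::{banach, second_countable_topology}"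
  assumes "A \<in> sets F" "integrable M f"
  shows "set_integrable M A f"
  unfolding set_integrable_def using assms sets_F by (intro integrable_mult_indicator) auto

lemma AE_nonneg_of_set_integrals:
  fixes h :: "'a \<Rightarrow> real"
  assumes [measurable]: "h \<in> borel_measurable F" and h: "integrable M h"
    and nn: "\<And>A. A \<in> sets F \<Longrightarrow> 0 \<le> (LINT t:A|M. h t)"
  shows "AE t in M. 0 \<le> h t"
proof -
  have S: "{t\<in>space M. h t < 0} \<in> sets F" unfolding space_F[symmetric] by measurable
  have "AE t in M. - (indicator {t\<in>space M. h t < 0} t * h t) = 0"
  proof (rule integral_nonneg_eq_0_iff_AE[THEN iffD1])
    let ?g = "\<lambda>t. - (indicator {t\<in>space M. h t < 0} t * h t)"
    show int: "integrable M ?g"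
      using set_integrable_F[OF S h] by (auto simp: set_integrable_def)
    show nn': "AE t in M. 0 \<le> ?g t" by (auto simp: indicator_def)
    have "integral\<^sup>L M ?g = - (LINT t:{t\<in>space M. h t < 0}|M. h t)"
      by (simp add: set_lebesgue_integral_def)
    also have "\<dots> \<le> 0" using nn[OF S] by simp
    finally show "integral\<^sup>L M ?g = 0" using integral_nonneg_AE[OF nn'] by linarith
  qed
  with AE_space show ?thesis by eventually_elim (auto simp: indicator_def split: if_splits)
qed

text \<open>On the \<open>F\<close>-set \<open>P\<close>, where the conditional probability of
  \<open>D0\<close> is at most that of \<open>D - D0\<close>, the part \<open>D0\<close> is kept,
  elsewhere the part \<open>D - D0\<close>. This takes at most half of \<open>D\<close>
  conditionally on \<open>F\<close>.\<close>

lemma halving_subset: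
  assumes ne: "nowhere_equivalent M F" and D: "D \<in> sets M" "measure M D > 0"
  obtains D' where "D' \<in> sets M" "D' \<subseteq> D" "measure M D' > 0"
    "\<And>E. E \<in> sets F \<Longrightarrow> measure M (E \<inter> D') \<le> measure M (E \<inter> D) / 2"
proof -
  have "\<exists>D0\<in>sets M. D0 \<subseteq> D \<and> (\<forall>D1\<in>{D \<inter> D' |D'. D' \<in> sets F}. measure M (sym_diff D0 D1) > 0)"
    using ne[unfolded nowhere_equivalent_def, rule_format, OF D(1)] D(2) by blast
  then obtain D0 where D0: "D0 \<in> sets M" "D0 \<subseteq> D"
    and D0': "\<forall>D1\<in>{D \<inter> D' |D'. D' \<in> sets F}. measure M (sym_diff D0 D1) > 0"
    by (elim bexE conjE) simp
  have pos: "measure M (sym_diff D0 (D \<inter> D')) > 0" if "D' \<in> sets F" for D'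
    using that by (intro bspec[OF D0']) auto
  define p where "p = real_cond_exp M F (indicator D0)"
  define q where "q = real_cond_exp M F (indicator (D - D0))"
  define P where "P = {t \<in> space M. p t \<le> q t}"
  have pq [measurable]: "p \<in> borel_measurable F" "q \<in> borel_measurable F"
    by (auto simp: p_def q_def)
  have P: "P \<in> sets F"
    unfolding P_def space_F[symmetric] by measurable
  have ip: "integrable M p" "integrable M q"
    unfolding p_def q_def using D D0 by (auto intro!: real_cond_exp_int)
  define D' where "D' = (D0 \<inter> P) \<union> ((D - D0) - P)"
  have D': "D' \<in> sets M" "D' \<subseteq> D"
    using D0 D sets_F[OF P] by (auto simp: D'_def)
  have half: "measure M (E \<inter> D') \<le> measure M (E \<inter> D) / 2" if E: "E \<in> sets F" for E
  proof -
    have Em: "E \<in> sets M" "P \<in> sets M" using E P sets_F by auto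
    have 1: "E \<inter> P \<in> sets F" "E - P \<in> sets F" using E P by auto
    have ci: "(LINT t:A|M. p t) = measure M (A \<inter> D0)" "(LINT t:A|M. q t) = measure M (A \<inter> (D - D0))"
      if "A \<in> sets F" for A
      unfolding p_def q_def using that D0 D by (intro cond_exp_indicator; auto)+
    have "(LINT t:E \<inter> P|M. p t) \<le> (LINT t:E \<inter> P|M. q t)"
      by (intro set_integral_mono set_integrable_F 1 ip) (auto simp: P_def)
    then have a: "measure M (E \<inter> P \<inter> D0) \<le> measure M (E \<inter> P \<inter> (D - D0))"
      by (simp only: ci[OF 1(1)])
    have "(LINT t:E - P|M. q t) \<le> (LINT t:E - P|M. p t)"
      using sets.sets_into_space[OF Em(1)] by (intro set_integral_mono set_integrable_F 1 ip) (auto simp: P_def)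
    then have b: "measure M ((E - P) \<inter> (D - D0)) \<le> measure M ((E - P) \<inter> D0)"
      by (simp only: ci[OF 1(2)])
    have add: "measure M (X \<union> Y) = measure M X + measure M Y"
      if "X \<in> sets M" "Y \<in> sets M" "X \<inter> Y = {}" for X Y
      using that by (intro finite_measure_Union)
    have m: "E \<inter> P \<inter> D0 \<in> sets M" "(E - P) \<inter> (D - D0) \<in> sets M" "E \<inter> P \<inter> (D - D0) \<in> sets M"
      "(E - P) \<inter> D0 \<in> sets M"
      using Em D0 D by auto
    have "E \<inter> D' = (E \<inter> P \<inter> D0) \<union> ((E - P) \<inter> (D - D0))"
      by (auto simp: D'_def)
    then have c: "measure M (E \<inter> D') = measure M (E \<inter> P \<inter> D0) + measure M ((E - P) \<inter> (D - D0))"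
      using m by (simp only:) (rule add, auto)
    have "E \<inter> D = (E \<inter> P \<inter> D0 \<union> E \<inter> P \<inter> (D - D0)) \<union> ((E - P) \<inter> D0 \<union> (E - P) \<inter> (D - D0))"
      using D0 by auto
    then have "measure M (E \<inter> D) = measure M (E \<inter> P \<inter> D0 \<union> E \<inter> P \<inter> (D - D0)) +
       measure M ((E - P) \<inter> D0 \<union> (E - P) \<inter> (D - D0))"
      using m by (simp only:) (rule add, auto)
    also have "measure M (E \<inter> P \<inter> D0 \<union> E \<inter> P \<inter> (D - D0)) =
        measure M (E \<inter> P \<inter> D0) + measure M (E \<inter> P \<inter> (D - D0))"
      using m by (intro add) auto
    also have "measure M ((E - P) \<inter> D0 \<union> (E - P) \<inter> (D - D0)) =
        measure M ((E - P) \<inter> D0) + measure M ((E - P) \<inter> (D - D0))"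
      using m by (intro add) auto
    finally have d: "measure M (E \<inter> D) = (measure M (E \<inter> P \<inter> D0) + measure M (E \<inter> P \<inter> (D - D0))) +
       (measure M ((E - P) \<inter> D0) + measure M ((E - P) \<inter> (D - D0)))" .
    show ?thesis using a b c d by simp
  qed
  have "measure M D' > 0"
  proof (rule ccontr)
    assume "\<not> measure M D' > 0"
    then have z: "measure M D' = 0" by (simp add: zero_less_measure_iff)
    \<comment> \<open>If \<open>D'\<close> were null, \<open>D0\<close> would agree up to a null set
      with the trace on \<open>D\<close> of the complement of \<open>P\<close>, which the choice of
      \<open>D0\<close> excludes.\<close>
    have "sym_diff D0 (D \<inter> (space M - P)) \<subseteq> D'"
      using D0 sets.sets_into_space[OF D0(1)] by (auto simp: D'_def)
    then have "measure M (sym_diff D0 (D \<inter> (space M - P))) \<le> measure M D'"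
      by (intro finite_measure_mono D')
    moreover have "space M - P \<in> sets F" using P unfolding space_F[symmetric] by auto
    ultimately show False using pos[of "space M - P"] z by auto
  qed
  then show ?thesis using that D' half by blast
qed

lemma small_subset:
  assumes ne: "nowhere_equivalent M F" and D: "D \<in> sets M" "measure M D > 0"
  shows "\<exists>D'. D' \<in> sets M \<and> D' \<subseteq> D \<and> measure M D' > 0 \<and>
    (\<forall>E\<in>sets F. measure M (E \<inter> D') \<le> measure M (E \<inter> D) / 2 ^ n)"
proof (induction n)
  case 0
  then show ?case using D by (intro exI[of _ D]) auto
next
  case (Suc n)
  then obtain D' where D': "D' \<in> sets M" "D' \<subseteq> D" "measure M D' > 0"
    "\<And>E. E \<in> sets F \<Longrightarrow> measure M (E \<inter> D') \<le> measure M (E \<inter> D) / 2 ^ n" by blast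
  obtain D'' where D'': "D'' \<in> sets M" "D'' \<subseteq> D'" "measure M D'' > 0"
    "\<And>E. E \<in> sets F \<Longrightarrow> measure M (E \<inter> D'') \<le> measure M (E \<inter> D') / 2"
    using halving_subset[OF ne D'(1,3)] by metis
  have "measure M (E \<inter> D'') \<le> measure M (E \<inter> D) / 2 ^ Suc n" if "E \<in> sets F" for E
    using D'(4)[OF that] D''(4)[OF that] by simp
  then show ?case using D' D'' by (intro exI[of _ D'']) auto
qed

text \<open>Exhaustion: each step of the sequence \<open>B\<close> realizes at least half of the
  gain in measure that is still possible. As the measures converge, these gains tend to zero, so
  that no admissible superset of the union has larger measure.\<close>

lemma greedy_maximal_subset:
  assumes P0: "P {}" and Psets: "\<And>B. P B \<Longrightarrow> B \<in> sets M"
    and Pun: "\<And>B::nat \<Rightarrow> 'a set. incseq B \<Longrightarrow> (\<And>n. P (B n)) \<Longrightarrow> P (\<Union>n. B n)"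
  obtains B where "P B" "\<And>B'. P B' \<Longrightarrow> B \<subseteq> B' \<Longrightarrow> measure M B' \<le> measure M B"
proof -
  have step: "\<exists>B'. P B' \<and> B \<subseteq> B' \<and> (\<forall>B''. P B'' \<longrightarrow> B' \<subseteq> B'' \<longrightarrow>
      measure M B'' - measure M B \<le> 2 * (measure M B' - measure M B))" if B: "P B" for B
  proof -
    define S where "S = {measure M B' |B'. P B' \<and> B \<subseteq> B'}"
    have S: "S \<noteq> {}" "bdd_above S"
      using B by (auto simp: S_def bdd_above_def intro!: exI[of _ "measure M (space M)"] bounded_measure)
    show ?thesis
    proof (cases "Sup S > measure M B")
      case True
      then have "(Sup S + measure M B) / 2 < Sup S" by simp
      then have "\<exists>x\<in>S. (Sup S + measure M B) / 2 < x"
        using less_cSup_iff[OF S] by blast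
      then obtain B' where B': "P B'" "B \<subseteq> B'" "(Sup S + measure M B) / 2 < measure M B'"
        by (auto simp: S_def)
      have "measure M B'' - measure M B \<le> 2 * (measure M B' - measure M B)"
        if "P B''" "B' \<subseteq> B''" for B''
      proof -
        have "measure M B'' \<le> Sup S"
          using that B' by (intro cSup_upper[OF _ S(2)]) (auto simp: S_def)
        then show ?thesis using B'(3) by (simp add: field_simps)
      qed
      then show ?thesis using B' by blast
    next
      case False
      have "measure M B'' \<le> Sup S" if "P B''" "B \<subseteq> B''" for B''
        using that by (intro cSup_upper[OF _ S(2)]) (auto simp: S_def)
      with False B show ?thesis by (intro exI[of _ B]) force
    qed
  qed
  obtain nxt where nxt: "\<And>B. P B \<Longrightarrow> P (nxt B) \<and> B \<subseteq> nxt B \<and> (\<forall>B''. P B'' \<longrightarrow> nxt B \<subseteq> B'' \<longrightarrow>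
      measure M B'' - measure M B \<le> 2 * (measure M (nxt B) - measure M B))"
    using step by metis
  define B where "B n = (nxt ^^ n) {}" for n
  have PB: "P (B n)" for n by (induction n) (auto simp: B_def P0 nxt)
  have Bs: "B (Suc n) = nxt (B n)" for n by (simp add: B_def)
  have inc: "incseq B" by (rule incseq_SucI) (auto simp: Bs nxt PB)
  let ?U = "\<Union>n. B n"
  have lim: "(\<lambda>n. measure M (B n)) \<longlonglongrightarrow> measure M ?U"
    using PB Psets by (intro finite_Lim_measure_incseq inc) auto
  have lim': "(\<lambda>n. measure M (B n) + 2 * (measure M (B (Suc n)) - measure M (B n))) \<longlonglongrightarrow>
      measure M ?U + 2 * (measure M ?U - measure M ?U)"
    using lim LIMSEQ_Suc[OF lim] by (intro tendsto_intros)
  have "measure M B' \<le> measure M ?U" if B': "P B'" "?U \<subseteq> B'" for B'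
  proof -
    have "measure M B' \<le> measure M (B n) + 2 * (measure M (B (Suc n)) - measure M (B n))" for n
      using nxt[OF PB[of n]] B' by (force simp: Bs[symmetric])
    then show ?thesis using LIMSEQ_le_const[OF lim'] by auto
  qed
  then show ?thesis using that[of ?U] Pun[OF inc PB] by blast
qed

text \<open>A maximal packing of \<open>D\<close> with conditional density at most the prescribed one attains it, since otherwise a small subset could be added (Maharam).\<close>

lemma conditional_splitting:
  assumes ne: "nowhere_equivalent M F" and D: "D \<in> sets M"
    and f: "f \<in> borel_measurable F" "integrable M f"
    and f0: "\<And>E. E \<in> sets F \<Longrightarrow> 0 \<le> (LINT t:E|M. f t)"
    and f1: "\<And>E. E \<in> sets F \<Longrightarrow> (LINT t:E|M. f t) \<le> measure M (E \<inter> D)"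
  obtains D' where "D' \<in> sets M" "D' \<subseteq> D"
    "\<And>E. E \<in> sets F \<Longrightarrow> measure M (E \<inter> D') = (LINT t:E|M. f t)"
proof -
  define P where "P B \<longleftrightarrow> B \<in> sets M \<and> B \<subseteq> D \<and> (\<forall>E\<in>sets F. measure M (E \<inter> B) \<le> (LINT t:E|M. f t))" for B
  obtain B where B: "P B" and max: "\<And>B'. P B' \<Longrightarrow> B \<subseteq> B' \<Longrightarrow> measure M B' \<le> measure M B"
  proof (rule greedy_maximal_subset[of P])
    show "P {}" using f0 by (simp add: P_def)
    show "P (\<Union>n. C n)" if C: "incseq C" "\<And>n. P (C n)" for C
    proof -
      have "measure M (E \<inter> (\<Union>n. C n)) \<le> (LINT t:E|M. f t)" if E: "E \<in> sets F" for E
      proof (rule LIMSEQ_le_const2)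
        have "(\<lambda>n. measure M (E \<inter> C n)) \<longlonglongrightarrow> measure M (\<Union>n. E \<inter> C n)"
          using C sets_F[OF E] by (intro finite_Lim_measure_incseq) (auto simp: P_def incseq_def)
        then show "(\<lambda>n. measure M (E \<inter> C n)) \<longlonglongrightarrow> measure M (E \<inter> (\<Union>n. C n))" by simp
        show "\<exists>N. \<forall>n\<ge>N. measure M (E \<inter> C n) \<le> (LINT t:E|M. f t)"
          using C(2) E by (auto simp: P_def)
      qed
      then show ?thesis using C(2) by (auto simp: P_def)
    qed
  qed (auto simp: P_def)
  have Bm: "B \<in> sets M" "B \<subseteq> D" and Bf: "\<And>E. E \<in> sets F \<Longrightarrow> measure M (E \<inter> B) \<le> (LINT t:E|M. f t)"
    using B by (auto simp: P_def)
  have "measure M (E \<inter> B) = (LINT t:E|M. f t)" if E: "E \<in> sets F" for E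
  proof (rule ccontr)
    assume neq: "measure M (E \<inter> B) \<noteq> (LINT t:E|M. f t)"
    define c where "c = real_cond_exp M F (indicator B)"
    define h where "h t = f t - c t" for t
    have c [measurable]: "c \<in> borel_measurable F" "integrable M c"
      unfolding c_def using Bm by (auto intro: real_cond_exp_int)
    have h [measurable]: "h \<in> borel_measurable F" "integrable M h"
      unfolding h_def using c f by auto
    have hint: "(LINT t:A|M. h t) = (LINT t:A|M. f t) - measure M (A \<inter> B)" if "A \<in> sets F" for A
      unfolding h_def using set_integrable_F[OF that f(2)] set_integrable_F[OF that c(2)] cond_exp_indicator[OF that Bm(1)]
      by (simp add: c_def)
    have hnn: "AE t in M. 0 \<le> h t"
      using hint Bf by (intro AE_nonneg_of_set_integrals h) simp
    \<comment> \<open>If \<open>B\<close> falls short of the prescribed density, the deficit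
      \<open>h\<close> exceeds some \<open>1 / 2 ^ n\<close> on a set of positive measure. There
      \<open>small_subset\<close> cuts from \<open>D - B\<close> a piece of conditional density at
      most \<open>1 / 2 ^ n\<close>, which still fits and contradicts the maximality of
      \<open>B\<close>.\<close>
    define S where "S n = {t\<in>space M. h t > 1 / 2 ^ n}" for n :: nat
    have S: "S n \<in> sets F" for n unfolding S_def space_F[symmetric] by measurable
    have "\<exists>n. measure M (S n) > 0"
    proof (rule ccontr)
      assume "\<nexists>n. measure M (S n) > 0"
      then have "AE t in M. t \<notin> S n" for n
        using sets_F[OF S] by (intro AE_not_in) (simp add: emeasure_eq_measure null_setsI zero_less_measure_iff)
      then have "AE t in M. \<forall>n. t \<notin> S n" by (simp add: AE_all_countable)
      with hnn AE_space have "AE t in M. h t = 0"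
      proof eventually_elim
        case (elim t)
        show ?case
        proof (rule ccontr)
          assume "h t \<noteq> 0"
          with elim obtain n where "(1/2) ^ n < h t" using real_arch_pow_inv[of "h t" "1/2"] by auto
          with elim show False by (auto simp: S_def power_divide)
        qed
      qed
      then have "(LINT t:E|M. h t) = 0"
        unfolding set_lebesgue_integral_def by (intro integral_eq_zero_AE) auto
      with neq hint[OF E] show False by simp
    qed
    then obtain n where n: "measure M (S n) > 0" by blast
    let ?D = "S n \<inter> (D - B)"
    have "0 < (1 / 2 ^ n) * measure M (S n)" using n by simp
    also have "\<dots> = (LINT t:S n|M. 1 / 2 ^ n)" using sets_F[OF S] by (simp only: set_integral_const_real)
    also have "\<dots> \<le> (LINT t:S n|M. h t)"
      using S by (intro set_integral_mono set_integrable_F h(2)) (auto simp: S_def)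
    also have "\<dots> \<le> measure M (S n \<inter> D) - measure M (S n \<inter> B)"
      using hint[OF S] f1[OF S] by simp
    also have "\<dots> = measure M ?D"
    proof -
      have "measure M (S n \<inter> D) = measure M (?D \<union> (S n \<inter> B))"
        using Bm by (intro arg_cong[where f = "measure M"]) auto
      also have "\<dots> = measure M ?D + measure M (S n \<inter> B)"
        using Bm D sets_F[OF S] by (intro finite_measure_Union) auto
      finally show ?thesis by simp
    qed
    finally have "measure M ?D > 0" .
    moreover have "?D \<in> sets M" using Bm D sets_F[OF S] by auto
    ultimately obtain D2 where D2: "D2 \<in> sets M" "D2 \<subseteq> ?D" "measure M D2 > 0"
      "\<And>E. E \<in> sets F \<Longrightarrow> measure M (E \<inter> D2) \<le> measure M (E \<inter> ?D) / 2 ^ n"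
      using small_subset[OF ne] by metis
    have "P (B \<union> D2)"
      unfolding P_def
    proof (intro conjI ballI)
      show "B \<union> D2 \<in> sets M" "B \<union> D2 \<subseteq> D" using Bm D2 by auto
      fix A assume A: "A \<in> sets F"
      then have AS: "A \<inter> S n \<in> sets F" using S by auto
      have "measure M (A \<inter> D2) \<le> measure M (A \<inter> S n) / 2 ^ n"
      proof -
        have "measure M (A \<inter> ?D) \<le> measure M (A \<inter> S n)"
          by (intro finite_measure_mono sets_F[OF AS]) auto
        then have "measure M (A \<inter> ?D) / 2 ^ n \<le> measure M (A \<inter> S n) / 2 ^ n"
          by (intro divide_right_mono) auto
        with D2(4)[OF A] show ?thesis by linarith
      qed
      also have "\<dots> = (LINT t:A \<inter> S n|M. 1 / 2 ^ n)" using sets_F[OF AS] by (simp add: set_integral_const_real)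
      also have "\<dots> \<le> (LINT t:A \<inter> S n|M. h t)"
        using AS by (intro set_integral_mono set_integrable_F h(2)) (auto simp: S_def)
      also have "\<dots> \<le> (LINT t:A|M. h t)"
        unfolding set_lebesgue_integral_def
      proof (rule integral_mono_AE)
        show "integrable M (\<lambda>t. indicator (A \<inter> S n) t *\<^sub>R h t)" "integrable M (\<lambda>t. indicator A t *\<^sub>R h t)"
          using set_integrable_F[OF A h(2)] set_integrable_F[OF AS h(2)] by (simp_all only: set_integrable_def)
        show "AE t in M. indicator (A \<inter> S n) t *\<^sub>R h t \<le> indicator A t *\<^sub>R h t"
          using hnn by eventually_elim (auto simp: indicator_def)
      qed
      also have "\<dots> = (LINT t:A|M. f t) - measure M (A \<inter> B)" using hint[OF A] .
      finally have 1: "measure M (A \<inter> D2) + measure M (A \<inter> B) \<le> (LINT t:A|M. f t)" by simp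
      have "measure M (A \<inter> (B \<union> D2)) = measure M (A \<inter> B) + measure M (A \<inter> D2)"
        using Bm D2 sets_F[OF A] by (subst finite_measure_Union[symmetric]) (auto intro!: arg_cong[where f = "measure M"])
      with 1 show "measure M (A \<inter> (B \<union> D2)) \<le> (LINT t:A|M. f t)" by simp
    qed
    then have "measure M (B \<union> D2) \<le> measure M B" using max by auto
    moreover have "measure M (B \<union> D2) = measure M B + measure M D2"
      using Bm D2 by (intro finite_measure_Union) auto
    ultimately show False using D2 by simp
  qed
  then show ?thesis using that Bm by blast
qed

end


section \<open>Brouwer equilibria of finite population games\<close>

lemma pointwise_convergent_subsequence:
  fixes f :: "nat \<Rightarrow> nat \<Rightarrow> real"
  assumes bdd: "\<And>n k. \<bar>f n k\<bar> \<le> B k"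
  obtains r where "strict_mono r" "\<And>k. convergent (\<lambda>n. f (r n) k)"
proof -
  interpret subseqs "\<lambda>k s. convergent (\<lambda>n. f (s n) k)"
  proof
    fix k and s :: "nat \<Rightarrow> nat" assume "strict_mono s"
    have "bounded (range (\<lambda>n. f (s n) k))"
      using bdd by (auto simp: bounded_iff)
    then obtain l r where "strict_mono r" "((\<lambda>n. f (s n) k) \<circ> r) \<longlonglongrightarrow> l"
      using bounded_imp_convergent_subsequence by blast
    then show "\<exists>r. strict_mono r \<and> convergent (\<lambda>n. f ((s \<circ> r) n) k)"
      by (auto simp: convergent_def o_def)
  qed
  have "convergent (\<lambda>n. f (diagseq n) k)" for k
  proof -
    have "convergent (\<lambda>n. f ((diagseq \<circ> ((+) (Suc k))) n) k)"
    proof (rule diagseq_holds)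
      fix r s :: "nat \<Rightarrow> nat" and n assume "strict_mono r" "convergent (\<lambda>i. f (s i) n)"
      then show "convergent (\<lambda>i. f ((s \<circ> r) i) n)"
        using convergent_subseq_convergent[of "\<lambda>i. f (s i) n" r] by (simp add: o_def)
    qed
    then have "convergent (\<lambda>n. f (diagseq (n + Suc k)) k)"
      by (simp add: o_def add.commute)
    then show ?thesis using convergent_ignore_initial_segment[of "\<lambda>n. f (diagseq n) k" "Suc k"] by simp
  qed
  then show ?thesis using that subseq_diagseq by blast
qed

text \<open>The dimension is a number rather than a type, since the numbers of cells and of actions
  grow with the stage of the approximation. On the grid of mesh \<open>1 / p\<close> Kuhn's lemma
  gives a small cube in which, for every coordinate \<open>i\<close>, some vertex has
  \<open>f\<close> not below and some vertex has \<open>f\<close> not above the identity in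
  coordinate \<open>i\<close>. As the mesh tends to zero, all these vertices tend to one point along
  a subsequence, and this point is fixed.\<close>

lemma brouwer_cube_nat:
  fixes f :: "(nat \<Rightarrow> real) \<Rightarrow> nat \<Rightarrow> real"
  assumes cont: "\<And>X x i. (\<And>k j. j < n \<Longrightarrow> X k j \<in> {0..1}) \<Longrightarrow> (\<And>j. j < n \<Longrightarrow> x j \<in> {0..1}) \<Longrightarrow>
      (\<And>j. j < n \<Longrightarrow> (\<lambda>k. X k j) \<longlonglongrightarrow> x j) \<Longrightarrow> i < n \<Longrightarrow> (\<lambda>k. f (X k) i) \<longlonglongrightarrow> f x i"
    and ran: "\<And>x i. (\<And>j. j < n \<Longrightarrow> x j \<in> {0..1}) \<Longrightarrow> i < n \<Longrightarrow> f x i \<in> {0..1}"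
  obtains x where "\<And>j. j < n \<Longrightarrow> x j \<in> {0..1}" "\<And>i. i < n \<Longrightarrow> f x i = x i"
proof -
  define pt where "pt p q i = (if i < n then real (q i) / real p else 0)" for p and q :: "nat \<Rightarrow> nat" and i
  \<comment> \<open>Kuhn's lemma prescribes the label 0 on the lower and 1 on the upper faces. Both
    agree with the meaning of the labels in \<open>lab0\<close> and \<open>lab1\<close>, because
    \<open>f\<close> maps the cube into itself.\<close>
  define label where "label p q i = (if q i = 0 then 0 else
    if q i = p \<or> f (pt p q) i < pt p q i then 1 else (0::nat))" for p q i
  have pt01: "pt p q j \<in> {0..1}" if "\<forall>i<n. q i \<le> p" for p q j
    using that by (auto simp: pt_def divide_le_eq_1)
  have lab0: "pt p q i \<le> f (pt p q) i" if "\<forall>i<n. q i \<le> p" "i < n" "label p q i = 0" for p q i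
    using that ran[of "pt p q" i, OF pt01[OF that(1)] that(2)] by (auto simp: label_def pt_def split: if_splits)
  have lab1: "f (pt p q) i \<le> pt p q i" if "\<forall>i<n. q i \<le> p" "i < n" "label p q i = 1" for p q i
    using that ran[of "pt p q" i, OF pt01[OF that(1)] that(2)] by (auto simp: label_def pt_def split: if_splits)
  have ex: "\<exists>q. (\<forall>i<n. q i \<le> p) \<and> (\<forall>i<n. \<exists>a b. (\<forall>j<n. \<bar>pt p a j - pt p q j\<bar> \<le> 1 / p \<and> pt p a j \<in> {0..1}) \<and>
     (\<forall>j<n. \<bar>pt p b j - pt p q j\<bar> \<le> 1 / p \<and> pt p b j \<in> {0..1}) \<and>
     pt p a i \<le> f (pt p a) i \<and> f (pt p b) i \<le> pt p b i)" if p: "p > 0" for p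
  proof -
    obtain q where q: "\<forall>i<n. q i < p" and
      lab: "\<forall>i<n. \<exists>r s. (\<forall>j<n. q j \<le> r j \<and> r j \<le> q j + 1) \<and> (\<forall>j<n. q j \<le> s j \<and> s j \<le> q j + 1) \<and>
         label p r i \<noteq> label p s i"
      by (rule kuhn_lemma[of p n "label p"]) (use p in \<open>auto simp: label_def\<close>)
    have close: "\<bar>pt p a j - pt p q j\<bar> \<le> 1 / p" if "q j \<le> a j" "a j \<le> q j + 1" for a j
      using that p by (auto simp: pt_def diff_divide_distrib[symmetric] divide_right_mono)
    show ?thesis
    proof (rule exI[of _ q], intro conjI allI impI)
      fix i assume i: "i < n"
      obtain r s where rs: "\<forall>j<n. q j \<le> r j \<and> r j \<le> q j + 1" "\<forall>j<n. q j \<le> s j \<and> s j \<le> q j + 1"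
         "label p r i \<noteq> label p s i" using lab i by blast
      have le: "\<forall>j<n. r j \<le> p" "\<forall>j<n. s j \<le> p" using rs q by fastforce+
      have l01: "label p r i = 0 \<and> label p s i = 1 \<or> label p s i = 0 \<and> label p r i = 1"
        using rs(3) p by (auto simp: label_def split: if_splits)
      show "\<exists>a b. (\<forall>j<n. \<bar>pt p a j - pt p q j\<bar> \<le> 1 / p \<and> pt p a j \<in> {0..1}) \<and>
         (\<forall>j<n. \<bar>pt p b j - pt p q j\<bar> \<le> 1 / p \<and> pt p b j \<in> {0..1}) \<and>
         pt p a i \<le> f (pt p a) i \<and> f (pt p b) i \<le> pt p b i"
        using l01
      proof
        assume "label p r i = 0 \<and> label p s i = 1"
        then show ?thesis using lab0[OF le(1) i] lab1[OF le(2) i] pt01[OF le(1)] pt01[OF le(2)] close rs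
          by (intro exI[of _ r] exI[of _ s]) auto
      next
        assume "label p s i = 0 \<and> label p r i = 1"
        then show ?thesis using lab0[OF le(2) i] lab1[OF le(1) i] pt01[OF le(1)] pt01[OF le(2)] close rs
          by (intro exI[of _ s] exI[of _ r]) auto
      qed
    qed (use q in auto)
  qed
  have "\<forall>p. \<exists>q. (\<forall>i<n. q i \<le> Suc p) \<and> (\<forall>i<n. \<exists>a b. (\<forall>j<n. \<bar>pt (Suc p) a j - pt (Suc p) q j\<bar> \<le> 1 / Suc p \<and> pt (Suc p) a j \<in> {0..1}) \<and>
     (\<forall>j<n. \<bar>pt (Suc p) b j - pt (Suc p) q j\<bar> \<le> 1 / Suc p \<and> pt (Suc p) b j \<in> {0..1}) \<and>
     pt (Suc p) a i \<le> f (pt (Suc p) a) i \<and> f (pt (Suc p) b) i \<le> pt (Suc p) b i)"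
    using ex by blast
  then obtain q where q: "\<And>p. \<forall>i<n. q p i \<le> Suc p"
    and q': "\<And>p. \<forall>i<n. \<exists>a b. (\<forall>j<n. \<bar>pt (Suc p) a j - pt (Suc p) (q p) j\<bar> \<le> 1 / Suc p \<and> pt (Suc p) a j \<in> {0..1}) \<and>
     (\<forall>j<n. \<bar>pt (Suc p) b j - pt (Suc p) (q p) j\<bar> \<le> 1 / Suc p \<and> pt (Suc p) b j \<in> {0..1}) \<and>
     pt (Suc p) a i \<le> f (pt (Suc p) a) i \<and> f (pt (Suc p) b) i \<le> pt (Suc p) b i"
    unfolding choice_iff by (elim exE) blast
  define Y where "Y p = pt (Suc p) (q p)" for p
  have "\<bar>Y p j\<bar> \<le> 1" for p j using pt01[OF q] by (auto simp: Y_def abs_le_iff)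
  then obtain r where r: "strict_mono r" "\<And>j. convergent (\<lambda>p. Y (r p) j)"
    using pointwise_convergent_subsequence[of Y "\<lambda>_. 1"] by blast
  define x where "x j = lim (\<lambda>p. Y (r p) j)" for j
  have x: "(\<lambda>p. Y (r p) j) \<longlonglongrightarrow> x j" for j
    using r(2) by (simp add: x_def convergent_LIMSEQ_iff)
  have x01: "x j \<in> {0..1}" for j
    using LIMSEQ_le_const[OF x, of 0 j] LIMSEQ_le_const2[OF x, of j 1] pt01[OF q] by (auto simp: Y_def)
  have small: "(\<lambda>p. 1 / real (Suc (r p))) \<longlonglongrightarrow> 0"
    using LIMSEQ_subseq_LIMSEQ[OF LIMSEQ_inverse_real_of_nat r(1)] by (simp add: o_def inverse_eq_divide)
  have near: "(\<lambda>p. Z p j) \<longlonglongrightarrow> x j" if Z: "\<And>p. \<bar>Z p j - Y (r p) j\<bar> \<le> 1 / Suc (r p)" for Z :: "nat \<Rightarrow> nat \<Rightarrow> real" and j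
  proof -
    have "(\<lambda>p. Z p j - Y (r p) j) \<longlonglongrightarrow> 0"
      by (rule Lim_null_comparison[OF _ small]) (use Z in auto)
    from tendsto_add[OF this x[of j]] show ?thesis by simp
  qed
  have "f x i = x i" if i: "i < n" for i
  proof -
    have "\<forall>p. \<exists>a b. (\<forall>j<n. \<bar>a j - Y (r p) j\<bar> \<le> 1 / Suc (r p) \<and> a j \<in> {0..1}) \<and>
     (\<forall>j<n. \<bar>b j - Y (r p) j\<bar> \<le> 1 / Suc (r p) \<and> b j \<in> {0..1}) \<and> a i \<le> f a i \<and> f b i \<le> b i"
    proof
      fix p
      obtain a b where "(\<forall>j<n. \<bar>pt (Suc (r p)) a j - Y (r p) j\<bar> \<le> 1 / Suc (r p) \<and> pt (Suc (r p)) a j \<in> {0..1}) \<and>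
         (\<forall>j<n. \<bar>pt (Suc (r p)) b j - Y (r p) j\<bar> \<le> 1 / Suc (r p) \<and> pt (Suc (r p)) b j \<in> {0..1}) \<and>
         pt (Suc (r p)) a i \<le> f (pt (Suc (r p)) a) i \<and> f (pt (Suc (r p)) b) i \<le> pt (Suc (r p)) b i"
        using q'[of "r p", rule_format, OF i] unfolding Y_def by (elim exE)
      then show "\<exists>a b. (\<forall>j<n. \<bar>a j - Y (r p) j\<bar> \<le> 1 / Suc (r p) \<and> a j \<in> {0..1}) \<and>
         (\<forall>j<n. \<bar>b j - Y (r p) j\<bar> \<le> 1 / Suc (r p) \<and> b j \<in> {0..1}) \<and> a i \<le> f a i \<and> f b i \<le> b i"
        by (rule exI[of _ "pt (Suc (r p)) a", OF exI[of _ "pt (Suc (r p)) b"]])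
    qed
    then obtain a b where a: "\<And>p j. j < n \<Longrightarrow> \<bar>a p j - Y (r p) j\<bar> \<le> 1 / Suc (r p)" "\<And>p j. j < n \<Longrightarrow> a p j \<in> {0..1}"
      and b: "\<And>p j. j < n \<Longrightarrow> \<bar>b p j - Y (r p) j\<bar> \<le> 1 / Suc (r p)" "\<And>p j. j < n \<Longrightarrow> b p j \<in> {0..1}"
      and ab: "\<And>p. a p i \<le> f (a p) i" "\<And>p. f (b p) i \<le> b p i"
      unfolding choice_iff by (elim exE) blast
    have la: "(\<lambda>p. a p j) \<longlonglongrightarrow> x j" if "j < n" for j using a(1) that by (intro near) auto
    have lb: "(\<lambda>p. b p j) \<longlonglongrightarrow> x j" if "j < n" for j using b(1) that by (intro near) auto
    have fa: "(\<lambda>p. f (a p) i) \<longlonglongrightarrow> f x i" using a(2) x01 la i by (intro cont) auto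
    have fb: "(\<lambda>p. f (b p) i) \<longlonglongrightarrow> f x i" using b(2) x01 lb i by (intro cont) auto
    have "x i \<le> f x i" using LIMSEQ_le[OF la[OF i] fa] ab by auto
    moreover have "f x i \<le> x i" using LIMSEQ_le[OF fb lb[OF i]] ab by auto
    ultimately show ?thesis by simp
  qed
  then show ?thesis using that x01 by blast
qed

lemma brouwer_cube_finite:
  fixes f :: "('i \<Rightarrow> real) \<Rightarrow> 'i \<Rightarrow> real"
  assumes I: "finite I"
    and cont: "\<And>X x i. (\<And>k j. j \<in> I \<Longrightarrow> X k j \<in> {0..1}) \<Longrightarrow> (\<And>j. j \<in> I \<Longrightarrow> x j \<in> {0..1}) \<Longrightarrow>
      (\<And>j. j \<in> I \<Longrightarrow> (\<lambda>k. X k j) \<longlonglongrightarrow> x j) \<Longrightarrow> i \<in> I \<Longrightarrow> (\<lambda>k. f (X k) i) \<longlonglongrightarrow> f x i"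
    and ran: "\<And>x i. (\<And>j. j \<in> I \<Longrightarrow> x j \<in> {0..1}) \<Longrightarrow> i \<in> I \<Longrightarrow> f x i \<in> {0..1}"
  obtains x where "\<And>j. j \<in> I \<Longrightarrow> x j \<in> {0..1}" "\<And>i. i \<in> I \<Longrightarrow> f x i = x i"
proof -
  obtain h where h: "bij_betw h I {..<card I}"
    using ex_bij_betw_finite_nat[OF I] by (auto simp: atLeast0LessThan)
  define g where "g = the_inv_into I h"
  have g: "\<And>i. i < card I \<Longrightarrow> g i \<in> I" "\<And>i. i < card I \<Longrightarrow> h (g i) = i" "\<And>j. j \<in> I \<Longrightarrow> g (h j) = j"
    and hI: "\<And>j. j \<in> I \<Longrightarrow> h j < card I"
    using h unfolding g_def bij_betw_def
    by (auto intro: the_inv_into_into the_inv_into_f_f f_the_inv_into_f)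
  obtain x where x: "\<And>j. j < card I \<Longrightarrow> x j \<in> {0..1}" "\<And>i. i < card I \<Longrightarrow> f (\<lambda>j. x (h j)) (g i) = x i"
  proof (rule brouwer_cube_nat[of "card I" "\<lambda>x i. f (\<lambda>j. x (h j)) (g i)"])
    fix X :: "nat \<Rightarrow> nat \<Rightarrow> real" and x i assume "\<And>k j. j < card I \<Longrightarrow> X k j \<in> {0..1}" "\<And>j. j < card I \<Longrightarrow> x j \<in> {0..1}"
      "\<And>j. j < card I \<Longrightarrow> (\<lambda>k. X k j) \<longlonglongrightarrow> x j" "i < card I"
    then show "(\<lambda>k. f (\<lambda>j. X k (h j)) (g i)) \<longlonglongrightarrow> f (\<lambda>j. x (h j)) (g i)"
      using g hI by (intro cont) auto
  next
    fix x :: "nat \<Rightarrow> real" and i assume "\<And>j. j < card I \<Longrightarrow> x j \<in> {0..1}" "i < card I"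
    then show "f (\<lambda>j. x (h j)) (g i) \<in> {0..1}" using g hI by (intro ran) auto
  qed blast
  show ?thesis
    using x g hI by (intro that[of "\<lambda>j. x (h j)"]) (auto, metis)
qed

text \<open>Nash's map adds to the weight of every action its excess over the mean payoff and
  renormalizes. Brouwer's theorem is at hand for cubes, so the map is preceded by a retraction of
  the cube onto the product of simplices.\<close>

lemma population_game_equilibrium:
  fixes u :: "'j \<Rightarrow> 'n \<Rightarrow> ('j \<Rightarrow> 'n \<Rightarrow> real) \<Rightarrow> real"
  defines "\<Delta> J N \<equiv> {w. \<forall>j\<in>J. (\<forall>i\<in>N. 0 \<le> w j i) \<and> (\<Sum>i\<in>N. w j i) = 1}"
  assumes J: "finite J" and N: "finite N" "N \<noteq> {}"
    and cont: "\<And>W w j i. (\<And>k. W k \<in> \<Delta> J N) \<Longrightarrow> w \<in> \<Delta> J N \<Longrightarrow>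
      (\<And>j i. j \<in> J \<Longrightarrow> i \<in> N \<Longrightarrow> (\<lambda>k. W k j i) \<longlonglongrightarrow> w j i) \<Longrightarrow> j \<in> J \<Longrightarrow> i \<in> N \<Longrightarrow>
      (\<lambda>k. u j i (W k)) \<longlonglongrightarrow> u j i w"
  obtains w where "w \<in> \<Delta> J N" "\<And>j k. j \<in> J \<Longrightarrow> k \<in> N \<Longrightarrow> u j k w \<le> (\<Sum>i\<in>N. w j i * u j i w)"
proof -
  have cN: "real (card N) > 0" using N by (simp add: card_gt_0_iff)
  define s where "s x j = (\<Sum>i\<in>N. x (j, i))" for x :: "'j \<times> 'n \<Rightarrow> real" and j
  \<comment> \<open>The retraction: a total below 1 is filled up evenly, a total above 1 is scaled
    down, and both rules agree at 1. The values of \<open>f\<close> have total 1 already, so that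
    \<open>r\<close> does not move a fixed point.\<close>
  define r where "r x j i = (x (j, i) + max 0 (1 - s x j) / card N) / max 1 (s x j)" for x j i
  define e where "e w j i = max 0 (u j i w - (\<Sum>k\<in>N. w j k * u j k w))" for w j i
  define f where "f x = (\<lambda>(j, i). (r x j i + e (r x) j i) / (1 + (\<Sum>k\<in>N. e (r x) j k)))" for x
  have e0: "0 \<le> e w j i" for w j i by (simp add: e_def)
  have eS: "0 \<le> (\<Sum>k\<in>N. e w j k)" for w j by (intro sum_nonneg e0)
  have rD: "r x \<in> \<Delta> J N" if "\<And>j. j \<in> J \<times> N \<Longrightarrow> x j \<in> {0..1}" for x
  proof -
    have "(\<Sum>i\<in>N. r x j i) = 1" for j
    proof -
      have "(\<Sum>i\<in>N. r x j i) = (s x j + max 0 (1 - s x j)) / max 1 (s x j)"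
        using cN by (simp add: r_def s_def sum_divide_distrib[symmetric] sum.distrib)
      also have "\<dots> = 1" by (auto simp: max_def)
      finally show ?thesis .
    qed
    moreover have "0 \<le> r x j i" if "j \<in> J" "i \<in> N" for j i
      using that \<open>\<And>j. j \<in> J \<times> N \<Longrightarrow> x j \<in> {0..1}\<close>[of "(j, i)"] cN
      by (auto simp: r_def intro!: divide_nonneg_nonneg add_nonneg_nonneg)
    ultimately show ?thesis by (auto simp: \<Delta>_def)
  qed
  have fsum: "(\<Sum>i\<in>N. f x (j, i)) = 1" if "\<And>j. j \<in> J \<times> N \<Longrightarrow> x j \<in> {0..1}" "j \<in> J" for x j
  proof -
    have "(\<Sum>i\<in>N. f x (j, i)) = ((\<Sum>i\<in>N. r x j i) + (\<Sum>i\<in>N. e (r x) j i)) / (1 + (\<Sum>k\<in>N. e (r x) j k))"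
      by (simp add: f_def sum_divide_distrib[symmetric] sum.distrib)
    also have "(\<Sum>i\<in>N. r x j i) = 1" using rD[OF that(1)] that(2) by (auto simp: \<Delta>_def)
    finally show ?thesis using eS[of "r x" j] by simp
  qed
  have f0: "0 \<le> f x (j, i)" if "\<And>j. j \<in> J \<times> N \<Longrightarrow> x j \<in> {0..1}" "j \<in> J" "i \<in> N" for x j i
    using rD[OF that(1)] that(2,3) eS[of "r x" j] e0[of "r x" j i] by (auto simp: \<Delta>_def f_def)
  obtain x where x: "\<And>j. j \<in> J \<times> N \<Longrightarrow> x j \<in> {0..1}" and fp: "\<And>j. j \<in> J \<times> N \<Longrightarrow> f x j = x j"
  proof (rule brouwer_cube_finite[of "J \<times> N" f])
    show "finite (J \<times> N)" using J N by simp
    show "f x i \<in> {0..1}" if x: "\<And>j. j \<in> J \<times> N \<Longrightarrow> x j \<in> {0..1}" "i \<in> J \<times> N" for x i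
    proof -
      obtain j k where i: "i = (j, k)" "j \<in> J" "k \<in> N" using x(2) by auto
      have "f x (j, k) \<le> (\<Sum>i\<in>N. f x (j, i))"
        using f0[OF x(1) i(2)] i N by (intro member_le_sum) auto
      then show ?thesis using fsum[OF x(1) i(2)] f0[OF x(1) i(2,3)] i(1) by auto
    qed
    show "(\<lambda>k. f (X k) i) \<longlonglongrightarrow> f x i"
      if X: "\<And>k j. j \<in> J \<times> N \<Longrightarrow> X k j \<in> {0..1}" and x: "\<And>j. j \<in> J \<times> N \<Longrightarrow> x j \<in> {0..1}"
      and lim: "\<And>j. j \<in> J \<times> N \<Longrightarrow> (\<lambda>k. X k j) \<longlonglongrightarrow> x j" and i: "i \<in> J \<times> N" for X x i
    proof -
      have s: "(\<lambda>k. s (X k) j) \<longlonglongrightarrow> s x j" if "j \<in> J" for j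
        unfolding s_def using lim that by (intro tendsto_sum) auto
      have r: "(\<lambda>k. r (X k) j i) \<longlonglongrightarrow> r x j i" if "j \<in> J" "i \<in> N" for j i
        unfolding r_def using lim[of "(j, i)"] that s[OF that(1)] cN by (intro tendsto_intros) auto
      have u: "(\<lambda>k. u j i (r (X k))) \<longlonglongrightarrow> u j i (r x)" if "j \<in> J" "i \<in> N" for j i
        using rD X x r that by (intro cont) auto
      have e: "(\<lambda>k. e (r (X k)) j i) \<longlonglongrightarrow> e (r x) j i" if "j \<in> J" "i \<in> N" for j i
        unfolding e_def using u r that by (intro tendsto_intros) auto
      obtain j k where [simp]: "i = (j, k)" and jk: "j \<in> J" "k \<in> N" using i by auto
      have "1 + (\<Sum>k\<in>N. e (r x) j k) \<noteq> 0" using eS[of "r x" j] by simp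
      then show ?thesis unfolding f_def using e r jk by (auto intro!: tendsto_intros)
    qed
  qed blast
  define w where "w = r x"
  have xs: "s x j = 1" if "j \<in> J" for j
    using fsum[of x j, OF x that] fp that by (simp add: s_def)
  have wx: "w j i = x (j, i)" if "j \<in> J" for j i
    using xs[OF that] by (simp add: w_def r_def)
  have wD: "w \<in> \<Delta> J N" unfolding w_def by (rule rD[OF x])
  have "u j k w \<le> (\<Sum>i\<in>N. w j i * u j i w)" if jk: "j \<in> J" "k \<in> N" for j k
  proof -
    let ?u = "\<Sum>i\<in>N. w j i * u j i w" and ?S = "\<Sum>k\<in>N. e w j k"
    have w: "\<And>i. i \<in> N \<Longrightarrow> 0 \<le> w j i" "(\<Sum>i\<in>N. w j i) = 1" using wD jk by (auto simp: \<Delta>_def)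
    have eq: "w j i * ?S = e w j i" if "i \<in> N" for i
    proof -
      have "(w j i + e w j i) / (1 + ?S) = w j i"
        using fp[of "(j, i)"] jk that wx by (simp add: f_def w_def[symmetric])
      then show ?thesis using eS[of w j] by (simp add: field_simps)
    qed
    have "?S = 0"
    proof (rule ccontr)
      assume "?S \<noteq> 0"
      then have S: "?S > 0" using eS[of w j] by simp
      have pos: "0 < u j i w - ?u" if "i \<in> N" "w j i \<noteq> 0" for i
      proof -
        have "0 < w j i * ?S" using w that S by (simp add: less_le)
        then show ?thesis using eq[OF that(1)] by (simp add: e_def max_def split: if_splits)
      qed
      \<comment> \<open>Weighted by \<open>w j\<close>, the deviations from the mean payoff add up
        to zero, whereas a positive total excess would make them positive for every action in
        use.\<close>
      have "(\<Sum>i\<in>N. w j i * (u j i w - ?u)) = ?u - (\<Sum>i\<in>N. w j i) * ?u"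
        by (simp add: right_diff_distrib sum_subtractf sum_distrib_right)
      also have "\<dots> = 0" using w(2) by simp
      finally have z: "(\<Sum>i\<in>N. w j i * (u j i w - ?u)) = 0" .
      have nn: "0 \<le> w j i * (u j i w - ?u)" if "i \<in> N" for i
        using pos[OF that] w(1)[OF that] by (cases "w j i = 0") auto
      have "\<forall>i\<in>N. w j i * (u j i w - ?u) = 0"
        using z nn N by (subst (asm) sum_nonneg_eq_0_iff) auto
      then have "\<forall>i\<in>N. w j i = 0" using pos by fastforce
      then show False using w(2) by simp
    qed
    then have "e w j k = 0" using eq[OF jk(2)] by simp
    then show ?thesis by (simp add: e_def max_def split: if_splits)
  qed
  then show ?thesis using that wD by blast
qed


section \<open>Densities and pairings\<close>

context finite_measure_subalgebra
begin

lemma AE_eq_of_set_integrals: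
  fixes f h :: "'a \<Rightarrow> real"
  assumes [measurable]: "f \<in> borel_measurable F" "h \<in> borel_measurable F" and i: "integrable M f" "integrable M h"
    and eq: "\<And>A. A \<in> sets F \<Longrightarrow> (LINT t:A|M. f t) = (LINT t:A|M. h t)"
  shows "AE t in M. f t = h t"
proof -
  have "AE t in M. 0 \<le> f t - h t"
    using eq i by (intro AE_nonneg_of_set_integrals) (auto simp: set_integral_diff set_integrable_F)
  moreover have "AE t in M. 0 \<le> h t - f t"
    using eq i by (intro AE_nonneg_of_set_integrals) (auto simp: set_integral_diff set_integrable_F)
  ultimately show ?thesis by eventually_elim simp
qed

text \<open>The bound makes \<open>m\<close> continuous at the empty set, so that finite additivity
  already gives countable additivity. Adding \<open>K * measure M\<close> yields a nonnegative
  measure, to which the Radon-Nikodym theorem over \<open>F\<close> applies.\<close>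

lemma bounded_additive_density:
  fixes m :: "'a set \<Rightarrow> real"
  assumes add: "\<And>A B. A \<in> sets F \<Longrightarrow> B \<in> sets F \<Longrightarrow> A \<inter> B = {} \<Longrightarrow> m (A \<union> B) = m A + m B"
    and bdd: "\<And>A. A \<in> sets F \<Longrightarrow> \<bar>m A\<bar> \<le> K * measure M A" and K: "0 \<le> K"
  obtains \<phi> where "\<phi> \<in> borel_measurable F" "\<And>t. \<bar>\<phi> t\<bar> \<le> K" "\<And>A. A \<in> sets F \<Longrightarrow> (LINT t:A|M. \<phi> t) = m A"
proof -
  let ?R = "restr_to_subalg M F"
  interpret R: finite_measure ?R by (rule finite_measure_restr_to_subalg[OF subalg]) unfold_locales
  define \<nu> where "\<nu> A = m A + K * measure M A" for A
  have \<nu>0: "0 \<le> \<nu> A" and \<nu>2: "\<nu> A \<le> 2 * K * measure M A" if "A \<in> sets F" for A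
    using bdd[OF that] by (auto simp: \<nu>_def abs_le_iff)
  have \<nu>add: "\<nu> (A \<union> B) = \<nu> A + \<nu> B" if "A \<in> sets F" "B \<in> sets F" "A \<inter> B = {}" for A B
    using that add[OF that] finite_measure_Union[of A B] sets_F by (simp add: \<nu>_def algebra_simps)
  have \<nu>e: "\<nu> {} = 0" using bdd[of "{}"] by (simp add: \<nu>_def)
  define N where "N = measure_of (space M) (sets F) (\<lambda>A. ennreal (\<nu> A))"
  have sF: "sigma_sets (space M) (sets F) = sets F" using sets.sigma_sets_eq[of F] by (simp add: space_F)
  have FP: "sets F \<subseteq> Pow (space M)" using sets.space_closed[of F] by (simp add: space_F)
  have "countably_additive (sets F) (\<lambda>A. ennreal (\<nu> A))"
  proof (rule sets.empty_continuous_imp_countably_additive)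
    show "positive (sets F) (\<lambda>A. ennreal (\<nu> A))" by (simp add: positive_def \<nu>e)
    show "Measure_Space.additive (sets F) (\<lambda>A. ennreal (\<nu> A))"
      using \<nu>add \<nu>0 by (auto simp: additive_def ennreal_plus[symmetric] simp del: ennreal_plus)
    show "\<forall>A\<in>sets F. ennreal (\<nu> A) \<noteq> \<infinity>" by simp
    fix A :: "nat \<Rightarrow> 'a set" assume A: "range A \<subseteq> sets F" "decseq A" "(\<Inter>i. A i) = {}"
    have "(\<lambda>i. measure M (A i)) \<longlonglongrightarrow> measure M (\<Inter>i. A i)"
      using A sets_F by (intro finite_Lim_measure_decseq) auto
    then have "(\<lambda>i. 2 * K * measure M (A i)) \<longlonglongrightarrow> 2 * K * 0" using A by (intro tendsto_intros) auto
    then have "(\<lambda>i. \<nu> (A i)) \<longlonglongrightarrow> 0"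
      using A \<nu>0 \<nu>2 by (intro real_tendsto_sandwich[of "\<lambda>_. 0" "\<lambda>i. \<nu> (A i)" _ "\<lambda>i. 2 * K * measure M (A i)"]) (auto intro!: always_eventually)
    then show "(\<lambda>i. ennreal (\<nu> (A i))) \<longlonglongrightarrow> 0" by (metis ennreal_0 tendsto_ennrealI)
  qed
  then have N: "emeasure N A = ennreal (\<nu> A)" if "A \<in> sets F" for A
    unfolding N_def using sets.sigma_algebra_axioms[of F] that
    by (intro emeasure_measure_of_sigma) (auto simp: positive_def \<nu>e space_F)
  have sN: "sets N = sets ?R"
    unfolding N_def sets_restr_to_subalg[OF subalg] using FP sF by simp
  have "absolutely_continuous ?R N"
    unfolding absolutely_continuous_def
  proof
    fix A assume "A \<in> null_sets ?R"
    then have A: "A \<in> sets F" "measure M A = 0"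
      unfolding null_sets_restr_to_subalg[OF subalg] by (auto simp: measure_def)
    then have "\<nu> A = 0" using \<nu>0[OF A(1)] \<nu>2[OF A(1)] by simp
    then show "A \<in> null_sets N" using N[OF A(1)] A(1) sN
      by (intro null_setsI) (auto simp: sets_restr_to_subalg[OF subalg])
  qed
  from R.Radon_Nikodym[OF this sN] obtain f where f: "f \<in> borel_measurable ?R" "density ?R f = N" by blast
  have fF [measurable]: "f \<in> borel_measurable F" using f(1) by (rule measurable_in_subalg'[OF subalg])
  have fA: "(\<integral>\<^sup>+t. f t * indicator A t \<partial>M) = ennreal (\<nu> A)" if [measurable]: "A \<in> sets F" for A
  proof -
    have "(\<integral>\<^sup>+t. f t * indicator A t \<partial>M) = (\<integral>\<^sup>+t. f t * indicator A t \<partial>?R)"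
      by (intro nn_integral_subalgebra2[OF subalg, symmetric]) measurable
    also have "\<dots> = emeasure N A"
      unfolding f(2)[symmetric] using f(1) that by (subst emeasure_density) (auto simp: sets_restr_to_subalg[OF subalg])
    finally show ?thesis using N[OF that] by simp
  qed
  have fM [measurable]: "f \<in> borel_measurable M" by (rule meas_F[OF fF])
  have spF: "space M \<in> sets F" using sets.top[of F] by (simp add: space_F)
  have "(\<integral>\<^sup>+t. f t \<partial>M) = (\<integral>\<^sup>+t. f t * indicator (space M) t \<partial>M)" by (intro nn_integral_cong) simp
  then have fint: "(\<integral>\<^sup>+t. f t \<partial>M) = ennreal (\<nu> (space M))" using fA[OF spF] by simp
  then have fin: "AE t in M. f t \<noteq> \<infinity>" by (intro nn_integral_noteq_infinite) auto
  define h where "h t = enn2real (f t)" for t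
  have hF [measurable]: "h \<in> borel_measurable F" unfolding h_def by measurable
  have hM [measurable]: "h \<in> borel_measurable M" by (rule meas_F[OF hF])
  have h_ennreal: "AE t in M. ennreal (h t) = f t" using fin by eventually_elim (simp add: h_def less_top)
  have hint: "integrable M h"
  proof (rule integrableI_bounded)
    have "(\<integral>\<^sup>+t. ennreal (norm (h t)) \<partial>M) = (\<integral>\<^sup>+t. f t \<partial>M)"
      using h_ennreal by (intro nn_integral_cong_AE) (auto simp: h_def)
    then show "(\<integral>\<^sup>+t. ennreal (norm (h t)) \<partial>M) < \<infinity>" using fint by simp
  qed simp
  have hA: "(LINT t:A|M. h t) = \<nu> A" if A: "A \<in> sets F" for A
  proof -
    have [measurable]: "A \<in> sets M" by (rule sets_F[OF A])
    have "(LINT t:A|M. h t) = enn2real (\<integral>\<^sup>+t. ennreal (indicator A t *\<^sub>R h t) \<partial>M)"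
      unfolding set_lebesgue_integral_def by (intro integral_eq_nn_integral) (auto simp: h_def)
    also have "(\<integral>\<^sup>+t. ennreal (indicator A t *\<^sub>R h t) \<partial>M) = (\<integral>\<^sup>+t. f t * indicator A t \<partial>M)"
      using h_ennreal by (intro nn_integral_cong_AE) (auto simp: indicator_def)
    finally show ?thesis using fA[OF A] \<nu>0[OF A] by simp
  qed
  have up: "AE t in M. 0 \<le> 2 * K - h t"
    using hint hA \<nu>2 sets_F
    by (intro AE_nonneg_of_set_integrals) (auto simp: set_integral_diff set_integrable_F set_integral_const_real mult_ac)
  \<comment> \<open>Undo the shift and truncate. Almost everywhere the truncation changes nothing;
    it makes the bound hold at every \<open>t\<close>.\<close>
  define \<phi> where "\<phi> t = max (- K) (min K (h t - K))" for t
  have "AE t in M. \<phi> t = h t - K"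
    using up by eventually_elim (auto simp: \<phi>_def h_def)
  then have "(LINT t:A|M. \<phi> t) = m A" if A: "A \<in> sets F" for A
  proof -
    assume eq: "AE t in M. \<phi> t = h t - K"
    have "(LINT t:A|M. \<phi> t) = (LINT t:A|M. h t - K)"
      unfolding set_lebesgue_integral_def using eq sets_F[OF A]
      by (intro integral_cong_AE) (auto simp: \<phi>_def)
    also have "\<dots> = \<nu> A - K * measure M A"
      using hA[OF A] hint A sets_F[OF A] by (simp add: set_integral_diff set_integrable_F set_integral_const_real)
    finally show ?thesis by (simp add: \<nu>_def)
  qed
  moreover have "\<phi> \<in> borel_measurable F" unfolding \<phi>_def by measurable
  moreover have "\<bar>\<phi> t\<bar> \<le> K" for t using K by (auto simp: \<phi>_def)
  ultimately show ?thesis using that by blast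
qed

end

text \<open>The sets along which the frequencies converge form a Dynkin system: in a countable
  disjoint union the terms are dominated by the summable \<open>measure M (A i)\<close>, so that the
  limit may be taken under the sum (Tannery). Thus convergence on a countable generator, obtained by
  a diagonal argument, extends to the whole sub-\<sigma>-algebra.\<close>

lemma (in finite_measure) convergent_measure_Int:
  assumes C: "Int_stable C" "C \<subseteq> Pow (space M)" "sigma_sets (space M) C \<subseteq> sets M"
    and B: "\<And>n. B n \<in> sets M"
    and conv: "\<And>A. A \<in> C \<Longrightarrow> convergent (\<lambda>n. measure M (A \<inter> B n))"
      "convergent (\<lambda>n. measure M (space M \<inter> B n))"
    and A: "A \<in> sigma_sets (space M) C"
  shows "convergent (\<lambda>n::nat. measure M (A \<inter> B n))"
  using C(1,2) A
proof (induction rule: sigma_sets_induct_disjoint)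
  case (basic A)
  then show ?case using conv by blast
next
  case empty
  then show ?case by (simp add: convergent_const)
next
  case (compl A)
  have "measure M ((space M - A) \<inter> B n) = measure M (space M \<inter> B n) - measure M (A \<inter> B n)" for n
  proof -
    have "A \<in> sets M" using compl(1) C(3) by blast
    moreover from this have "A \<subseteq> space M" by (rule sets.sets_into_space)
    ultimately have "measure M (space M \<inter> B n - A \<inter> B n) = measure M (space M \<inter> B n) - measure M (A \<inter> B n)"
      using B by (intro finite_measure_Diff) auto
    moreover have "(space M - A) \<inter> B n = space M \<inter> B n - A \<inter> B n" by auto
    ultimately show ?thesis by simp
  qed
  then show ?case using convergent_diff[OF conv(2) compl(2)] by simp
next
  case (union A)
  have Am: "A i \<in> sets M" for i using union(2) C(3) by auto
  have eq: "measure M ((\<Union>i. A i) \<inter> B n) = (\<Sum>i. measure M (A i \<inter> B n))" for n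
  proof -
    have "(\<lambda>i. measure M (A i \<inter> B n)) sums measure M (\<Union>i. A i \<inter> B n)"
    proof (rule finite_measure_UNION)
      show "disjoint_family (\<lambda>i. A i \<inter> B n)"
        using union(1) unfolding disjoint_family_on_def by blast
    qed (use Am B in auto)
    then show ?thesis by (simp add: sums_iff)
  qed
  have sm: "summable (\<lambda>i. measure M (A i))"
    using finite_measure_UNION[of A] Am union(1) by (auto simp: sums_iff)
  have lim: "(\<lambda>n. measure M (A i \<inter> B n)) \<longlonglongrightarrow> lim (\<lambda>n. measure M (A i \<inter> B n))" for i
    using union(3) by (simp add: convergent_LIMSEQ_iff)
  have "(\<lambda>n. \<Sum>i. measure M (A i \<inter> B n)) \<longlonglongrightarrow> (\<Sum>i. lim (\<lambda>n. measure M (A i \<inter> B n)))"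
  proof (rule tannerys_theorem[THEN conjunct2, THEN conjunct2])
    show "\<forall>\<^sub>F (k, n) in sequentially \<times>\<^sub>F sequentially. norm (measure M (A k \<inter> B n)) \<le> measure M (A k)"
      using Am B by (intro always_eventually) (auto intro!: finite_measure_mono)
  qed (use lim sm in auto)
  then show ?case unfolding eq by (auto simp: convergent_def)
qed

lemma (in finite_measure) approx_by_algebra:
  assumes R: "\<And>A. A \<in> R \<Longrightarrow> A \<in> sets M" "{} \<in> R" "\<And>A. A \<in> R \<Longrightarrow> space M - A \<in> R"
      "\<And>A B. A \<in> R \<Longrightarrow> B \<in> R \<Longrightarrow> A \<union> B \<in> R"
    and C: "C \<subseteq> R" and A: "A \<in> sigma_sets (space M) C" and e: "e > 0"
  obtains B where "B \<in> R" "measure M (sym_diff A B) < e"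
proof -
  have "\<forall>e>0. \<exists>B\<in>R. measure M (sym_diff A B) < e"
    using A
  proof induction
    case (Basic a)
    then show ?case using C by (intro allI impI bexI[of _ a]) auto
  next
    case Empty
    then show ?case using R by (intro allI impI bexI[of _ "{}"]) auto
  next
    case (Compl a)
    show ?case
    proof (intro allI impI)
      fix e :: real assume "e > 0"
      then obtain B where B: "B \<in> R" "measure M (sym_diff a B) < e" using Compl(2) by auto
      have "C \<subseteq> Pow (space M)" using C sets.sets_into_space[OF R(1)] by auto
      then have "a \<subseteq> space M" using Compl(1) by (rule sigma_sets_into_sp)
      then have "sym_diff (space M - a) (space M - B) = sym_diff a B"
        using sets.sets_into_space[OF R(1)[OF B(1)]] by auto
      then show "\<exists>B\<in>R. measure M (sym_diff (space M - a) B) < e" using B(2) by (intro bexI[OF _ R(3)[OF B(1)]]) simp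
    qed
  next
    case (Union a)
    have am: "a i \<in> sets M" for i
    proof -
      have "sigma_sets (space M) C \<subseteq> sets M" using C R(1) by (intro sets.sigma_sets_subset) auto
      then show ?thesis using Union(1) by auto
    qed
    show ?case
    proof (intro allI impI)
      fix e :: real assume e: "e > 0"
      have "(\<lambda>n. measure M (\<Union>i<n. a i)) \<longlonglongrightarrow> measure M (\<Union>n. \<Union>i<n. a i)"
        using am by (intro finite_Lim_measure_incseq monoI UN_mono) auto
      moreover have U: "(\<Union>n. \<Union>i<n. a i) = (\<Union>i. a i)" by auto
      ultimately have "\<forall>\<^sub>F n in sequentially. dist (measure M (\<Union>i<n. a i)) (measure M (\<Union>i. a i)) < e / 2"
        using e by (auto dest!: tendstoD[of _ _ _ "e/2"])
      then obtain n where n: "dist (measure M (\<Union>i<n. a i)) (measure M (\<Union>i. a i)) < e / 2"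
        by (auto simp: eventually_sequentially)
      have "\<forall>i. \<exists>B\<in>R. measure M (sym_diff (a i) B) < e / (2 * Suc n)" using Union(2) e by simp
      then obtain B where B: "\<And>i. B i \<in> R" "\<And>i. measure M (sym_diff (a i) (B i)) < e / (2 * Suc n)" by metis
      have Bm: "B i \<in> sets M" for i using B(1) R(1) by blast
      have BR: "(\<Union>i<k. B i) \<in> R" for k by (induction k) (auto simp: lessThan_Suc R(2) intro!: R(4) B(1))
      have "measure M (sym_diff (\<Union>i. a i) (\<Union>i<n. B i)) \<le>
          measure M (((\<Union>i. a i) - (\<Union>i<n. a i)) \<union> (\<Union>i<n. sym_diff (a i) (B i)))"
        using am Bm by (intro finite_measure_mono) auto
      also have "\<dots> \<le> measure M ((\<Union>i. a i) - (\<Union>i<n. a i)) + measure M (\<Union>i<n. sym_diff (a i) (B i))"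
        using am Bm by (intro measure_Un_le) auto
      also have "measure M ((\<Union>i. a i) - (\<Union>i<n. a i)) = measure M (\<Union>i. a i) - measure M (\<Union>i<n. a i)"
        using am by (intro finite_measure_Diff) auto
      also have "\<dots> < e / 2" using n[unfolded dist_real_def abs_less_iff] by linarith
      also have "measure M (\<Union>i<n. sym_diff (a i) (B i)) \<le> (\<Sum>i<n. measure M (sym_diff (a i) (B i)))"
        using am Bm by (intro measure_UNION_le) auto
      also have "\<dots> \<le> (\<Sum>i<n. e / (2 * Suc n))" using B(2) by (intro sum_mono) (auto intro: less_imp_le)
      also have "\<dots> \<le> e / 2" using e by (simp add: field_simps)
      finally have "measure M (sym_diff (\<Union>i. a i) (\<Union>i<n. B i)) < e" by simp
      then show "\<exists>B\<in>R. measure M (sym_diff (\<Union>i. a i) B) < e" using BR by blast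
    qed
  qed
  then show ?thesis using that e by blast
qed

section \<open>Pairings of fields of functionals with integrable functions\<close>

lemma measurable_pairing:
  fixes L :: "'a \<Rightarrow> 'b::{real_normed_vector, second_countable_topology} \<Rightarrow> real"
  assumes L: "\<And>t. t \<in> space M \<Longrightarrow> bounded_linear (L t)" "\<And>v. (\<lambda>t. L t v) \<in> borel_measurable M"
    and f: "f \<in> borel_measurable M"
  shows "(\<lambda>t. L t (f t)) \<in> borel_measurable M"
proof -
  obtain s where s: "\<And>i. simple_function M (s i)" "\<And>t. t \<in> space M \<Longrightarrow> (\<lambda>i. s i t) \<longlonglongrightarrow> f t"
    using borel_measurable_implies_sequence_metric[OF f, of 0] by blast
  show ?thesis
  proof (rule borel_measurable_LIMSEQ_real)
    show "(\<lambda>i. L t (s i t)) \<longlonglongrightarrow> L t (f t)" if "t \<in> space M" for t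
      using bounded_linear.tendsto[OF L(1)[OF that] s(2)[OF that]] .
    show "(\<lambda>t. L t (s i t)) \<in> borel_measurable M" for i
    proof (rule measurable_compose_countable'[where f = "\<lambda>v t. L t v" and g = "s i" and I = "s i ` space M"])
      show "s i \<in> M \<rightarrow>\<^sub>M count_space (s i ` space M)"
        using measurable_sets[OF measurable_simple_function[OF s(1)[of i]]] by (auto simp: measurable_def)
      show "countable (s i ` space M)" by (intro countable_finite simple_functionD(1)[OF s(1)])
    qed (rule L(2))
  qed
qed

lemma integrable_pairing:
  fixes L :: "'a \<Rightarrow> 'b::{banach, second_countable_topology} \<Rightarrow> real"
  assumes L: "\<And>t. t \<in> space M \<Longrightarrow> bounded_linear (L t)" "\<And>v. (\<lambda>t. L t v) \<in> borel_measurable M"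
      "\<And>t v. t \<in> space M \<Longrightarrow> \<bar>L t v\<bar> \<le> K * norm v"
    and f: "integrable M f"
  shows "integrable M (\<lambda>t. L t (f t))" "\<bar>LINT t|M. L t (f t)\<bar> \<le> K * (LINT t|M. norm (f t))"
proof -
  have m: "(\<lambda>t. L t (f t)) \<in> borel_measurable M"
    by (rule measurable_pairing[OF L(1,2) borel_measurable_integrable[OF f]])
  have K: "integrable M (\<lambda>t. K * norm (f t))" using f by auto
  show i: "integrable M (\<lambda>t. L t (f t))"
  proof (rule Bochner_Integration.integrable_bound[OF K m])
    show "AE t in M. norm (L t (f t)) \<le> norm (K * norm (f t))"
    proof (rule AE_I2)
      fix t assume "t \<in> space M"
      then have "\<bar>L t (f t)\<bar> \<le> K * norm (f t)" by (rule L(3))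
      then show "norm (L t (f t)) \<le> norm (K * norm (f t))" by simp
    qed
  qed
  have "\<bar>LINT t|M. L t (f t)\<bar> \<le> (LINT t|M. \<bar>L t (f t)\<bar>)" by (rule integral_abs_bound)
  also have "\<dots> \<le> (LINT t|M. K * norm (f t))" using i K L(3) by (intro integral_mono) auto
  finally show "\<bar>LINT t|M. L t (f t)\<bar> \<le> K * (LINT t|M. norm (f t))" by simp
qed

text \<open>The assumed limits concern indicators times constant vectors and extend to simple
  functions by linearity. The uniform bound \<open>K\<close> makes the set of admissible
  \<open>f\<close> closed under convergence in the mean, and simple functions are dense.\<close>

lemma (in finite_measure_subalgebra) pairing_tendsto:
  fixes L :: "nat \<Rightarrow> 'a \<Rightarrow> 'b::{banach, second_countable_topology} \<Rightarrow> real"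
  assumes L: "\<And>n t. t \<in> space M \<Longrightarrow> bounded_linear (L n t)" "\<And>n v. (\<lambda>t. L n t v) \<in> borel_measurable M"
      "\<And>n t v. t \<in> space M \<Longrightarrow> \<bar>L n t v\<bar> \<le> K * norm v"
    and L': "\<And>t. t \<in> space M \<Longrightarrow> bounded_linear (L' t)" "\<And>v. (\<lambda>t. L' t v) \<in> borel_measurable M"
      "\<And>t v. t \<in> space M \<Longrightarrow> \<bar>L' t v\<bar> \<le> K * norm v"
    and K: "0 \<le> K"
    and lim: "\<And>A v. A \<in> sets F \<Longrightarrow> (\<lambda>n. LINT t:A|M. L n t v) \<longlonglongrightarrow> (LINT t:A|M. L' t v)"
    and f: "integrable (restr_to_subalg M F) f"
  shows "(\<lambda>n. LINT t|M. L n t (f t)) \<longlonglongrightarrow> (LINT t|M. L' t (f t))"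
  using f
proof (induction rule: integrable_induct)
  case (base A c)
  then have A: "A \<in> sets F" by (simp add: sets_restr_to_subalg[OF subalg])
  have "(LINT t|M. L n t (indicator A t *\<^sub>R c)) = (LINT t:A|M. L n t c)" for n
    unfolding set_lebesgue_integral_def
    by (intro Bochner_Integration.integral_cong refl) (simp add: linear_simps(5)[OF L(1)])
  moreover have "(LINT t|M. L' t (indicator A t *\<^sub>R c)) = (LINT t:A|M. L' t c)"
    unfolding set_lebesgue_integral_def
    by (intro Bochner_Integration.integral_cong refl) (simp add: linear_simps(5)[OF L'(1)])
  ultimately show ?case using lim[OF A] by simp
next
  case (add f g)
  have fg: "integrable M f" "integrable M g"
    using add integrable_from_subalg[OF subalg] by auto
  have "(LINT t|M. L n t (f t + g t)) = (LINT t|M. L n t (f t)) + (LINT t|M. L n t (g t))" for n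
    using integrable_pairing(1)[of M "L n", OF L fg(1)] integrable_pairing(1)[of M "L n", OF L fg(2)]
    by (simp add: linear_simps(1)[OF L(1)] cong: Bochner_Integration.integral_cong)
  moreover have "(LINT t|M. L' t (f t + g t)) = (LINT t|M. L' t (f t)) + (LINT t|M. L' t (g t))"
    using integrable_pairing(1)[of M L', OF L' fg(1)] integrable_pairing(1)[of M L', OF L' fg(2)]
    by (simp add: linear_simps(1)[OF L'(1)] cong: Bochner_Integration.integral_cong)
  ultimately show ?case using tendsto_add[OF add(3,4)] by simp
next
  case (lim f s)
  have sp: "space (restr_to_subalg M F) = space M" by (rule space_restr_to_subalg)
  have f: "integrable M f" and s: "\<And>i. integrable M (s i)"
    using lim(1,4) integrable_from_subalg[OF subalg] by auto
  have d: "integrable M (\<lambda>t. f t - s i t)" for i using f s by auto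
  have dint: "(\<lambda>i. LINT t|M. norm (f t - s i t)) \<longlonglongrightarrow> (LINT t|M. 0)"
  proof (rule integral_dominated_convergence[where w = "\<lambda>t. 3 * norm (f t)"])
    show "AE t in M. (\<lambda>i. norm (f t - s i t)) \<longlonglongrightarrow> 0"
    proof (rule AE_I2)
      fix t assume "t \<in> space M"
      then have "(\<lambda>i. norm (f t - s i t)) \<longlonglongrightarrow> norm (f t - f t)"
        by (intro tendsto_intros lim(2)) (simp add: sp)
      then show "(\<lambda>i. norm (f t - s i t)) \<longlonglongrightarrow> 0" by simp
    qed
    show "AE t in M. norm (norm (f t - s i t)) \<le> 3 * norm (f t)" for i
    proof (rule AE_I2)
      fix t assume "t \<in> space M"
      then have "norm (s i t) \<le> 2 * norm (f t)" using lim(3) sp by auto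
      then show "norm (norm (f t - s i t)) \<le> 3 * norm (f t)"
        using norm_triangle_ineq4[of "f t" "s i t"] by simp
    qed
  qed (use f s in auto)
  have diff: "\<bar>(LINT t|M. L n t (f t)) - (LINT t|M. L n t (s i t))\<bar> \<le> K * (LINT t|M. norm (f t - s i t))" for n i
  proof -
    have "(LINT t|M. L n t (f t)) - (LINT t|M. L n t (s i t)) = (LINT t|M. L n t (f t - s i t))"
      using integrable_pairing(1)[of M "L n", OF L f] integrable_pairing(1)[of M "L n", OF L s]
      by (simp add: linear_simps(2)[OF L(1)] cong: Bochner_Integration.integral_cong)
    then show ?thesis using integrable_pairing(2)[of M "L n", OF L d] by simp
  qed
  have diff': "\<bar>(LINT t|M. L' t (f t)) - (LINT t|M. L' t (s i t))\<bar> \<le> K * (LINT t|M. norm (f t - s i t))" for i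
  proof -
    have "(LINT t|M. L' t (f t)) - (LINT t|M. L' t (s i t)) = (LINT t|M. L' t (f t - s i t))"
      using integrable_pairing(1)[of M L', OF L' f] integrable_pairing(1)[of M L', OF L' s]
      by (simp add: linear_simps(2)[OF L'(1)] cong: Bochner_Integration.integral_cong)
    then show ?thesis using integrable_pairing(2)[of M L', OF L' d] by simp
  qed
  show ?case
  proof (rule LIMSEQ_I)
    fix e :: real assume e: "e > 0"
    have "(\<lambda>i. K * (LINT t|M. norm (f t - s i t))) \<longlonglongrightarrow> K * 0"
      using dint by (intro tendsto_intros) simp
    then have "\<forall>\<^sub>F i in sequentially. dist (K * (LINT t|M. norm (f t - s i t))) (K * 0) < e / 3"
      using e by (intro tendstoD) auto
    then obtain i where "dist (K * (LINT t|M. norm (f t - s i t))) (K * 0) < e / 3"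
      by (auto simp only: eventually_sequentially)
    then have i: "K * (LINT t|M. norm (f t - s i t)) < e / 3"
      by (simp only: dist_real_def abs_less_iff) simp
    obtain N where N: "\<And>n. n \<ge> N \<Longrightarrow> norm ((LINT t|M. L n t (s i t)) - (LINT t|M. L' t (s i t))) < e / 3"
      using LIMSEQ_D[OF lim(5)[of i], of "e / 3"] e by auto
    show "\<exists>N. \<forall>n\<ge>N. norm ((LINT t|M. L n t (f t)) - (LINT t|M. L' t (f t))) < e"
    proof (intro exI allI impI)
      fix n assume "n \<ge> N"
      then show "norm ((LINT t|M. L n t (f t)) - (LINT t|M. L' t (f t))) < e"
        using N[of n] diff[of n i] diff'[of i] i unfolding real_norm_def abs_le_iff abs_less_iff by linarith
    qed
  qed
qed


section \<open>Purification and compactness of strategy profiles\<close>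

locale prob_subalgebra = prob_space M + finite_measure_subalgebra M F for M F :: "'a measure"

lemma (in finite_measure) set_integral_finite_valued:
  fixes c :: "'s \<Rightarrow> real"
  assumes P: "finite P" "\<And>t. t \<in> space M \<Longrightarrow> S t \<in> P" "\<And>\<sigma>. \<sigma> \<in> P \<Longrightarrow> {t\<in>space M. S t = \<sigma>} \<in> sets M"
    and E: "E \<in> sets M"
  shows "(LINT t:E|M. c (S t)) = (\<Sum>\<sigma>\<in>P. c \<sigma> * measure M (E \<inter> {t\<in>space M. S t = \<sigma>}))"
    and "set_integrable M E (\<lambda>t. c (S t))"
proof -
  have eq: "indicator E t *\<^sub>R c (S t) = (\<Sum>\<sigma>\<in>P. c \<sigma> * indicator (E \<inter> {t\<in>space M. S t = \<sigma>}) t)"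
    if t: "t \<in> space M" for t
  proof -
    have "(\<Sum>\<sigma>\<in>P. c \<sigma> * indicator (E \<inter> {t\<in>space M. S t = \<sigma>}) t) = (\<Sum>\<sigma>\<in>P. if \<sigma> = S t then indicator E t * c \<sigma> else 0)"
      using t by (intro sum.cong) (auto simp: indicator_def)
    then show ?thesis using P(1) P(2)[OF t] by simp
  qed
  have m: "E \<inter> {t\<in>space M. S t = \<sigma>} \<in> sets M" if "\<sigma> \<in> P" for \<sigma> using P(3)[OF that] E by auto
  have i: "integrable M (\<lambda>t. c \<sigma> * indicator (E \<inter> {t\<in>space M. S t = \<sigma>}) t)" if "\<sigma> \<in> P" for \<sigma>
    using m[OF that] by (intro integrable_mult_right) (simp add: emeasure_eq_measure)
  have "(LINT t:E|M. c (S t)) = (LINT t|M. (\<Sum>\<sigma>\<in>P. c \<sigma> * indicator (E \<inter> {t\<in>space M. S t = \<sigma>}) t))"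
    unfolding set_lebesgue_integral_def using eq by (intro Bochner_Integration.integral_cong) auto
  also have "\<dots> = (\<Sum>\<sigma>\<in>P. LINT t|M. c \<sigma> * indicator (E \<inter> {t\<in>space M. S t = \<sigma>}) t)"
    using i by (intro Bochner_Integration.integral_sum) auto
  also have "\<dots> = (\<Sum>\<sigma>\<in>P. c \<sigma> * measure M (E \<inter> {t\<in>space M. S t = \<sigma>}))"
    using m by (intro sum.cong refl) simp
  finally show "(LINT t:E|M. c (S t)) = (\<Sum>\<sigma>\<in>P. c \<sigma> * measure M (E \<inter> {t\<in>space M. S t = \<sigma>}))" .
  have "integrable M (\<lambda>t. (\<Sum>\<sigma>\<in>P. c \<sigma> * indicator (E \<inter> {t\<in>space M. S t = \<sigma>}) t))"
    using i by (intro Bochner_Integration.integrable_sum) auto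
  then show "set_integrable M E (\<lambda>t. c (S t))"
    unfolding set_integrable_def using eq by (simp cong: Bochner_Integration.integrable_cong)
qed

lemma (in finite_measure_subalgebra) finite_conditional_splitting:
  assumes ne: "nowhere_equivalent M F"
    and w: "\<And>i::nat. i < n \<Longrightarrow> w i \<in> borel_measurable F" "\<And>i. i < n \<Longrightarrow> integrable M (w i)"
      "\<And>i t. i < n \<Longrightarrow> 0 \<le> w i t"
    and D: "D \<in> sets M" "\<And>E. E \<in> sets F \<Longrightarrow> (\<Sum>i<n. LINT t:E|M. w i t) \<le> measure M (E \<inter> D)"
  shows "\<exists>B. (\<forall>i<n. B i \<in> sets M \<and> B i \<subseteq> D \<and> (\<forall>E\<in>sets F. measure M (E \<inter> B i) = (LINT t:E|M. w i t))) \<and>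
      disjoint_family_on B {..<n}"
  using w D
proof (induction n arbitrary: D)
  case 0
  then show ?case by (auto simp: disjoint_family_on_def)
next
  case (Suc n)
  have nn: "0 \<le> (LINT t:E|M. w i t)" if "i < Suc n" for i E
    unfolding set_lebesgue_integral_def using Suc.prems(3)[OF that] by (intro Bochner_Integration.integral_nonneg) (auto simp: indicator_def)
  have le: "(LINT t:E|M. w n t) \<le> measure M (E \<inter> D)" if "E \<in> sets F" for E
  proof -
    have "0 \<le> (\<Sum>i<n. LINT t:E|M. w i t)" using nn by (intro sum_nonneg) auto
    then show ?thesis using Suc.prems(5)[OF that] by simp
  qed
  obtain Bn where Bn: "Bn \<in> sets M" "Bn \<subseteq> D"
    "\<And>E. E \<in> sets F \<Longrightarrow> measure M (E \<inter> Bn) = (LINT t:E|M. w n t)"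
    using conditional_splitting[OF ne Suc.prems(4), of "w n"] Suc.prems(1,2) nn le by blast
  have "(\<Sum>i<n. LINT t:E|M. w i t) \<le> measure M (E \<inter> (D - Bn))" if E: "E \<in> sets F" for E
  proof -
    have "E \<inter> (D - Bn) = E \<inter> D - E \<inter> Bn" by auto
    then have "measure M (E \<inter> (D - Bn)) = measure M (E \<inter> D) - measure M (E \<inter> Bn)"
      using Bn Suc.prems(4) sets_F[OF E] by (simp only:) (intro finite_measure_Diff, auto)
    then show ?thesis using Suc.prems(5)[OF E] Bn(3)[OF E] by simp
  qed
  then obtain B where B: "\<forall>i<n. B i \<in> sets M \<and> B i \<subseteq> D - Bn \<and> (\<forall>E\<in>sets F. measure M (E \<inter> B i) = (LINT t:E|M. w i t))"
     "disjoint_family_on B {..<n}"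
    using Suc.IH[of "D - Bn"] Suc.prems Bn(1) by auto
  show ?case
  proof (rule exI[of _ "B(n := Bn)"], intro conjI allI impI)
    fix i assume "i < Suc n"
    then show "(B(n := Bn)) i \<in> sets M" "(B(n := Bn)) i \<subseteq> D"
      "\<forall>E\<in>sets F. measure M (E \<inter> (B(n := Bn)) i) = (LINT t:E|M. w i t)"
      using B(1) Bn by (auto simp: less_Suc_eq)
  next
    have "B i \<inter> Bn = {}" if "i < n" for i using B(1) that by blast
    then have disj: "B i \<inter> Bn = {}" "Bn \<inter> B i = {}" if "i < n" for i using that by auto
    have disj': "B i \<inter> B j = {}" if "i < n" "j < n" "i \<noteq> j" for i j
      using B(2) that unfolding disjoint_family_on_def by blast
    show "disjoint_family_on (B(n := Bn)) {..<Suc n}"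
      unfolding disjoint_family_on_def
    proof (intro ballI impI)
      fix i j assume "i \<in> {..<Suc n}" "j \<in> {..<Suc n}" "i \<noteq> j"
      then show "(B(n := Bn)) i \<inter> (B(n := Bn)) j = {}"
        using disj disj' by (cases "i = n"; cases "j = n") (simp_all add: less_Suc_eq)
    qed
  qed
qed

text \<open>An \<open>F\<close>-measurable mixed choice has a pure version with the same conditional
  law, in the manner of Dvoretzky, Wald and Wolfowitz: the sets \<open>B i\<close> with conditional
  probabilities \<open>w i\<close> are cut out one after another, each from what is left.\<close>

lemma (in finite_measure_subalgebra) purification:
  assumes ne: "nowhere_equivalent M F" and n: "0 < n"
    and w: "\<And>i::nat. i < n \<Longrightarrow> w i \<in> borel_measurable F" 
      "\<And>i t. i < n \<Longrightarrow> 0 \<le> w i t" "\<And>t. t \<in> space M \<Longrightarrow> (\<Sum>i<n. w i t) = 1"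
  obtains \<iota> where "\<And>t. \<iota> t < n" "\<And>i. {t\<in>space M. \<iota> t = i} \<in> sets M"
    "\<And>i E. i < n \<Longrightarrow> E \<in> sets F \<Longrightarrow> measure M (E \<inter> {t\<in>space M. \<iota> t = i}) = (LINT t:E|M. w i t)"
proof -
  have le1: "w i t \<le> 1" if "i < n" "t \<in> space M" for i t
    unfolding w(3)[OF that(2), symmetric] using that w(2) by (intro member_le_sum) auto
  have wM [measurable]: "w i \<in> borel_measurable M" if "i < n" for i by (rule meas_F[OF w(1)[OF that]])
  have int: "integrable M (w i)" if "i < n" for i
  proof (rule integrable_const_bound[of _ 1])
    show "AE t in M. norm (w i t) \<le> 1" using le1[OF that] w(2)[OF that] by (intro AE_I2) auto
  qed (use wM that in auto)
  have sum1: "(\<Sum>i<n. LINT t:E|M. w i t) = measure M E" if E: "E \<in> sets F" for E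
  proof -
    have "(\<Sum>i<n. LINT t:E|M. w i t) = (LINT t|M. (\<Sum>i<n. indicator E t *\<^sub>R w i t))"
      unfolding set_lebesgue_integral_def
      using set_integrable_F[OF E int] by (intro Bochner_Integration.integral_sum[symmetric]) (auto simp: set_integrable_def)
    also have "\<dots> = (LINT t|M. indicator E t)"
    proof (rule Bochner_Integration.integral_cong)
      fix t assume "t \<in> space M"
      then show "(\<Sum>i<n. indicator E t *\<^sub>R w i t) = indicator E t"
        using w(3)[of t] by (simp flip: sum_distrib_left)
    qed simp
    finally show ?thesis using sets_F[OF E] by simp
  qed
  obtain B where B: "\<And>i. i < n \<Longrightarrow> B i \<in> sets M"
     "\<And>i E. i < n \<Longrightarrow> E \<in> sets F \<Longrightarrow> measure M (E \<inter> B i) = (LINT t:E|M. w i t)"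
     and disj: "disjoint_family_on B {..<n}"
  proof -
    have "\<exists>B. (\<forall>i<n. B i \<in> sets M \<and> B i \<subseteq> space M \<and> (\<forall>E\<in>sets F. measure M (E \<inter> B i) = (LINT t:E|M. w i t))) \<and>
      disjoint_family_on B {..<n}"
      using w int sum1 sets.sets_into_space[OF sets_F]
      by (intro finite_conditional_splitting[OF ne]) (auto simp: Int_absorb2)
    then show ?thesis using that by auto
  qed
  \<comment> \<open>The sets \<open>B i\<close> fill the space up to a null set. The points left
    over get the value 0, so that \<open>\<iota>\<close> stays below \<open>n\<close>
    everywhere.\<close>
  define \<iota> where "\<iota> t = (if \<exists>i<n. t \<in> B i then (LEAST i. i < n \<and> t \<in> B i) else 0)" for t
  have \<iota>B: "\<iota> t = i" if "i < n" "t \<in> B i" for t i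
  proof -
    have "(LEAST i. i < n \<and> t \<in> B i) = i"
    proof (rule Least_equality)
      fix j assume "j < n \<and> t \<in> B j"
      then have "j = i" using that disj unfolding disjoint_family_on_def by blast
      then show "i \<le> j" by simp
    qed (use that in blast)
    then show ?thesis using that by (auto simp: \<iota>_def)
  qed
  have lt: "\<iota> t < n" for t
  proof (cases "\<exists>i<n. t \<in> B i")
    case True
    then show ?thesis using \<iota>B by auto
  qed (use n in \<open>auto simp: \<iota>_def\<close>)
  have Bsub: "B i \<subseteq> space M" if "i < n" for i using B(1)[OF that] by (rule sets.sets_into_space)
  define Z where "Z = space M - (\<Union>i<n. B i)"
  have Z: "Z \<in> sets M" unfolding Z_def using B(1) by auto
  have spF: "space M \<in> sets F" using sets.top[of F] by (simp add: space_F)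
  have Z0: "measure M Z = 0"
  proof -
    have "measure M (\<Union>i<n. B i) = (\<Sum>i<n. measure M (B i))"
      using B(1) disj by (intro finite_measure_finite_Union) auto
    also have "\<dots> = (\<Sum>i<n. LINT t:space M|M. w i t)"
      using B(2)[OF _ spF] Bsub by (intro sum.cong) (auto simp: Int_absorb1)
    also have "\<dots> = measure M (space M)" by (rule sum1[OF spF])
    finally show ?thesis unfolding Z_def using B(1) by (subst finite_measure_compl) auto
  qed
  have eq: "{t\<in>space M. \<iota> t = i} = (if i = 0 then B i \<union> Z else B i)" if "i < n" for i
  proof -
    have "\<iota> t = i \<longleftrightarrow> t \<in> (if i = 0 then B i \<union> Z else B i)" if t: "t \<in> space M" for t
    proof (cases "\<exists>j<n. t \<in> B j")
      case True
      then obtain j where j: "j < n" "t \<in> B j" by blast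
      then have "t \<notin> Z" by (auto simp: Z_def)
      then show ?thesis using \<iota>B[OF j] \<iota>B[OF \<open>i < n\<close>] j by auto
    next
      case False
      then have "\<iota> t = 0" "t \<in> Z" using t by (auto simp: \<iota>_def Z_def)
      then show ?thesis using False \<open>i < n\<close> by auto
    qed
    moreover have "(if i = 0 then B i \<union> Z else B i) \<subseteq> space M" using Bsub[OF that] by (auto simp: Z_def)
    ultimately show ?thesis by blast
  qed
  have m: "{t\<in>space M. \<iota> t = i} \<in> sets M" for i
  proof (cases "i < n")
    case True
    then show ?thesis using eq B(1) Z by auto
  next
    case False
    then have "{t\<in>space M. \<iota> t = i} = {}" using lt by auto
    then show ?thesis by (simp only: sets.empty_sets)
  qed
  have "measure M (E \<inter> {t\<in>space M. \<iota> t = i}) = (LINT t:E|M. w i t)" if "i < n" "E \<in> sets F" for i E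
  proof -
    have Em: "E \<in> sets M" by (rule sets_F[OF that(2)])
    have "measure M (E \<inter> {t\<in>space M. \<iota> t = i}) \<le> measure M (E \<inter> B i \<union> Z)"
      using eq[OF that(1)] B(1)[OF that(1)] Z Em by (intro finite_measure_mono) auto
    also have "\<dots> \<le> measure M (E \<inter> B i) + measure M Z"
      using B(1)[OF that(1)] Z Em by (intro measure_Un_le) auto
    finally have 1: "measure M (E \<inter> {t\<in>space M. \<iota> t = i}) \<le> measure M (E \<inter> B i)" using Z0 by simp
    have "measure M (E \<inter> B i) \<le> measure M (E \<inter> {t\<in>space M. \<iota> t = i})"
      using eq[OF that(1)] m[of i] Em by (intro finite_measure_mono) auto
    with 1 B(2)[OF that] show ?thesis by simp
  qed
  then show ?thesis using that lt m by blast
qed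


section \<open>Pure profiles with values in a compact metric space\<close>

locale compact_actions = prob_subalgebra M F for M F :: "'a measure" +
  fixes K :: "'k::{metric_space, second_countable_topology} set"
  assumes K: "compact K" "K \<noteq> {}"
begin

definition profiles :: "('a \<Rightarrow> 'k) set" where
  "profiles = {g. g \<in> borel_measurable M \<and> (\<forall>t\<in>space M. g t \<in> K)}"

text \<open>Stable convergence relative to \<open>F\<close>, that is, convergence of the conditional
  laws as Young measures. Products of an \<open>F\<close>-indicator with a continuous function
  suffice as tests; see \<open>caratheodory_tendsto\<close>.\<close>

definition tends_F :: "(nat \<Rightarrow> 'a \<Rightarrow> 'k) \<Rightarrow> ('a \<Rightarrow> 'k) \<Rightarrow> bool" where
  "tends_F g h \<longleftrightarrow> (\<forall>A\<in>sets F. \<forall>\<psi>::'k \<Rightarrow> real. continuous_on K \<psi> \<longrightarrow>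
     (\<lambda>n. LINT t:A|M. \<psi> (g n t)) \<longlonglongrightarrow> (LINT t:A|M. \<psi> (h t)))"

lemma profilesD: "g \<in> profiles \<Longrightarrow> g \<in> borel_measurable M" "g \<in> profiles \<Longrightarrow> t \<in> space M \<Longrightarrow> g t \<in> K"
  by (auto simp: profiles_def)

lemma continuous_on_K_bounded:
  fixes \<psi> :: "'k \<Rightarrow> real"
  assumes "continuous_on K \<psi>"
  obtains B where "0 \<le> B" "\<And>x. x \<in> K \<Longrightarrow> \<bar>\<psi> x\<bar> \<le> B"
proof -
  have "bounded (\<psi> ` K)" using assms K by (intro compact_imp_bounded compact_continuous_image)
  then obtain B where "\<And>x. x \<in> K \<Longrightarrow> \<bar>\<psi> x\<bar> \<le> B" by (auto simp: bounded_iff)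
  then show ?thesis using that[of "max 0 B"] by (meson max.cobounded1 max.coboundedI2)
qed

lemma continuous_profile:
  fixes \<psi> :: "'k \<Rightarrow> real"
  assumes g: "g \<in> profiles" and \<psi>: "continuous_on K \<psi>"
  shows "(\<lambda>t. \<psi> (g t)) \<in> borel_measurable M" and "integrable M (\<lambda>t. \<psi> (g t))"
proof -
  have "g \<in> M \<rightarrow>\<^sub>M restrict_space borel K"
    using g by (intro measurable_restrict_space2) (auto simp: profiles_def)
  from measurable_comp[OF this borel_measurable_continuous_on_restrict[OF \<psi>]]
  show m: "(\<lambda>t. \<psi> (g t)) \<in> borel_measurable M" by (simp add: o_def)
  obtain B where "\<And>x. x \<in> K \<Longrightarrow> \<bar>\<psi> x\<bar> \<le> B" using continuous_on_K_bounded[OF \<psi>] by blast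
  then show "integrable M (\<lambda>t. \<psi> (g t))"
    using m profilesD(2)[OF g] by (intro integrable_const_bound[of _ B]) auto
qed

lemma dense_sequence:
  obtains a :: "nat \<Rightarrow> 'k" where "\<And>i. a i \<in> K" "K \<subseteq> closure (range a)"
proof -
  obtain T where T: "countable T" "T \<subseteq> K" "K \<subseteq> closure T" by (rule separable)
  then have "T \<noteq> {}" using K by auto
  then have "range (from_nat_into T) = T" using T by (intro range_from_nat_into)
  then show ?thesis using that[of "from_nat_into T"] T by auto
qed

text \<open>The questions ask for membership in the balls of radius \<open>1 / Suc k\<close> about a
  dense sequence, for all \<open>k\<close>. By compactness finitely many balls of one radius cover
  \<open>K\<close>, and two points with the same answers then lie in a common ball.\<close>

lemma separating_questions:
  obtains B :: "nat \<Rightarrow> 'k set" where "\<And>m. B m \<in> sets borel"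
    "\<And>e. e > 0 \<Longrightarrow> \<exists>n. \<forall>x\<in>K. \<forall>y\<in>K. (\<forall>m<n. x \<in> B m \<longleftrightarrow> y \<in> B m) \<longrightarrow> dist x y < e"
proof -
  obtain a :: "nat \<Rightarrow> 'k" where a: "\<And>i. a i \<in> K" "K \<subseteq> closure (range a)" using dense_sequence by blast
  define B where "B m = ball (a (fst (prod_decode m))) (1 / Suc (snd (prod_decode m)))" for m
  have "\<exists>n. \<forall>x\<in>K. \<forall>y\<in>K. (\<forall>m<n. x \<in> B m \<longleftrightarrow> y \<in> B m) \<longrightarrow> dist x y < e" if e: "e > 0" for e
  proof -
    obtain k where k: "1 / real (Suc k) < e / 2" using e nat_approx_posE[of "e/2"] by auto
    have "K \<subseteq> (\<Union>i\<in>UNIV. ball (a i) (1 / Suc k))"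
    proof
      fix x assume "x \<in> K"
      then have "x \<in> closure (range a)" using a by auto
      then obtain y where "y \<in> range a" "dist y x < 1 / Suc k"
        using closure_approachable[of x "range a"] by (meson of_nat_0_less_iff zero_less_Suc zero_less_divide_1_iff)
      then show "x \<in> (\<Union>i\<in>UNIV. ball (a i) (1 / Suc k))" by auto
    qed
    then obtain I where I: "finite I" "K \<subseteq> (\<Union>i\<in>I. ball (a i) (1 / Suc k))"
      using compactE_image[OF K(1), of UNIV "\<lambda>i. ball (a i) (1 / Suc k)"] by auto
    \<comment> \<open>Large enough for all indices that encode balls of the finite cover. Answers
      are compared for \<open>m < n\<close> only, hence \<open>Suc\<close>.\<close>
    define n where "n = Suc (Max ((\<lambda>i. prod_encode (i, k)) ` I))"
    show ?thesis
    proof (intro exI[of _ n] ballI impI)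
      fix x y assume xy: "x \<in> K" "y \<in> K" "\<forall>m<n. x \<in> B m \<longleftrightarrow> y \<in> B m"
      obtain i where i: "i \<in> I" "x \<in> ball (a i) (1 / Suc k)" using I xy by auto
      have "prod_encode (i, k) < n" using I(1) i(1) by (auto simp: n_def less_Suc_eq_le intro!: Max_ge)
      then have "x \<in> B (prod_encode (i, k)) \<longleftrightarrow> y \<in> B (prod_encode (i, k))" using xy by blast
      then have "y \<in> ball (a i) (1 / Suc k)" using i by (simp add: B_def)
      then have "dist x y < 1 / Suc k + 1 / Suc k"
        using i(2) dist_triangle_less_add[of x "a i" "1 / Suc k" y "1 / Suc k"] by (auto simp: dist_commute)
      also have "\<dots> < e" using k by (simp add: field_simps)
      finally show "dist x y < e" .
    qed
  qed
  moreover have "B m \<in> sets borel" for m by (simp add: B_def)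
  ultimately show ?thesis using that by blast
qed


text \<open>A diagonal argument handles countably many sets. Closing the generator under finite
  intersections makes \<open>convergent_measure_Int\<close> applicable to all of
  \<open>F\<close>.\<close>

lemma subsequence_of_set_frequencies:
  fixes B :: "nat \<Rightarrow> 'j \<Rightarrow> 'a set"
  assumes cg: "countably_generated F" and J: "countable J" "J \<noteq> {}"
    and B: "\<And>n j. j \<in> J \<Longrightarrow> B n j \<in> sets M"
  obtains r where "strict_mono r"
    "\<And>j A. j \<in> J \<Longrightarrow> A \<in> sets F \<Longrightarrow> convergent (\<lambda>n. measure M (A \<inter> B (r n) j))"
proof -
  obtain C0 where C0: "countable C0" "C0 \<subseteq> Pow (space F)" "sets F = sigma_sets (space F) C0"
    using cg unfolding countably_generated_def by blast
  define C where "C = {space M \<inter> \<Inter>S |S. finite S \<and> S \<subseteq> C0}"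
  have C_eq: "C = (\<lambda>S. space M \<inter> \<Inter>S) ` {S. finite S \<and> S \<subseteq> C0}" by (auto simp: C_def)
  have cC: "countable C" unfolding C_eq using C0(1) by (intro countable_image countable_Collect_finite_subset)
  have "C0 \<subseteq> sets F" unfolding C0(3) by auto
  have CF: "C \<subseteq> sets F"
  proof
    fix A assume "A \<in> C"
    then obtain S where S: "finite S" "S \<subseteq> C0" "A = space M \<inter> \<Inter>S" by (auto simp: C_def)
    have "space F \<inter> \<Inter>S \<in> sets F"
      using S(1,2)
    proof (induction S)
      case (insert x S)
      have "space F \<inter> \<Inter>(insert x S) = x \<inter> (space F \<inter> \<Inter>S)" by auto
      then show ?case using insert \<open>C0 \<subseteq> sets F\<close> by auto
    qed simp
    then show "A \<in> sets F" using S(3) by (simp add: space_F)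
  qed
  have C0C: "C0 \<subseteq> C"
  proof
    fix A assume A: "A \<in> C0"
    then have "A = space M \<inter> \<Inter>{A}" using C0(2) by (auto simp: space_F)
    then show "A \<in> C" using A unfolding C_def by (intro CollectI exI[of _ "{A}"]) auto
  qed
  have sC: "sigma_sets (space M) C = sets F"
  proof
    show "sigma_sets (space M) C \<subseteq> sets F" using CF sets.sigma_sets_subset[of C F] by (simp add: space_F)
    show "sets F \<subseteq> sigma_sets (space M) C" unfolding C0(3) space_F by (rule sigma_sets_mono') (rule C0C)
  qed
  have IC: "Int_stable C"
  proof (rule Int_stableI)
    fix a b assume "a \<in> C" "b \<in> C"
    then obtain S S' where "finite S" "S \<subseteq> C0" "a = space M \<inter> \<Inter>S" "finite S'" "S' \<subseteq> C0" "b = space M \<inter> \<Inter>S'"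
      by (auto simp: C_def)
    then show "a \<inter> b \<in> C" unfolding C_def by (intro CollectI exI[of _ "S \<union> S'"]) auto
  qed
  have spC: "space M \<in> C" unfolding C_def by (intro CollectI exI[of _ "{}"]) auto
  have CP: "C \<subseteq> Pow (space M)" by (auto simp: C_def)
  define Q where "Q = C \<times> J"
  have Q: "countable Q" "Q \<noteq> {}" using cC J spC by (auto simp: Q_def)
  define q where "q = from_nat_into Q"
  have qQ: "range q = Q" unfolding q_def using Q by (intro range_from_nat_into)
  define f where "f n k = measure M (fst (q k) \<inter> B n (snd (q k)))" for n k
  obtain r where r: "strict_mono r" "\<And>k. convergent (\<lambda>n. f (r n) k)"
    using pointwise_convergent_subsequence[of f "\<lambda>_. 1"] by (auto simp: f_def)
  have "convergent (\<lambda>n. measure M (A \<inter> B (r n) j))" if j: "j \<in> J" and A: "A \<in> sets F" for j A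
  proof (rule convergent_measure_Int[OF IC CP])
    show "sigma_sets (space M) C \<subseteq> sets M" unfolding sC using subalg by (simp add: subalgebra_def)
    have cv: "convergent (\<lambda>n. measure M (A \<inter> B (r n) j))" if "A \<in> C" for A
    proof -
      have "(A, j) \<in> range q" using that j by (simp add: qQ Q_def)
      then obtain k where "q k = (A, j)" by auto
      then show ?thesis using r(2)[of k] by (simp add: f_def)
    qed
    then show "\<And>A. A \<in> C \<Longrightarrow> convergent (\<lambda>n. measure M (A \<inter> B (r n) j))"
      "convergent (\<lambda>n. measure M (space M \<inter> B (r n) j))" using spC by auto
  qed (use B[OF j] A sC in auto)
  then show ?thesis using that r(1) by blast
qed

text \<open>The first \<open>n\<close> binary answers, encoded as the set of questions answered by
  yes. The cells of equal answers are thus indexed by the finite set \<open>Pow {..<n}\<close>. This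
  serves for the questions about actions as well as for the sets that generate
  \<open>F\<close>.\<close>

definition sig :: "(nat \<Rightarrow> 'a set) \<Rightarrow> nat \<Rightarrow> 'a \<Rightarrow> nat set" where
  "sig G n t = {m. m < n \<and> t \<in> G m}"

lemma sig_sets:
  assumes "\<And>m. m < n \<Longrightarrow> G m \<in> sets N"
  shows "{t\<in>space N. sig G n t = \<sigma>} \<in> sets N"
proof -
  have "{t\<in>space N. sig G n t = \<sigma>} =
     (if \<sigma> \<subseteq> {..<n} then {t\<in>space N. \<forall>m\<in>{..<n}. t \<in> (if m \<in> \<sigma> then G m else space N - G m)} else {})"
    by (auto simp: sig_def split: if_splits)
  also have "\<dots> \<in> sets N" using assms by (auto intro!: sets.sets_Collect_finite_All)
  finally show ?thesis .
qed

lemma sig_subset: "sig G n t \<in> Pow {..<n}"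
  by (auto simp: sig_def)

text \<open>A Kolmogorov extension inside the given space: \<open>m n \<sigma>\<close> prescribes
  the conditional probability of the answer pattern \<open>\<sigma>\<close> to the first
  \<open>n\<close> questions, and \<open>mS\<close> says that the prescriptions are consistent.
  Question \<open>n\<close> is realized by splitting every cell of the preceding stage in the
  prescribed conditional proportion.\<close>

lemma random_signature:
  assumes ne: "nowhere_equivalent M F"
    and m0: "\<And>E. E \<in> sets F \<Longrightarrow> m 0 {} E = measure M E"
    and mS: "\<And>n \<sigma> E. \<sigma> \<subseteq> {..<n} \<Longrightarrow> E \<in> sets F \<Longrightarrow> m n \<sigma> E = m (Suc n) \<sigma> E + m (Suc n) (insert n \<sigma>) E"
    and mnn: "\<And>n \<sigma> E. \<sigma> \<subseteq> {..<n} \<Longrightarrow> E \<in> sets F \<Longrightarrow> 0 \<le> m n \<sigma> E"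
    and dens: "\<And>n \<sigma>. \<sigma> \<subseteq> {..<n} \<Longrightarrow> \<exists>\<phi>. \<phi> \<in> borel_measurable F \<and> integrable M \<phi> \<and> (\<forall>E\<in>sets F. (LINT t:E|M. \<phi> t) = m n \<sigma> E)"
  obtains G where "\<And>k. G k \<in> sets M"
    "\<And>n \<sigma> E. \<sigma> \<subseteq> {..<n} \<Longrightarrow> E \<in> sets F \<Longrightarrow> measure M (E \<inter> {t\<in>space M. sig G n t = \<sigma>}) = m n \<sigma> E"
proof -
  define P where "P n G \<longleftrightarrow> (\<forall>k<n. G k \<in> sets M) \<and>
    (\<forall>\<sigma>\<subseteq>{..<n}. \<forall>E\<in>sets F. measure M (E \<inter> {t\<in>space M. sig G n t = \<sigma>}) = m n \<sigma> E)" for n and G :: "nat \<Rightarrow> 'a set"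
  have "\<exists>f. \<forall>n. P n (f n) \<and> (\<forall>k<n. f (Suc n) k = f n k)"
  proof (rule dependent_nat_choice)
    have "E \<inter> {t\<in>space M. sig G 0 t = {}} = E" if "E \<in> sets F" for E and G :: "nat \<Rightarrow> 'a set"
      using sets.sets_into_space[OF sets_F[OF that]] by (auto simp: sig_def)
    then show "\<exists>G. P 0 G" using m0 by (auto simp: P_def)
  next
    fix G n assume PG: "P n G"
    have Gk: "\<And>k. k < n \<Longrightarrow> G k \<in> sets M" and Gm: "\<And>\<sigma> E. \<sigma> \<subseteq> {..<n} \<Longrightarrow> E \<in> sets F \<Longrightarrow>
      measure M (E \<inter> {t\<in>space M. sig G n t = \<sigma>}) = m n \<sigma> E" using PG by (auto simp: P_def)
    define D where "D \<sigma> = {t\<in>space M. sig G n t = \<sigma>}" for \<sigma>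
    have D: "D \<sigma> \<in> sets M" for \<sigma> unfolding D_def using Gk by (rule sig_sets)
    have "\<exists>H. H \<in> sets M \<and> H \<subseteq> D \<sigma> \<and> (\<forall>E\<in>sets F. measure M (E \<inter> H) = m (Suc n) (insert n \<sigma>) E)"
      if \<sigma>: "\<sigma> \<subseteq> {..<n}" for \<sigma>
    proof -
      have \<sigma>': "\<sigma> \<subseteq> {..<Suc n}" "insert n \<sigma> \<subseteq> {..<Suc n}" using \<sigma> by (auto simp: less_Suc_eq)
      obtain \<phi> where \<phi>: "\<phi> \<in> borel_measurable F" "integrable M \<phi>"
        "\<And>E. E \<in> sets F \<Longrightarrow> (LINT t:E|M. \<phi> t) = m (Suc n) (insert n \<sigma>) E" using dens[OF \<sigma>'(2)] by blast
      show ?thesis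
      proof (rule conditional_splitting[OF ne D[of \<sigma>] \<phi>(1,2)])
        show "0 \<le> (LINT t:E|M. \<phi> t)" if "E \<in> sets F" for E using \<phi>(3)[OF that] mnn[OF \<sigma>'(2) that] by simp
        show "(LINT t:E|M. \<phi> t) \<le> measure M (E \<inter> D \<sigma>)" if "E \<in> sets F" for E
          using \<phi>(3)[OF that] Gm[OF \<sigma> that] mS[OF \<sigma> that] mnn[OF \<sigma>'(1) that] by (simp add: D_def)
      qed (use \<phi>(3) in auto)
    qed
    then obtain H where H: "\<And>\<sigma>. \<sigma> \<subseteq> {..<n} \<Longrightarrow> H \<sigma> \<in> sets M" "\<And>\<sigma>. \<sigma> \<subseteq> {..<n} \<Longrightarrow> H \<sigma> \<subseteq> D \<sigma>"
      "\<And>\<sigma> E. \<sigma> \<subseteq> {..<n} \<Longrightarrow> E \<in> sets F \<Longrightarrow> measure M (E \<inter> H \<sigma>) = m (Suc n) (insert n \<sigma>) E" by metis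
    \<comment> \<open>The yes set of question \<open>n\<close>. Inside each old cell it consists of
      the piece cut from that cell, since the cells are disjoint.\<close>
    define U where "U = (\<Union>\<sigma>\<in>Pow {..<n}. H \<sigma>)"
    define G' where "G' = G(n := U)"
    have U: "U \<in> sets M" unfolding U_def using H(1) by (intro sets.finite_UN) auto
    have UD: "U \<inter> D \<sigma> = H \<sigma>" if "\<sigma> \<subseteq> {..<n}" for \<sigma>
    proof -
      have "H \<tau> \<inter> D \<sigma> = {}" if "\<tau> \<subseteq> {..<n}" "\<tau> \<noteq> \<sigma>" for \<tau>
        using H(2)[OF that(1)] that(2) by (auto simp: D_def)
      then show ?thesis using H(2)[OF that] that by (auto simp: U_def)
    qed
    have sig': "sig G' (Suc n) t = (if t \<in> U then insert n (sig G n t) else sig G n t)" for t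
      by (auto simp: sig_def G'_def less_Suc_eq)
    have nsig: "n \<notin> sig G n t" for t by (auto simp: sig_def)
    have "P (Suc n) G'"
      unfolding P_def
    proof (intro conjI allI impI ballI)
      fix k assume "k < Suc n"
      then show "G' k \<in> sets M" using Gk U by (auto simp: G'_def less_Suc_eq)
    next
      fix \<sigma> E assume \<sigma>: "\<sigma> \<subseteq> {..<Suc n}" and E: "E \<in> sets F"
      show "measure M (E \<inter> {t\<in>space M. sig G' (Suc n) t = \<sigma>}) = m (Suc n) \<sigma> E"
      proof (cases "n \<in> \<sigma>")
        case True
        then have \<tau>: "\<sigma> - {n} \<subseteq> {..<n}" "insert n (\<sigma> - {n}) = \<sigma>" using \<sigma> by (auto simp: less_Suc_eq)
        have "{t\<in>space M. sig G' (Suc n) t = \<sigma>} = U \<inter> D (\<sigma> - {n})"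
          using True nsig unfolding sig' D_def by auto
        then show ?thesis using UD[OF \<tau>(1)] H(3)[OF \<tau>(1) E] \<tau>(2) by simp
      next
        case False
        then have \<tau>: "\<sigma> \<subseteq> {..<n}" using \<sigma> by (auto simp: less_Suc_eq)
        have "{t\<in>space M. sig G' (Suc n) t = \<sigma>} = D \<sigma> - U"
          using False nsig unfolding sig' D_def by (auto split: if_splits)
        then have "E \<inter> {t\<in>space M. sig G' (Suc n) t = \<sigma>} = E \<inter> D \<sigma> - E \<inter> H \<sigma>" using UD[OF \<tau>] by auto
        then have "measure M (E \<inter> {t\<in>space M. sig G' (Suc n) t = \<sigma>}) = measure M (E \<inter> D \<sigma>) - measure M (E \<inter> H \<sigma>)"
          using D H(1,2)[OF \<tau>] sets_F[OF E] by (simp only:) (intro finite_measure_Diff, auto)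
        then show ?thesis using Gm[OF \<tau> E] H(3)[OF \<tau> E] mS[OF \<tau> E] by (simp add: D_def)
      qed
    qed
    moreover have "\<forall>k<n. G' k = G k" by (auto simp: G'_def)
    ultimately show "\<exists>G'. P (Suc n) G' \<and> (\<forall>k<n. G' k = G k)" by blast
  qed
  then obtain f where f0: "\<forall>n. P n (f n) \<and> (\<forall>k<n. f (Suc n) k = f n k)" by (elim exE)
  have f1: "P n (f n)" for n using f0 by blast
  have f2: "f (Suc n) k = f n k" if "k < n" for n k using f0 that by blast
  \<comment> \<open>Stage \<open>Suc k\<close> fixes the \<open>k\<close>-th set and all later
    stages keep it, so the diagonal carries every finite stage at once.\<close>
  define G where "G k = f (Suc k) k" for k
  have fG: "f n k = G k" if "k < n" for n k
    using that
  proof (induction n)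
    case (Suc n)
    show ?case
    proof (cases "k = n")
      case False
      then have "k < n" using Suc.prems by simp
      then show ?thesis using f2 Suc.IH by simp
    qed (simp add: G_def)
  qed simp
  have "sig G n t = sig (f n) n t" for n t using fG by (auto simp: sig_def)
  moreover have "G k \<in> sets M" for k using f1[of "Suc k"] by (auto simp: P_def G_def)
  moreover have "measure M (E \<inter> {t\<in>space M. sig (f n) n t = \<sigma>}) = m n \<sigma> E" if "\<sigma> \<subseteq> {..<n}" "E \<in> sets F" for n \<sigma> E
    using f1[of n] that unfolding P_def by blast
  ultimately show ?thesis using that[of G] by simp
qed

text \<open>From the sets \<open>G\<close> that realize the limit frequencies, a profile is read off
  by choosing a point in each cell met by the answers. These points form a Cauchy sequence because
  the cells shrink. The cells are not closed, so the limit profile need not give the answers coded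
  by \<open>G\<close>; only the small diameter of the cells enters.\<close>

lemma profile_subsequence:
  fixes g :: "nat \<Rightarrow> 'a \<Rightarrow> 'k"
  assumes ne: "nowhere_equivalent M F" and cg: "countably_generated F"
    and g: "\<And>n. g n \<in> profiles"
  obtains r h where "strict_mono r" "h \<in> profiles" "tends_F (\<lambda>n. g (r n)) h"
proof -
  obtain Q :: "nat \<Rightarrow> 'k set" where Q: "\<And>m. Q m \<in> sets borel" and
    Qres: "\<And>e. e > 0 \<Longrightarrow> \<exists>n. \<forall>x\<in>K. \<forall>y\<in>K. (\<forall>m<n. x \<in> Q m \<longleftrightarrow> y \<in> Q m) \<longrightarrow> dist x y < e"
    using separating_questions by blast
  define A where "A n m = {t\<in>space M. g n t \<in> Q m}" for n m
  have A: "A n m \<in> sets M" for n m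
    unfolding A_def using measurable_sets[OF profilesD(1)[OF g[of n]] Q[of m]] by (simp add: vimage_def Int_def conj_commute)
  define B where "B n j = {t\<in>space M. sig (A n) (fst j) t = snd j}" for n and j :: "nat \<times> nat set"
  have B: "B n j \<in> sets M" for n j unfolding B_def using A by (intro sig_sets)
  have "{(N::nat, \<sigma>). \<sigma> \<subseteq> {..<N}} \<subseteq> UNIV \<times> Collect finite" by clarsimp (erule finite_subset, simp)
  then have J: "countable {(N::nat, \<sigma>). \<sigma> \<subseteq> {..<N}}"
    by (rule countable_subset) (intro countable_SIGMA countable_Collect_finite countableI_type)
  obtain r where r: "strict_mono r" and
    conv: "\<And>j E. j \<in> {(N::nat, \<sigma>). \<sigma> \<subseteq> {..<N}} \<Longrightarrow> E \<in> sets F \<Longrightarrow> convergent (\<lambda>n. measure M (E \<inter> B (r n) j))"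
  proof (rule subsequence_of_set_frequencies[OF cg J, of B])
    show "{(N::nat, \<sigma>). \<sigma> \<subseteq> {..<N}} \<noteq> {}" by auto
  qed (use B in blast)+
  define m where "m N \<sigma> E = lim (\<lambda>n. measure M (E \<inter> B (r n) (N, \<sigma>)))" for N \<sigma> E
  have m: "(\<lambda>n. measure M (E \<inter> B (r n) (N, \<sigma>))) \<longlonglongrightarrow> m N \<sigma> E" if "\<sigma> \<subseteq> {..<N}" "E \<in> sets F" for N \<sigma> E
    unfolding m_def using conv[of "(N, \<sigma>)" E] that by (simp add: convergent_LIMSEQ_iff)
  have mnn: "0 \<le> m N \<sigma> E" if "\<sigma> \<subseteq> {..<N}" "E \<in> sets F" for N \<sigma> E
    by (rule LIMSEQ_le_const[OF m[OF that]]) auto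
  have mle: "m N \<sigma> E \<le> measure M E" if "\<sigma> \<subseteq> {..<N}" "E \<in> sets F" for N \<sigma> E
    by (rule LIMSEQ_le_const2[OF m[OF that]]) (auto intro!: exI[of _ 0] finite_measure_mono sets_F[OF that(2)])
  have m0: "m 0 {} E = measure M E" if "E \<in> sets F" for E
  proof -
    have "E \<inter> B n (0, {}) = E" for n
      using sets.sets_into_space[OF sets_F[OF that]] by (auto simp: B_def sig_def)
    then show ?thesis by (simp add: m_def)
  qed
  have mS: "m N \<sigma> E = m (Suc N) \<sigma> E + m (Suc N) (insert N \<sigma>) E" if s: "\<sigma> \<subseteq> {..<N}" and E: "E \<in> sets F" for N \<sigma> E
  proof -
    have s': "\<sigma> \<subseteq> {..<Suc N}" "insert N \<sigma> \<subseteq> {..<Suc N}" using s by (auto simp: less_Suc_eq)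
    have "measure M (E \<inter> B n (N, \<sigma>)) = measure M (E \<inter> B n (Suc N, \<sigma>)) + measure M (E \<inter> B n (Suc N, insert N \<sigma>))" for n
    proof -
      have sS: "sig (A n) (Suc N) t = (if t \<in> A n N then insert N (sig (A n) N t) else sig (A n) N t)" for t
        by (auto simp: sig_def less_Suc_eq)
      have nN: "N \<notin> sig (A n) N t" "N \<notin> \<sigma>" for t using s by (auto simp: sig_def)
      have e: "E \<inter> B n (N, \<sigma>) = (E \<inter> B n (Suc N, \<sigma>)) \<union> (E \<inter> B n (Suc N, insert N \<sigma>))"
        using nN unfolding B_def fst_conv snd_conv sS by (auto simp: insert_ident split: if_splits)
      have d: "(E \<inter> B n (Suc N, \<sigma>)) \<inter> (E \<inter> B n (Suc N, insert N \<sigma>)) = {}"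
        using nN unfolding B_def fst_conv snd_conv by auto
      show ?thesis unfolding e using B sets_F[OF E] d by (intro finite_measure_Union) auto
    qed
    then have "(\<lambda>n. measure M (E \<inter> B (r n) (N, \<sigma>))) \<longlonglongrightarrow> m (Suc N) \<sigma> E + m (Suc N) (insert N \<sigma>) E"
      using tendsto_add[OF m[OF s'(1) E] m[OF s'(2) E]] by simp
    then show ?thesis using m[OF s E] LIMSEQ_unique by blast
  qed
  have dens: "\<exists>\<phi>. \<phi> \<in> borel_measurable F \<and> integrable M \<phi> \<and> (\<forall>E\<in>sets F. (LINT t:E|M. \<phi> t) = m N \<sigma> E)"
    if s: "\<sigma> \<subseteq> {..<N}" for N \<sigma>
  proof (rule bounded_additive_density[of "m N \<sigma>" 1])
    show "m N \<sigma> (E \<union> E') = m N \<sigma> E + m N \<sigma> E'" if E: "E \<in> sets F" "E' \<in> sets F" "E \<inter> E' = {}" for E E'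
    proof -
      have "measure M ((E \<union> E') \<inter> B n (N, \<sigma>)) = measure M (E \<inter> B n (N, \<sigma>)) + measure M (E' \<inter> B n (N, \<sigma>))" for n
        unfolding Int_Un_distrib2 using B E sets_F by (intro finite_measure_Union) auto
      then have "(\<lambda>n. measure M ((E \<union> E') \<inter> B (r n) (N, \<sigma>))) \<longlonglongrightarrow> m N \<sigma> E + m N \<sigma> E'"
        using tendsto_add[OF m[OF s E(1)] m[OF s E(2)]] by simp
      then show ?thesis using m[OF s sets.Un[OF E(1,2)]] LIMSEQ_unique by blast
    qed
    show "\<bar>m N \<sigma> E\<bar> \<le> 1 * measure M E" if "E \<in> sets F" for E using mnn[OF s that] mle[OF s that] by simp
    show ?thesis if "\<phi> \<in> borel_measurable F" "\<And>t. \<bar>\<phi> t\<bar> \<le> 1" "\<And>E. E \<in> sets F \<Longrightarrow> (LINT t:E|M. \<phi> t) = m N \<sigma> E" for \<phi>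
      using that meas_F[OF that(1)] by (intro exI[of _ \<phi>] conjI ballI integrable_const_bound[of _ 1]) auto
  qed simp
  obtain G where G: "\<And>k. G k \<in> sets M" and Gm:
    "\<And>N \<sigma> E. \<sigma> \<subseteq> {..<N} \<Longrightarrow> E \<in> sets F \<Longrightarrow> measure M (E \<inter> {t\<in>space M. sig G N t = \<sigma>}) = m N \<sigma> E"
    using random_signature[of m, OF ne m0 mS mnn dens] by blast
  obtain a0 where a0: "a0 \<in> K" using K by blast
  define cellK where "cellK N \<sigma> = {x\<in>K. \<forall>k<N. x \<in> Q k \<longleftrightarrow> k \<in> \<sigma>}" for N \<sigma>
  define b where "b N \<sigma> = (if cellK N \<sigma> = {} then a0 else SOME x. x \<in> cellK N \<sigma>)" for N \<sigma>
  have bK: "b N \<sigma> \<in> K" for N \<sigma>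
  proof (cases "cellK N \<sigma> = {}")
    case False
    then have "(SOME x. x \<in> cellK N \<sigma>) \<in> cellK N \<sigma>" by (simp add: some_in_eq)
    then show ?thesis using False by (auto simp: b_def cellK_def)
  qed (simp add: b_def a0)
  have bc: "b N \<sigma> \<in> cellK N \<sigma>" if "cellK N \<sigma> \<noteq> {}" for N \<sigma>
    using that by (simp add: b_def some_in_eq)
  \<comment> \<open>An answer pattern that no point of \<open>K\<close> gives never occurs along the
    sequence, so its limit frequency is zero. Hence almost every \<open>t\<close> has a nonempty
    cell at every level.\<close>
  define good where "good t \<longleftrightarrow> (\<forall>N. cellK N (sig G N t) \<noteq> {})" for t
  have good_set: "{t\<in>space M. good t} \<in> sets M"
  proof -
    have "{t\<in>space M. cellK N (sig G N t) \<noteq> {}} =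
      (\<Union>\<sigma>\<in>{\<sigma>\<in>Pow {..<N}. cellK N \<sigma> \<noteq> {}}. {t\<in>space M. sig G N t = \<sigma>})" for N
      using sig_subset[of G N] by auto
    then have "{t\<in>space M. cellK N (sig G N t) \<noteq> {}} \<in> sets M" for N
      using sig_sets[of N G M] G by (auto intro!: sets.finite_UN)
    then show ?thesis unfolding good_def by (intro sets.sets_Collect_countable_All)
  qed
  have spF: "space M \<in> sets F" using sets.top[of F] by (simp add: space_F)
  have good_AE: "AE t in M. good t"
    unfolding good_def AE_all_countable
  proof
    fix N
    have "AE t in M. t \<notin> (\<Union>\<sigma>\<in>{\<sigma>\<in>Pow {..<N}. cellK N \<sigma> = {}}. {t\<in>space M. sig G N t = \<sigma>})"
    proof (intro AE_not_in null_sets_UN' countable_finite)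
      fix \<sigma> assume s: "\<sigma> \<in> {\<sigma>\<in>Pow {..<N}. cellK N \<sigma> = {}}"
      then have s': "\<sigma> \<subseteq> {..<N}" "cellK N \<sigma> = {}" by auto
      have "B n (N, \<sigma>) = {}" for n
      proof (rule ccontr)
        assume "B n (N, \<sigma>) \<noteq> {}"
        then obtain t where t: "t \<in> space M" "sig (A n) N t = \<sigma>" by (auto simp: B_def)
        then have "g n t \<in> cellK N \<sigma>" using profilesD(2)[OF g] by (auto simp: cellK_def sig_def A_def)
        then show False using s' by blast
      qed
      then have "m N \<sigma> (space M) = 0" by (simp add: m_def)
      then have "measure M {t\<in>space M. sig G N t = \<sigma>} = 0"
        using Gm[OF s'(1) spF] by (simp add: Int_def)
      then show "{t\<in>space M. sig G N t = \<sigma>} \<in> null_sets M"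
        using sig_sets[of N G M \<sigma>] G by (intro null_setsI) (auto simp: emeasure_eq_measure)
    qed auto
    then show "AE t in M. cellK N (sig G N t) \<noteq> {}"
      using AE_space by eventually_elim (use sig_subset[of G N] in blast)
  qed
  \<comment> \<open>At the remaining \<open>t\<close> the constant \<open>a0\<close> is used, which
    keeps \<open>h N\<close> measurable and the sequence Cauchy everywhere.\<close>
  define h where "h N t = (if good t then b N (sig G N t) else a0)" for N t
  have hK: "h N t \<in> K" for N t using bK a0 by (simp add: h_def)
  have hM: "h N \<in> borel_measurable M" for N
  proof -
    have "(\<lambda>t. b N (sig G N t)) \<in> borel_measurable M"
    proof (rule measurable_compose_countable'[where g = "sig G N" and I = "Pow {..<N}" and f = "\<lambda>\<sigma> t. b N \<sigma>"])
      show "sig G N \<in> M \<rightarrow>\<^sub>M count_space (Pow {..<N})"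
      proof (rule measurable_count_space_eq2[THEN iffD2], simp, intro conjI ballI)
        show "sig G N \<in> space M \<rightarrow> Pow {..<N}" using sig_subset by blast
        show "sig G N -` {\<sigma>} \<inter> space M \<in> sets M" for \<sigma>
          using sig_sets[of N G M \<sigma>] G by (simp add: vimage_def Int_def conj_commute)
      qed
    qed (auto intro: countable_finite)
    then show ?thesis unfolding h_def using good_set by (intro measurable_If) auto
  qed
  have res: "dist (h N t) (h N' t) < e"
    if e: "\<forall>x\<in>K. \<forall>y\<in>K. (\<forall>m<n. x \<in> Q m \<longleftrightarrow> y \<in> Q m) \<longrightarrow> dist x y < e" "e > 0" and N: "n \<le> N" "n \<le> N'" for n e N N' t
  proof (cases "good t")
    case True
    then have "b N (sig G N t) \<in> cellK N (sig G N t)" "b N' (sig G N' t) \<in> cellK N' (sig G N' t)"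
      by (auto intro!: bc simp: good_def)
    then have "\<forall>m<n. b N (sig G N t) \<in> Q m \<longleftrightarrow> b N' (sig G N' t) \<in> Q m"
      using N by (auto simp: cellK_def sig_def)
    then show ?thesis using True e(1) bK by (auto simp: h_def)
  qed (use e in \<open>auto simp: h_def\<close>)
  have Cau: "Cauchy (\<lambda>N. h N t)" for t
  proof (rule metric_CauchyI)
    fix e :: real assume e: "e > 0"
    from Qres[OF e] res[OF _ e] show "\<exists>M. \<forall>m\<ge>M. \<forall>n\<ge>M. dist (h m t) (h n t) < e" by meson
  qed
  define f where "f t = lim (\<lambda>N. h N t)" for t
  have ex: "\<exists>l\<in>K. (\<lambda>N. h N t) \<longlonglongrightarrow> l" for t
    using compact_imp_complete[OF K(1), unfolded complete_def, rule_format, of "\<lambda>N. h N t"] hK Cau by blast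
  have hf: "(\<lambda>N. h N t) \<longlonglongrightarrow> f t" for t
    using ex[of t] unfolding f_def by (auto simp: limI)
  have fK: "f t \<in> K" for t
    using ex[of t] unfolding f_def by (auto simp: limI)
  have f: "f \<in> profiles"
    unfolding profiles_def using fK borel_measurable_LIMSEQ_metric[OF hM hf] by auto
  have hle: "dist (h N t) (f t) \<le> e"
    if e: "\<forall>x\<in>K. \<forall>y\<in>K. (\<forall>m<N. x \<in> Q m \<longleftrightarrow> y \<in> Q m) \<longrightarrow> dist x y < e" "e > 0" for N e t
  proof (rule LIMSEQ_le_const2)
    show "(\<lambda>N'. dist (h N t) (h N' t)) \<longlonglongrightarrow> dist (h N t) (f t)" by (intro tendsto_intros hf)
    show "\<exists>n. \<forall>N'\<ge>n. dist (h N t) (h N' t) \<le> e"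
      using res[OF e] by (intro exI[of _ N]) (auto intro: less_imp_le)
  qed
  have "tends_F (\<lambda>n. g (r n)) f"
    unfolding tends_F_def
  proof (intro ballI allI impI)
    fix E and \<psi> :: "'k \<Rightarrow> real" assume E: "E \<in> sets F" and \<psi>: "continuous_on K \<psi>"
    have Em: "E \<in> sets M" by (rule sets_F[OF E])
    show "(\<lambda>n. LINT t:E|M. \<psi> (g (r n) t)) \<longlonglongrightarrow> (LINT t:E|M. \<psi> (f t))"
    proof (rule LIMSEQ_I)
      fix e :: real assume e: "e > 0"
      have "uniformly_continuous_on K \<psi>" using \<psi> K by (intro compact_uniformly_continuous)
      then obtain d where d: "d > 0" "\<And>x y. x \<in> K \<Longrightarrow> y \<in> K \<Longrightarrow> dist x y < d \<Longrightarrow> \<bar>\<psi> x - \<psi> y\<bar> < e / 3"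
        unfolding uniformly_continuous_on_def dist_real_def using e by (metis zero_less_divide_iff zero_less_numeral)
      \<comment> \<open>Cells of diameter below \<open>d / 2\<close> instead of \<open>d\<close>:
        the distance from the limit \<open>f t\<close> to the chosen point of its cell obeys only a
        non-strict inequality.\<close>
      obtain N where N: "\<forall>x\<in>K. \<forall>y\<in>K. (\<forall>m<N. x \<in> Q m \<longleftrightarrow> y \<in> Q m) \<longrightarrow> dist x y < d / 2"
        using Qres[of "d / 2"] d by auto
      define c where "c \<sigma> = \<psi> (b N \<sigma>)" for \<sigma>
      have bound: "\<bar>(LINT t:E|M. \<psi> (u t)) - (LINT t:E|M. c (S t))\<bar> \<le> e / 3"
        if u: "u \<in> profiles" and S: "set_integrable M E (\<lambda>t. c (S t))" and close: "AE t in M. \<bar>\<psi> (u t) - c (S t)\<bar> \<le> e / 3"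
        for u and S :: "'a \<Rightarrow> nat set"
      proof -
        have i: "set_integrable M E (\<lambda>t. \<psi> (u t))" by (intro set_integrable_F E continuous_profile u \<psi>)
        have "(LINT t:E|M. \<psi> (u t)) - (LINT t:E|M. c (S t)) = (LINT t:E|M. \<psi> (u t) - c (S t))"
          using i S by (simp add: set_integral_diff)
        also have "\<bar>\<dots>\<bar> \<le> (LINT t|M. \<bar>indicator E t *\<^sub>R (\<psi> (u t) - c (S t))\<bar>)"
          unfolding set_lebesgue_integral_def by (rule integral_abs_bound)
        also have "\<dots> \<le> (LINT t|M. e / 3)"
        proof (rule integral_mono_AE)
          show "integrable M (\<lambda>t. \<bar>indicator E t *\<^sub>R (\<psi> (u t) - c (S t))\<bar>)"
            using set_integral_diff(1)[OF i S] unfolding set_integrable_def by (rule integrable_abs)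
          show "AE t in M. \<bar>indicator E t *\<^sub>R (\<psi> (u t) - c (S t))\<bar> \<le> e / 3"
            using close by eventually_elim (use e in \<open>auto simp: indicator_def\<close>)
        qed simp
        also have "\<dots> = e / 3" by (simp add: prob_space)
        finally show ?thesis .
      qed
      have fin: "(LINT t:E|M. c (sig X N t)) = (\<Sum>\<sigma>\<in>Pow {..<N}. c \<sigma> * measure M (E \<inter> {t\<in>space M. sig X N t = \<sigma>}))"
        "set_integrable M E (\<lambda>t. c (sig X N t))" if X: "\<And>k. X k \<in> sets M" for X
        using set_integral_finite_valued[of "Pow {..<N}" "sig X N" E c] sig_subset sig_sets[of N X M] X Em by auto
      have 1: "\<bar>(LINT t:E|M. \<psi> (g n t)) - (\<Sum>\<sigma>\<in>Pow {..<N}. c \<sigma> * measure M (E \<inter> B n (N, \<sigma>)))\<bar> \<le> e / 3" for n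
      proof -
        have "AE t in M. \<bar>\<psi> (g n t) - c (sig (A n) N t)\<bar> \<le> e / 3"
        proof (rule AE_I2)
          fix t assume t: "t \<in> space M"
          then have gc: "g n t \<in> cellK N (sig (A n) N t)" using profilesD(2)[OF g] by (auto simp: cellK_def sig_def A_def)
          then have "b N (sig (A n) N t) \<in> cellK N (sig (A n) N t)" by (intro bc) auto
          with gc have "dist (g n t) (b N (sig (A n) N t)) < d / 2" using N by (auto simp: cellK_def)
          then show "\<bar>\<psi> (g n t) - c (sig (A n) N t)\<bar> \<le> e / 3"
            unfolding c_def using d profilesD(2)[OF g t] bK by (intro less_imp_le d(2)) auto
        qed
        from bound[OF g fin(2)[OF A] this] show ?thesis unfolding fin(1)[OF A] B_def by simp
      qed
      have 2: "\<bar>(LINT t:E|M. \<psi> (f t)) - (\<Sum>\<sigma>\<in>Pow {..<N}. c \<sigma> * m N \<sigma> E)\<bar> \<le> e / 3"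
      proof -
        have "AE t in M. \<bar>\<psi> (f t) - c (sig G N t)\<bar> \<le> e / 3"
          using good_AE
        proof eventually_elim
          case (elim t)
          then have "dist (f t) (b N (sig G N t)) \<le> d / 2" using hle[OF N, of t] d by (auto simp: h_def dist_commute)
          then show ?case unfolding c_def using d fK bK by (intro less_imp_le d(2)) auto
        qed
        from bound[OF f fin(2)[OF G] this] show ?thesis unfolding fin(1)[OF G] using Gm[OF _ E] by simp
      qed
      have "(\<lambda>n. \<Sum>\<sigma>\<in>Pow {..<N}. c \<sigma> * measure M (E \<inter> B (r n) (N, \<sigma>))) \<longlonglongrightarrow> (\<Sum>\<sigma>\<in>Pow {..<N}. c \<sigma> * m N \<sigma> E)"
        using m E by (intro tendsto_intros) auto
      from LIMSEQ_D[OF this, of "e / 3"] e obtain n0 where n0: "\<And>n. n \<ge> n0 \<Longrightarrow>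
        norm ((\<Sum>\<sigma>\<in>Pow {..<N}. c \<sigma> * measure M (E \<inter> B (r n) (N, \<sigma>))) - (\<Sum>\<sigma>\<in>Pow {..<N}. c \<sigma> * m N \<sigma> E)) < e / 3" by auto
      show "\<exists>n0. \<forall>n\<ge>n0. norm ((LINT t:E|M. \<psi> (g (r n) t)) - (LINT t:E|M. \<psi> (f t))) < e"
      proof (intro exI allI impI)
        fix n assume "n \<ge> n0"
        from n0[OF this] 1[of "r n"] 2 show "norm ((LINT t:E|M. \<psi> (g (r n) t)) - (LINT t:E|M. \<psi> (f t))) < e"
          unfolding real_norm_def abs_le_iff abs_less_iff by linarith
      qed
    qed
  qed
  then show ?thesis using that r f by blast
qed


lemma abs_le_on_K:
  fixes D :: "'k \<Rightarrow> real" and a :: "nat \<Rightarrow> 'k"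
  assumes a: "\<And>i. a i \<in> K" "K \<subseteq> closure (range a)" and D: "continuous_on K D"
    and le: "\<And>i. \<bar>D (a i)\<bar> \<le> c" and x: "x \<in> K"
  shows "\<bar>D x\<bar> \<le> c"
proof -
  have "closure (range a) \<subseteq> K"
    using a(1) compact_imp_closed[OF K(1)] by (intro closure_minimal) auto
  then have "closure (range a) = K" using a(2) by auto
  then show ?thesis
    using continuous_on_closure_norm_le[of "range a" D c x] D le x by auto
qed

lemma partition_of_unity:
  fixes a :: "nat \<Rightarrow> 'k"
  assumes a: "\<And>i. a i \<in> K" "K \<subseteq> closure (range a)" and d: "d > 0"
  obtains I :: "nat set" and \<eta> where "finite I" "\<And>i. continuous_on K (\<eta> i :: 'k \<Rightarrow> real)"
    "\<And>i x. x \<in> K \<Longrightarrow> 0 \<le> \<eta> i x" "\<And>x. x \<in> K \<Longrightarrow> (\<Sum>i\<in>I. \<eta> i x) = 1"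
    "\<And>i x. x \<in> K \<Longrightarrow> \<eta> i x \<noteq> 0 \<Longrightarrow> dist (a i) x < d"
proof -
  have "K \<subseteq> (\<Union>i\<in>UNIV. ball (a i) d)"
  proof
    fix x assume "x \<in> K"
    then have "x \<in> closure (range a)" using a by auto
    then obtain y where "y \<in> range a" "dist y x < d"
      using closure_approachable[of x "range a"] d by blast
    then show "x \<in> (\<Union>i\<in>UNIV. ball (a i) d)" by auto
  qed
  then obtain I where I: "finite I" "K \<subseteq> (\<Union>i\<in>I. ball (a i) d)"
    using compactE_image[OF K(1), of UNIV "\<lambda>i. ball (a i) d"] by auto
  define \<beta> where "\<beta> i x = max 0 (d - dist (a i) x)" for i x
  define s where "s x = (\<Sum>i\<in>I. \<beta> i x)" for x
  have \<beta>0: "0 \<le> \<beta> i x" for i x by (simp add: \<beta>_def)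
  have s: "s x > 0" if x: "x \<in> K" for x
  proof -
    obtain i where i: "i \<in> I" "dist (a i) x < d" using I(2) x by auto
    then have "0 < \<beta> i x" by (simp add: \<beta>_def)
    also have "\<dots> \<le> s x" unfolding s_def using \<beta>0 i I(1) by (intro member_le_sum) auto
    finally show ?thesis .
  qed
  have c: "continuous_on K (\<beta> i)" for i unfolding \<beta>_def by (intro continuous_intros)
  then have cs: "continuous_on K s" unfolding s_def by (intro continuous_intros)
  show ?thesis
  proof (rule that[of I "\<lambda>i x. \<beta> i x / s x"])
    show "continuous_on K (\<lambda>x. \<beta> i x / s x)" for i
      using s c cs by (intro continuous_intros) (auto simp: less_imp_neq[THEN not_sym])
    show "0 \<le> \<beta> i x / s x" if "x \<in> K" for i x using s[OF that] \<beta>0 by (simp add: less_imp_le)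
    show "(\<Sum>i\<in>I. \<beta> i x / s x) = 1" if "x \<in> K" for x
      using s[OF that] by (simp add: s_def flip: sum_divide_distrib)
    show "dist (a i) x < d" if "x \<in> K" "\<beta> i x / s x \<noteq> 0" for i x
      using that by (auto simp: \<beta>_def max_def split: if_splits)
  qed (rule I)
qed

section \<open>Test functions that depend on the player\<close>

context
  fixes \<psi> :: "'a \<Rightarrow> 'k \<Rightarrow> real" and B :: real
  assumes cont: "\<And>t. t \<in> space M \<Longrightarrow> continuous_on K (\<psi> t)"
    and meas: "\<And>x. x \<in> K \<Longrightarrow> (\<lambda>t. \<psi> t x) \<in> borel_measurable F"
    and bdd: "\<And>t x. t \<in> space M \<Longrightarrow> x \<in> K \<Longrightarrow> \<bar>\<psi> t x\<bar> \<le> B"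
begin

text \<open>Separates the dependence on the player from that on the action: on \<open>K\<close> the
  function \<open>\<psi> t\<close> is replaced by an interpolation from its values at points
  \<open>a i\<close>, with coefficients measurable in \<open>t\<close>. The error is governed by the
  uniform continuity of \<open>\<psi> t\<close>; it vanishes for every \<open>t\<close> and, being
  bounded by \<open>2 * B\<close>, also in the mean.\<close>

lemma caratheodory_approx:
  obtains a :: "nat \<Rightarrow> 'k" and I :: "nat \<Rightarrow> nat set" and \<eta> :: "nat \<Rightarrow> nat \<Rightarrow> 'k \<Rightarrow> real" and err :: "nat \<Rightarrow> 'a \<Rightarrow> real"
  where "\<And>i. a i \<in> K" "\<And>k. finite (I k)" "\<And>k i. continuous_on K (\<eta> k i)"
    "\<And>k i x. x \<in> K \<Longrightarrow> \<bar>\<eta> k i x\<bar> \<le> 1"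
    "\<And>k t x. t \<in> space M \<Longrightarrow> x \<in> K \<Longrightarrow> \<bar>\<psi> t x - (\<Sum>i\<in>I k. \<psi> t (a i) * \<eta> k i x)\<bar> \<le> err k t"
    "\<And>k. integrable M (err k)" "\<And>t. t \<in> space M \<Longrightarrow> (\<lambda>k. err k t) \<longlonglongrightarrow> 0"
    "(\<lambda>k. LINT t|M. err k t) \<longlonglongrightarrow> 0"
proof -
  obtain a :: "nat \<Rightarrow> 'k" where a: "\<And>i. a i \<in> K" "K \<subseteq> closure (range a)" using dense_sequence by blast
  have "\<exists>I \<eta>. finite (I::nat set) \<and> (\<forall>i. continuous_on K (\<eta> i :: 'k \<Rightarrow> real)) \<and>
    (\<forall>i. \<forall>x\<in>K. 0 \<le> \<eta> i x) \<and> (\<forall>x\<in>K. (\<Sum>i\<in>I. \<eta> i x) = 1) \<and>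
    (\<forall>i. \<forall>x\<in>K. \<eta> i x \<noteq> 0 \<longrightarrow> dist (a i) x < 1 / Suc k)" for k
  proof -
    obtain I :: "nat set" and \<eta> where "finite I" "\<And>i. continuous_on K (\<eta> i :: 'k \<Rightarrow> real)"
    "\<And>i x. x \<in> K \<Longrightarrow> 0 \<le> \<eta> i x" "\<And>x. x \<in> K \<Longrightarrow> (\<Sum>i\<in>I. \<eta> i x) = 1"
    "\<And>i x. x \<in> K \<Longrightarrow> \<eta> i x \<noteq> 0 \<Longrightarrow> dist (a i) x < 1 / Suc k"
      using partition_of_unity[OF a, of "1 / Suc k"] by auto
    then show ?thesis by (intro exI[of _ I] exI[of _ \<eta>]) auto
  qed
  then obtain I0 \<eta> where I0: "\<And>k. finite (I0 k :: nat set)" and \<eta>c: "\<And>k i. continuous_on K (\<eta> k i :: 'k \<Rightarrow> real)" and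
    \<eta>0: "\<And>k i x. x \<in> K \<Longrightarrow> 0 \<le> \<eta> k i x" and \<eta>1: "\<And>k x. x \<in> K \<Longrightarrow> (\<Sum>i\<in>I0 k. \<eta> k i x) = 1" and
    \<eta>d: "\<And>k i x. x \<in> K \<Longrightarrow> \<eta> k i x \<noteq> 0 \<Longrightarrow> dist (a i) x < 1 / Suc k" by metis
  have B0: "0 \<le> B"
  proof -
    obtain t where "t \<in> space M" using not_empty by blast
    then show ?thesis using bdd[OF _ a(1)[of 0]] by (meson abs_ge_zero order_trans)
  qed
  \<comment> \<open>Indices outside the finite cover get the zero function, so that the bound by 1
    holds for every index.\<close>
  define \<eta>' where "\<eta>' k i = (if i \<in> I0 k then \<eta> k i else (\<lambda>_. 0))" for k i
  have \<eta>': "\<eta>' k i x = (if i \<in> I0 k then \<eta> k i x else 0)" for k i x by (simp add: \<eta>'_def)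
  define D where "D k t x = \<psi> t x - (\<Sum>i\<in>I0 k. \<psi> t (a i) * \<eta>' k i x)" for k t x
  \<comment> \<open>The supremum runs over a countable dense set of points, which makes
    \<open>err k\<close> measurable; continuity extends the bound to all of
    \<open>K\<close>.\<close>
  define err where "err k t = (SUP i. \<bar>D k t (a i)\<bar>)" for k t
  have D_eq: "D k t x = (\<Sum>i\<in>I0 k. (\<psi> t x - \<psi> t (a i)) * \<eta> k i x)" if x: "x \<in> K" for k t x
  proof -
    have "(\<Sum>i\<in>I0 k. (\<psi> t x - \<psi> t (a i)) * \<eta> k i x) = (\<Sum>i\<in>I0 k. \<psi> t x * \<eta> k i x - \<psi> t (a i) * \<eta> k i x)"
      by (simp add: left_diff_distrib)
    also have "\<dots> = \<psi> t x * (\<Sum>i\<in>I0 k. \<eta> k i x) - (\<Sum>i\<in>I0 k. \<psi> t (a i) * \<eta> k i x)"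
      by (simp add: sum_subtractf sum_distrib_left)
    finally show ?thesis using \<eta>1[OF x] by (simp add: D_def \<eta>')
  qed
  have Dle: "\<bar>D k t x\<bar> \<le> c" if x: "x \<in> K" and c: "\<And>i. dist (a i) x < 1 / Suc k \<Longrightarrow> \<bar>\<psi> t x - \<psi> t (a i)\<bar> \<le> c" "0 \<le> c" for k t x c
  proof -
    have "\<bar>D k t x\<bar> \<le> (\<Sum>i\<in>I0 k. \<bar>(\<psi> t x - \<psi> t (a i)) * \<eta> k i x\<bar>)" unfolding D_eq[OF x] by (rule sum_abs)
    also have "\<dots> \<le> (\<Sum>i\<in>I0 k. c * \<eta> k i x)"
    proof (rule sum_mono)
      fix i
      show "\<bar>(\<psi> t x - \<psi> t (a i)) * \<eta> k i x\<bar> \<le> c * \<eta> k i x"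
        using \<eta>0[OF x, of k i] \<eta>d[OF x, of k i] c(1)[of i]
        by (cases "\<eta> k i x = 0") (auto simp: abs_mult intro!: mult_right_mono)
    qed
    also have "\<dots> = c" using \<eta>1[OF x] by (simp flip: sum_distrib_left)
    finally show ?thesis .
  qed
  have D2B: "\<bar>D k t x\<bar> \<le> 2 * B" if "t \<in> space M" "x \<in> K" for k t x
  proof (rule Dle[OF that(2)])
    show "\<bar>\<psi> t x - \<psi> t (a i)\<bar> \<le> 2 * B" for i using bdd[OF that] bdd[OF that(1) a(1)[of i]] by linarith
  qed (use B0 in auto)
  have bdd': "bdd_above (range (\<lambda>i. \<bar>D k t (a i)\<bar>))" if "t \<in> space M" for k t
    using D2B[OF that a(1)] by (intro bdd_aboveI[of _ "2 * B"]) auto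
  have Dc: "continuous_on K (D k t)" if "t \<in> space M" for k t
    unfolding D_def using cont[OF that] \<eta>c by (auto intro!: continuous_intros simp: \<eta>'_def)
  have Derr: "\<bar>D k t x\<bar> \<le> err k t" if "t \<in> space M" "x \<in> K" for k t x
    by (rule abs_le_on_K[OF a Dc[OF that(1)] _ that(2)]) (auto simp: err_def intro!: cSUP_upper bdd' that)
  have err0: "0 \<le> err k t" if "t \<in> space M" for k t using Derr[OF that a(1)] by (meson abs_ge_zero order_trans)
  have err_le: "err k t \<le> c" if "t \<in> space M" "\<And>x. x \<in> K \<Longrightarrow> \<bar>D k t x\<bar> \<le> c" for k t c
    unfolding err_def by (intro cSUP_least) (use that(2)[OF a(1)] in auto)
  have \<psi>M: "(\<lambda>t. \<psi> t x) \<in> borel_measurable M" if "x \<in> K" for x by (rule meas_F[OF meas[OF that]])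
  have errM: "err k \<in> borel_measurable M" for k
    unfolding err_def
  proof (rule borel_measurable_cSUP)
    show "(\<lambda>t. \<bar>D k t (a i)\<bar>) \<in> borel_measurable M" for i
      unfolding D_def using \<psi>M a(1) by (intro borel_measurable_abs borel_measurable_diff borel_measurable_sum borel_measurable_times) auto
  qed (use bdd' in auto)
  have err2B: "\<bar>err k t\<bar> \<le> 2 * B" if "t \<in> space M" for k t
    using err0[OF that, of k] err_le[OF that D2B[OF that]] by simp
  have errI: "integrable M (err k)" for k
    by (rule integrable_const_bound[of _ "2 * B"]) (use err2B errM in auto)
  have lim: "(\<lambda>k. err k t) \<longlonglongrightarrow> 0" if t: "t \<in> space M" for t
  proof (rule LIMSEQ_I)
    fix e :: real assume e: "e > 0"
    have "uniformly_continuous_on K (\<psi> t)" using cont[OF t] K by (intro compact_uniformly_continuous)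
    then obtain d where d: "d > 0" "\<And>x y. x \<in> K \<Longrightarrow> y \<in> K \<Longrightarrow> dist y x < d \<Longrightarrow> dist (\<psi> t y) (\<psi> t x) < e / 2"
      unfolding uniformly_continuous_on_def using e by (metis half_gt_zero)
    obtain k0 where k0: "1 / real (Suc k0) < d" using nat_approx_posE[OF d(1)] by blast
    show "\<exists>k0. \<forall>k\<ge>k0. norm (err k t - 0) < e"
    proof (intro exI allI impI)
      fix k assume "k \<ge> k0"
      then have kd: "1 / real (Suc k) < d" using k0 by (smt (verit) frac_le of_nat_0_less_iff of_nat_mono Suc_le_mono zero_less_Suc)
      have "err k t \<le> e / 2"
      proof (rule err_le[OF t], rule Dle)
        fix x i assume x: "x \<in> K" and di: "dist (a i) x < 1 / Suc k"
        then have "dist (\<psi> t (a i)) (\<psi> t x) < e / 2" using kd a(1) by (intro d(2)) auto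
        then show "\<bar>\<psi> t x - \<psi> t (a i)\<bar> \<le> e / 2" by (simp add: dist_real_def abs_minus_commute)
      qed (use e in auto)
      then show "norm (err k t - 0) < e" using err0[OF t, of k] e by simp
    qed
  qed
  have "(\<lambda>k. LINT t|M. err k t) \<longlonglongrightarrow> (LINT t|M. 0)"
    by (rule integral_dominated_convergence[where w = "\<lambda>_. 2 * B"]) (use errM lim err2B in auto)
  moreover have "\<bar>\<eta>' k i x\<bar> \<le> 1" if x: "x \<in> K" for k i x
  proof (cases "i \<in> I0 k")
    case True
    have "\<eta> k i x \<le> (\<Sum>i\<in>I0 k. \<eta> k i x)" using True I0 \<eta>0[OF x] by (intro member_le_sum) auto
    then show ?thesis using True \<eta>1[OF x] \<eta>0[OF x] by (simp add: \<eta>')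
  qed (simp add: \<eta>')
  moreover have "continuous_on K (\<eta>' k i)" for k i using \<eta>c by (simp add: \<eta>'_def)
  ultimately show ?thesis
    using that[of a I0 \<eta>' err] a(1) I0 Derr errI lim unfolding D_def by simp
qed

lemma caratheodory_measurable:
  assumes g: "g \<in> profiles"
  shows "(\<lambda>t. \<psi> t (g t)) \<in> borel_measurable M"
proof -
  obtain a :: "nat \<Rightarrow> 'k" and I :: "nat \<Rightarrow> nat set" and \<eta> :: "nat \<Rightarrow> nat \<Rightarrow> 'k \<Rightarrow> real" and err :: "nat \<Rightarrow> 'a \<Rightarrow> real"
  where *: "\<And>i. a i \<in> K" "\<And>k. finite (I k)" "\<And>k i. continuous_on K (\<eta> k i)"
    "\<And>k i x. x \<in> K \<Longrightarrow> \<bar>\<eta> k i x\<bar> \<le> 1"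
    "\<And>k t x. t \<in> space M \<Longrightarrow> x \<in> K \<Longrightarrow> \<bar>\<psi> t x - (\<Sum>i\<in>I k. \<psi> t (a i) * \<eta> k i x)\<bar> \<le> err k t"
    "\<And>k. integrable M (err k)" "\<And>t. t \<in> space M \<Longrightarrow> (\<lambda>k. err k t) \<longlonglongrightarrow> 0"
    "(\<lambda>k. LINT t|M. err k t) \<longlonglongrightarrow> 0"
    by (rule caratheodory_approx) (rule that; assumption)
  show ?thesis
  proof (rule borel_measurable_LIMSEQ_real)
    show "(\<lambda>t. \<Sum>i\<in>I k. \<psi> t (a i) * \<eta> k i (g t)) \<in> borel_measurable M" for k
      using meas_F[OF meas[OF *(1)]] continuous_profile(1)[OF g *(3)]
      by (intro borel_measurable_sum borel_measurable_times) auto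
    show "(\<lambda>k. \<Sum>i\<in>I k. \<psi> t (a i) * \<eta> k i (g t)) \<longlonglongrightarrow> \<psi> t (g t)" if t: "t \<in> space M" for t
    proof -
      have "(\<lambda>k. \<psi> t (g t) - (\<Sum>i\<in>I k. \<psi> t (a i) * \<eta> k i (g t))) \<longlonglongrightarrow> 0"
        using *(5)[OF t profilesD(2)[OF g t]] by (intro Lim_null_comparison[OF _ *(7)[OF t]]) auto
      from tendsto_diff[OF tendsto_const[of "\<psi> t (g t)"] this] show ?thesis by simp
    qed
  qed
qed

lemma caratheodory_integrable:
  assumes g: "g \<in> profiles"
  shows "integrable M (\<lambda>t. \<psi> t (g t))"
  using caratheodory_measurable[OF g] bdd profilesD(2)[OF g]
  by (intro integrable_const_bound[of _ B]) auto

text \<open>After interpolation each term is the product of an \<open>F\<close>-integrable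
  coefficient \<open>\<psi> t (a i)\<close> and a continuous function of the action. It is treated
  by \<open>pairing_tendsto\<close> over the real line, where the field of functionals is
  multiplication by \<open>\<eta> k i (g n t)\<close>.\<close>

lemma caratheodory_tendsto:
  assumes g: "\<And>n. g n \<in> profiles" "h \<in> profiles" and gh: "tends_F g h"
  shows "(\<lambda>n. LINT t|M. \<psi> t (g n t)) \<longlonglongrightarrow> (LINT t|M. \<psi> t (h t))"
proof -
  obtain a :: "nat \<Rightarrow> 'k" and I :: "nat \<Rightarrow> nat set" and \<eta> :: "nat \<Rightarrow> nat \<Rightarrow> 'k \<Rightarrow> real" and err :: "nat \<Rightarrow> 'a \<Rightarrow> real"
  where *: "\<And>i. a i \<in> K" "\<And>k. finite (I k)" "\<And>k i. continuous_on K (\<eta> k i)"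
    "\<And>k i x. x \<in> K \<Longrightarrow> \<bar>\<eta> k i x\<bar> \<le> 1"
    "\<And>k t x. t \<in> space M \<Longrightarrow> x \<in> K \<Longrightarrow> \<bar>\<psi> t x - (\<Sum>i\<in>I k. \<psi> t (a i) * \<eta> k i x)\<bar> \<le> err k t"
    "\<And>k. integrable M (err k)" "\<And>t. t \<in> space M \<Longrightarrow> (\<lambda>k. err k t) \<longlonglongrightarrow> 0"
    "(\<lambda>k. LINT t|M. err k t) \<longlonglongrightarrow> 0"
    by (rule caratheodory_approx) (rule that; assumption)
  have \<psi>I: "integrable M (\<lambda>t. \<psi> t (a i))" for i
    using meas_F[OF meas[OF *(1)]] bdd *(1) by (intro integrable_const_bound[of _ B]) auto
  have \<psi>IF: "integrable (restr_to_subalg M F) (\<lambda>t. \<psi> t (a i))" for i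
    by (rule integrable_in_subalg[OF subalg meas[OF *(1)] \<psi>I])
  have lim1: "(\<lambda>n. LINT t|M. \<psi> t (a i) * \<eta> k i (g n t)) \<longlonglongrightarrow> (LINT t|M. \<psi> t (a i) * \<eta> k i (h t))" for i k
  proof (rule pairing_tendsto[where L = "\<lambda>n t v. v * \<eta> k i (g n t)" and L' = "\<lambda>t v. v * \<eta> k i (h t)" and K = 1, OF _ _ _ _ _ _ _ _ \<psi>IF])
    show "(\<lambda>n. LINT t:A|M. v * \<eta> k i (g n t)) \<longlonglongrightarrow> (LINT t:A|M. v * \<eta> k i (h t))" if "A \<in> sets F" for A v
      using gh *(3)[of k i] that unfolding tends_F_def set_integral_mult_right by (intro tendsto_intros) auto
    show "\<bar>v * \<eta> k i (g n t)\<bar> \<le> 1 * norm v" if "t \<in> space M" for n t v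
      using *(4)[OF profilesD(2)[OF g(1) that]] by (simp add: abs_mult mult_left_le)
    show "\<bar>v * \<eta> k i (h t)\<bar> \<le> 1 * norm v" if "t \<in> space M" for t v
      using *(4)[OF profilesD(2)[OF g(2) that]] by (simp add: abs_mult mult_left_le)
  qed (use continuous_profile(1)[OF g(1) *(3)] continuous_profile(1)[OF g(2) *(3)] in
      \<open>auto intro: bounded_linear_mult_left\<close>)
  have termI: "integrable M (\<lambda>t. \<psi> t (a i) * \<eta> k i (u t))" if u: "u \<in> profiles" for i k u
  proof (rule Bochner_Integration.integrable_bound[OF \<psi>I[of i]])
    show "(\<lambda>t. \<psi> t (a i) * \<eta> k i (u t)) \<in> borel_measurable M"
      using \<psi>I[of i] continuous_profile(1)[OF u *(3)] by auto
    show "AE t in M. norm (\<psi> t (a i) * \<eta> k i (u t)) \<le> norm (\<psi> t (a i))"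
      using *(4)[OF profilesD(2)[OF u]] by (intro AE_I2) (simp add: abs_mult mult_left_le)
  qed
  define P where "P k u = (\<Sum>i\<in>I k. LINT t|M. \<psi> t (a i) * \<eta> k i (u t))" for k u
  have P: "\<bar>(LINT t|M. \<psi> t (u t)) - P k u\<bar> \<le> (LINT t|M. err k t)" if u: "u \<in> profiles" for k u
  proof -
    have Pe: "P k u = (LINT t|M. (\<Sum>i\<in>I k. \<psi> t (a i) * \<eta> k i (u t)))"
      unfolding P_def using termI[OF u] by simp
    have i: "integrable M (\<lambda>t. \<psi> t (u t) - (\<Sum>i\<in>I k. \<psi> t (a i) * \<eta> k i (u t)))"
      using termI[OF u] caratheodory_integrable[OF u] by auto
    have "(LINT t|M. \<psi> t (u t)) - P k u = (LINT t|M. \<psi> t (u t) - (\<Sum>i\<in>I k. \<psi> t (a i) * \<eta> k i (u t)))"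
      unfolding Pe using termI[OF u] caratheodory_integrable[OF u] by (intro Bochner_Integration.integral_diff[symmetric]) auto
    also have "\<bar>\<dots>\<bar> \<le> (LINT t|M. \<bar>\<psi> t (u t) - (\<Sum>i\<in>I k. \<psi> t (a i) * \<eta> k i (u t))\<bar>)" by (rule integral_abs_bound)
    also have "\<dots> \<le> (LINT t|M. err k t)"
      using i *(6) *(5)[OF _ profilesD(2)[OF u]] by (intro integral_mono) auto
    finally show ?thesis .
  qed
  show ?thesis
  proof (rule LIMSEQ_I)
    fix e :: real assume e: "e > 0"
    obtain k where "norm ((LINT t|M. err k t) - 0) < e / 3"
      using LIMSEQ_D[OF *(8), of "e / 3"] e by auto
    then have k: "(LINT t|M. err k t) < e / 3" by (simp add: abs_less_iff)
    have "(\<lambda>n. P k (g n)) \<longlonglongrightarrow> P k h" unfolding P_def by (intro tendsto_intros lim1)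
    from LIMSEQ_D[OF this, of "e / 3"] e obtain n0 where n0: "\<And>n. n \<ge> n0 \<Longrightarrow> norm (P k (g n) - P k h) < e / 3" by auto
    show "\<exists>n0. \<forall>n\<ge>n0. norm ((LINT t|M. \<psi> t (g n t)) - (LINT t|M. \<psi> t (h t))) < e"
    proof (intro exI allI impI)
      fix n assume "n \<ge> n0"
      from n0[OF this] P[OF g(1)[of n], of k] P[OF g(2), of k] k
      show "norm ((LINT t|M. \<psi> t (g n t)) - (LINT t|M. \<psi> t (h t))) < e"
        unfolding real_norm_def abs_le_iff abs_less_iff by linarith
    qed
  qed
qed

end

end

section \<open>Realizing prescribed weights; best replies from averages\<close>

lemma (in finite_measure_subalgebra) integral_indicator_density:
  fixes f q :: "'a \<Rightarrow> real"
  assumes f: "f \<in> borel_measurable F" "\<And>t. t \<in> space M \<Longrightarrow> \<bar>f t\<bar> \<le> B" and B0: "B0 \<in> sets M"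
    and q: "q \<in> borel_measurable F" "integrable M q"
    and eq: "\<And>E. E \<in> sets F \<Longrightarrow> measure M (E \<inter> B0) = (LINT t:E|M. q t)"
  shows "(LINT t|M. f t * indicator B0 t) = (LINT t|M. f t * q t)"
proof -
  have ind: "(LINT t:E|M. indicator B0 t) = measure M (E \<inter> B0)" if "E \<in> sets F" for E
    using cond_exp_indicator[OF that B0] real_cond_exp_intA[OF integrable_indicator_finite[OF B0] that] by simp
  have AE: "AE t in M. real_cond_exp M F (indicator B0) t = q t"
    using ind eq q B0 by (intro real_cond_exp_charact) auto
  have fM: "f \<in> borel_measurable M" by (rule meas_F[OF f(1)])
  have i: "integrable M (\<lambda>t. f t * indicator B0 t)"
    using f(2) fM B0 by (intro integrable_const_bound[of _ "\<bar>B\<bar>"])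
      (auto simp: indicator_def intro!: AE_I2 intro: order_trans[OF _ abs_ge_self])
  have "(LINT t|M. f t * indicator B0 t) = (LINT t|M. f t * real_cond_exp M F (indicator B0) t)"
    using real_cond_exp_intg(2)[OF i f(1)] B0 by simp
  also have "\<dots> = (LINT t|M. f t * q t)"
  proof (rule integral_cong_AE)
    show "AE t in M. f t * real_cond_exp M F (indicator B0) t = f t * q t"
      using AE by eventually_elim simp
  qed (use fM q meas_F in auto)
  finally show ?thesis .
qed

context compact_actions
begin

text \<open>Weights that depend on \<open>t\<close> only through its cell under the first
  \<open>n\<close> generators are carried out by a pure profile. By the formula, integrals of test
  functions \<open>F\<close>-measurable in the player depend on this profile only through the
  weights, and linearly.\<close>

lemma stage_profile:
  fixes C :: "nat \<Rightarrow> 'a set" and a :: "nat \<Rightarrow> 'k" and w :: "nat set \<Rightarrow> nat \<Rightarrow> real"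
  assumes ne: "nowhere_equivalent M F" and C: "\<And>m. C m \<in> sets F" and a: "\<And>i. a i \<in> K"
    and N: "0 < N" and w: "\<And>j i. j \<subseteq> {..<n} \<Longrightarrow> i < N \<Longrightarrow> 0 \<le> w j i" "\<And>j. j \<subseteq> {..<n} \<Longrightarrow> (\<Sum>i<N. w j i) = 1"
  shows "\<exists>g\<in>profiles. \<forall>\<psi> B. (\<forall>i. (\<lambda>t. \<psi> t (a i)) \<in> borel_measurable F) \<longrightarrow>
      (\<forall>t\<in>space M. \<forall>i. \<bar>\<psi> t (a i)\<bar> \<le> B) \<longrightarrow>
      (LINT t|M. \<psi> t (g t)) = (\<Sum>j\<in>Pow {..<n}. \<Sum>i<N. w j i * (LINT t:{t\<in>space M. sig C n t = j}|M. \<psi> t (a i)))"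
proof -
  have cF: "{t\<in>space M. sig C n t = j} \<in> sets F" for j
    using sig_sets[of n C F j] C by (simp add: space_F)
  have cM: "{t\<in>space M. sig C n t = j} \<in> sets M" for j using cF by (rule sets_F)
  define W where "W i t = w (sig C n t) i" for i t
  have WF: "W i \<in> borel_measurable F" for i
    unfolding W_def
  proof (rule measurable_compose_countable'[where g = "sig C n" and I = "Pow {..<n}" and f = "\<lambda>j t. w j i"])
    show "sig C n \<in> F \<rightarrow>\<^sub>M count_space (Pow {..<n})"
    proof (rule measurable_count_space_eq2[THEN iffD2], simp, intro conjI ballI)
      show "sig C n \<in> space F \<rightarrow> Pow {..<n}" using sig_subset by blast
      show "sig C n -` {\<sigma>} \<inter> space F \<in> sets F" for \<sigma>
        using cF[of \<sigma>] by (simp add: vimage_def Int_def conj_commute space_F)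
    qed
  qed (auto intro: countable_finite)
  obtain \<iota> where \<iota>: "\<And>t. \<iota> t < N" "\<And>i. {t\<in>space M. \<iota> t = i} \<in> sets M"
    "\<And>i E. i < N \<Longrightarrow> E \<in> sets F \<Longrightarrow> measure M (E \<inter> {t\<in>space M. \<iota> t = i}) = (LINT t:E|M. W i t)"
    by (rule purification[OF ne N, of W]) (use WF w sig_subset[of C n] in \<open>auto simp: W_def\<close>)
  have W01: "0 \<le> W i t" "W i t \<le> 1" if i: "i < N" for i t
  proof -
    have s: "sig C n t \<subseteq> {..<n}" using sig_subset[of C n t] by auto
    have "w (sig C n t) i \<le> (\<Sum>i<N. w (sig C n t) i)"
      using w(1)[OF s] i by (intro member_le_sum) auto
    then show "0 \<le> W i t" "W i t \<le> 1" using w(1)[OF s i] w(2)[OF s] by (auto simp: W_def)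
  qed
  have WI: "integrable M (W i)" if "i < N" for i
    by (rule integrable_const_bound[of _ 1]) (use W01[OF that] meas_F[OF WF] in auto)
  define g where "g t = a (\<iota> t)" for t
  have "g \<in> borel_measurable M"
    unfolding g_def
  proof (rule measurable_compose_countable'[where g = \<iota> and I = UNIV and f = "\<lambda>i t. a i"])
    show "\<iota> \<in> M \<rightarrow>\<^sub>M count_space UNIV"
      using \<iota>(2) by (intro measurable_count_space_eq_countable[THEN iffD2])
        (auto simp: vimage_def Int_def conj_commute)
  qed auto
  then have "g \<in> profiles" using a by (auto simp: profiles_def g_def)
  moreover have "(LINT t|M. \<psi> t (g t)) = (\<Sum>j\<in>Pow {..<n}. \<Sum>i<N. w j i * (LINT t:{t\<in>space M. sig C n t = j}|M. \<psi> t (a i)))"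
    if \<psi>: "\<And>i. (\<lambda>t. \<psi> t (a i)) \<in> borel_measurable F" "\<And>t i. t \<in> space M \<Longrightarrow> \<bar>\<psi> t (a i)\<bar> \<le> B" for \<psi> B
  proof -
    have \<psi>M: "(\<lambda>t. \<psi> t (a i)) \<in> borel_measurable M" for i by (rule meas_F[OF \<psi>(1)])
    have \<psi>I: "integrable M (\<lambda>t. \<psi> t (a i))" for i
      by (rule integrable_const_bound[of _ B]) (use \<psi>(2) \<psi>M in auto)
    have I1: "integrable M (\<lambda>t. \<psi> t (a i) * indicator {t\<in>space M. \<iota> t = i} t)" for i
      using integrable_mult_indicator[OF \<iota>(2) \<psi>I[of i], of i] by (simp add: mult.commute)
    have "(LINT t|M. \<psi> t (g t)) = (LINT t|M. (\<Sum>i<N. \<psi> t (a i) * indicator {t\<in>space M. \<iota> t = i} t))"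
    proof (rule Bochner_Integration.integral_cong[OF refl])
      fix t assume t: "t \<in> space M"
      have "(\<Sum>i<N. \<psi> t (a i) * indicator {t\<in>space M. \<iota> t = i} t) = (\<Sum>i<N. if i = \<iota> t then \<psi> t (a i) else 0)"
        using t by (intro sum.cong) (auto simp: indicator_def)
      then show "\<psi> t (g t) = (\<Sum>i<N. \<psi> t (a i) * indicator {t\<in>space M. \<iota> t = i} t)"
        using \<iota>(1)[of t] by (simp add: g_def)
    qed
    also have "\<dots> = (\<Sum>i<N. LINT t|M. \<psi> t (a i) * indicator {t\<in>space M. \<iota> t = i} t)"
      using I1 by (intro Bochner_Integration.integral_sum) auto
    also have "\<dots> = (\<Sum>i<N. LINT t|M. \<psi> t (a i) * W i t)"
      using \<psi> \<iota> WF WI by (intro sum.cong refl integral_indicator_density[of _ B]) auto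
    also have "\<dots> = (\<Sum>i<N. \<Sum>j\<in>Pow {..<n}. w j i * (LINT t:{t\<in>space M. sig C n t = j}|M. \<psi> t (a i)))"
    proof (rule sum.cong[OF refl])
      fix i assume "i \<in> {..<N}"
      have J: "integrable M (\<lambda>t. w j i * (indicator {t\<in>space M. sig C n t = j} t *\<^sub>R \<psi> t (a i)))" for j
        using integrable_mult_indicator[OF cM \<psi>I] by (intro integrable_mult_right)
      have "(LINT t|M. \<psi> t (a i) * W i t) =
         (LINT t|M. (\<Sum>j\<in>Pow {..<n}. w j i * (indicator {t\<in>space M. sig C n t = j} t *\<^sub>R \<psi> t (a i))))"
      proof (rule Bochner_Integration.integral_cong[OF refl])
        fix t assume t: "t \<in> space M"
        have "(\<Sum>j\<in>Pow {..<n}. w j i * (indicator {t\<in>space M. sig C n t = j} t *\<^sub>R \<psi> t (a i))) =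
          (\<Sum>j\<in>Pow {..<n}. if j = sig C n t then w j i * \<psi> t (a i) else 0)"
          using t by (intro sum.cong) (auto simp: indicator_def)
        then show "\<psi> t (a i) * W i t = (\<Sum>j\<in>Pow {..<n}. w j i * (indicator {t\<in>space M. sig C n t = j} t *\<^sub>R \<psi> t (a i)))"
          using sig_subset[of C n t] by (simp add: W_def)
      qed
      also have "\<dots> = (\<Sum>j\<in>Pow {..<n}. LINT t|M. w j i * (indicator {t\<in>space M. sig C n t = j} t *\<^sub>R \<psi> t (a i)))"
        using J by (intro Bochner_Integration.integral_sum) auto
      finally show "(LINT t|M. \<psi> t (a i) * W i t) = (\<Sum>j\<in>Pow {..<n}. w j i * (LINT t:{t\<in>space M. sig C n t = j}|M. \<psi> t (a i)))"
        by (simp add: set_lebesgue_integral_def)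
    qed
    also have "\<dots> = (\<Sum>j\<in>Pow {..<n}. \<Sum>i<N. w j i * (LINT t:{t\<in>space M. sig C n t = j}|M. \<psi> t (a i)))"
      by (rule sum.swap)
    finally show ?thesis .
  qed
  ultimately show ?thesis by blast
qed

text \<open>The function \<open>v\<close> is only measurable for \<open>M\<close>, so testing on
  \<open>F\<close>-sets does not compare it with \<open>x k\<close> directly. Its conditional
  expectation \<open>v'\<close> can be compared: it dominates every \<open>x k\<close>, hence their
  supremum \<open>V\<close>, while \<open>v \<le> V\<close> pointwise. As \<open>v\<close> and
  \<open>v'\<close> have the same integral, \<open>v = V\<close> almost everywhere.\<close>

lemma AE_eq_of_dominated_averages:
  fixes v :: "'a \<Rightarrow> real" and x :: "nat \<Rightarrow> 'a \<Rightarrow> real"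
  assumes v: "integrable M v" and x: "\<And>k. x k \<in> borel_measurable F" "\<And>k. integrable M (x k)"
    and le: "\<And>D k. D \<in> sets F \<Longrightarrow> (LINT t:D|M. x k t) \<le> (LINT t:D|M. v t)"
    and sup: "\<And>t c. t \<in> space M \<Longrightarrow> (\<And>k. x k t \<le> c) \<Longrightarrow> v t \<le> c" and k: "\<And>t k. t \<in> space M \<Longrightarrow> x k t \<le> B"
  shows "AE t in M. \<forall>k. x k t \<le> v t"
proof -
  define V where "V t = (SUP k. x k t)" for t
  have bd: "bdd_above (range (\<lambda>k. x k t))" if "t \<in> space M" for t
    using k[OF that] by (intro bdd_aboveI[of _ B]) auto
  have xV: "x i t \<le> V t" if "t \<in> space M" for i t
    unfolding V_def by (rule cSUP_upper[OF UNIV_I bd[OF that]])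
  have VB: "V t \<le> B" if "t \<in> space M" for t unfolding V_def by (rule cSUP_least) (use k[OF that] in auto)
  have vV: "v t \<le> V t" if "t \<in> space M" for t using sup[OF that] xV[OF that] by blast
  define v' where "v' = real_cond_exp M F v"
  have v': "integrable M v'" "v' \<in> borel_measurable F" "(LINT t|M. v' t) = (LINT t|M. v t)"
    unfolding v'_def using v by (auto intro: real_cond_exp_int)
  have "AE t in M. 0 \<le> v' t - x i t" for i
  proof (rule AE_nonneg_of_set_integrals)
    fix D assume D: "D \<in> sets F"
    have "(LINT t:D|M. v' t - x i t) = (LINT t:D|M. v t) - (LINT t:D|M. x i t)"
      using set_integrable_F[OF D v'(1)] set_integrable_F[OF D x(2)[of i]] real_cond_exp_intA[OF v D]
      by (simp add: set_integral_diff v'_def)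
    then show "0 \<le> (LINT t:D|M. v' t - x i t)" using le[OF D, of i] by simp
  qed (use v' x in auto)
  then have "AE t in M. \<forall>i. 0 \<le> v' t - x i t" by (simp add: AE_all_countable)
  then have Vv': "AE t in M. V t \<le> v' t"
    unfolding V_def by eventually_elim (auto intro!: cSUP_least)
  have VM: "V \<in> borel_measurable M"
    unfolding V_def using x meas_F bd by (intro borel_measurable_cSUP) auto
  have "integrable M V"
  proof (rule Bochner_Integration.integrable_bound[of M "\<lambda>t. \<bar>v t\<bar> + \<bar>B\<bar>"])
    show "AE t in M. norm (V t) \<le> norm (\<bar>v t\<bar> + \<bar>B\<bar>)"
      using vV VB by (intro AE_I2) (smt (verit) real_norm_def)
  qed (use v VM in auto)
  have "(LINT t|M. V t - v t) \<le> 0"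
    using integral_mono_AE[OF \<open>integrable M V\<close> v'(1) Vv'] v'(3) v \<open>integrable M V\<close> by simp
  moreover have nn: "AE t in M. 0 \<le> V t - v t" using vV by (intro AE_I2) auto
  ultimately have "(LINT t|M. V t - v t) = 0" using integral_nonneg_AE[OF nn] by linarith
  then have "AE t in M. V t - v t = 0"
    using integral_nonneg_eq_0_iff_AE[OF _ nn] v \<open>integrable M V\<close> by auto
  with AE_space show ?thesis
    by eventually_elim (use xV in \<open>metis diff_self eq_iff_diff_eq_0\<close>)
qed

end


section \<open>Equilibria on compact metric action spaces\<close>

text \<open>A tube lemma along a sequence: compactness of \<open>K\<close> makes the convergence
  uniform in the own action. Uniformity is what counts later, when the own actions vary with
  \<open>n\<close> without converging pointwise.\<close>

lemma uniform_section_limit: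
  fixes f :: "'k::topological_space \<times> 'c \<Rightarrow> real"
  assumes K: "compact K" and f: "continuous_map (prod_topology (top_of_set K) X) euclideanreal f"
    and c: "limitin X c l sequentially" and e: "e > 0"
  shows "\<forall>\<^sub>F n in sequentially. \<forall>x\<in>K. \<bar>f (x, c n) - f (x, l)\<bar> < e"
proof -
  have l: "l \<in> topspace X" using c by (rule limitin_topspace)
  define box where "box x U V \<longleftrightarrow> openin (top_of_set K) U \<and> openin X V \<and> x \<in> U \<and> l \<in> V \<and>
    (\<forall>y\<in>U. \<forall>z\<in>V. \<bar>f (y, z) - f (x, l)\<bar> < e / 2)" for x U V
  have "\<exists>U V. box x U V" if x: "x \<in> K" for x
  proof -
    define S where "S = {p \<in> topspace (prod_topology (top_of_set K) X). f p \<in> ball (f (x, l)) (e / 2)}"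
    have opS: "openin (prod_topology (top_of_set K) X) S"
      unfolding S_def by (rule openin_continuous_map_preimage[OF f]) simp
    have memS: "(x, l) \<in> S" using x l e by (simp add: S_def)
    obtain U V where UV: "openin (top_of_set K) U" "openin X V" "x \<in> U" "l \<in> V" "U \<times> V \<subseteq> S"
      using openin_prod_topology_alt[THEN iffD1, rule_format, OF opS memS] by (elim exE conjE) (rule that)
    have "\<bar>f (y, z) - f (x, l)\<bar> < e / 2" if "y \<in> U" "z \<in> V" for y z
    proof -
      have "(y, z) \<in> S" using UV(5) that by blast
      then show ?thesis by (simp add: S_def dist_real_def abs_minus_commute)
    qed
    then show ?thesis using UV by (intro exI[of _ U] exI[of _ V]) (simp add: box_def)
  qed
  then obtain U V where "\<And>x. x \<in> K \<Longrightarrow> box x (U x) (V x)" by metis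
  then have U: "\<And>x. x \<in> K \<Longrightarrow> openin (top_of_set K) (U x)" "\<And>x. x \<in> K \<Longrightarrow> x \<in> U x"
    and V: "\<And>x. x \<in> K \<Longrightarrow> openin X (V x)" "\<And>x. x \<in> K \<Longrightarrow> l \<in> V x"
    and UV: "\<And>x y z. x \<in> K \<Longrightarrow> y \<in> U x \<Longrightarrow> z \<in> V x \<Longrightarrow> \<bar>f (y, z) - f (x, l)\<bar> < e / 2"
    by (simp_all add: box_def)
  have "(\<forall>c\<in>U ` K. openin (top_of_set K) c) \<and> K \<subseteq> \<Union>(U ` K)" using U by blast
  then obtain \<D> where \<D>: "\<D> \<subseteq> U ` K" "finite \<D>" "K \<subseteq> \<Union>\<D>"
    using K[unfolded compact_eq_openin_cover, rule_format, of "U ` K"] by blast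
  obtain P where P: "P \<subseteq> K" "finite P" "\<D> = U ` P" using finite_subset_image[OF \<D>(2,1)] by blast
  have "\<forall>\<^sub>F n in sequentially. \<forall>x\<in>P. c n \<in> V x"
    using P V c by (intro eventually_ball_finite) (auto simp: limitin_def)
  then show ?thesis
  proof eventually_elim
    case (elim n)
    show ?case
    proof
      fix y assume "y \<in> K"
      then obtain x where x: "x \<in> P" "y \<in> U x" using \<D>(3) P(3) by auto
      then have xK: "x \<in> K" using P(1) by auto
      have "\<bar>f (y, c n) - f (x, l)\<bar> < e / 2" "\<bar>f (y, l) - f (x, l)\<bar> < e / 2"
        using UV[OF xK x(2)] elim x(1) V(2)[OF xK] by auto
      then show "\<bar>f (y, c n) - f (y, l)\<bar> < e" by linarith
    qed
  qed
qed

lemma (in finite_measure) set_integral_nonneg_from_algebra: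
  fixes f :: "'a \<Rightarrow> real"
  assumes R: "\<And>A. A \<in> R \<Longrightarrow> A \<in> sets M" "{} \<in> R" "\<And>A. A \<in> R \<Longrightarrow> space M - A \<in> R"
      "\<And>A B. A \<in> R \<Longrightarrow> B \<in> R \<Longrightarrow> A \<union> B \<in> R"
    and C: "C \<subseteq> R" and A: "A \<in> sigma_sets (space M) C"
    and f: "integrable M f" "\<And>t. t \<in> space M \<Longrightarrow> \<bar>f t\<bar> \<le> B" and nn: "\<And>A. A \<in> R \<Longrightarrow> 0 \<le> (LINT t:A|M. f t)"
  shows "0 \<le> (LINT t:A|M. f t)"
proof (rule field_le_epsilon)
  fix e :: real assume e: "e > 0"
  have Am: "A \<in> sets M"
  proof -
    have "sigma_sets (space M) C \<subseteq> sets M" using C R(1) by (intro sets.sigma_sets_subset) auto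
    then show ?thesis using A by auto
  qed
  define d where "d = e / (\<bar>B\<bar> + 1)"
  have d: "d > 0" using e by (simp add: d_def)
  obtain A' where A': "A' \<in> R" "measure M (sym_diff A A') < d"
    by (rule approx_by_algebra[OF R C A d]) auto
  have A'm: "A' \<in> sets M" using R(1) A' by blast
  have i: "integrable M (\<lambda>t. indicator X t *\<^sub>R f t)" if "X \<in> sets M" for X
    using that f(1) by (intro integrable_mult_indicator)
  have si: "integrable M (\<lambda>t. \<bar>B\<bar> * indicator (sym_diff A A') t)"
    using Am A'm by (intro integrable_mult_right) (simp add: emeasure_eq_measure)
  have "(LINT t:A'|M. f t) - (LINT t:A|M. f t) = (LINT t|M. indicator A' t *\<^sub>R f t - indicator A t *\<^sub>R f t)"
    unfolding set_lebesgue_integral_def using i Am A'm by simp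
  also have "\<dots> \<le> (LINT t|M. \<bar>B\<bar> * indicator (sym_diff A A') t)"
  proof (rule integral_mono[OF _ si])
    show "integrable M (\<lambda>t. indicator A' t *\<^sub>R f t - indicator A t *\<^sub>R f t)" using i Am A'm by auto
    show "indicator A' t *\<^sub>R f t - indicator A t *\<^sub>R f t \<le> \<bar>B\<bar> * indicator (sym_diff A A') t" if "t \<in> space M" for t
      using f(2)[OF that] by (auto simp: indicator_def abs_le_iff)
  qed
  also have "\<dots> = \<bar>B\<bar> * measure M (sym_diff A A')" using Am A'm by simp
  also have "\<dots> \<le> (\<bar>B\<bar> + 1) * d"
    using A'(2) by (intro mult_mono) auto
  also have "\<dots> = e" by (simp add: d_def)
  finally show "0 \<le> (LINT t:A|M. f t) + e" using nn[OF A'(1)] by simp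
qed

lemma countably_generated_sequence:
  assumes "countably_generated F"
  obtains C :: "nat \<Rightarrow> 'a set" where "\<And>m. C m \<in> sets F" "sets F = sigma_sets (space F) (range C)"
proof -
  obtain C0 where C0: "countable C0" "C0 \<subseteq> Pow (space F)" "sets F = sigma_sets (space F) C0"
    using assms unfolding countably_generated_def by blast
  define C where "C = from_nat_into (insert {} C0)"
  have r: "range C = insert {} C0" unfolding C_def using C0(1) by (intro range_from_nat_into) auto
  have "C m \<in> sets F" for m
  proof -
    have "C m \<in> insert {} C0" using r by auto
    then show ?thesis unfolding C0(3) by (auto intro: sigma_sets.Empty)
  qed
  moreover have "sets F = sigma_sets (space F) (range C)"
  proof
    show "sets F \<subseteq> sigma_sets (space F) (range C)" unfolding C0(3) r by (intro sigma_sets_mono') auto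
    show "sigma_sets (space F) (range C) \<subseteq> sets F"
      using \<open>\<And>m. C m \<in> sets F\<close> by (intro sets.sigma_sets_subset) auto
  qed
  ultimately show ?thesis using that by blast
qed

text \<open>The common core of both cases: the aggregates form an arbitrary topological space, and
  the aggregation operator enters only through its sequential continuity with respect to
  \<open>tends_F\<close>.\<close>

locale continuous_game = compact_actions M F K for M F :: "'a measure" and K :: "'k::{metric_space, second_countable_topology} set" +
  fixes X\<Gamma> :: "'c topology" and E :: "('a \<Rightarrow> 'k) \<Rightarrow> 'c" and u :: "'a \<Rightarrow> 'k \<times> 'c \<Rightarrow> real" and B :: real
  assumes E_top: "\<And>g. g \<in> profiles \<Longrightarrow> E g \<in> topspace X\<Gamma>"
    and E_lim: "\<And>g h. (\<And>n. g n \<in> profiles) \<Longrightarrow> h \<in> profiles \<Longrightarrow> tends_F g h \<Longrightarrow>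
        limitin X\<Gamma> (\<lambda>n. E (g n)) (E h) sequentially"
    and u_cont: "\<And>t. t \<in> space M \<Longrightarrow> continuous_map (prod_topology (top_of_set K) X\<Gamma>) euclideanreal (u t)"
    and u_meas: "\<And>x c. x \<in> K \<Longrightarrow> c \<in> topspace X\<Gamma> \<Longrightarrow> (\<lambda>t. u t (x, c)) \<in> borel_measurable F"
    and u_bdd: "\<And>t x c. t \<in> space M \<Longrightarrow> x \<in> K \<Longrightarrow> c \<in> topspace X\<Gamma> \<Longrightarrow> \<bar>u t (x, c)\<bar> \<le> B"
begin

lemma u_section_continuous:
  assumes "t \<in> space M" "c \<in> topspace X\<Gamma>"
  shows "continuous_on K (\<lambda>x. u t (x, c))"
proof -
  have "continuous_map (top_of_set K) (prod_topology (top_of_set K) X\<Gamma>) (\<lambda>x. (x, c))"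
    using assms(2) by (intro continuous_map_pairedI) (auto simp: continuous_map_const)
  from continuous_map_compose[OF this u_cont[OF assms(1)]] show ?thesis
    by (simp add: o_def)
qed

lemma u_integrable: "x \<in> K \<Longrightarrow> c \<in> topspace X\<Gamma> \<Longrightarrow> integrable M (\<lambda>t. u t (x, c))"
  using u_meas meas_F u_bdd by (intro integrable_const_bound[of _ B]) auto

lemma u_limit:
  assumes "t \<in> space M" "limitin X\<Gamma> c l sequentially" "x \<in> K"
  shows "(\<lambda>n. u t (x, c n)) \<longlonglongrightarrow> u t (x, l)"
proof (rule tendstoI)
  fix e :: real assume "e > 0"
  from uniform_section_limit[OF K(1) u_cont[OF assms(1)] assms(2) this]
  show "\<forall>\<^sub>F n in sequentially. dist (u t (x, c n)) (u t (x, l)) < e"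
    by eventually_elim (use assms(3) in \<open>auto simp: dist_real_def\<close>)
qed

text \<open>The populations are the cells of the first \<open>n\<close> generators, each with one
  weight vector on \<open>a 0\<close>, ..., \<open>a n\<close>, and the payoff of a population is
  the integral over its cell. Optimality in single cells adds up over unions of cells, and in this
  form it can be compared between different stages.\<close>

lemma stage_equilibrium:
  fixes C :: "nat \<Rightarrow> 'a set" and a :: "nat \<Rightarrow> 'k" and n :: nat
  assumes ne: "nowhere_equivalent M F" and C: "\<And>m. C m \<in> sets F" and a: "\<And>i. a i \<in> K"
  obtains g where "g \<in> profiles" "\<And>S k. S \<subseteq> Pow {..<n} \<Longrightarrow> k \<le> n \<Longrightarrow>
     (LINT t:{t\<in>space M. sig C n t \<in> S}|M. u t (a k, E g)) \<le> (LINT t:{t\<in>space M. sig C n t \<in> S}|M. u t (g t, E g))"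
proof -
  define N where "N = Suc n"
  let ?J = "Pow {..<n}" and ?N = "{..<N}"
  define cell where "cell j = {t\<in>space M. sig C n t = j}" for j
  have cF: "cell j \<in> sets F" for j
    unfolding cell_def using sig_sets[of n C F j] C by (simp add: space_F)
  define \<Delta> where "\<Delta> = {w :: nat set \<Rightarrow> nat \<Rightarrow> real. \<forall>j\<in>?J. (\<forall>i\<in>?N. 0 \<le> w j i) \<and> (\<Sum>i\<in>?N. w j i) = 1}"
  have "\<forall>w\<in>\<Delta>. \<exists>g. g \<in> profiles \<and> (\<forall>\<psi> B. (\<forall>i. (\<lambda>t. \<psi> t (a i)) \<in> borel_measurable F) \<longrightarrow>
      (\<forall>t\<in>space M. \<forall>i. \<bar>\<psi> t (a i)\<bar> \<le> B) \<longrightarrow>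
      (LINT t|M. \<psi> t (g t)) = (\<Sum>j\<in>?J. \<Sum>i<N. w j i * (LINT t:cell j|M. \<psi> t (a i))))"
  proof
    fix w assume w: "w \<in> \<Delta>"
    have "0 < N" by (simp add: N_def)
    from stage_profile[OF ne C a this, of n w] w
    show "\<exists>g. g \<in> profiles \<and> (\<forall>\<psi> B. (\<forall>i. (\<lambda>t. \<psi> t (a i)) \<in> borel_measurable F) \<longrightarrow>
      (\<forall>t\<in>space M. \<forall>i. \<bar>\<psi> t (a i)\<bar> \<le> B) \<longrightarrow>
      (LINT t|M. \<psi> t (g t)) = (\<Sum>j\<in>?J. \<Sum>i<N. w j i * (LINT t:cell j|M. \<psi> t (a i))))"
      unfolding \<Delta>_def cell_def Bex_def by simp
  qed
  from bchoice[OF this] obtain G where "\<forall>w\<in>\<Delta>. G w \<in> profiles \<and> (\<forall>\<psi> B. (\<forall>i. (\<lambda>t. \<psi> t (a i)) \<in> borel_measurable F) \<longrightarrow>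
      (\<forall>t\<in>space M. \<forall>i. \<bar>\<psi> t (a i)\<bar> \<le> B) \<longrightarrow>
      (LINT t|M. \<psi> t (G w t)) = (\<Sum>j\<in>?J. \<Sum>i<N. w j i * (LINT t:cell j|M. \<psi> t (a i))))"
    by (elim exE)
  then have G: "G w \<in> profiles" and GI: "(\<And>i. (\<lambda>t. \<psi> t (a i)) \<in> borel_measurable F) \<Longrightarrow>
      (\<And>t i. t \<in> space M \<Longrightarrow> \<bar>\<psi> t (a i)\<bar> \<le> B) \<Longrightarrow>
      (LINT t|M. \<psi> t (G w t)) = (\<Sum>j\<in>?J. \<Sum>i<N. w j i * (LINT t:cell j|M. \<psi> t (a i)))"
    if "w \<in> \<Delta>" for w \<psi> B
    using that by blast+
  define pay where "pay j i w = (LINT t:cell j|M. u t (a i, E (G w)))" for j i w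
  obtain w where w: "w \<in> \<Delta>" and eq: "\<And>j k. j \<in> ?J \<Longrightarrow> k \<in> ?N \<Longrightarrow> pay j k w \<le> (\<Sum>i\<in>?N. w j i * pay j i w)"
  proof (rule population_game_equilibrium[of ?J ?N pay, folded \<Delta>_def])
    show "(\<lambda>k. pay j i (W k)) \<longlonglongrightarrow> pay j i w"
      if W: "\<And>k. W k \<in> \<Delta>" "w \<in> \<Delta>" and lim: "\<And>j i. j \<in> ?J \<Longrightarrow> i \<in> ?N \<Longrightarrow> (\<lambda>k. W k j i) \<longlonglongrightarrow> w j i"
      for W w j i
    proof -
      \<comment> \<open>The profiles \<open>G w\<close> are picked without any continuity in
        \<open>w\<close>, but by \<open>GI\<close> their conditional laws are linear in the weights.
        So the aggregate of \<open>G w\<close> depends sequentially continuously on \<open>w\<close>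
        all the same.\<close>
      have "tends_F (\<lambda>k. G (W k)) (G w)"
        unfolding tends_F_def
      proof (intro ballI allI impI)
        fix A and \<psi> :: "'k \<Rightarrow> real" assume A: "A \<in> sets F" and \<psi>: "continuous_on K \<psi>"
        obtain c where c: "0 \<le> c" "\<And>x. x \<in> K \<Longrightarrow> \<bar>\<psi> x\<bar> \<le> c" using continuous_on_K_bounded[OF \<psi>] by blast
        have m: "(\<lambda>t. indicator A t * \<psi> (a i)) \<in> borel_measurable F" for i using A by measurable
        have b: "\<bar>indicator A t * \<psi> (a i)\<bar> \<le> c" for t i using c a by (auto simp: indicator_def)
        have I: "(LINT t:A|M. \<psi> (G w t)) = (\<Sum>j\<in>?J. \<Sum>i<N. w j i * (LINT t:cell j|M. indicator A t * \<psi> (a i)))"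
          if "w \<in> \<Delta>" for w
          using GI[OF that, of "\<lambda>t x. indicator A t * \<psi> x" c] m b by (simp add: set_lebesgue_integral_def)
        show "(\<lambda>n. LINT t:A|M. \<psi> (G (W n) t)) \<longlonglongrightarrow> (LINT t:A|M. \<psi> (G w t))"
          unfolding I[OF W(1)] I[OF W(2)] using lim by (intro tendsto_intros) auto
      qed
      then have L: "limitin X\<Gamma> (\<lambda>k. E (G (W k))) (E (G w)) sequentially"
        by (intro E_lim G W)
      have um: "(\<lambda>t. u t (a i, E (G w))) \<in> borel_measurable M" if "w \<in> \<Delta>" for w
        by (intro meas_F u_meas a E_top G that)
      have cM: "cell j \<in> sets M" by (rule sets_F[OF cF])
      show ?thesis
        unfolding pay_def set_lebesgue_integral_def
      proof (rule integral_dominated_convergence[where w = "\<lambda>_. \<bar>B\<bar>"])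
        show "AE t in M. (\<lambda>k. indicator (cell j) t *\<^sub>R u t (a i, E (G (W k)))) \<longlonglongrightarrow> indicator (cell j) t *\<^sub>R u t (a i, E (G w))"
          using L a by (intro AE_I2 tendsto_intros u_limit)
        show "AE t in M. norm (indicator (cell j) t *\<^sub>R u t (a i, E (G (W k)))) \<le> \<bar>B\<bar>" for k
          using u_bdd[OF _ a E_top[OF G[OF W(1)]]] by (intro AE_I2) (auto simp: indicator_def intro: order_trans[OF _ abs_ge_self])
      qed (use um W cM in auto)
    qed
  qed (auto simp: N_def)
  define c where "c = E (G w)"
  have c: "c \<in> topspace X\<Gamma>" unfolding c_def by (intro E_top G w)
  have "(LINT t:{t\<in>space M. sig C n t \<in> S}|M. u t (a k, c)) \<le> (LINT t:{t\<in>space M. sig C n t \<in> S}|M. u t (G w t, c))"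
    if S: "S \<subseteq> ?J" and k: "k \<le> n" for S k
  proof -
    let ?D = "{t\<in>space M. sig C n t \<in> S}"
    have fS: "finite S" using S by (rule finite_subset) simp
    have D_eq: "?D = (\<Union>j\<in>S. cell j)" by (auto simp: cell_def)
    have DF: "?D \<in> sets F" unfolding D_eq using cF fS by auto
    have part: "(LINT t:cell j|M. indicator ?D t * f t) = (if j \<in> S then LINT t:cell j|M. f t else 0)" for j and f :: "'a \<Rightarrow> real"
    proof -
      have "(LINT t:cell j|M. indicator ?D t * f t) = (LINT t|M. (if j \<in> S then indicator (cell j) t *\<^sub>R f t else 0))"
        unfolding set_lebesgue_integral_def by (intro Bochner_Integration.integral_cong) (auto simp: indicator_def cell_def)
      then show ?thesis by (simp add: set_lebesgue_integral_def)
    qed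
    have "(LINT t:?D|M. u t (a k, c)) = (\<Sum>j\<in>S. LINT t:cell j|M. u t (a k, c))"
      unfolding D_eq
    proof (rule set_integral_finite_Union)
      show "disjoint_family_on cell S" by (auto simp: disjoint_family_on_def cell_def)
      show "set_integrable M (cell j) (\<lambda>t. u t (a k, c))" for j
        by (intro set_integrable_F u_integrable cF a c)
      show "cell j \<in> sets M" for j by (rule sets_F[OF cF])
    qed (rule fS)
    also have "\<dots> \<le> (\<Sum>j\<in>S. \<Sum>i<N. w j i * (LINT t:cell j|M. u t (a i, c)))"
    proof (rule sum_mono)
      fix j assume "j \<in> S"
      then have "j \<in> ?J" "k \<in> ?N" using S k by (auto simp: N_def)
      from eq[OF this] show "(LINT t:cell j|M. u t (a k, c)) \<le> (\<Sum>i<N. w j i * (LINT t:cell j|M. u t (a i, c)))"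
        by (simp only: pay_def c_def[symmetric])
    qed
    \<comment> \<open>The sum is extended to all cells by putting the indicator of \<open>?D\<close>
      into the integrand, so that \<open>GI\<close> applies to the payoff obtained on
      \<open>?D\<close>.\<close>
    also have "\<dots> = (\<Sum>j\<in>?J. \<Sum>i<N. w j i * (LINT t:cell j|M. indicator ?D t * u t (a i, c)))"
      unfolding part using S by (intro sum.mono_neutral_cong_left) auto
    also have "\<dots> = (LINT t|M. indicator ?D t * u t (G w t, c))"
    proof (rule GI[OF w, of "\<lambda>t x. indicator ?D t * u t (x, c)" "\<bar>B\<bar>", symmetric])
      show "(\<lambda>t. indicator ?D t * u t (a i, c)) \<in> borel_measurable F" for i
        using DF u_meas[OF a c] by (intro borel_measurable_times borel_measurable_indicator)
      show "\<bar>indicator ?D t * u t (a i, c)\<bar> \<le> \<bar>B\<bar>" if "t \<in> space M" for t i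
        using u_bdd[OF that a c, of i] by (auto simp: indicator_def)
    qed
    finally show ?thesis by (simp add: set_lebesgue_integral_def)
  qed
  then show ?thesis using that[of "G w"] G[OF w] by (simp add: c_def)
qed


definition determined :: "(nat \<Rightarrow> 'a set) \<Rightarrow> nat \<Rightarrow> 'a set set" where
  "determined C n = {{t\<in>space M. sig C n t \<in> S} |S. S \<subseteq> Pow {..<n}}"

lemma determined_mono:
  assumes "A \<in> determined C n" "n \<le> n'"
  shows "A \<in> determined C n'"
proof -
  obtain S where S: "S \<subseteq> Pow {..<n}" "A = {t\<in>space M. sig C n t \<in> S}" using assms by (auto simp: determined_def)
  have "sig C n t = sig C n' t \<inter> {..<n}" for t using assms(2) by (auto simp: sig_def)
  then have "A = {t\<in>space M. sig C n' t \<in> {s\<in>Pow {..<n'}. s \<inter> {..<n} \<in> S}}"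
    using S(2) sig_subset[of C n'] by auto
  then show ?thesis unfolding determined_def by blast
qed

lemma determined_algebra:
  assumes C: "\<And>m. C m \<in> sets F"
  defines "R \<equiv> \<Union>n. determined C n"
  shows "\<And>A. A \<in> R \<Longrightarrow> A \<in> sets F" "{} \<in> R" "\<And>A. A \<in> R \<Longrightarrow> space M - A \<in> R"
    "\<And>A A'. A \<in> R \<Longrightarrow> A' \<in> R \<Longrightarrow> A \<union> A' \<in> R" "range C \<subseteq> R"
proof -
  show "A \<in> sets F" if AR: "A \<in> R" for A
  proof -
    obtain n S where S: "S \<subseteq> Pow {..<n}" "A = {t\<in>space M. sig C n t \<in> S}"
      using AR by (auto simp: R_def determined_def)
    then have "A = (\<Union>s\<in>S. {t\<in>space F. sig C n t = s})" by (auto simp: space_F)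
    moreover have "finite S" using S(1) by (rule finite_subset) simp
    ultimately show ?thesis using sig_sets[of n C F] C by auto
  qed
  show "{} \<in> R" by (auto simp: R_def determined_def)
  show "space M - A \<in> R" if AR: "A \<in> R" for A
  proof -
    obtain n S where S: "S \<subseteq> Pow {..<n}" "A = {t\<in>space M. sig C n t \<in> S}"
      using AR by (auto simp: R_def determined_def)
    then have "space M - A = {t\<in>space M. sig C n t \<in> Pow {..<n} - S}" using sig_subset[of C n] by auto
    then show ?thesis unfolding R_def determined_def by blast
  qed
  show "A \<union> A' \<in> R" if AR: "A \<in> R" "A' \<in> R" for A A'
  proof -
    obtain n n' where "A \<in> determined C n" "A' \<in> determined C n'" using AR by (auto simp: R_def)
    then have "A \<in> determined C (max n n')" "A' \<in> determined C (max n n')"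
      by (auto intro: determined_mono)
    then obtain S S' where S: "S \<subseteq> Pow {..<max n n'}" "A = {t\<in>space M. sig C (max n n') t \<in> S}"
       "S' \<subseteq> Pow {..<max n n'}" "A' = {t\<in>space M. sig C (max n n') t \<in> S'}" by (auto simp: determined_def)
    then have "A \<union> A' = {t\<in>space M. sig C (max n n') t \<in> S \<union> S'}" by auto
    then have "A \<union> A' \<in> determined C (max n n')" unfolding determined_def using S by blast
    then show ?thesis by (auto simp: R_def)
  qed
  show "range C \<subseteq> R"
  proof
    fix A assume "A \<in> range C"
    then obtain m where m: "A = C m" by auto
    have "A \<subseteq> space M" unfolding m using sets.sets_into_space[OF sets_F[OF C]] .
    then have "A = {t\<in>space M. sig C (Suc m) t \<in> {s\<in>Pow {..<Suc m}. m \<in> s}}"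
      using sig_subset[of C "Suc m"] by (auto simp: m sig_def)
    then show "A \<in> R" unfolding R_def determined_def by blast
  qed
qed

lemma deviations_unprofitable:
  fixes a :: "nat \<Rightarrow> 'k"
  assumes ne: "nowhere_equivalent M F" and cg: "countably_generated F" and a: "\<And>i. a i \<in> K"
  obtains h where "h \<in> profiles"
    "\<And>D k. D \<in> sets F \<Longrightarrow> (LINT t:D|M. u t (a k, E h)) \<le> (LINT t:D|M. u t (h t, E h))"
proof -
  obtain C :: "nat \<Rightarrow> 'a set" where C: "\<And>m. C m \<in> sets F" "sets F = sigma_sets (space F) (range C)"
    using countably_generated_sequence[OF cg] by blast
  have "\<exists>g. g \<in> profiles \<and> (\<forall>D\<in>determined C n. \<forall>k\<le>n. (LINT t:D|M. u t (a k, E g)) \<le> (LINT t:D|M. u t (g t, E g)))" for n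
  proof -
    obtain g where "g \<in> profiles" "\<And>S k. S \<subseteq> Pow {..<n} \<Longrightarrow> k \<le> n \<Longrightarrow>
     (LINT t:{t\<in>space M. sig C n t \<in> S}|M. u t (a k, E g)) \<le> (LINT t:{t\<in>space M. sig C n t \<in> S}|M. u t (g t, E g))"
      by (rule stage_equilibrium[OF ne C(1) a, of n]) (rule that; assumption)
    then show ?thesis unfolding determined_def by blast
  qed
  then obtain g where g: "\<And>n. g n \<in> profiles" and
    g_eq: "\<And>n D k. D \<in> determined C n \<Longrightarrow> k \<le> n \<Longrightarrow> (LINT t:D|M. u t (a k, E (g n))) \<le> (LINT t:D|M. u t (g n t, E (g n)))"
    by metis
  obtain r h where r: "strict_mono r" and h: "h \<in> profiles" and gh: "tends_F (\<lambda>n. g (r n)) h"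
    by (rule profile_subsequence[OF ne cg, of g, OF g]) (rule that; assumption)
  have L: "limitin X\<Gamma> (\<lambda>n. E (g (r n))) (E h) sequentially" using g h gh by (intro E_lim)
  define c where "c = E h"
  define cn where "cn n = E (g (r n))" for n
  have c: "c \<in> topspace X\<Gamma>" and cn: "cn n \<in> topspace X\<Gamma>" for n
    using E_top g h by (auto simp: c_def cn_def)
  have L: "limitin X\<Gamma> cn c sequentially" using L by (simp add: c_def cn_def[abs_def])
  have car: "(\<lambda>t. u t (g' t, e)) \<in> borel_measurable M" "integrable M (\<lambda>t. u t (g' t, e))"
    if "g' \<in> profiles" "e \<in> topspace X\<Gamma>" for g' e
    using caratheodory_measurable[of "\<lambda>t x. u t (x, e)" B g'] caratheodory_integrable[of "\<lambda>t x. u t (x, e)" B g']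
      u_section_continuous u_meas u_bdd that by auto
  have main: "(LINT t:D|M. u t (a k, c)) \<le> (LINT t:D|M. u t (h t, c))" if D: "D \<in> determined C n0" for D k n0
  proof -
    have DF: "D \<in> sets F" by (rule determined_algebra(1)[of C, OF C(1)]) (rule UN_I[of n0], simp, rule D)
    have DM: "D \<in> sets M" by (rule sets_F[OF DF])
    have 1: "(\<lambda>n. LINT t:D|M. u t (a k, cn n)) \<longlonglongrightarrow> (LINT t:D|M. u t (a k, c))"
      unfolding set_lebesgue_integral_def
    proof (rule integral_dominated_convergence[where w = "\<lambda>_. \<bar>B\<bar>"])
      show "AE t in M. (\<lambda>n. indicator D t *\<^sub>R u t (a k, cn n)) \<longlonglongrightarrow> indicator D t *\<^sub>R u t (a k, c)"
        using L a by (intro AE_I2 tendsto_intros u_limit)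
      show "AE t in M. norm (indicator D t *\<^sub>R u t (a k, cn n)) \<le> \<bar>B\<bar>" for n
        using u_bdd[OF _ a cn] by (intro AE_I2) (auto simp: indicator_def intro: order_trans[OF _ abs_ge_self])
    qed (use DM u_integrable[OF a c] u_integrable[OF a cn] in auto)
    \<comment> \<open>Actions and aggregates vary together. The aggregate is first replaced by its
      limit, uniformly in the action; then the convergence in law is applied to the payoff with this
      aggregate fixed.\<close>
    have 2: "(\<lambda>n. (LINT t:D|M. u t (g (r n) t, cn n)) - (LINT t:D|M. u t (g (r n) t, c))) \<longlonglongrightarrow> 0"
    proof -
      have e: "(LINT t:D|M. u t (g (r n) t, cn n)) - (LINT t:D|M. u t (g (r n) t, c)) =
        (LINT t|M. indicator D t * (u t (g (r n) t, cn n) - u t (g (r n) t, c)))" for n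
        using set_integrable_F[OF DF car(2)[OF g c]] set_integrable_F[OF DF car(2)[OF g cn]]
        by (subst set_integral_diff(2)[symmetric]) (auto simp: set_lebesgue_integral_def)
      have "(\<lambda>n. LINT t|M. indicator D t * (u t (g (r n) t, cn n) - u t (g (r n) t, c))) \<longlonglongrightarrow> (LINT t|M. 0)"
      proof (rule integral_dominated_convergence[where w = "\<lambda>_. 2 * \<bar>B\<bar>"])
        show "AE t in M. (\<lambda>n. indicator D t * (u t (g (r n) t, cn n) - u t (g (r n) t, c))) \<longlonglongrightarrow> 0"
        proof (rule AE_I2)
          fix t assume t: "t \<in> space M"
          have "(\<lambda>n. u t (g (r n) t, cn n) - u t (g (r n) t, c)) \<longlonglongrightarrow> 0"
          proof (rule tendstoI)
            fix e :: real assume "e > 0"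
            from uniform_section_limit[OF K(1) u_cont[OF t] L this]
            show "\<forall>\<^sub>F n in sequentially. dist (u t (g (r n) t, cn n) - u t (g (r n) t, c)) 0 < e"
              by eventually_elim (use profilesD(2)[OF g t] in auto)
          qed
          from tendsto_mult[OF tendsto_const[of "indicator D t"] this]
          show "(\<lambda>n. indicator D t * (u t (g (r n) t, cn n) - u t (g (r n) t, c))) \<longlonglongrightarrow> 0" by simp
        qed
        show "AE t in M. norm (indicator D t * (u t (g (r n) t, cn n) - u t (g (r n) t, c))) \<le> 2 * \<bar>B\<bar>" for n
        proof (rule AE_I2)
          fix t assume t: "t \<in> space M"
          have "\<bar>u t (g (r n) t, cn n)\<bar> \<le> B" "\<bar>u t (g (r n) t, c)\<bar> \<le> B"
            using u_bdd[OF t profilesD(2)[OF g t]] c cn by auto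
          then have "\<bar>u t (g (r n) t, cn n) - u t (g (r n) t, c)\<bar> \<le> 2 * \<bar>B\<bar>" by linarith
          then show "norm (indicator D t * (u t (g (r n) t, cn n) - u t (g (r n) t, c))) \<le> 2 * \<bar>B\<bar>"
            by (auto simp: indicator_def)
        qed
      qed (use DM car(1)[OF g c] car(1)[OF g cn] in auto)
      then show ?thesis unfolding e by simp
    qed
    have 3: "(\<lambda>n. LINT t:D|M. u t (g (r n) t, c)) \<longlonglongrightarrow> (LINT t:D|M. u t (h t, c))"
      unfolding set_lebesgue_integral_def real_scaleR_def
    proof (rule caratheodory_tendsto[where \<psi> = "\<lambda>t x. indicator D t * u t (x, c)" and B = "\<bar>B\<bar>"])
      show "continuous_on K (\<lambda>x. indicator D t * u t (x, c))" if "t \<in> space M" for t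
        using u_section_continuous[OF that c] by (intro continuous_intros)
      show "(\<lambda>t. indicator D t * u t (x, c)) \<in> borel_measurable F" if "x \<in> K" for x
        using DF u_meas[OF that c] by (intro borel_measurable_times borel_measurable_indicator)
      show "\<bar>indicator D t * u t (x, c)\<bar> \<le> \<bar>B\<bar>" if "t \<in> space M" "x \<in> K" for t x
        using u_bdd[OF that c] by (auto simp: indicator_def)
    qed (use g h gh in auto)
    have "(\<lambda>n. LINT t:D|M. u t (g (r n) t, cn n)) \<longlonglongrightarrow> (LINT t:D|M. u t (h t, c))"
      using tendsto_add[OF 2 3] by simp
    then show ?thesis
    proof (rule LIMSEQ_le[OF 1])
      show "\<exists>N. \<forall>n\<ge>N. (LINT t:D|M. u t (a k, cn n)) \<le> (LINT t:D|M. u t (g (r n) t, cn n))"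
      proof (intro exI allI impI)
        fix n assume n: "n \<ge> max k n0"
        then have rn: "r n \<ge> k" "r n \<ge> n0" using seq_suble[OF r, of n] by auto
        show "(LINT t:D|M. u t (a k, cn n)) \<le> (LINT t:D|M. u t (g (r n) t, cn n))"
          unfolding cn_def by (rule g_eq[OF determined_mono[OF D rn(2)] rn(1)])
      qed
    qed
  qed
  have "(LINT t:D|M. u t (a k, c)) \<le> (LINT t:D|M. u t (h t, c))" if D: "D \<in> sets F" for D k
  proof -
    note alg = determined_algebra[of C, OF C(1)]
    have i: "integrable M (\<lambda>t. u t (h t, c))" "integrable M (\<lambda>t. u t (a k, c))"
      using car(2)[OF h c] u_integrable[OF a c] by auto
    have diff: "(LINT t:A|M. u t (h t, c) - u t (a k, c)) = (LINT t:A|M. u t (h t, c)) - (LINT t:A|M. u t (a k, c))"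
      if "A \<in> sets F" for A
      using set_integrable_F[OF that i(1)] set_integrable_F[OF that i(2)] by (simp add: set_integral_diff)
    \<comment> \<open>From the union of the finite algebras to all of \<open>F\<close> by
      approximation in measure; the payoffs are bounded.\<close>
    have "0 \<le> (LINT t:D|M. u t (h t, c) - u t (a k, c))"
    proof (rule set_integral_nonneg_from_algebra[where R = "\<Union>n. determined C n" and C = "range C" and B = "2 * \<bar>B\<bar>"])
      show "D \<in> sigma_sets (space M) (range C)" using D C(2) by (simp add: space_F)
      show "\<bar>u t (h t, c) - u t (a k, c)\<bar> \<le> 2 * \<bar>B\<bar>" if "t \<in> space M" for t
        using u_bdd[OF that profilesD(2)[OF h that] c] u_bdd[OF that a c, of k] by linarith
      show "0 \<le> (LINT t:A|M. u t (h t, c) - u t (a k, c))" if "A \<in> (\<Union>n. determined C n)" for A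
        using that main alg(1)[OF that] by (auto simp: diff)
    qed (use alg sets_F i in auto)
    then show ?thesis using diff[OF D] by simp
  qed
  then show ?thesis using that[OF h] by (simp add: c_def)
qed

theorem equilibrium_exists:
  assumes ne: "nowhere_equivalent M F" and cg: "countably_generated F"
  shows "\<exists>g\<in>profiles. AE t in M. \<forall>x\<in>K. u t (x, E g) \<le> u t (g t, E g)"
proof -
  obtain a :: "nat \<Rightarrow> 'k" where a: "\<And>i. a i \<in> K" "K \<subseteq> closure (range a)" using dense_sequence by blast
  obtain h where h: "h \<in> profiles" and
    le: "\<And>D k. D \<in> sets F \<Longrightarrow> (LINT t:D|M. u t (a k, E h)) \<le> (LINT t:D|M. u t (h t, E h))"
    by (rule deviations_unprofitable[OF ne cg, of a, OF a(1)]) (rule that; assumption)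
  define c where "c = E h"
  have c: "c \<in> topspace X\<Gamma>" unfolding c_def by (rule E_top[OF h])
  have clos: "closure (range a) = K"
    using a compact_imp_closed[OF K(1)] by (intro antisym closure_minimal) auto
  have ext: "u t (x, c) \<le> d" if t: "t \<in> space M" and d: "\<And>k. u t (a k, c) \<le> d" and x: "x \<in> K" for t x d
    using continuous_le_on_closure[of "range a" "\<lambda>x. u t (x, c)" x d] u_section_continuous[OF t c] d x clos by auto
  \<comment> \<open>The dense sequence comes arbitrarily close to \<open>h t\<close>, so the payoff
    obtained is at most the supremum of the \<open>F\<close>-measurable payoffs of the
    \<open>a k\<close>. The averaged inequalities then force equality almost everywhere.\<close>
  have "AE t in M. \<forall>k. u t (a k, c) \<le> u t (h t, c)"
  proof (rule AE_eq_of_dominated_averages[where B = B])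
    show "integrable M (\<lambda>t. u t (h t, c))"
      using caratheodory_integrable[of "\<lambda>t x. u t (x, c)" B h] u_section_continuous u_meas u_bdd c h by auto
    show "u t (h t, c) \<le> d" if "t \<in> space M" "\<And>k. u t (a k, c) \<le> d" for t d
      using ext[OF that profilesD(2)[OF h that(1)]] .
    show "u t (a k, c) \<le> B" if "t \<in> space M" for t k using u_bdd[OF that a(1)[of k] c] by simp
  qed (use u_meas[OF a(1) c] u_integrable[OF a(1) c] le in \<open>auto simp: c_def\<close>)
  with AE_space have "AE t in M. \<forall>x\<in>K. u t (x, c) \<le> u t (h t, c)"
    by eventually_elim (use ext in blast)
  then show ?thesis using h unfolding c_def by blast
qed

end


section \<open>Dual spaces\<close>

definition sublinear :: "('x::real_vector \<Rightarrow> real) \<Rightarrow> bool" where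
  "sublinear p \<longleftrightarrow> (\<forall>x y. p (x + y) \<le> p x + p y) \<and> (\<forall>r x. 0 \<le> r \<longrightarrow> p (r *\<^sub>R x) \<le> r * p x)"

lemma sublinearD:
  assumes "sublinear p"
  shows "p (x + y) \<le> p x + p y" "0 \<le> r \<Longrightarrow> p (r *\<^sub>R x) = r * p x" "p 0 = 0" "- p (- x) \<le> p x"
proof -
  show add: "p (x + y) \<le> p x + p y" for x y using assms by (simp add: sublinear_def)
  have le: "0 \<le> r \<Longrightarrow> p (r *\<^sub>R x) \<le> r * p x" for r x using assms by (simp add: sublinear_def)
  show z: "p 0 = 0" using add[of 0 0] le[of 0 0] by simp
  show "p (r *\<^sub>R x) = r * p x" if "0 \<le> r"
  proof (cases "r = 0")
    case False
    have "p ((1 / r) *\<^sub>R r *\<^sub>R x) \<le> (1 / r) * p (r *\<^sub>R x)" using that by (intro le) simp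
    then have "r * p x \<le> p (r *\<^sub>R x)" using False that by (simp add: field_simps)
    then show ?thesis using le[OF that, of x] by simp
  qed (simp add: z)
  show "- p (- x) \<le> p x" using add[of x "- x"] z by simp
qed

text \<open>For sublinear \<open>p\<close> this is the greatest sublinear functional below
  \<open>p\<close> whose value at \<open>- y\<close> is at most \<open>- p y\<close>. A minimal
  \<open>p\<close> coincides with it, which makes \<open>p\<close> odd.\<close>

definition sublinear_shift :: "('x::real_vector \<Rightarrow> real) \<Rightarrow> 'x \<Rightarrow> 'x \<Rightarrow> real" where
  "sublinear_shift p y x = (INF t\<in>{0..}. p (x + t *\<^sub>R y) - t * p y)"

lemma sublinear_shift:
  assumes p: "sublinear p"
  shows "sublinear (sublinear_shift p y)" "sublinear_shift p y x \<le> p x" "sublinear_shift p y (- y) \<le> - p y"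
proof -
  note P = sublinearD[OF p]
  have bd: "bdd_below ((\<lambda>t. p (x + t *\<^sub>R y) - t * p y) ` {0..})" for x
  proof (rule bdd_belowI2)
    fix t :: real assume "t \<in> {0..}"
    then have "t * p y = p (t *\<^sub>R y)" using P(2) by simp
    also have "\<dots> \<le> p (x + t *\<^sub>R y) + p (- x)" using P(1)[of "x + t *\<^sub>R y" "- x"] by simp
    finally show "- p (- x) \<le> p (x + t *\<^sub>R y) - t * p y" by simp
  qed
  have le: "sublinear_shift p y x \<le> p (x + t *\<^sub>R y) - t * p y" if "0 \<le> t" for t x
    unfolding sublinear_shift_def using that by (intro cINF_lower bd) simp
  have ge: "c \<le> sublinear_shift p y x" if "\<And>t. 0 \<le> t \<Longrightarrow> c \<le> p (x + t *\<^sub>R y) - t * p y" for c x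
    unfolding sublinear_shift_def using that by (intro cINF_greatest) auto
  show "sublinear_shift p y x \<le> p x" using le[of 0 x] by simp
  show "sublinear_shift p y (- y) \<le> - p y" using le[of 1 "- y"] P(3) by simp
  show "sublinear (sublinear_shift p y)"
    unfolding sublinear_def
  proof (intro conjI allI impI)
    fix x x'
    have "sublinear_shift p y (x + x') - (p (x' + t' *\<^sub>R y) - t' * p y) \<le> p (x + t *\<^sub>R y) - t * p y"
      if "0 \<le> t" "0 \<le> t'" for t t'
      using le[of "t + t'" "x + x'"] that P(1)[of "x + t *\<^sub>R y" "x' + t' *\<^sub>R y"] by (simp add: algebra_simps)
    then have "sublinear_shift p y (x + x') - (p (x' + t' *\<^sub>R y) - t' * p y) \<le> sublinear_shift p y x" if "0 \<le> t'" for t'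
      using that by (intro ge)
    then have "sublinear_shift p y (x + x') - sublinear_shift p y x \<le> sublinear_shift p y x'"
      by (intro ge) (simp add: algebra_simps)
    then show "sublinear_shift p y (x + x') \<le> sublinear_shift p y x + sublinear_shift p y x'" by simp
  next
    fix r :: real and x assume r: "0 \<le> r"
    show "sublinear_shift p y (r *\<^sub>R x) \<le> r * sublinear_shift p y x"
    proof (cases "r = 0")
      case True
      then show ?thesis using le[of 0 0] P(3) by simp
    next
      case False
      then have r: "r > 0" using r by simp
      have "sublinear_shift p y (r *\<^sub>R x) / r \<le> p (x + t *\<^sub>R y) - t * p y" if t: "0 \<le> t" for t
      proof -
        have "sublinear_shift p y (r *\<^sub>R x) \<le> p (r *\<^sub>R (x + t *\<^sub>R y)) - r * t * p y"
          using le[of "r * t" "r *\<^sub>R x"] r t by (simp add: scaleR_add_right)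
        also have "\<dots> = r * (p (x + t *\<^sub>R y) - t * p y)" using r P(2)[of r "x + t *\<^sub>R y"] by (simp add: right_diff_distrib)
        finally show ?thesis using r by (simp add: pos_divide_le_eq mult.commute)
      qed
      then have "sublinear_shift p y (r *\<^sub>R x) / r \<le> sublinear_shift p y x" by (rule ge)
      then show ?thesis using r by (simp add: pos_divide_le_eq mult.commute)
    qed
  qed
qed

text \<open>Hahn--Banach: a minimal sublinear functional below the norm is linear.\<close>

lemma norm_attaining_functional:
  fixes x0 :: "'x::real_normed_vector"
  obtains f :: "'x \<Rightarrow>\<^sub>L real" where "norm f \<le> 1" "blinfun_apply f x0 = norm x0"
proof -
  \<comment> \<open>The last condition is inherited by smaller functionals, and for an odd
    \<open>p\<close> it reads \<open>norm x0 \<le> p x0\<close>. The order \<open>R\<close> is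
    reversed, so that Zorn's lemma delivers a minimal functional.\<close>
  define A where "A = {p :: 'x \<Rightarrow> real. sublinear p \<and> (\<forall>x. p x \<le> norm x) \<and> p (- x0) \<le> - norm x0}"
  define R where "R p q \<longleftrightarrow> (\<forall>x. q x \<le> p x)" for p q :: "'x \<Rightarrow> real"
  have nsub: "sublinear (norm :: 'x \<Rightarrow> real)" by (auto simp: sublinear_def norm_triangle_ineq)
  have ne: "sublinear_shift norm x0 \<in> A"
    unfolding A_def using sublinear_shift[OF nsub] by auto
  have po: "partial_order_on A (relation_of R A)"
    by (rule partial_order_on_relation_ofI) (auto simp: R_def fun_eq_iff intro: order_trans antisym)
  have "\<exists>m\<in>A. \<forall>a\<in>A. R m a \<longrightarrow> a = m"
  proof (rule predicate_Zorn[OF po])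
    fix C assume C: "C \<in> Chains (relation_of R A)"
    then have CA: "C \<subseteq> A" and ch: "\<And>p q. p \<in> C \<Longrightarrow> q \<in> C \<Longrightarrow> R p q \<or> R q p"
      by (auto simp: Chains_def relation_of_def)
    show "\<exists>u\<in>A. \<forall>a\<in>C. R a u"
    proof (cases "C = {}")
      case True
      then show ?thesis using ne by auto
    next
      case False
      define u where "u x = (INF p\<in>C. p x)" for x
      have lo: "- norm x \<le> p x" if "p \<in> C" for p x
      proof -
        have p: "sublinear p" "\<And>x. p x \<le> norm x" using CA that by (auto simp: A_def)
        show ?thesis using sublinearD(4)[OF p(1), of x] p(2)[of "- x"] by simp
      qed
      have le: "u x \<le> p x" if "p \<in> C" for p x
        unfolding u_def using lo that by (intro cINF_lower bdd_belowI2[where m = "- norm x"]) auto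
      have ge: "c \<le> u x" if "\<And>p. p \<in> C \<Longrightarrow> c \<le> p x" for c x
        unfolding u_def using that False by (intro cINF_greatest) auto
      have Csub: "sublinear p" "p x \<le> norm x" "p (- x0) \<le> - norm x0" if "p \<in> C" for p x
        using CA that by (auto simp: A_def)
      have "sublinear u"
        unfolding sublinear_def
      proof (intro conjI allI impI)
        fix x y
        have pq: "u (x + y) \<le> p x + q y" if "p \<in> C" "q \<in> C" for p q
          using ch[OF that]
        proof
          assume "R p q"
          then show ?thesis using le[OF that(2), of "x + y"] sublinearD(1)[OF Csub(1)[OF that(2)], of x y]
            by (auto simp: R_def) (smt (verit))
        next
          assume "R q p"
          then show ?thesis using le[OF that(1), of "x + y"] sublinearD(1)[OF Csub(1)[OF that(1)], of x y]
            by (auto simp: R_def) (smt (verit))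
        qed
        then have "u (x + y) - q y \<le> u x" if "q \<in> C" for q
          using that by (intro ge) (simp add: algebra_simps)
        then have "u (x + y) - u x \<le> u y" by (intro ge) (simp add: algebra_simps)
        then show "u (x + y) \<le> u x + u y" by simp
      next
        fix r :: real and x assume r: "0 \<le> r"
        obtain p0 where p0: "p0 \<in> C" using False by blast
        show "u (r *\<^sub>R x) \<le> r * u x"
        proof (cases "r = 0")
          case True
          then show ?thesis using le[OF p0, of 0] sublinearD(3)[OF Csub(1)[OF p0]] by simp
        next
          case False
          then have r: "r > 0" using r by simp
          have "u (r *\<^sub>R x) / r \<le> p x" if "p \<in> C" for p
            using le[OF that, of "r *\<^sub>R x"] sublinearD(2)[OF Csub(1)[OF that], of r x] r
            by (simp add: pos_divide_le_eq mult.commute)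
          then have "u (r *\<^sub>R x) / r \<le> u x" by (rule ge)
          then show ?thesis using r by (simp add: pos_divide_le_eq mult.commute)
        qed
      qed
      moreover obtain p0 where p0: "p0 \<in> C" using False by blast
      ultimately have "u \<in> A"
        unfolding A_def using le[OF p0] Csub[OF p0] by (auto intro: order_trans)
      then show ?thesis using le by (auto simp: R_def)
    qed
  qed
  then obtain p where pA: "p \<in> A" and min: "\<And>q. q \<in> A \<Longrightarrow> R p q \<Longrightarrow> q = p" by blast
  have p: "sublinear p" "\<And>x. p x \<le> norm x" "p (- x0) \<le> - norm x0" using pA by (auto simp: A_def)
  note P = sublinearD[OF p(1)]
  have odd: "p (- y) = - p y" for y
  proof -
    have "sublinear_shift p y \<in> A"
      unfolding A_def using sublinear_shift[OF p(1), of y] p by (auto intro: order_trans)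
    moreover have "R p (sublinear_shift p y)" using sublinear_shift(2)[OF p(1)] by (auto simp: R_def)
    ultimately have "sublinear_shift p y = p" by (rule min)
    then have "p (- y) \<le> - p y" using sublinear_shift(3)[OF p(1), of y] by simp
    then show ?thesis using P(4)[of y] by simp
  qed
  have add: "p (x + y) = p x + p y" for x y
    using P(1)[of x y] P(1)[of "- x" "- y"] odd[of x] odd[of y] odd[of "x + y"] by simp
  have scale: "p (r *\<^sub>R x) = r * p x" for r x
  proof (cases "0 \<le> r")
    case False
    then have "p ((- r) *\<^sub>R x) = (- r) * p x" by (intro P(2)) simp
    then show ?thesis using odd[of "r *\<^sub>R x"] by simp
  qed (rule P(2))
  have bd: "\<bar>p x\<bar> \<le> norm x" for x using p(2)[of x] p(2)[of "- x"] odd[of x] by (simp add: abs_le_iff)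
  have bl: "bounded_linear p" using add scale bd by (intro bounded_linear_intro[where K = 1]) auto
  show ?thesis
  proof
    show "norm (Blinfun p) \<le> 1" using bd by (intro norm_blinfun_bound) (auto simp: bounded_linear_Blinfun_apply[OF bl])
    show "blinfun_apply (Blinfun p) x0 = norm x0"
      using p(3) bd[of x0] odd[of x0] by (simp add: bounded_linear_Blinfun_apply[OF bl])
  qed
qed

lemma dense_sequence_UNIV:
  obtains d :: "nat \<Rightarrow> 'x::{metric_space, second_countable_topology}" where "\<And>x e. e > 0 \<Longrightarrow> \<exists>i. dist (d i) x < e"
proof -
  obtain T :: "'x set" where T: "countable T" "T \<subseteq> UNIV" "UNIV \<subseteq> closure T" by (rule separable)
  have "T \<noteq> {}" using T(3) by auto
  then have r: "range (from_nat_into T) = T" using T(1) by (intro range_from_nat_into)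
  have "\<exists>i. dist (from_nat_into T i) x < e" if e: "e > 0" for x e
  proof -
    have "x \<in> closure T" using T(3) by auto
    then obtain y where "y \<in> T" "dist y x < e" using closure_approachable[of x T] e by blast
    then show ?thesis using r by (metis rangeE)
  qed
  then show ?thesis using that by blast
qed

text \<open>Norm-attaining functionals at the points of a dense sequence. They express the norm as a
  countable supremum, so that norm estimates and equality of vectors can be established almost
  everywhere, one functional at a time.\<close>

lemma norming_sequence:
  obtains e :: "nat \<Rightarrow> 'x::{real_normed_vector, second_countable_topology} \<Rightarrow>\<^sub>L real" where
    "\<And>i. norm (e i) \<le> 1" "\<forall>x. \<forall>\<epsilon>>0. \<exists>i. norm x < blinfun_apply (e i) x + \<epsilon>"
proof -
  obtain d :: "nat \<Rightarrow> 'x" where d: "\<And>x e. e > 0 \<Longrightarrow> \<exists>i. dist (d i) x < e" using dense_sequence_UNIV by blast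
  have "\<exists>f::'x \<Rightarrow>\<^sub>L real. norm f \<le> 1 \<and> blinfun_apply f (d i) = norm (d i)" for i
    using norm_attaining_functional[of "d i"] by blast
  then obtain e :: "nat \<Rightarrow> 'x \<Rightarrow>\<^sub>L real" where e: "\<And>i. norm (e i) \<le> 1" "\<And>i. blinfun_apply (e i) (d i) = norm (d i)" by metis
  have "\<exists>i. norm x < blinfun_apply (e i) x + \<epsilon>" if "\<epsilon> > 0" for x \<epsilon>
  proof -
    obtain i where i: "dist (d i) x < \<epsilon> / 2" using d[of "\<epsilon> / 2"] \<open>\<epsilon> > 0\<close> by auto
    have "\<bar>blinfun_apply (e i) (d i - x)\<bar> \<le> norm (e i) * norm (d i - x)" using norm_blinfun[of "e i" "d i - x"] by simp
    also have "\<dots> \<le> 1 * norm (d i - x)" using e(1) by (intro mult_right_mono) auto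
    finally have "norm (d i) - blinfun_apply (e i) x < \<epsilon> / 2" using i e(2)[of i]
      by (simp add: blinfun.diff_right dist_norm abs_le_iff)
    moreover have "norm x \<le> norm (d i) + \<epsilon> / 2" using i norm_triangle_ineq2[of x "d i"]
      by (simp add: dist_norm norm_minus_commute)
    ultimately show ?thesis by (intro exI[of _ i]) linarith
  qed
  then show ?thesis using that e(1) by blast
qed

text \<open>Banach-Steinhaus by way of Baire's theorem. It turns weak and weak* compactness of the
  action set into a norm bound.\<close>

lemma uniform_boundedness:
  fixes S :: "('y::banach \<Rightarrow>\<^sub>L real) set"
  assumes bd: "\<And>y. \<exists>B. \<forall>f\<in>S. \<bar>blinfun_apply f y\<bar> \<le> B"
  obtains R where "0 \<le> R" "\<And>f. f \<in> S \<Longrightarrow> norm f \<le> R"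
proof -
  define T where "T n = {y. \<forall>f\<in>S. \<bar>blinfun_apply f y\<bar> \<le> real n}" for n
  have clT: "closed (T n)" for n
  proof -
    have "T n = (\<Inter>f\<in>S. {y. \<bar>blinfun_apply f y\<bar> \<le> real n})" by (auto simp: T_def)
    moreover have "closed {y. \<bar>blinfun_apply f y\<bar> \<le> real n}" for f :: "'y \<Rightarrow>\<^sub>L real"
      by (intro closed_Collect_le continuous_intros)
    ultimately show ?thesis by (simp add: closed_INT)
  qed
  have U: "(\<Union>n. T n) = UNIV"
  proof -
    have "\<exists>n. y \<in> T n" for y
    proof -
      obtain B where "\<forall>f\<in>S. \<bar>blinfun_apply f y\<bar> \<le> B" using bd by blast
      moreover obtain n where "B \<le> real n" using real_arch_simple by blast
      ultimately show ?thesis by (auto simp: T_def intro: order_trans)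
    qed
    then show ?thesis by auto
  qed
  have "\<exists>n. interior (T n) \<noteq> {}"
  proof (rule ccontr)
    assume n: "\<nexists>n. interior (T n) \<noteq> {}"
    have "(euclidean :: 'y topology) interior_of \<Union>(range T) = {}"
    proof (rule Baire_category_alt)
      show "completely_metrizable_space (euclidean :: 'y topology) \<or>
        locally_compact_space (euclidean :: 'y topology) \<and> regular_space (euclidean :: 'y topology)"
        by (simp add: completely_metrizable_space_euclidean)
    qed (use n clT in auto)
    then show False using U by (simp add: interior_of_topspace)
  qed
  then obtain n y where "y \<in> interior (T n)" by blast
  then obtain e where e: "e > 0" "ball y e \<subseteq> T n" by (meson mem_interior)
  have "norm f \<le> 4 * real n / e" if f: "f \<in> S" for f
  proof (rule norm_blinfun_bound)
    show "0 \<le> 4 * real n / e" using e by simp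
    fix x
    show "norm (blinfun_apply f x) \<le> 4 * real n / e * norm x"
    proof (cases "x = 0")
      case False
      define s where "s = e / (2 * norm x)"
      have s: "s > 0" using False e by (simp add: s_def)
      have "y + s *\<^sub>R x \<in> ball y e" "y \<in> ball y e" using False e by (auto simp: s_def dist_norm)
      then have "y + s *\<^sub>R x \<in> T n" "y \<in> T n" using e(2) by blast+
      then have "\<bar>blinfun_apply f (y + s *\<^sub>R x)\<bar> \<le> n" "\<bar>blinfun_apply f y\<bar> \<le> n" using f by (auto simp: T_def)
      then have "\<bar>s * blinfun_apply f x\<bar> \<le> 2 * n" by (simp add: blinfun.add_right blinfun.scaleR_right)
      then have "s * \<bar>blinfun_apply f x\<bar> \<le> 2 * n" using s by (simp add: abs_mult)
      then have "\<bar>blinfun_apply f x\<bar> \<le> 2 * n / s" using s by (simp add: pos_le_divide_eq mult.commute)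
      also have "\<dots> = 4 * real n / e * norm x" using e False by (simp add: s_def)
      finally show ?thesis by simp
    qed simp
  qed
  then show ?thesis using that[of "4 * real n / e"] e by simp
qed

text \<open>Comparing \<open>c i + r * c j\<close> with \<open>c k\<close> encodes linearity and
  boundedness at once: where the vectors nearly coincide, so do the values. With rational
  \<open>r\<close> only, the hypothesis is a countable family of inequalities and can be secured
  almost everywhere when \<open>c\<close> depends on a player.\<close>

lemma functional_from_dense_values:
  fixes d :: "nat \<Rightarrow> 'x::real_normed_vector" and c :: "nat \<Rightarrow> real"
  assumes d: "\<And>x e. e > 0 \<Longrightarrow> \<exists>i. dist (d i) x < e"
    and K: "0 \<le> K"
    and ineq: "\<And>i j k r. r \<in> \<rat> \<Longrightarrow> \<bar>c i + r * c j - c k\<bar> \<le> K * norm (d i + r *\<^sub>R d j - d k)"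
  obtains L :: "'x \<Rightarrow>\<^sub>L real" where "norm L \<le> K" "\<And>i. blinfun_apply L (d i) = c i"
proof -
  have ineq: "\<bar>c i + r * c j - c k\<bar> \<le> K * norm (d i + r *\<^sub>R d j - d k)" for i j k r
  proof -
    have "closed {r. \<bar>c i + r * c j - c k\<bar> \<le> K * norm (d i + r *\<^sub>R d j - d k)}"
      by (intro closed_Collect_le continuous_intros)
    then have "closure \<rat> \<subseteq> {r. \<bar>c i + r * c j - c k\<bar> \<le> K * norm (d i + r *\<^sub>R d j - d k)}"
      using ineq by (intro closure_minimal) auto
    then show ?thesis using Rats_closure_real by auto
  qed
  have lip: "\<bar>c i - c k\<bar> \<le> K * norm (d i - d k)" for i k using ineq[of i 0 i k] by simp
  define s where "s x n = (SOME i. dist (d i) x < 1 / Suc n)" for x n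
  have s: "dist (d (s x n)) x < 1 / Suc n" for x n
    unfolding s_def by (rule someI_ex) (rule d, simp)
  have ds: "(\<lambda>n. d (s x n)) \<longlonglongrightarrow> x" for x
  proof (rule metric_LIMSEQ_I)
    fix e :: real assume "e > 0"
    then obtain n0 where "1 / real (Suc n0) < e" using nat_approx_posE by blast
    then show "\<exists>n0. \<forall>n\<ge>n0. dist (d (s x n)) x < e"
      using s by (intro exI[of _ n0]) (smt (verit) frac_le of_nat_0_less_iff of_nat_mono Suc_le_mono zero_less_Suc)
  qed
  have "Cauchy (\<lambda>n. c (s x n))" for x
  proof (rule metric_CauchyI)
    fix e :: real assume e: "e > 0"
    have "Cauchy (\<lambda>n. d (s x n))" using ds by (intro LIMSEQ_imp_Cauchy)
    then obtain N where N: "\<And>m n. m \<ge> N \<Longrightarrow> n \<ge> N \<Longrightarrow> dist (d (s x m)) (d (s x n)) < e / (K + 1)"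
      using metric_CauchyD[of "\<lambda>n. d (s x n)" "e / (K + 1)"] e K by auto
    show "\<exists>M. \<forall>m\<ge>M. \<forall>n\<ge>M. dist (c (s x m)) (c (s x n)) < e"
    proof (intro exI allI impI)
      fix m n assume mn: "m \<ge> N" "n \<ge> N"
      have "dist (c (s x m)) (c (s x n)) \<le> K * norm (d (s x m) - d (s x n))" using lip by (simp add: dist_real_def)
      also have "\<dots> \<le> K * (e / (K + 1))" using N[OF mn] K by (intro mult_left_mono) (auto simp: dist_norm)
      also have "\<dots> < e" using e K by (simp add: field_simps)
      finally show "dist (c (s x m)) (c (s x n)) < e" .
    qed
  qed
  then have conv: "convergent (\<lambda>n. c (s x n))" for x by (simp add: Cauchy_convergent_iff)
  define l where "l x = lim (\<lambda>n. c (s x n))" for x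
  have l: "(\<lambda>n. c (s x n)) \<longlonglongrightarrow> l x" for x using conv by (simp add: l_def convergent_LIMSEQ_iff)
  have comb: "l (x + r *\<^sub>R y) = l x + r * l y" for x y r
  proof -
    have "(\<lambda>n. d (s x n) + r *\<^sub>R d (s y n) - d (s (x + r *\<^sub>R y) n)) \<longlonglongrightarrow> x + r *\<^sub>R y - (x + r *\<^sub>R y)"
      by (intro tendsto_intros ds)
    then have "(\<lambda>n. K * norm (d (s x n) + r *\<^sub>R d (s y n) - d (s (x + r *\<^sub>R y) n))) \<longlonglongrightarrow> K * norm (x + r *\<^sub>R y - (x + r *\<^sub>R y))"
      by (intro tendsto_mult tendsto_const tendsto_norm)
    then have "(\<lambda>n. K * norm (d (s x n) + r *\<^sub>R d (s y n) - d (s (x + r *\<^sub>R y) n))) \<longlonglongrightarrow> 0" by simp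
    then have "(\<lambda>n. c (s x n) + r * c (s y n) - c (s (x + r *\<^sub>R y) n)) \<longlonglongrightarrow> 0"
      using ineq by (intro Lim_null_comparison[of "\<lambda>n. c (s x n) + r * c (s y n) - c (s (x + r *\<^sub>R y) n)"]) auto
    moreover have "(\<lambda>n. c (s x n) + r * c (s y n) - c (s (x + r *\<^sub>R y) n)) \<longlonglongrightarrow> l x + r * l y - l (x + r *\<^sub>R y)"
      by (intro tendsto_intros l)
    ultimately show ?thesis using LIMSEQ_unique by fastforce
  qed
  have ld: "l (d i) = c i" for i
  proof -
    have "(\<lambda>n. K * norm (d (s (d i) n) - d i)) \<longlonglongrightarrow> K * norm (d i - d i)" by (intro tendsto_intros ds)
    then have "(\<lambda>n. K * norm (d (s (d i) n) - d i)) \<longlonglongrightarrow> 0" by simp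
    then have "(\<lambda>n. c (s (d i) n) - c i) \<longlonglongrightarrow> 0"
      using lip by (intro Lim_null_comparison[of "\<lambda>n. c (s (d i) n) - c i"]) auto
    from tendsto_add[OF this tendsto_const[of "c i"]] have "(\<lambda>n. c (s (d i) n)) \<longlonglongrightarrow> c i" by simp
    then show ?thesis using l LIMSEQ_unique by blast
  qed
  have add: "l (x + y) = l x + l y" for x y using comb[of x 1 y] by simp
  have l0: "l 0 = 0" using add[of 0 0] by simp
  have scale: "l (r *\<^sub>R x) = r * l x" for r x using comb[of 0 r x] l0 by simp
  have bdd: "\<bar>l x\<bar> \<le> K * norm x" for x
  proof -
    have "(\<lambda>n. K * norm (d (s x n) - d (s 0 n))) \<longlonglongrightarrow> K * norm (x - 0)" by (intro tendsto_intros ds)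
    moreover have "(\<lambda>n. \<bar>c (s x n) - c (s 0 n)\<bar>) \<longlonglongrightarrow> \<bar>l x - l 0\<bar>" by (intro tendsto_intros l)
    ultimately have "\<bar>l x - l 0\<bar> \<le> K * norm (x - 0)" using lip by (intro LIMSEQ_le[of "\<lambda>n. \<bar>c (s x n) - c (s 0 n)\<bar>"]) auto
    then show ?thesis by (simp add: l0)
  qed
  have bl: "bounded_linear l" using add scale bdd by (intro bounded_linear_intro[where K = K]) (auto simp: mult.commute)
  show ?thesis
  proof
    show "norm (Blinfun l) \<le> K" using bdd K by (intro norm_blinfun_bound) (auto simp: bounded_linear_Blinfun_apply[OF bl])
    show "blinfun_apply (Blinfun l) (d i) = c i" for i by (simp add: bounded_linear_Blinfun_apply[OF bl] ld)
  qed
qed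

text \<open>Induction step: the map sending \<open>x\<close> to the sum of the
  \<open>blinfun_apply (f j) x *\<^sub>R a j\<close> is not the identity, because the
  \<open>a j\<close> do not span the space. A nonzero remainder \<open>z\<close> is annihilated by
  the old functionals, and a functional attaining its norm at \<open>z\<close> is corrected by them
  so as to vanish at the old vectors.\<close>

lemma biorthogonal_system:
  assumes "infinite_dimensional TYPE('x::real_normed_vector)"
  shows "\<exists>(a :: nat \<Rightarrow> 'x) f. \<forall>i<N. \<forall>j<N. blinfun_apply (f i :: 'x \<Rightarrow>\<^sub>L real) (a j) = (if i = j then 1 else 0)"
proof (induction N)
  case (Suc N)
  then obtain a :: "nat \<Rightarrow> 'x" and f :: "nat \<Rightarrow> 'x \<Rightarrow>\<^sub>L real"
    where af: "\<And>i j. i < N \<Longrightarrow> j < N \<Longrightarrow> blinfun_apply (f i) (a j) = (if i = j then 1 else 0)" by blast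
  have "\<exists>x. x \<noteq> (\<Sum>j<N. blinfun_apply (f j) x *\<^sub>R a j)"
  proof (rule ccontr)
    assume "\<nexists>x. x \<noteq> (\<Sum>j<N. blinfun_apply (f j) x *\<^sub>R a j)"
    then have "x \<in> span (a ` {..<N})" for x
      by (metis (no_types, lifting) span_sum span_scale span_base imageI)
    then have "span (a ` {..<N}) = UNIV" by auto
    then show False using assms unfolding infinite_dimensional_def by (metis finite_imageI finite_lessThan)
  qed
  then obtain x where x: "x \<noteq> (\<Sum>j<N. blinfun_apply (f j) x *\<^sub>R a j)" by blast
  define z where "z = x - (\<Sum>j<N. blinfun_apply (f j) x *\<^sub>R a j)"
  have z0: "z \<noteq> 0" using x by (simp add: z_def)
  have fz: "blinfun_apply (f i) z = 0" if "i < N" for i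
  proof -
    have "(\<Sum>j<N. blinfun_apply (f j) x * blinfun_apply (f i) (a j)) = (\<Sum>j<N. if j = i then blinfun_apply (f j) x else 0)"
      using af[OF that] by (intro sum.cong) auto
    then show ?thesis using that by (simp add: z_def blinfun.diff_right blinfun.sum_right blinfun.scaleR_right)
  qed
  obtain g :: "'x \<Rightarrow>\<^sub>L real" where g: "blinfun_apply g z = norm z" using norm_attaining_functional by blast
  define h where "h = (1 / norm z) *\<^sub>R (g - (\<Sum>i<N. blinfun_apply g (a i) *\<^sub>R f i))"
  have hz: "blinfun_apply h z = 1"
    using z0 fz g by (simp add: h_def blinfun.scaleR_left blinfun.diff_left blinfun.sum_left)
  have ha: "blinfun_apply h (a j) = 0" if "j < N" for j
  proof -
    have "(\<Sum>i<N. blinfun_apply g (a i) * blinfun_apply (f i) (a j)) = (\<Sum>i<N. if i = j then blinfun_apply g (a i) else 0)"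
      using af[OF _ that] by (intro sum.cong) auto
    then show ?thesis using that by (simp add: h_def blinfun.scaleR_left blinfun.diff_left blinfun.sum_left)
  qed
  show ?case
    by (rule exI[of _ "a(N := z)"], rule exI[of _ "f(N := h)"])
      (use af fz hz ha in \<open>auto simp: less_Suc_eq\<close>)
qed simp


section \<open>Transfer to topological action spaces\<close>

lemma space_borel_of [simp]: "space (borel_of X) = topspace X"
  by (simp add: borel_of_def space_measure_of_conv)

lemma sets_borel_of: "sets (borel_of X) = sigma_sets (topspace X) {U. openin X U}"
  unfolding borel_of_def by (rule sets_measure_of) (auto dest: openin_subset)

lemma measurable_borel_of:
  assumes "\<And>t. t \<in> space N \<Longrightarrow> g t \<in> topspace X" "\<And>U. openin X U \<Longrightarrow> {t\<in>space N. g t \<in> U} \<in> sets N"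
  shows "g \<in> N \<rightarrow>\<^sub>M borel_of X"
  unfolding borel_of_def
proof (rule measurable_measure_of)
  show "{U. openin X U} \<subseteq> Pow (topspace X)" using openin_subset[of X] by blast
qed (use assms in \<open>auto simp: vimage_def Int_def conj_commute\<close>)

lemma borel_of_preimage:
  assumes "g \<in> N \<rightarrow>\<^sub>M borel_of X" "openin X U"
  shows "{t\<in>space N. g t \<in> U} \<in> sets N"
proof -
  have "U \<in> sets (borel_of X)" unfolding sets_borel_of using assms(2) by auto
  from measurable_sets[OF assms(1) this] show ?thesis by (simp add: vimage_def Int_def conj_commute)
qed

lemma continuous_map_borel_measurable:
  fixes f :: "'p \<Rightarrow> 'b::topological_space"
  assumes g: "g \<in> N \<rightarrow>\<^sub>M borel_of X" and f: "continuous_map X euclidean f"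
  shows "(\<lambda>t. f (g t)) \<in> borel_measurable N"
proof (rule borel_measurableI)
  fix S :: "'b set" assume "open S"
  then have "openin X {x \<in> topspace X. f x \<in> S}" by (intro openin_continuous_map_preimage[OF f]) simp
  from borel_of_preimage[OF g this] have "{t\<in>space N. g t \<in> topspace X \<and> f (g t) \<in> S} \<in> sets N" by simp
  moreover have "{t\<in>space N. g t \<in> topspace X \<and> f (g t) \<in> S} = (\<lambda>t. f (g t)) -` S \<inter> space N"
    using measurable_space[OF g] by auto
  ultimately show "(\<lambda>t. f (g t)) -` S \<inter> space N \<in> sets N" by simp
qed

lemma payoff_assignmentD:
  assumes G: "payoff_assignment F XA X\<Gamma> G" and t: "t \<in> space F"
  shows "continuous_map (prod_topology XA X\<Gamma>) euclideanreal (G t)"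
proof -
  have "G t \<in> space (borel_of (mtopology_of (payoff_functions XA X\<Gamma>)))"
    using G t unfolding payoff_assignment_def by (rule measurable_space)
  then show ?thesis by (simp add: payoff_functions_def)
qed

text \<open>Evaluation at a point is 1-Lipschitz for the supremum distance, so measurability into
  the function space gives measurability of each single payoff.\<close>

lemma payoff_assignment_measurable:
  assumes G: "payoff_assignment F XA X\<Gamma> G" and p: "p \<in> topspace (prod_topology XA X\<Gamma>)"
  shows "(\<lambda>t. G t p) \<in> borel_measurable F"
proof (rule continuous_map_borel_measurable[where g = G and f = "\<lambda>f. f p"])
  show "G \<in> F \<rightarrow>\<^sub>M borel_of (mtopology_of (payoff_functions XA X\<Gamma>))"
    using G by (simp add: payoff_assignment_def)
  have "Lipschitz_continuous_map (payoff_functions XA X\<Gamma>) euclidean_metric (\<lambda>f. f p)"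
    unfolding Lipschitz_continuous_map_def
  proof (intro conjI exI[of _ 1] ballI)
    fix f g assume "f \<in> mspace (payoff_functions XA X\<Gamma>)" "g \<in> mspace (payoff_functions XA X\<Gamma>)"
    then show "mdist euclidean_metric (f p) (g p) \<le> 1 * mdist (payoff_functions XA X\<Gamma>) f g"
      unfolding payoff_functions_def using p by (simp only: mult_1) (rule mdist_cfunspace_imp_mdist_le[OF _ _ order_refl])
  qed auto
  from Lipschitz_continuous_imp_continuous_map[OF this]
  show "continuous_map (mtopology_of (payoff_functions XA X\<Gamma>)) euclidean (\<lambda>f. f p)" by simp
qed

text \<open>The counterpart of \<open>tends_F\<close> without a metric on the actions. The
  integrands may depend on the player, because functionals of the aggregate lead to such
  integrands.\<close>

definition converges_in_law_F :: "'t measure \<Rightarrow> 't measure \<Rightarrow> 'p topology \<Rightarrow> (nat \<Rightarrow> 't \<Rightarrow> 'p) \<Rightarrow> ('t \<Rightarrow> 'p) \<Rightarrow> bool" where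
  "converges_in_law_F M F XA g h \<longleftrightarrow> (\<forall>\<psi> B.
     (\<forall>t\<in>space M. continuous_map XA euclideanreal (\<psi> t)) \<longrightarrow>
     (\<forall>x\<in>topspace XA. (\<lambda>t. \<psi> t x) \<in> borel_measurable F) \<longrightarrow>
     (\<forall>t\<in>space M. \<forall>x\<in>topspace XA. \<bar>\<psi> t x\<bar> \<le> B) \<longrightarrow>
     (\<lambda>n. LINT t|M. \<psi> t (g n t)) \<longlonglongrightarrow> (LINT t|M. \<psi> t (h t)))"

text \<open>A sequence of continuous functions that separates points makes the compact space
  \<open>XA\<close> homeomorphic to a compact set of real sequences, and so brings it under the
  metric theory. Weakly and weak* compact sets of actions both have such a sequence.\<close>

theorem nash_equilibrium_exists:
  fixes M F :: "'t measure" and XA :: "'p topology" and e :: "'p \<Rightarrow> nat \<Rightarrow> real"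
  assumes M: "prob_space M" "subalgebra M F" "nowhere_equivalent M F" "countably_generated F"
    and XA: "compact_space XA" "topspace XA \<noteq> {}"
    and e: "\<And>i. continuous_map XA euclideanreal (\<lambda>x. e x i)" "inj_on e (topspace XA)"
    and E_top: "\<And>g. g \<in> M \<rightarrow>\<^sub>M borel_of XA \<Longrightarrow> E g \<in> topspace X\<Gamma>"
    and E_lim: "\<And>g h. (\<And>n. g n \<in> M \<rightarrow>\<^sub>M borel_of XA) \<Longrightarrow> h \<in> M \<rightarrow>\<^sub>M borel_of XA \<Longrightarrow>
        converges_in_law_F M F XA g h \<Longrightarrow> limitin X\<Gamma> (\<lambda>n. E (g n)) (E h) sequentially"
    and G: "payoff_assignment F XA X\<Gamma> G"
  shows "\<exists>g. nash_equilibrium M XA E G g"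
proof -
  define K where "K = e ` topspace XA"
  have e_cont: "continuous_map XA euclidean e"
    unfolding euclidean_product_topology[symmetric] by (simp add: continuous_map_componentwise_UNIV e(1))
  have cK: "compact K"
    using image_compactin[of XA "topspace XA" euclidean e] e_cont XA(1) by (simp add: K_def compact_space_def)
  have e_K: "continuous_map XA (top_of_set K) e"
    using e_cont by (auto simp: continuous_map_in_subtopology K_def)
  have "homeomorphic_map XA (top_of_set K) e"
  proof (rule bijective_closed_imp_homeomorphic_map)
    show "closed_map XA (top_of_set K) e"
    proof (rule continuous_imp_closed_map_gen[OF XA(1) _ e_K])
      show "kc_space (top_of_set K)" by (intro Hausdorff_imp_kc_space Hausdorff_space_subtopology) simp
    qed
  qed (use e_K e(2) in \<open>auto simp: K_def\<close>)
  then obtain e' where "homeomorphic_maps XA (top_of_set K) e e'" unfolding homeomorphic_map_maps by blast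
  then have e'_cont: "continuous_map (top_of_set K) XA e'"
    and e'e: "\<And>x. x \<in> topspace XA \<Longrightarrow> e' (e x) = x"
    by (auto simp: homeomorphic_maps_def)
  interpret prob_space M by (rule M(1))
  interpret compact_actions M F K
    by unfold_locales (use M cK XA(2) in \<open>auto simp: K_def\<close>)
  have e'K: "e' y \<in> topspace XA" if "y \<in> K" for y
    using continuous_map_image_subset_topspace[OF e'_cont] that by auto
  have prof: "(\<lambda>t. e' (g t)) \<in> M \<rightarrow>\<^sub>M borel_of XA" if g: "g \<in> profiles" for g
  proof (rule measurable_borel_of)
    show "e' (g t) \<in> topspace XA" if "t \<in> space M" for t using e'K profilesD(2)[OF g that] .
    fix U assume "openin XA U"
    then have "openin (top_of_set K) {y \<in> K. e' y \<in> U}"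
      using openin_continuous_map_preimage[OF e'_cont] by simp
    then obtain T where T: "open T" "{y \<in> K. e' y \<in> U} = K \<inter> T" by (auto simp: openin_open)
    have "{t \<in> space M. e' (g t) \<in> U} = g -` T \<inter> space M" using T(2) profilesD(2)[OF g] by auto
    then show "{t \<in> space M. e' (g t) \<in> U} \<in> sets M"
      using measurable_sets[OF profilesD(1)[OF g]] T(1) by simp
  qed
  \<comment> \<open>The arctangent makes the payoffs uniformly bounded. It is continuous and
    strictly increasing, so best replies, continuity and measurability are unaffected.\<close>
  define u where "u t = (\<lambda>(y, c). arctan (G t (e' y, c)))" for t
  define E' where "E' g = E (\<lambda>t. e' (g t))" for g
  interpret continuous_game M F K X\<Gamma> E' u "pi / 2"
  proof
    show "E' g \<in> topspace X\<Gamma>" if "g \<in> profiles" for g unfolding E'_def by (intro E_top prof that)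
    show "limitin X\<Gamma> (\<lambda>n. E' (g n)) (E' h) sequentially" if "\<And>n. g n \<in> profiles" "h \<in> profiles" "tends_F g h" for g h
      unfolding E'_def
    proof (rule E_lim)
      show "converges_in_law_F M F XA (\<lambda>n t. e' (g n t)) (\<lambda>t. e' (h t))"
        unfolding converges_in_law_F_def
      proof (intro allI impI)
        fix \<psi> :: "'t \<Rightarrow> 'p \<Rightarrow> real" and B
        assume \<psi>: "\<forall>t\<in>space M. continuous_map XA euclideanreal (\<psi> t)"
          "\<forall>x\<in>topspace XA. (\<lambda>t. \<psi> t x) \<in> borel_measurable F"
          "\<forall>t\<in>space M. \<forall>x\<in>topspace XA. \<bar>\<psi> t x\<bar> \<le> B"
        show "(\<lambda>n. LINT t|M. \<psi> t (e' (g n t))) \<longlonglongrightarrow> (LINT t|M. \<psi> t (e' (h t)))"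
        proof (rule caratheodory_tendsto[where \<psi> = "\<lambda>t y. \<psi> t (e' y)" and B = B])
          show "continuous_on K (\<lambda>y. \<psi> t (e' y))" if "t \<in> space M" for t
            using continuous_map_compose[OF e'_cont, of euclideanreal "\<psi> t"] \<psi>(1) that by (simp add: o_def)
        qed (use \<psi>(2,3) e'K that in auto)
      qed
    qed (use prof that in auto)
    show "continuous_map (prod_topology (top_of_set K) X\<Gamma>) euclideanreal (u t)" if t: "t \<in> space M" for t
    proof -
      have 1: "continuous_map (prod_topology (top_of_set K) X\<Gamma>) (prod_topology XA X\<Gamma>) (\<lambda>p. (e' (fst p), snd p))"
        using continuous_map_compose[OF continuous_map_fst e'_cont] continuous_map_snd
        by (intro continuous_map_pairedI) (auto simp: o_def)
      have 2: "continuous_map (prod_topology XA X\<Gamma>) euclideanreal (G t)"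
        using payoff_assignmentD[OF G, of t] t by (simp add: space_F)
      have "continuous_map euclideanreal euclideanreal arctan"
        by (simp add: continuous_on_arctan continuous_on_id)
      moreover have "u t = (\<lambda>p. arctan (G t (e' (fst p), snd p)))" by (auto simp: u_def fun_eq_iff)
      ultimately show ?thesis
        using continuous_map_compose[OF continuous_map_compose[OF 1 2], of euclideanreal arctan] by (simp add: o_def)
    qed
    show "(\<lambda>t. u t (x, c)) \<in> borel_measurable F" if "x \<in> K" "c \<in> topspace X\<Gamma>" for x c
      using payoff_assignment_measurable[OF G, of "(e' x, c)"] e'K[OF that(1)] that(2)
      by (auto simp: u_def intro: borel_measurable_arctan)
    show "\<bar>u t (x, c)\<bar> \<le> pi / 2" for t x c
      using arctan_bounded[of "G t (e' x, c)"] by (auto simp: u_def)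
  qed
  obtain g where g: "g \<in> profiles" and eq: "AE t in M. \<forall>x\<in>K. u t (x, E' g) \<le> u t (g t, E' g)"
    using equilibrium_exists[OF M(3,4)] by blast
  have "nash_equilibrium M XA E G (\<lambda>t. e' (g t))"
    unfolding nash_equilibrium_def
  proof
    show "(\<lambda>t. e' (g t)) \<in> M \<rightarrow>\<^sub>M borel_of XA" by (rule prof[OF g])
    show "AE t in M. \<forall>a\<in>topspace XA. G t (a, E (\<lambda>t. e' (g t))) \<le> G t (e' (g t), E (\<lambda>t. e' (g t)))"
      using eq
    proof eventually_elim
      case (elim t)
      show ?case
      proof
        fix a assume a: "a \<in> topspace XA"
        then have "e a \<in> K" by (simp add: K_def)
        with elim have "u t (e a, E' g) \<le> u t (g t, E' g)" by blast
        then show "G t (a, E (\<lambda>t. e' (g t))) \<le> G t (e' (g t), E (\<lambda>t. e' (g t)))"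
          by (simp add: u_def E'_def e'e[OF a] arctan_le_iff)
      qed
    qed
  qed
  then show ?thesis by blast
qed


section \<open>The Gel'fand case\<close>

lemma topspace_initial_topology: "\<Phi> \<noteq> {} \<Longrightarrow> topspace (initial_topology S \<Phi>) = S"
  unfolding initial_topology_def topology_generated_by_topspace by auto

lemma continuous_map_initial_topology:
  assumes "\<phi> \<in> \<Phi>"
  shows "continuous_map (initial_topology S \<Phi>) euclideanreal \<phi>"
  unfolding continuous_map_alt
proof (intro conjI allI impI)
  fix U :: "real set" assume "openin euclideanreal U"
  then have U: "open U" by simp
  have "\<phi> -` U \<inter> topspace (initial_topology S \<Phi>) = {p\<in>S. \<phi> p \<in> U}"
    using assms by (subst topspace_initial_topology) auto
  also have "openin (initial_topology S \<Phi>) \<dots>"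
    unfolding initial_topology_def using assms U by (intro topology_generated_by_Basis) blast
  finally show "openin (initial_topology S \<Phi>) (\<phi> -` U \<inter> topspace (initial_topology S \<Phi>))" .
qed auto

lemma limitin_initial_topology:
  assumes S: "\<And>n. c n \<in> S" "l \<in> S" and \<Phi>: "\<Phi> \<noteq> {}"
    and lim: "\<And>\<phi>. \<phi> \<in> \<Phi> \<Longrightarrow> (\<lambda>n. \<phi> (c n)) \<longlonglongrightarrow> \<phi> l"
  shows "limitin (initial_topology S \<Phi>) c l sequentially"
  unfolding limitin_def
proof (intro conjI allI impI)
  show "l \<in> topspace (initial_topology S \<Phi>)" using S \<Phi> by (simp add: topspace_initial_topology)
  fix U assume U: "openin (initial_topology S \<Phi>) U \<and> l \<in> U"
  then have "generate_topology_on {{p\<in>S. \<phi> p \<in> U} |\<phi> U. \<phi> \<in> \<Phi> \<and> open U} U"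
    unfolding initial_topology_def openin_topology_generated_by_iff by simp
  then have "l \<in> U \<longrightarrow> (\<forall>\<^sub>F n in sequentially. c n \<in> U)"
  proof induction
    case Empty
    then show ?case by simp
  next
    case (Int a b)
    then show ?case by (auto intro: eventually_conj)
  next
    case (UN K)
    show ?case
    proof
      assume "l \<in> \<Union>K"
      then obtain k where k: "k \<in> K" "l \<in> k" by blast
      with UN have "\<forall>\<^sub>F n in sequentially. c n \<in> k" by blast
      then show "\<forall>\<^sub>F n in sequentially. c n \<in> \<Union>K" by eventually_elim (use k in blast)
    qed
  next
    case (Basis s)
    then obtain \<phi> V where V: "s = {p\<in>S. \<phi> p \<in> V}" "\<phi> \<in> \<Phi>" "open V" by blast
    show ?case
    proof
      assume "l \<in> s"
      then have "\<forall>\<^sub>F n in sequentially. \<phi> (c n) \<in> V" using V by (intro topological_tendstoD[OF lim]) auto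
      then show "\<forall>\<^sub>F n in sequentially. c n \<in> s" by eventually_elim (use V S in auto)
    qed
  qed
  then show "\<forall>\<^sub>F n in sequentially. c n \<in> U" using U by simp
qed

lemma weak_star_continuous_eval: "continuous_map weak_star_topology euclideanreal (\<lambda>f. blinfun_apply f y)"
  by (rule strong_operator_topology_continuous_evaluation)

lemma weak_star_compact_bounded:
  fixes A :: "('y::banach \<Rightarrow>\<^sub>L real) set"
  assumes "compactin weak_star_topology A"
  obtains R where "0 \<le> R" "\<And>a. a \<in> A \<Longrightarrow> norm a \<le> R"
proof (rule uniform_boundedness[of A])
  fix y
  have "compact ((\<lambda>f. blinfun_apply f y) ` A)"
    using image_compactin[OF assms weak_star_continuous_eval[of y]] by simp
  then have "bounded ((\<lambda>f. blinfun_apply f y) ` A)" by (rule compact_imp_bounded)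
  then show "\<exists>B. \<forall>f\<in>A. \<bar>blinfun_apply f y\<bar> \<le> B" by (auto simp: bounded_iff)
qed blast

lemma limitin_weak_star:
  assumes lim: "\<And>y. (\<lambda>k. blinfun_apply (h k) y) \<longlonglongrightarrow> blinfun_apply l y"
  shows "limitin weak_star_topology h l sequentially"
  unfolding limitin_def
proof (intro conjI allI impI)
  have L: "limitin euclidean (\<lambda>k y. blinfun_apply (h k) y) (\<lambda>y. blinfun_apply l y) sequentially"
    unfolding euclidean_product_topology[symmetric] limitin_componentwise using lim by simp
  fix U assume U: "openin weak_star_topology U \<and> l \<in> U"
  then obtain V where V: "openin euclidean V" "U = blinfun_apply -` V \<inter> UNIV"
    unfolding strong_operator_topology_def openin_pullback_topology by auto
  then have "\<forall>\<^sub>F k in sequentially. (\<lambda>y. blinfun_apply (h k) y) \<in> V"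
    using L U unfolding limitin_def by auto
  then show "\<forall>\<^sub>F k in sequentially. h k \<in> U" by eventually_elim (simp add: V(2))
qed (simp add: strong_operator_topology_topspace)

lemma limitin_sequence_closure_of:
  assumes "limitin X h l sequentially" "\<And>k. h k \<in> S"
  shows "l \<in> X closure_of S"
  unfolding in_closure_of
proof (intro conjI allI impI)
  show "l \<in> topspace X" using assms(1) by (rule limitin_topspace)
  fix T assume "l \<in> T \<and> openin X T"
  then have "\<forall>\<^sub>F k in sequentially. h k \<in> T" using assms(1) by (simp add: limitin_def)
  then obtain k where "h k \<in> T" by (auto simp: eventually_sequentially)
  then show "\<exists>y. y \<in> S \<and> y \<in> T" using assms(2) by blast
qed

text \<open>All quantifiers range over numbers, which shows that the set of points of convergence of
  a sequence of measurable functions is measurable.\<close>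

lemma LIMSEQ_iff_inverse_Suc:
  "X \<longlonglongrightarrow> (l::real) \<longleftrightarrow> (\<forall>n. \<exists>N. \<forall>k\<in>{N..}. \<bar>X k - l\<bar> < 1 / real (Suc n))"
proof
  assume X: "X \<longlonglongrightarrow> l"
  show "\<forall>n. \<exists>N. \<forall>k\<in>{N..}. \<bar>X k - l\<bar> < 1 / real (Suc n)"
  proof
    fix n
    show "\<exists>N. \<forall>k\<in>{N..}. \<bar>X k - l\<bar> < 1 / real (Suc n)"
      using LIMSEQ_D[OF X, of "1 / real (Suc n)"] by auto
  qed
next
  assume X: "\<forall>n. \<exists>N. \<forall>k\<in>{N..}. \<bar>X k - l\<bar> < 1 / real (Suc n)"
  show "X \<longlonglongrightarrow> l"
  proof (rule LIMSEQ_I)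
    fix r :: real assume "r > 0"
    then obtain n where n: "1 / real (Suc n) < r" by (rule nat_approx_posE)
    obtain N where "\<forall>k\<in>{N..}. \<bar>X k - l\<bar> < 1 / real (Suc n)" using X by blast
    then have "\<forall>k\<ge>N. norm (X k - l) < r" by (auto intro: less_trans[OF _ n])
    then show "\<exists>N. \<forall>k\<ge>N. norm (X k - l) < r" by blast
  qed
qed

section \<open>Gel'fand conditional expectations\<close>

context prob_subalgebra
begin

text \<open>The versions of the conditional probabilities are nonnegative with sum 1 at every
  \<open>t\<close>, not only almost everywhere, so that convex combinations formed with them lie in
  the convex hull for every \<open>t\<close>.\<close>

lemma finite_valued_conditional_law:
  assumes P: "finite P" "\<And>t. t \<in> space M \<Longrightarrow> S t \<in> P" "\<And>\<sigma>. \<sigma> \<in> P \<Longrightarrow> {t\<in>space M. S t = \<sigma>} \<in> sets M"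
  obtains p :: "'s \<Rightarrow> 'a \<Rightarrow> real" where "\<And>\<sigma>. p \<sigma> \<in> borel_measurable F" "\<And>\<sigma> t. \<sigma> \<in> P \<Longrightarrow> 0 \<le> p \<sigma> t"
    "\<And>t. (\<Sum>\<sigma>\<in>P. p \<sigma> t) = 1" "\<And>\<sigma>. \<sigma> \<in> P \<Longrightarrow> integrable M (p \<sigma>)"
    "\<And>\<sigma> B. \<sigma> \<in> P \<Longrightarrow> B \<in> sets F \<Longrightarrow> (LINT t:B|M. p \<sigma> t) = measure M (B \<inter> {t\<in>space M. S t = \<sigma>})"
proof -
  obtain t0 where "t0 \<in> space M" using not_empty by blast
  then obtain \<sigma>0 where \<sigma>0: "\<sigma>0 \<in> P" using P(2) by blast
  define C where "C \<sigma> = {t\<in>space M. S t = \<sigma>}" for \<sigma>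
  have C: "C \<sigma> \<in> sets M" if "\<sigma> \<in> P" for \<sigma> unfolding C_def by (rule P(3)[OF that])
  define q where "q \<sigma> = real_cond_exp M F (indicator (C \<sigma>))" for \<sigma>
  have qF [measurable]: "q \<sigma> \<in> borel_measurable F" for \<sigma> by (simp add: q_def)
  have qI: "integrable M (q \<sigma>)" if "\<sigma> \<in> P" for \<sigma>
    unfolding q_def using C[OF that] by (intro real_cond_exp_int) simp
  have qint: "(LINT t:B|M. q \<sigma> t) = measure M (B \<inter> C \<sigma>)" if "\<sigma> \<in> P" "B \<in> sets F" for \<sigma> B
    unfolding q_def by (rule cond_exp_indicator[OF that(2) C[OF that(1)]])
  have q0: "AE t in M. \<forall>\<sigma>\<in>P. 0 \<le> q \<sigma> t"
    using qint qI by (intro AE_finite_allI[OF P(1)] AE_nonneg_of_set_integrals) auto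
  have q1: "AE t in M. (\<Sum>\<sigma>\<in>P. q \<sigma> t) = 1"
  proof (rule AE_eq_of_set_integrals)
    fix B assume B: "B \<in> sets F"
    have Bm: "B \<in> sets M" by (rule sets_F[OF B])
    have "(LINT t:B|M. (\<Sum>\<sigma>\<in>P. q \<sigma> t)) = (\<Sum>\<sigma>\<in>P. LINT t:B|M. q \<sigma> t)"
      using set_integrable_F[OF B qI] unfolding set_lebesgue_integral_def set_integrable_def
      by (simp add: sum_distrib_left)
    also have "\<dots> = (\<Sum>\<sigma>\<in>P. measure M (B \<inter> C \<sigma>))" using qint B by simp
    also have "\<dots> = measure M (\<Union>\<sigma>\<in>P. B \<inter> C \<sigma>)"
      using C Bm P(1) by (intro finite_measure_finite_Union[symmetric]) (auto simp: disjoint_family_on_def C_def)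
    also have "(\<Union>\<sigma>\<in>P. B \<inter> C \<sigma>) = B"
      using P(2) sets.sets_into_space[OF Bm] by (auto simp: C_def)
    also have "measure M B = (LINT t:B|M. 1)" using Bm by (simp add: set_integral_const_real)
    finally show "(LINT t:B|M. (\<Sum>\<sigma>\<in>P. q \<sigma> t)) = (LINT t:B|M. 1)" .
  qed (use qI in auto)
  define N where "N = {t\<in>space F. (\<forall>\<sigma>\<in>P. 0 \<le> q \<sigma> t) \<and> (\<Sum>\<sigma>\<in>P. q \<sigma> t) = 1}"
  have N: "N \<in> sets F"
    unfolding N_def using P(1) by (intro sets.sets_Collect_conj sets.sets_Collect_finite_All) auto
  have NAE: "AE t in M. t \<in> N" using q0 q1 AE_space by eventually_elim (auto simp: N_def space_F)
  \<comment> \<open>Off the \<open>F\<close>-set \<open>N\<close> on which the versions are proper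
    weights, all weight is put on one fixed value.\<close>
  define p where "p \<sigma> t = (if t \<in> N then q \<sigma> t else if \<sigma> = \<sigma>0 then 1 else 0)" for \<sigma> t
  have eq: "AE t in M. p \<sigma> t = q \<sigma> t" for \<sigma> using NAE by eventually_elim (simp add: p_def)
  have pF: "p \<sigma> \<in> borel_measurable F" for \<sigma>
    unfolding p_def using N by (intro measurable_If_set) auto
  show ?thesis
  proof (rule that[of p])
    show "0 \<le> p \<sigma> t" if "\<sigma> \<in> P" for \<sigma> t using that by (auto simp: p_def N_def)
    show "(\<Sum>\<sigma>\<in>P. p \<sigma> t) = 1" for t
    proof (cases "t \<in> N")
      case True
      then have "(\<Sum>\<sigma>\<in>P. q \<sigma> t) = 1" by (simp add: N_def)
      with True show ?thesis by (simp add: p_def)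
    next
      case False
      then show ?thesis using P(1) \<sigma>0 by (simp add: p_def)
    qed
    show "integrable M (p \<sigma>)" if "\<sigma> \<in> P" for \<sigma>
      using qI[OF that] eq[of \<sigma>] meas_F[OF pF] meas_F[OF qF] by (subst integrable_cong_AE[of _ _ "q \<sigma>"]) auto
    show "(LINT t:B|M. p \<sigma> t) = measure M (B \<inter> {t\<in>space M. S t = \<sigma>})" if s: "\<sigma> \<in> P" and B: "B \<in> sets F" for \<sigma> B
    proof -
      have "(LINT t:B|M. p \<sigma> t) = (LINT t:B|M. q \<sigma> t)"
        unfolding set_lebesgue_integral_def
      proof (rule integral_cong_AE)
        show "AE t in M. indicator B t *\<^sub>R p \<sigma> t = indicator B t *\<^sub>R q \<sigma> t"
          using eq[of \<sigma>] by eventually_elim simp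
      qed (use meas_F[OF pF] meas_F[OF qF] sets_F[OF B] in auto)
      then show ?thesis using qint[OF s B] by (simp add: C_def)
    qed
  qed (rule pF)
qed

text \<open>The values are to lie in the closed convex hull at every \<open>t\<close>, so
  \<open>f\<close> is built as a limit of convex combinations of actions. The profile is rounded to
  finitely many actions, and \<open>fk k\<close> averages these with their conditional
  probabilities. At every \<open>d i\<close> the \<open>fk k\<close> converge almost everywhere to
  the scalar conditional expectation \<open>v i\<close>, and the common bound \<open>R\<close> makes
  the limits the values of one functional.\<close>

lemma gelfand_conditional_expectation:
  fixes g :: "'a \<Rightarrow> 'y::{banach, second_countable_topology} \<Rightarrow>\<^sub>L real"
  assumes A: "A \<noteq> {}" and R: "\<And>a. a \<in> A \<Longrightarrow> norm a \<le> R"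
    and g: "\<And>t. t \<in> space M \<Longrightarrow> g t \<in> A" "\<And>y. (\<lambda>t. blinfun_apply (g t) y) \<in> borel_measurable M"
  obtains f where "\<And>y. (\<lambda>t. blinfun_apply (f t) y) \<in> borel_measurable F"
    "\<And>t. f t \<in> weak_star_topology closure_of (convex hull A)" "\<And>t. norm (f t) \<le> R"
    "\<And>D y. D \<in> sets F \<Longrightarrow> (LINT t:D|M. blinfun_apply (f t) y) = (LINT t:D|M. blinfun_apply (g t) y)"
proof -
  obtain a0 where a0: "a0 \<in> A" using A by blast
  have R0: "0 \<le> R" using R[OF a0] norm_ge_zero[of a0] by linarith
  obtain d :: "nat \<Rightarrow> 'y" where d: "\<And>x e. e > 0 \<Longrightarrow> \<exists>i. dist (d i) x < e" using dense_sequence_UNIV by blast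
  have bnd: "\<bar>blinfun_apply a y\<bar> \<le> R * norm y" if "norm a \<le> R" for a :: "'y \<Rightarrow>\<^sub>L real" and y
    using norm_blinfun[of a y] mult_right_mono[OF that norm_ge_zero[of y]] by simp
  \<comment> \<open>The floors at scale \<open>2 ^ k\<close> locate the values at the first
    \<open>k\<close> vectors up to \<open>1 / 2 ^ k\<close>. By the norm bound only finitely many
    codes occur on \<open>A\<close>.\<close>
  define code where "code k a = map (\<lambda>i. \<lfloor>2 ^ k * blinfun_apply a (d i)\<rfloor>) [0..<k]" for k and a :: "'y \<Rightarrow>\<^sub>L real"
  define P where "P k = code k ` A" for k
  have finP: "finite (P k)" for k
  proof -
    define m where "m = Max (insert 0 ((\<lambda>i. \<lceil>2 ^ k * (R * norm (d i))\<rceil> + 1) ` {..<k}))"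
    have "P k \<subseteq> {xs. set xs \<subseteq> {-m..m} \<and> length xs = k}"
    proof
      fix xs assume "xs \<in> P k"
      then obtain a where a: "a \<in> A" "xs = code k a" by (auto simp: P_def)
      have "\<lfloor>2 ^ k * blinfun_apply a (d i)\<rfloor> \<in> {-m..m}" if i: "i < k" for i
      proof -
        have "\<lceil>2 ^ k * (R * norm (d i))\<rceil> + 1 \<le> m" unfolding m_def using i by (intro Max_ge) auto
        moreover have "\<bar>2 ^ k * blinfun_apply a (d i)\<bar> \<le> 2 ^ k * (R * norm (d i))"
          using bnd[OF R[OF a(1)], of "d i"] by (simp add: abs_mult)
        moreover have "-m \<le> \<lfloor>x\<rfloor> \<and> \<lfloor>x\<rfloor> \<le> m" if "\<lceil>y\<rceil> + 1 \<le> m" "\<bar>x\<bar> \<le> y" for x y :: real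
          using that by (intro conjI; linarith)
        ultimately show ?thesis by (simp only: atLeastAtMost_iff)
      qed
      then show "xs \<in> {xs. set xs \<subseteq> {-m..m} \<and> length xs = k}" unfolding a(2) code_def by auto
    qed
    then show ?thesis by (rule finite_subset) (rule finite_lists_length_eq, simp)
  qed
  define b where "b k \<sigma> = (SOME a. a \<in> A \<and> code k a = \<sigma>)" for k \<sigma>
  have b: "b k \<sigma> \<in> A" "code k (b k \<sigma>) = \<sigma>" if "\<sigma> \<in> P k" for k \<sigma>
    using someI_ex[of "\<lambda>a. a \<in> A \<and> code k a = \<sigma>"] that by (auto simp: b_def P_def)
  define S where "S k t = code k (g t)" for k t
  have SP: "S k t \<in> P k" if "t \<in> space M" for k t using g(1)[OF that] by (simp add: S_def P_def)
  have close: "\<bar>blinfun_apply (b k (S k t)) (d i) - blinfun_apply (g t) (d i)\<bar> \<le> 1 / 2 ^ k"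
    if t: "t \<in> space M" and i: "i < k" for k t i
  proof -
    have "code k (b k (S k t)) ! i = code k (g t) ! i" using b(2)[OF SP[OF t]] by (simp add: S_def)
    then have "\<lfloor>2 ^ k * blinfun_apply (b k (S k t)) (d i)\<rfloor> = \<lfloor>2 ^ k * blinfun_apply (g t) (d i)\<rfloor>"
      using i by (simp add: code_def)
    then have "\<bar>2 ^ k * blinfun_apply (b k (S k t)) (d i) - 2 ^ k * blinfun_apply (g t) (d i)\<bar> \<le> 1" by linarith
    then have "2 ^ k * \<bar>blinfun_apply (b k (S k t)) (d i) - blinfun_apply (g t) (d i)\<bar> \<le> 1"
      by (simp add: abs_mult flip: right_diff_distrib)
    then show ?thesis by (simp add: pos_le_divide_eq mult.commute)
  qed
  have Smeas: "{t\<in>space M. S k t = \<sigma>} \<in> sets M" if \<sigma>: "\<sigma> \<in> P k" for k \<sigma>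
  proof -
    have len: "length \<sigma> = k" using \<sigma> by (auto simp: P_def code_def)
    have "{t\<in>space M. S k t = \<sigma>} = {t\<in>space M. \<forall>i\<in>{..<k}. \<lfloor>2 ^ k * blinfun_apply (g t) (d i)\<rfloor> = \<sigma> ! i}"
      using len by (auto simp: S_def code_def list_eq_iff_nth_eq)
    also have "\<dots> \<in> sets M"
    proof (rule sets.sets_Collect_finite_All)
      show "{t\<in>space M. \<lfloor>2 ^ k * blinfun_apply (g t) (d i)\<rfloor> = \<sigma> ! i} \<in> sets M" for i
      proof -
        have "(\<lambda>t. \<lfloor>2 ^ k * blinfun_apply (g t) (d i)\<rfloor>) \<in> M \<rightarrow>\<^sub>M count_space UNIV"
          using g(2)[of "d i"] by measurable
        from measurable_sets[OF this, of "{\<sigma> ! i}"] show ?thesis by (simp add: vimage_def Int_def conj_commute)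
      qed
    qed simp
    finally show ?thesis .
  qed
  define law where "law k p \<longleftrightarrow> (\<forall>\<sigma>. p \<sigma> \<in> borel_measurable F) \<and> (\<forall>\<sigma>\<in>P k. \<forall>t. 0 \<le> p \<sigma> t) \<and>
     (\<forall>t. (\<Sum>\<sigma>\<in>P k. p \<sigma> t) = 1) \<and> (\<forall>\<sigma>\<in>P k. integrable M (p \<sigma>)) \<and>
     (\<forall>\<sigma>\<in>P k. \<forall>B\<in>sets F. (LINT t:B|M. p \<sigma> t) = measure M (B \<inter> {t\<in>space M. S k t = \<sigma>}))"
    for k and p :: "int list \<Rightarrow> 'a \<Rightarrow> real"
  have "\<exists>p. law k p" for k
  proof (rule finite_valued_conditional_law[OF finP[of k] SP Smeas])
    fix p :: "int list \<Rightarrow> 'a \<Rightarrow> real"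
    assume "\<And>\<sigma>. p \<sigma> \<in> borel_measurable F" "\<And>\<sigma> t. \<sigma> \<in> P k \<Longrightarrow> 0 \<le> p \<sigma> t"
    "\<And>t. (\<Sum>\<sigma>\<in>P k. p \<sigma> t) = 1" "\<And>\<sigma>. \<sigma> \<in> P k \<Longrightarrow> integrable M (p \<sigma>)"
    "\<And>\<sigma> B. \<sigma> \<in> P k \<Longrightarrow> B \<in> sets F \<Longrightarrow> (LINT t:B|M. p \<sigma> t) = measure M (B \<inter> {t\<in>space M. S k t = \<sigma>})"
    then show ?thesis by (intro exI[of _ p]) (simp add: law_def)
  qed
  then obtain p where p: "\<And>k. law k (p k)" by metis
  have pF: "\<And>k \<sigma>. p k \<sigma> \<in> borel_measurable F"
    and p0: "\<And>k \<sigma> t. \<sigma> \<in> P k \<Longrightarrow> 0 \<le> p k \<sigma> t" and p1: "\<And>k t. (\<Sum>\<sigma>\<in>P k. p k \<sigma> t) = 1"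
    and pI: "\<And>k \<sigma>. \<sigma> \<in> P k \<Longrightarrow> integrable M (p k \<sigma>)"
    and pint: "\<And>k \<sigma> B. \<sigma> \<in> P k \<Longrightarrow> B \<in> sets F \<Longrightarrow> (LINT t:B|M. p k \<sigma> t) = measure M (B \<inter> {t\<in>space M. S k t = \<sigma>})"
    using p by (simp_all add: law_def)
  define fk where "fk k t = (\<Sum>\<sigma>\<in>P k. p k \<sigma> t *\<^sub>R b k \<sigma>)" for k t
  have fk_hull: "fk k t \<in> convex hull A" for k t
    unfolding fk_def using finP p0 p1 b(1) hull_subset[of A convex]
    by (intro convex_sum) (auto simp: convex_convex_hull)
  have hullR: "norm a \<le> R" if "a \<in> convex hull A" for a
  proof -
    have "convex hull A \<subseteq> cball 0 R" using R by (intro hull_minimal) (auto simp: dist_norm)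
    then show ?thesis using that by auto
  qed
  have fk_apply: "blinfun_apply (fk k t) y = (\<Sum>\<sigma>\<in>P k. p k \<sigma> t * blinfun_apply (b k \<sigma>) y)" for k t y
    by (simp add: fk_def blinfun.sum_left blinfun.scaleR_left)
  have fkF: "(\<lambda>t. blinfun_apply (fk k t) y) \<in> borel_measurable F" for k y
    unfolding fk_apply using pF by (intro borel_measurable_sum borel_measurable_times) auto
  have fkI: "integrable M (\<lambda>t. blinfun_apply (fk k t) y)" for k y
    unfolding fk_apply using pI by (intro Bochner_Integration.integrable_sum integrable_mult_left) auto
  have gI: "integrable M (\<lambda>t. blinfun_apply (g t) y)" for y
    using g(2) bnd R g(1) by (intro integrable_const_bound[of _ "R * norm y"]) auto
  have fk_int: "(LINT t:B|M. blinfun_apply (fk k t) y) = (LINT t:B|M. blinfun_apply (b k (S k t)) y)"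
    if B: "B \<in> sets F" for B k y
  proof -
    have "(LINT t:B|M. blinfun_apply (fk k t) y) = (\<Sum>\<sigma>\<in>P k. LINT t:B|M. p k \<sigma> t * blinfun_apply (b k \<sigma>) y)"
    proof -
      have "integrable M (\<lambda>t. indicator B t * (p k \<sigma> t * blinfun_apply (b k \<sigma>) y))" if "\<sigma> \<in> P k" for \<sigma>
        using set_integrable_F[OF B integrable_mult_left[of "blinfun_apply (b k \<sigma>) y", OF pI[OF that]]]
        by (simp add: set_integrable_def)
      then show ?thesis unfolding fk_apply set_lebesgue_integral_def by (simp add: sum_distrib_left)
    qed
    also have "\<dots> = (\<Sum>\<sigma>\<in>P k. blinfun_apply (b k \<sigma>) y * measure M (B \<inter> {t\<in>space M. S k t = \<sigma>}))"
      using pint[OF _ B] by (intro sum.cong) (simp_all add: set_integral_mult_left mult.commute)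
    also have "\<dots> = (LINT t:B|M. blinfun_apply (b k (S k t)) y)"
      using set_integral_finite_valued(1)[OF finP[of k] SP Smeas sets_F[OF B], of "\<lambda>\<sigma>. blinfun_apply (b k \<sigma>) y"] by simp
    finally show ?thesis .
  qed
  define v where "v i = real_cond_exp M F (\<lambda>t. blinfun_apply (g t) (d i))" for i
  have vF [measurable]: "v i \<in> borel_measurable F" for i by (simp add: v_def)
  have vI: "integrable M (v i)" for i unfolding v_def using gI by (intro real_cond_exp_int)
  have vint: "(LINT t:B|M. v i t) = (LINT t:B|M. blinfun_apply (g t) (d i))" if "B \<in> sets F" for B i
    unfolding v_def using real_cond_exp_intA[OF gI that] by simp
  \<comment> \<open>The rounding error at \<open>d i\<close> is at most \<open>1 / 2 ^ k\<close>;
    integrated over arbitrary \<open>F\<close>-sets it gives the same bound between the two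
    \<open>F\<close>-measurable functions almost everywhere.\<close>
  have near: "AE t in M. \<bar>blinfun_apply (fk k t) (d i) - v i t\<bar> \<le> 1 / 2 ^ k" if i: "i < k" for i k
  proof -
    have est: "\<bar>(LINT t:B|M. blinfun_apply (fk k t) (d i)) - (LINT t:B|M. v i t)\<bar> \<le> 1 / 2 ^ k * measure M B"
      if B: "B \<in> sets F" for B
    proof -
      have si: "set_integrable M B (\<lambda>t. blinfun_apply (b k (S k t)) (d i))"
        using set_integral_finite_valued(2)[OF finP[of k] SP Smeas sets_F[OF B], of "\<lambda>\<sigma>. blinfun_apply (b k \<sigma>) (d i)"] by simp
      have sg: "set_integrable M B (\<lambda>t. blinfun_apply (g t) (d i))" by (rule set_integrable_F[OF B gI])
      have ii: "integrable M (\<lambda>t. indicator B t * (blinfun_apply (b k (S k t)) (d i) - blinfun_apply (g t) (d i)))"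
        using set_integral_diff(1)[OF si sg] by (simp add: set_integrable_def)
      have "(LINT t:B|M. blinfun_apply (fk k t) (d i)) - (LINT t:B|M. v i t) =
        (LINT t|M. indicator B t * (blinfun_apply (b k (S k t)) (d i) - blinfun_apply (g t) (d i)))"
        unfolding fk_int[OF B] vint[OF B] set_integral_diff(2)[OF si sg, symmetric] by (simp add: set_lebesgue_integral_def)
      also have "\<bar>\<dots>\<bar> \<le> (LINT t|M. \<bar>indicator B t * (blinfun_apply (b k (S k t)) (d i) - blinfun_apply (g t) (d i))\<bar>)"
        by (rule integral_abs_bound)
      also have "\<dots> \<le> (LINT t:B|M. 1 / 2 ^ k)"
        unfolding set_lebesgue_integral_def
      proof (rule integral_mono)
        show "integrable M (\<lambda>t. \<bar>indicator B t * (blinfun_apply (b k (S k t)) (d i) - blinfun_apply (g t) (d i))\<bar>)"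
          using ii by (rule integrable_abs)
        show "integrable M (\<lambda>t. indicator B t *\<^sub>R (1 / 2 ^ k :: real))"
          using set_integrable_F[OF B, of "\<lambda>_. 1 / 2 ^ k :: real"] by (simp add: set_integrable_def)
        show "\<bar>indicator B t * (blinfun_apply (b k (S k t)) (d i) - blinfun_apply (g t) (d i))\<bar> \<le> indicator B t *\<^sub>R (1 / 2 ^ k)"
          if "t \<in> space M" for t using close[OF that i] by (auto simp: indicator_def)
      qed
      also have "\<dots> = 1 / 2 ^ k * measure M B" using sets_F[OF B] by (simp only: set_integral_const_real)
      finally show ?thesis .
    qed
    have c: "set_integrable M B (\<lambda>_. 1 / 2 ^ k :: real)" if "B \<in> sets F" for B by (rule set_integrable_F[OF that]) simp
    have "AE t in M. 0 \<le> 1 / 2 ^ k - (blinfun_apply (fk k t) (d i) - v i t)"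
    proof (rule AE_nonneg_of_set_integrals)
      fix B assume B: "B \<in> sets F"
      have "(LINT t:B|M. 1 / 2 ^ k - (blinfun_apply (fk k t) (d i) - v i t)) =
        1 / 2 ^ k * measure M B - ((LINT t:B|M. blinfun_apply (fk k t) (d i)) - (LINT t:B|M. v i t))"
        using c[OF B] set_integrable_F[OF B fkI] set_integrable_F[OF B vI] sets_F[OF B]
        by (simp add: set_integral_diff set_integral_const_real)
      then show "0 \<le> (LINT t:B|M. 1 / 2 ^ k - (blinfun_apply (fk k t) (d i) - v i t))" using est[OF B] by (simp add: abs_le_iff)
    qed (use fkF fkI vI in auto)
    moreover have "AE t in M. 0 \<le> 1 / 2 ^ k + (blinfun_apply (fk k t) (d i) - v i t)"
    proof (rule AE_nonneg_of_set_integrals)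
      fix B assume B: "B \<in> sets F"
      have "(LINT t:B|M. 1 / 2 ^ k + (blinfun_apply (fk k t) (d i) - v i t)) =
        1 / 2 ^ k * measure M B + ((LINT t:B|M. blinfun_apply (fk k t) (d i)) - (LINT t:B|M. v i t))"
        using c[OF B] set_integrable_F[OF B fkI] set_integrable_F[OF B vI] sets_F[OF B]
        by (simp add: set_integral_diff set_integral_add set_integral_const_real)
      then show "0 \<le> (LINT t:B|M. 1 / 2 ^ k + (blinfun_apply (fk k t) (d i) - v i t))" using est[OF B] by (simp add: abs_le_iff)
    qed (use fkF fkI vI in auto)
    ultimately show ?thesis by eventually_elim (simp add: abs_le_iff)
  qed
  \<comment> \<open>The good set has to belong to \<open>F\<close>, because \<open>f\<close> will be
    redefined to be the constant \<open>a0\<close> outside of it and must stay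
    \<open>F\<close>-measurable.\<close>
  define G where "G = {t\<in>space F. \<forall>i. (\<lambda>k. blinfun_apply (fk k t) (d i)) \<longlonglongrightarrow> v i t}"
  have GF: "G \<in> sets F"
  proof -
    have "{t\<in>space F. (\<lambda>k. blinfun_apply (fk k t) (d i)) \<longlonglongrightarrow> v i t} \<in> sets F" for i
    proof -
      have m: "(\<lambda>t. blinfun_apply (fk k t) (d i) - v i t) \<in> borel_measurable F" for k using fkF[of k "d i"] by measurable
      have "{t\<in>space F. (\<lambda>k. blinfun_apply (fk k t) (d i)) \<longlonglongrightarrow> v i t} =
         {t\<in>space F. \<forall>n. \<exists>N. \<forall>k\<in>{N..}. \<bar>blinfun_apply (fk k t) (d i) - v i t\<bar> < 1 / Suc n}"
        by (simp only: LIMSEQ_iff_inverse_Suc)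
      also have "\<dots> \<in> sets F"
        using m by measurable
      finally show ?thesis .
    qed
    then show ?thesis unfolding G_def by (intro sets.sets_Collect_countable_All)
  qed
  have GAE: "AE t in M. t \<in> G"
  proof -
    have "AE t in M. \<forall>i k. i < k \<longrightarrow> \<bar>blinfun_apply (fk k t) (d i) - v i t\<bar> \<le> 1 / 2 ^ k"
      using near by (simp add: AE_all_countable)
    with AE_space show ?thesis
    proof eventually_elim
      case (elim t)
      have "(\<lambda>k. blinfun_apply (fk k t) (d i)) \<longlonglongrightarrow> v i t" for i
      proof -
        have "(\<lambda>k. (1 / 2 :: real) ^ k) \<longlonglongrightarrow> 0" by (rule LIMSEQ_realpow_zero) auto
        moreover have "\<forall>\<^sub>F k in sequentially. norm (blinfun_apply (fk k t) (d i) - v i t) \<le> (1 / 2) ^ k"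
          using elim(2) by (intro eventually_sequentiallyI[of "Suc i"]) (auto simp: power_divide)
        ultimately have "(\<lambda>k. blinfun_apply (fk k t) (d i) - v i t) \<longlonglongrightarrow> 0" by (rule Lim_null_comparison[rotated])
        from tendsto_add[OF this tendsto_const[of "v i t"]] show ?thesis by simp
      qed
      with elim show ?case by (simp add: G_def space_F)
    qed
  qed
  have "\<exists>L :: 'y \<Rightarrow>\<^sub>L real. norm L \<le> R \<and> (\<forall>i. blinfun_apply L (d i) = v i t)" if t: "t \<in> G" for t
  proof (rule functional_from_dense_values[OF d R0, of "\<lambda>i. v i t"])
    fix i j k :: nat and r :: real
    have lim: "(\<lambda>n. blinfun_apply (fk n t) (d i)) \<longlonglongrightarrow> v i t" for i using t by (simp add: G_def)
    show "\<bar>v i t + r * v j t - v k t\<bar> \<le> R * norm (d i + r *\<^sub>R d j - d k)"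
    proof (rule LIMSEQ_le_const2)
      show "(\<lambda>n. \<bar>blinfun_apply (fk n t) (d i) + r * blinfun_apply (fk n t) (d j) - blinfun_apply (fk n t) (d k)\<bar>) \<longlonglongrightarrow>
        \<bar>v i t + r * v j t - v k t\<bar>" by (intro tendsto_intros lim)
      have "\<bar>blinfun_apply (fk n t) (d i + r *\<^sub>R d j - d k)\<bar> \<le> R * norm (d i + r *\<^sub>R d j - d k)" for n
        by (intro bnd hullR fk_hull)
      then show "\<exists>N. \<forall>n\<ge>N. \<bar>blinfun_apply (fk n t) (d i) + r * blinfun_apply (fk n t) (d j) - blinfun_apply (fk n t) (d k)\<bar>
        \<le> R * norm (d i + r *\<^sub>R d j - d k)"
        by (simp add: blinfun.add_right blinfun.diff_right blinfun.scaleR_right)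
    qed
  qed auto
  then obtain L :: "'a \<Rightarrow> 'y \<Rightarrow>\<^sub>L real" where L: "\<And>t. t \<in> G \<Longrightarrow> norm (L t) \<le> R" "\<And>t i. t \<in> G \<Longrightarrow> blinfun_apply (L t) (d i) = v i t"
    by metis
  define f where "f t = (if t \<in> G then L t else a0)" for t
  have fR: "norm (f t) \<le> R" for t using L R[OF a0] by (simp add: f_def)
  \<comment> \<open>A property that passes to norm limits of the points \<open>d i\<close> holds for
    all vectors as soon as it holds for every \<open>d i\<close>. It is used for measurability and
    for equality of integrals.\<close>
  have dense_ind: "Q y" if cl: "\<And>s y. (\<And>n::nat. Q (d (s n))) \<Longrightarrow> (\<lambda>n. d (s n)) \<longlonglongrightarrow> y \<Longrightarrow> Q y" and dn: "\<And>i. Q (d i)" for Q y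
  proof -
    define s where "s n = (SOME i. dist (d i) y < 1 / Suc n)" for n
    have s: "dist (d (s n)) y < 1 / Suc n" for n unfolding s_def by (rule someI_ex) (rule d, simp)
    have "(\<lambda>n. dist (d (s n)) y) \<longlonglongrightarrow> 0"
    proof (rule Lim_null_comparison)
      show "\<forall>\<^sub>F n in sequentially. norm (dist (d (s n)) y) \<le> 1 / Suc n" using s by (intro always_eventually) (auto intro: less_imp_le)
      show "(\<lambda>n. 1 / real (Suc n)) \<longlonglongrightarrow> 0" using LIMSEQ_inverse_real_of_nat by (simp add: inverse_eq_divide)
    qed
    then have lim: "(\<lambda>n. d (s n)) \<longlonglongrightarrow> y" by (rule tendsto_dist_iff[THEN iffD2])
    show ?thesis by (rule cl[of s y, OF dn lim])
  qed
  have fF: "(\<lambda>t. blinfun_apply (f t) y) \<in> borel_measurable F" for y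
  proof (rule dense_ind[of "\<lambda>y. (\<lambda>t. blinfun_apply (f t) y) \<in> borel_measurable F"])
    fix s :: "nat \<Rightarrow> nat" and y assume m: "\<And>n. (\<lambda>t. blinfun_apply (f t) (d (s n))) \<in> borel_measurable F" and lim: "(\<lambda>n. d (s n)) \<longlonglongrightarrow> y"
    show "(\<lambda>t. blinfun_apply (f t) y) \<in> borel_measurable F"
    proof (rule borel_measurable_LIMSEQ_real[OF _ m])
      show "(\<lambda>n. blinfun_apply (f t) (d (s n))) \<longlonglongrightarrow> blinfun_apply (f t) y" for t by (intro tendsto_intros lim)
    qed
  next
    fix i
    have "(\<lambda>t. blinfun_apply (f t) (d i)) = (\<lambda>t. if t \<in> G then v i t else blinfun_apply a0 (d i))"
      by (auto simp: f_def L fun_eq_iff)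
    then show "(\<lambda>t. blinfun_apply (f t) (d i)) \<in> borel_measurable F" using GF by (simp only:) (intro measurable_If_set, auto)
  qed
  have int_cl: "(\<lambda>n. LINT t:D|M. blinfun_apply (u t) (y n)) \<longlonglongrightarrow> (LINT t:D|M. blinfun_apply (u t) z)"
    if u: "\<And>y. (\<lambda>t. blinfun_apply (u t) y) \<in> borel_measurable M" "\<And>t. t \<in> space M \<Longrightarrow> norm (u t) \<le> R"
      and D: "D \<in> sets F" and y: "y \<longlonglongrightarrow> z" for u :: "'a \<Rightarrow> 'y \<Rightarrow>\<^sub>L real" and D y z
  proof -
    obtain B where B: "\<And>n. norm (y n) \<le> B"
      using convergent_imp_bounded[OF y] by (auto simp: bounded_iff)
    show ?thesis
      unfolding set_lebesgue_integral_def
    proof (rule integral_dominated_convergence[where w = "\<lambda>_. R * B"])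
      show "AE t in M. (\<lambda>n. indicator D t *\<^sub>R blinfun_apply (u t) (y n)) \<longlonglongrightarrow> indicator D t *\<^sub>R blinfun_apply (u t) z"
        by (intro AE_I2 tendsto_intros y)
      have B0: "0 \<le> B" using B[of 0] norm_ge_zero order_trans by blast
      show "AE t in M. norm (indicator D t *\<^sub>R blinfun_apply (u t) (y n)) \<le> R * B" for n
      proof (rule AE_I2)
        fix t assume t: "t \<in> space M"
        have "\<bar>blinfun_apply (u t) (y n)\<bar> \<le> R * norm (y n)" by (rule bnd[OF u(2)[OF t]])
        also have "\<dots> \<le> R * B" using B R0 by (intro mult_left_mono)
        finally show "norm (indicator D t *\<^sub>R blinfun_apply (u t) (y n)) \<le> R * B"
          using R0 B0 by (auto simp: indicator_def)
      qed
    qed (use u(1) sets_F[OF D] in auto)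
  qed
  have fint: "(LINT t:D|M. blinfun_apply (f t) y) = (LINT t:D|M. blinfun_apply (g t) y)" if D: "D \<in> sets F" for D y
  proof (rule dense_ind[of "\<lambda>y. (LINT t:D|M. blinfun_apply (f t) y) = (LINT t:D|M. blinfun_apply (g t) y)"])
    fix s :: "nat \<Rightarrow> nat" and y assume eq: "\<And>n. (LINT t:D|M. blinfun_apply (f t) (d (s n))) = (LINT t:D|M. blinfun_apply (g t) (d (s n)))"
      and lim: "(\<lambda>n. d (s n)) \<longlonglongrightarrow> y"
    have "(\<lambda>n. LINT t:D|M. blinfun_apply (f t) (d (s n))) \<longlonglongrightarrow> (LINT t:D|M. blinfun_apply (f t) y)"
      using meas_F[OF fF] fR by (intro int_cl D lim)
    moreover have "(\<lambda>n. LINT t:D|M. blinfun_apply (g t) (d (s n))) \<longlonglongrightarrow> (LINT t:D|M. blinfun_apply (g t) y)"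
      using g R by (intro int_cl D lim) auto
    ultimately show "(LINT t:D|M. blinfun_apply (f t) y) = (LINT t:D|M. blinfun_apply (g t) y)"
      unfolding eq using LIMSEQ_unique by blast
  next
    fix i
    have "(LINT t:D|M. blinfun_apply (f t) (d i)) = (LINT t:D|M. v i t)"
      unfolding set_lebesgue_integral_def
    proof (rule integral_cong_AE)
      show "AE t in M. indicator D t *\<^sub>R blinfun_apply (f t) (d i) = indicator D t *\<^sub>R v i t"
        using GAE by eventually_elim (simp add: f_def L)
    qed (use meas_F[OF fF] meas_F[OF vF] sets_F[OF D] in auto)
    then show "(LINT t:D|M. blinfun_apply (f t) (d i)) = (LINT t:D|M. blinfun_apply (g t) (d i))" using vint[OF D] by simp
  qed
  have fcl: "f t \<in> weak_star_topology closure_of (convex hull A)" for t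
  proof (cases "t \<in> G")
    case False
    then have "f t \<in> convex hull A" using a0 hull_inc by (simp add: f_def)
    then show ?thesis using closure_of_subset[of "convex hull A" weak_star_topology]
      by (auto simp: strong_operator_topology_topspace)
  next
    case True
    have conv: "(\<lambda>k. blinfun_apply (fk k t) y) \<longlonglongrightarrow> blinfun_apply (f t) y" for y
    proof (rule LIMSEQ_I)
      fix e :: real assume e: "e > 0"
      obtain i where i: "dist (d i) y < e / (3 * (R + 1))" using d[of "e / (3 * (R + 1))" y] e R0 by auto
      have Rd: "R * norm (y - d i) < e / 3"
      proof -
        have "R * norm (y - d i) \<le> R * (e / (3 * (R + 1)))"
          using i R0 by (intro mult_left_mono) (auto simp: dist_norm norm_minus_commute)
        also have "\<dots> < e / 3" using e R0 by (simp add: field_simps)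
        finally show ?thesis .
      qed
      have "(\<lambda>k. blinfun_apply (fk k t) (d i)) \<longlonglongrightarrow> blinfun_apply (f t) (d i)"
        using True L(2)[OF True] by (simp add: G_def f_def)
      from LIMSEQ_D[OF this, of "e / 3"] e obtain k0 where k0: "\<And>k. k \<ge> k0 \<Longrightarrow>
        norm (blinfun_apply (fk k t) (d i) - blinfun_apply (f t) (d i)) < e / 3" by auto
      show "\<exists>k0. \<forall>k\<ge>k0. norm (blinfun_apply (fk k t) y - blinfun_apply (f t) y) < e"
      proof (intro exI allI impI)
        fix k assume "k \<ge> k0"
        from k0[OF this] bnd[OF hullR[OF fk_hull[of k t]], of "y - d i"] bnd[OF fR[of t], of "y - d i"] Rd
        show "norm (blinfun_apply (fk k t) y - blinfun_apply (f t) y) < e"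
          unfolding real_norm_def blinfun.diff_right abs_le_iff abs_less_iff by linarith
      qed
    qed
    have "limitin weak_star_topology (\<lambda>k. fk k t) (f t) sequentially"
      by (rule limitin_weak_star) (rule conv)
    then show ?thesis
      by (rule limitin_sequence_closure_of) (rule fk_hull)
  qed
  show ?thesis by (rule that[of f]) (fact fF fcl fR fint)+
qed

end

lemma gelfand_actions_borel:
  assumes "g \<in> M \<rightarrow>\<^sub>M borel_of (gelfand_actions A)"
  shows "t \<in> space M \<Longrightarrow> g t \<in> A" "(\<lambda>t. blinfun_apply (g t) y) \<in> borel_measurable M"
proof -
  show "g t \<in> A" if "t \<in> space M"
    using measurable_space[OF assms that] by (simp add: gelfand_actions_def)
  have "continuous_map (gelfand_actions A) euclideanreal (\<lambda>a. blinfun_apply a y)"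
    unfolding gelfand_actions_def by (rule continuous_map_from_subtopology[OF weak_star_continuous_eval])
  from continuous_map_borel_measurable[OF assms this]
  show "(\<lambda>t. blinfun_apply (g t) y) \<in> borel_measurable M" .
qed

context prob_subalgebra
begin

context
  fixes A :: "('y::{banach, second_countable_topology} \<Rightarrow>\<^sub>L real) set" and R :: real and g :: "'a \<Rightarrow> 'y \<Rightarrow>\<^sub>L real"
  assumes A: "A \<noteq> {}" and R: "\<And>a. a \<in> A \<Longrightarrow> norm a \<le> R"
    and g: "g \<in> M \<rightarrow>\<^sub>M borel_of (gelfand_actions A)"
begin

text \<open>Identifies the set of all versions with the class of one bounded version whose values
  lie in the closed convex hull, so that it is a point of the space of aggregates. Equality of
  versions is tested on a dense sequence of vectors, which costs countably many null sets.\<close>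

lemma gelfand_cond_exp_class:
  obtains f where "weak_star_measurable (restr_to_subalg M F) f" "\<And>t. norm (f t) \<le> R"
    "\<And>t. f t \<in> weak_star_topology closure_of (convex hull A)"
    "gelfand_cond_exp M F g = Linf_star_class (restr_to_subalg M F) f"
    "\<And>\<phi>. integrable (restr_to_subalg M F) \<phi> \<Longrightarrow> (LINT t|M. blinfun_apply (f t) (\<phi> t)) = (LINT t|M. blinfun_apply (g t) (\<phi> t))"
proof -
  let ?N = "restr_to_subalg M F"
  note gA = gelfand_actions_borel[OF g]
  obtain f where f: "\<And>y. (\<lambda>t. blinfun_apply (f t) y) \<in> borel_measurable F"
    "\<And>t. f t \<in> weak_star_topology closure_of (convex hull A)" "\<And>t. norm (f t) \<le> R"
    "\<And>D y. D \<in> sets F \<Longrightarrow> (LINT t:D|M. blinfun_apply (f t) y) = (LINT t:D|M. blinfun_apply (g t) y)"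
    by (rule gelfand_conditional_expectation[OF A R gA]) (assumption | rule that)+
  have R0: "0 \<le> R" using f(3)[of undefined] norm_ge_zero order_trans by blast
  have bnd: "\<bar>blinfun_apply a y\<bar> \<le> R * norm y" if "norm a \<le> R" for a :: "'y \<Rightarrow>\<^sub>L real" and y
    using norm_blinfun[of a y] mult_right_mono[OF that norm_ge_zero[of y]] by simp
  have fM: "(\<lambda>t. blinfun_apply (f t) y) \<in> borel_measurable M" for y by (rule meas_F[OF f(1)])
  have fI: "integrable M (\<lambda>t. blinfun_apply (f t) y)" for y
    using fM bnd[OF f(3)] by (intro integrable_const_bound[of _ "R * norm y"]) auto
  have mN: "h \<in> borel_measurable ?N \<longleftrightarrow> h \<in> borel_measurable F" for h :: "'a \<Rightarrow> real"
    using measurable_in_subalg[OF subalg] measurable_in_subalg'[OF subalg] by blast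
  obtain d :: "nat \<Rightarrow> 'y" where d: "\<And>x e. e > 0 \<Longrightarrow> \<exists>i. dist (d i) x < e" using dense_sequence_UNIV by blast
  have ext: "a = a'" if "\<And>i. blinfun_apply a (d i) = blinfun_apply a' (d i)" for a a' :: "'y \<Rightarrow>\<^sub>L real"
  proof (rule blinfun_eqI)
    fix y
    have "closed {y. blinfun_apply a y = blinfun_apply a' y}" by (intro closed_Collect_eq continuous_intros)
    moreover have "y \<in> closure (range d)" using d by (auto simp: closure_approachable)
    ultimately show "blinfun_apply a y = blinfun_apply a' y"
      using closure_minimal[of "range d" "{y. blinfun_apply a y = blinfun_apply a' y}"] that by auto
  qed
  have cls: "gelfand_cond_exp M F g = Linf_star_class ?N f"
  proof (intro subset_antisym subsetI)
    fix h assume "h \<in> gelfand_cond_exp M F g"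
    then have hI: "\<And>y. integrable ?N (\<lambda>t. blinfun_apply (h t) y)"
      and hD: "\<And>D. D \<in> sets F \<Longrightarrow> gelfand_integral M D g = gelfand_integral M D h"
      by (auto simp: gelfand_cond_exp_def gelfand_integrable_def)
    have hF: "(\<lambda>t. blinfun_apply (h t) y) \<in> borel_measurable F" for y using hI[of y] mN by auto
    have hint: "(LINT t:D|M. blinfun_apply (h t) y) = (LINT t:D|M. blinfun_apply (f t) y)" if "D \<in> sets F" for D y
      using fun_cong[OF hD[OF that], of y] f(4)[OF that] by (simp add: gelfand_integral_def)
    have "AE t in M. blinfun_apply (h t) (d i) = blinfun_apply (f t) (d i)" for i
      by (rule AE_eq_of_set_integrals[OF hF f(1) integrable_from_subalg[OF subalg hI] fI hint])
    then have "AE t in M. \<forall>i. blinfun_apply (h t) (d i) = blinfun_apply (f t) (d i)" by (simp add: AE_all_countable)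
    then have "AE t in ?N. \<forall>i. blinfun_apply (h t) (d i) = blinfun_apply (f t) (d i)"
    proof (rule AE_restr_to_subalg2[OF subalg])
      show "Measurable.pred F (\<lambda>t. \<forall>i. blinfun_apply (h t) (d i) = blinfun_apply (f t) (d i))"
        using hF f(1) by measurable
    qed
    then have "AE t in ?N. h t = f t" by eventually_elim (rule ext, blast)
    then show "h \<in> Linf_star_class ?N f"
      using hF mN by (auto simp: Linf_star_class_def weak_star_measurable_def)
  next
    fix h assume "h \<in> Linf_star_class ?N f"
    then have hF: "\<And>y. (\<lambda>t. blinfun_apply (h t) y) \<in> borel_measurable F" and hf: "AE t in ?N. h t = f t"
      using mN by (auto simp: Linf_star_class_def weak_star_measurable_def)
    have hfM: "AE t in M. h t = f t" by (rule AE_restr_to_subalg[OF subalg hf])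
    have hI: "integrable ?N (\<lambda>t. blinfun_apply (h t) y)" for y
    proof (rule integrable_in_subalg[OF subalg hF])
      show "integrable M (\<lambda>t. blinfun_apply (h t) y)"
        by (subst integrable_cong_AE[of _ _ "\<lambda>t. blinfun_apply (f t) y"])
          (use meas_F[OF hF] fM fI hfM in \<open>auto elim: eventually_mono\<close>)
    qed
    have "(LINT t:D|M. blinfun_apply (g t) y) = (LINT t:D|M. blinfun_apply (h t) y)" if D: "D \<in> sets F" for D y
    proof -
      have "(LINT t:D|M. blinfun_apply (h t) y) = (LINT t:D|M. blinfun_apply (f t) y)"
        unfolding set_lebesgue_integral_def
      proof (rule integral_cong_AE)
        show "AE t in M. indicator D t *\<^sub>R blinfun_apply (h t) y = indicator D t *\<^sub>R blinfun_apply (f t) y"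
          using hfM by eventually_elim simp
      qed (use meas_F[OF hF] fM sets_F[OF D] in auto)
      then show ?thesis using f(4)[OF D] by simp
    qed
    then show "h \<in> gelfand_cond_exp M F g"
      using hI by (auto simp: gelfand_cond_exp_def gelfand_integrable_def gelfand_integral_def)
  qed
  have pair: "(LINT t|M. blinfun_apply (f t) (\<phi> t)) = (LINT t|M. blinfun_apply (g t) (\<phi> t))"
    if \<phi>: "integrable ?N \<phi>" for \<phi>
  proof -
    \<comment> \<open>The convergence theorem is applied to a constant sequence: equality of the
      integrals over \<open>F\<close>-sets extends to equality of the pairings with all integrable
      \<open>\<phi>\<close>.\<close>
    have "(\<lambda>n::nat. LINT t|M. blinfun_apply (g t) (\<phi> t)) \<longlonglongrightarrow> (LINT t|M. blinfun_apply (f t) (\<phi> t))"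
    proof (rule pairing_tendsto[where K = R and L = "\<lambda>n t v. blinfun_apply (g t) v" and L' = "\<lambda>t v. blinfun_apply (f t) v", OF _ _ _ _ _ _ R0 _ \<phi>])
      show "\<bar>blinfun_apply (g t) v\<bar> \<le> R * norm v" if "t \<in> space M" for t v by (rule bnd[OF R[OF gA(1)[OF that]]])
      show "\<bar>blinfun_apply (f t) v\<bar> \<le> R * norm v" for t v by (rule bnd[OF f(3)])
      show "(\<lambda>n::nat. LINT t:D|M. blinfun_apply (g t) v) \<longlonglongrightarrow> (LINT t:D|M. blinfun_apply (f t) v)" if "D \<in> sets F" for D v
        unfolding f(4)[OF that] by (rule tendsto_const)
    qed (use gA(2) fM in \<open>auto intro: blinfun.bounded_linear_right\<close>)
    then show ?thesis using LIMSEQ_unique[OF _ tendsto_const] by metis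
  qed
  show ?thesis
    by (rule that[of f]) (use f(1-3) mN cls pair in \<open>auto simp: weak_star_measurable_def\<close>)
qed

lemma gelfand_cond_exp_aggregate: "gelfand_cond_exp M F g \<in> topspace (gelfand_aggregates M F A)"
proof -
  let ?N = "restr_to_subalg M F"
  obtain f where f: "weak_star_measurable ?N f" "\<And>t. norm (f t) \<le> R"
    "\<And>t. f t \<in> weak_star_topology closure_of (convex hull A)" "gelfand_cond_exp M F g = Linf_star_class ?N f"
    using gelfand_cond_exp_class by metis
  have "gelfand_cond_exp M F g \<in> Linf_star_space ?N"
    unfolding f(4) Linf_star_space_def using f(1,2) by blast
  moreover have "f \<in> gelfand_cond_exp M F g" unfolding f(4) using f(1) by (simp add: Linf_star_class_def)
  moreover have "topspace (Linf_weak_star_topology ?N) = Linf_star_space ?N"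
    for N :: "'a measure"
    unfolding Linf_weak_star_topology_def by (rule topspace_initial_topology) (auto intro!: exI[of _ "\<lambda>_. 0"])
  ultimately show ?thesis
    unfolding gelfand_aggregates_def topspace_subtopology using f(3) by auto
qed

lemma gelfand_cond_exp_functional:
  assumes \<phi>: "integrable (restr_to_subalg M F) \<phi>"
  shows "(LINT t|restr_to_subalg M F. blinfun_apply ((SOME f. f \<in> gelfand_cond_exp M F g) t) (\<phi> t)) =
    (LINT t|M. blinfun_apply (g t) (\<phi> t))"
proof -
  let ?N = "restr_to_subalg M F"
  obtain f where f: "weak_star_measurable ?N f" "gelfand_cond_exp M F g = Linf_star_class ?N f"
    "\<And>\<phi>. integrable ?N \<phi> \<Longrightarrow> (LINT t|M. blinfun_apply (f t) (\<phi> t)) = (LINT t|M. blinfun_apply (g t) (\<phi> t))"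
    using gelfand_cond_exp_class by metis
  define h where "h = (SOME f. f \<in> gelfand_cond_exp M F g)"
  have "f \<in> gelfand_cond_exp M F g" unfolding f(2) using f(1) by (simp add: Linf_star_class_def)
  then have "h \<in> gelfand_cond_exp M F g" unfolding h_def by (rule someI[of "\<lambda>f. f \<in> gelfand_cond_exp M F g"])
  then have h: "weak_star_measurable ?N h" "AE t in ?N. h t = f t" unfolding f(2) by (auto simp: Linf_star_class_def)
  have m: "(\<lambda>t. blinfun_apply (k t) (\<phi> t)) \<in> borel_measurable ?N" if "weak_star_measurable ?N k" for k
  proof (rule measurable_pairing[where L = "\<lambda>t v. blinfun_apply (k t) v"])
    show "(\<lambda>t. blinfun_apply (k t) v) \<in> borel_measurable ?N" for v
      using that by (simp add: weak_star_measurable_def)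
    show "\<phi> \<in> borel_measurable ?N" using \<phi> by auto
  qed (rule blinfun.bounded_linear_right)
  have "(LINT t|?N. blinfun_apply (h t) (\<phi> t)) = (LINT t|?N. blinfun_apply (f t) (\<phi> t))"
    using m[OF h(1)] m[OF f(1)] h(2) by (intro integral_cong_AE) (auto elim: eventually_mono)
  also have "\<dots> = (LINT t|M. blinfun_apply (f t) (\<phi> t))"
    using measurable_in_subalg'[OF subalg m[OF f(1)]] by (rule integral_subalgebra2[OF subalg])
  also have "\<dots> = (LINT t|M. blinfun_apply (g t) (\<phi> t))" by (rule f(3)[OF \<phi>])
  finally show ?thesis by (simp add: h_def)
qed

end

text \<open>Evaluations at a dense sequence of vectors separate the actions. The functionals on
  aggregates are pairings with integrable, possibly unbounded \<open>\<phi>\<close>; they are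
  reached from the bounded tests of \<open>converges_in_law_F\<close> through
  \<open>pairing_tendsto\<close>.\<close>

lemma gelfand_equilibrium_exists:
  fixes A :: "('y::{banach, second_countable_topology} \<Rightarrow>\<^sub>L real) set"
  assumes ne: "nowhere_equivalent M F" and cg: "countably_generated F"
    and game: "gelfand_large_game M F A G"
  shows "\<exists>g. gelfand_nash_equilibrium M F A G g"
proof -
  have A: "A \<noteq> {}" and cA: "compactin weak_star_topology A"
    and G: "payoff_assignment F (gelfand_actions A) (gelfand_aggregates M F A) G"
    using game by (auto simp: gelfand_large_game_def)
  obtain R where R: "0 \<le> R" "\<And>a. a \<in> A \<Longrightarrow> norm a \<le> R" using weak_star_compact_bounded[OF cA] by blast
  have top: "topspace (gelfand_actions A) = A"
    by (simp add: gelfand_actions_def strong_operator_topology_topspace)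
  obtain d :: "nat \<Rightarrow> 'y" where d: "\<And>x e. e > 0 \<Longrightarrow> \<exists>i. dist (d i) x < e" using dense_sequence_UNIV by blast
  have bnd: "\<bar>blinfun_apply a y\<bar> \<le> R * norm y" if "a \<in> A" for a :: "'y \<Rightarrow>\<^sub>L real" and y
    using norm_blinfun[of a y] mult_right_mono[OF R(2)[OF that] norm_ge_zero[of y]] by simp
  show ?thesis
    unfolding gelfand_nash_equilibrium_def
  proof (rule nash_equilibrium_exists[OF prob_space_axioms subalg ne cg, where e = "\<lambda>a i. blinfun_apply a (d i)", OF _ _ _ _ _ _ G])
    show "compact_space (gelfand_actions A)"
      unfolding gelfand_actions_def by (rule compact_space_subtopology[OF cA])
    show "topspace (gelfand_actions A) \<noteq> {}" using A top by simp
    show "continuous_map (gelfand_actions A) euclideanreal (\<lambda>a. blinfun_apply a (d i))" for i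
      unfolding gelfand_actions_def by (rule continuous_map_from_subtopology[OF weak_star_continuous_eval])
    show "inj_on (\<lambda>a i. blinfun_apply a (d i)) (topspace (gelfand_actions A))"
    proof (rule inj_onI, rule blinfun_eqI)
      fix a a' :: "'y \<Rightarrow>\<^sub>L real" and y assume eq: "(\<lambda>i. blinfun_apply a (d i)) = (\<lambda>i. blinfun_apply a' (d i))"
      have "closed {y. blinfun_apply a y = blinfun_apply a' y}" by (intro closed_Collect_eq continuous_intros)
      moreover have "y \<in> closure (range d)" using d by (auto simp: closure_approachable)
      ultimately show "blinfun_apply a y = blinfun_apply a' y"
        using closure_minimal[of "range d" "{y. blinfun_apply a y = blinfun_apply a' y}"] fun_cong[OF eq] by auto
    qed
    show "gelfand_cond_exp M F g \<in> topspace (gelfand_aggregates M F A)" if "g \<in> M \<rightarrow>\<^sub>M borel_of (gelfand_actions A)" for g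
      by (rule gelfand_cond_exp_aggregate[OF A R(2) that])
    show "limitin (gelfand_aggregates M F A) (\<lambda>n. gelfand_cond_exp M F (g n)) (gelfand_cond_exp M F h) sequentially"
      if g: "\<And>n. g n \<in> M \<rightarrow>\<^sub>M borel_of (gelfand_actions A)" and h: "h \<in> M \<rightarrow>\<^sub>M borel_of (gelfand_actions A)"
        and conv: "converges_in_law_F M F (gelfand_actions A) g h" for g h
    proof -
      let ?N = "restr_to_subalg M F"
      have agg: "gelfand_cond_exp M F k \<in> topspace (gelfand_aggregates M F A)"
        if "k \<in> M \<rightarrow>\<^sub>M borel_of (gelfand_actions A)" for k
        by (rule gelfand_cond_exp_aggregate[OF A R(2) that])
      have "limitin (Linf_weak_star_topology ?N) (\<lambda>n. gelfand_cond_exp M F (g n)) (gelfand_cond_exp M F h) sequentially"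
        unfolding Linf_weak_star_topology_def
      proof (rule limitin_initial_topology)
        show "gelfand_cond_exp M F (g n) \<in> Linf_star_space ?N" for n
          using agg[OF g] by (simp add: gelfand_aggregates_def)
        show "gelfand_cond_exp M F h \<in> Linf_star_space ?N"
          using agg[OF h] by (simp add: gelfand_aggregates_def)
        show "{\<lambda>c. LINT t|?N. blinfun_apply ((SOME f. f \<in> c) t) (\<phi> t) |\<phi>::'a \<Rightarrow> 'y. integrable ?N \<phi>} \<noteq> {}"
          by (auto intro!: exI[of _ "\<lambda>_. 0"])
        fix \<Phi> :: "('a \<Rightarrow> 'y \<Rightarrow>\<^sub>L real) set \<Rightarrow> real" assume "\<Phi> \<in> {\<lambda>c. LINT t|?N. blinfun_apply ((SOME f. f \<in> c) t) (\<phi> t) |\<phi>::'a \<Rightarrow> 'y. integrable ?N \<phi>}"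
        then obtain \<phi> :: "'a \<Rightarrow> 'y" where \<phi>: "integrable ?N \<phi>"
          "\<Phi> = (\<lambda>c. LINT t|?N. blinfun_apply ((SOME f. f \<in> c) t) (\<phi> t))" by blast
        have "(\<lambda>n. LINT t|M. blinfun_apply (g n t) (\<phi> t)) \<longlonglongrightarrow> (LINT t|M. blinfun_apply (h t) (\<phi> t))"
        proof (rule pairing_tendsto[where K = R and L = "\<lambda>n t v. blinfun_apply (g n t) v" and L' = "\<lambda>t v. blinfun_apply (h t) v", OF _ _ _ _ _ _ R(1) _ \<phi>(1)])
          show "\<bar>blinfun_apply (g n t) v\<bar> \<le> R * norm v" if "t \<in> space M" for n t v
            by (rule bnd[OF gelfand_actions_borel(1)[OF g that]])
          show "\<bar>blinfun_apply (h t) v\<bar> \<le> R * norm v" if "t \<in> space M" for t v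
            by (rule bnd[OF gelfand_actions_borel(1)[OF h that]])
          show "(\<lambda>n. LINT t:D|M. blinfun_apply (g n t) v) \<longlonglongrightarrow> (LINT t:D|M. blinfun_apply (h t) v)" if "D \<in> sets F" for D v
          proof -
            have c: "continuous_map (gelfand_actions A) euclideanreal (\<lambda>a. indicator D t * blinfun_apply a v)" for t
              unfolding gelfand_actions_def
              by (intro continuous_map_real_mult_left continuous_map_from_subtopology[OF weak_star_continuous_eval])
            have b: "\<bar>indicator D t * blinfun_apply a v\<bar> \<le> R * norm v" if "a \<in> A" for t a
              using bnd[OF that, of v] R(1) by (auto simp: indicator_def)
            have m: "(\<lambda>t. indicator D t * blinfun_apply a v) \<in> borel_measurable F" for a :: "'y \<Rightarrow>\<^sub>L real"
              by (intro borel_measurable_times borel_measurable_indicator that borel_measurable_const)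
            show ?thesis
              using conv[unfolded converges_in_law_F_def, rule_format, of "\<lambda>t a. indicator D t * blinfun_apply a v" "R * norm v"]
                c b m by (simp add: set_lebesgue_integral_def top)
          qed
        qed (use gelfand_actions_borel(2)[OF g] gelfand_actions_borel(2)[OF h] in \<open>auto intro: blinfun.bounded_linear_right\<close>)
        moreover have "\<Phi> (gelfand_cond_exp M F k) = (LINT t|M. blinfun_apply (k t) (\<phi> t))"
          if "k \<in> M \<rightarrow>\<^sub>M borel_of (gelfand_actions A)" for k
          unfolding \<phi>(2) by (rule gelfand_cond_exp_functional[OF A R(2) that \<phi>(1)])
        ultimately show "(\<lambda>n. \<Phi> (gelfand_cond_exp M F (g n))) \<longlonglongrightarrow> \<Phi> (gelfand_cond_exp M F h)"
          using g h by simp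
      qed
      then show ?thesis
        using agg[OF g] agg[OF h] unfolding gelfand_aggregates_def limitin_subtopology topspace_subtopology by auto
    qed
  qed
qed

end


section \<open>The Bochner case\<close>

lemma weak_continuous_functional: "continuous_map weak_topology euclideanreal (blinfun_apply f)"
  unfolding weak_topology_def by (rule continuous_map_initial_topology) simp

lemma topspace_weak_topology [simp]: "topspace weak_topology = UNIV"
  unfolding weak_topology_def by (rule topspace_initial_topology) auto

lemma limitin_weak_topology:
  fixes c :: "nat \<Rightarrow> 'x::real_normed_vector"
  assumes "\<And>\<phi> :: 'x \<Rightarrow>\<^sub>L real. (\<lambda>n. blinfun_apply \<phi> (c n)) \<longlonglongrightarrow> blinfun_apply \<phi> l"
  shows "limitin weak_topology c l sequentially"
  unfolding weak_topology_def by (rule limitin_initial_topology) (use assms in auto)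

text \<open>Weak compactness bounds \<open>A\<close> against each functional separately. Regarded as
  functionals on the dual space the points of \<open>A\<close> are then uniformly bounded by
  Banach-Steinhaus, and by Hahn-Banach the evaluation at a point has at least the norm of the
  point.\<close>

lemma weak_compact_bounded:
  fixes A :: "'x::real_normed_vector set"
  assumes "compactin weak_topology A"
  obtains R where "0 \<le> R" "\<And>a. a \<in> A \<Longrightarrow> norm a \<le> R"
proof -
  define ev where "ev a = Blinfun (\<lambda>f :: 'x \<Rightarrow>\<^sub>L real. blinfun_apply f a)" for a
  have ev: "blinfun_apply (ev a) f = blinfun_apply f a" for a f
    unfolding ev_def by (rule bounded_linear_Blinfun_apply[THEN fun_cong]) (rule blinfun.bounded_linear_left)
  have "\<exists>B. \<forall>\<phi>\<in>ev ` A. \<bar>blinfun_apply \<phi> f\<bar> \<le> B" for f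
  proof -
    have "compact (blinfun_apply f ` A)" using image_compactin[OF assms weak_continuous_functional[of f]] by simp
    then have "bounded (blinfun_apply f ` A)" by (rule compact_imp_bounded)
    then show ?thesis by (auto simp: bounded_iff ev)
  qed
  then obtain R where R: "0 \<le> R" "\<And>\<phi>. \<phi> \<in> ev ` A \<Longrightarrow> norm \<phi> \<le> R" using uniform_boundedness[of "ev ` A"] by metis
  have "norm a \<le> R" if a: "a \<in> A" for a
  proof -
    obtain f :: "'x \<Rightarrow>\<^sub>L real" where f: "norm f \<le> 1" "blinfun_apply f a = norm a" using norm_attaining_functional by blast
    have "norm a \<le> norm (ev a) * norm f" using norm_blinfun[of "ev a" f] f(2) by (simp add: ev)
    also have "\<dots> \<le> R * 1" using R(2)[of "ev a"] a f(1) R(1) by (intro mult_mono) auto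
    finally show ?thesis by simp
  qed
  then show ?thesis using that R(1) by blast
qed

lemma norming_sequence_le_iff:
  fixes \<nu> :: "nat \<Rightarrow> 'x::real_normed_vector \<Rightarrow>\<^sub>L real"
  assumes \<nu>: "\<And>i. norm (\<nu> i) \<le> 1" "\<forall>x. \<forall>\<epsilon>>0. \<exists>i. norm x < blinfun_apply (\<nu> i) x + \<epsilon>"
  shows "norm x \<le> c \<longleftrightarrow> (\<forall>i. blinfun_apply (\<nu> i) x \<le> c)"
proof
  assume c: "norm x \<le> c"
  show "\<forall>i. blinfun_apply (\<nu> i) x \<le> c"
  proof
    fix i
    have "\<bar>blinfun_apply (\<nu> i) x\<bar> \<le> norm (\<nu> i) * norm x" using norm_blinfun[of "\<nu> i" x] by simp
    also have "\<dots> \<le> 1 * norm x" using \<nu>(1) by (intro mult_right_mono) auto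
    finally show "blinfun_apply (\<nu> i) x \<le> c" using c by linarith
  qed
next
  assume c: "\<forall>i. blinfun_apply (\<nu> i) x \<le> c"
  show "norm x \<le> c"
  proof (rule field_le_epsilon)
    fix e :: real assume "e > 0"
    then obtain i where "norm x < blinfun_apply (\<nu> i) x + e" using \<nu>(2) by blast
    then show "norm x \<le> c + e" using c[rule_format, of i] by linarith
  qed
qed

lemma norming_sequence_eqI:
  fixes \<nu> :: "nat \<Rightarrow> 'x::real_normed_vector \<Rightarrow>\<^sub>L real"
  assumes \<nu>: "\<And>i. norm (\<nu> i) \<le> 1" "\<forall>x. \<forall>\<epsilon>>0. \<exists>i. norm x < blinfun_apply (\<nu> i) x + \<epsilon>"
    and eq: "\<And>i. blinfun_apply (\<nu> i) x = blinfun_apply (\<nu> i) y"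
  shows "x = y"
proof -
  have "norm (x - y) \<le> 0"
  proof (rule norming_sequence_le_iff[OF \<nu>, THEN iffD2], intro allI)
    show "blinfun_apply (\<nu> i) (x - y) \<le> 0" for i using eq[of i] by (simp add: blinfun.diff_right)
  qed
  then show ?thesis by simp
qed

text \<open>Pettis: by a norming sequence, the condition that \<open>g t\<close> lies in a given
  closed ball is a countable conjunction of scalar conditions. Taking the first point of a dense
  sequence that is close to \<open>g t\<close> gives measurable, countably valued
  approximations.\<close>

lemma weakly_measurable_imp_borel_measurable:
  fixes g :: "'t \<Rightarrow> 'x::{real_normed_vector, second_countable_topology}"
  assumes g: "\<And>\<phi> :: 'x \<Rightarrow>\<^sub>L real. (\<lambda>t. blinfun_apply \<phi> (g t)) \<in> borel_measurable M"
  shows "g \<in> borel_measurable M"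
proof -
  obtain \<nu> :: "nat \<Rightarrow> 'x \<Rightarrow>\<^sub>L real" where \<nu>: "\<And>i. norm (\<nu> i) \<le> 1"
    "\<forall>x. \<forall>\<epsilon>>0. \<exists>i. norm x < blinfun_apply (\<nu> i) x + \<epsilon>" using norming_sequence by blast
  obtain d :: "nat \<Rightarrow> 'x" where d: "\<And>x e. e > 0 \<Longrightarrow> \<exists>i. dist (d i) x < e" using dense_sequence_UNIV by blast
  have m: "Measurable.pred M (\<lambda>t. norm (g t - d i) \<le> c)" for i c
  proof -
    have [measurable]: "(\<lambda>t. blinfun_apply (\<nu> j) (g t)) \<in> borel_measurable M" for j by (rule g)
    have eq: "norm (g t - d i) \<le> c \<longleftrightarrow> (\<forall>j. blinfun_apply (\<nu> j) (g t) - blinfun_apply (\<nu> j) (d i) \<le> c)" for t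
      by (subst norming_sequence_le_iff[OF \<nu>]) (auto simp: blinfun.diff_right)
    show ?thesis unfolding eq by measurable
  qed
  define s where "s k t = (LEAST i. norm (g t - d i) \<le> 1 / Suc k)" for k t
  have s: "norm (g t - d (s k t)) \<le> 1 / Suc k" for k t
  proof -
    obtain i where "dist (d i) (g t) < 1 / Suc k" using d[of "1 / Suc k" "g t"] by auto
    then have "norm (g t - d i) \<le> 1 / Suc k" by (simp add: dist_norm norm_minus_commute)
    then show ?thesis unfolding s_def by (rule LeastI)
  qed
  have sM: "s k \<in> M \<rightarrow>\<^sub>M count_space UNIV" for k unfolding s_def using m by (intro measurable_Least)
  show ?thesis
  proof (rule borel_measurable_LIMSEQ_metric)
    show "(\<lambda>t. d (s k t)) \<in> borel_measurable M" for k
      by (rule measurable_compose_countable'[where f = "\<lambda>i t. d i" and g = "s k", OF _ sM]) auto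
    show "(\<lambda>k. d (s k t)) \<longlonglongrightarrow> g t" for t
    proof (rule Lim_null_comparison[THEN LIM_zero_cancel])
      show "\<forall>\<^sub>F k in sequentially. norm (d (s k t) - g t) \<le> 1 / Suc k"
        using s[of t] by (intro always_eventually) (simp add: norm_minus_commute)
      show "(\<lambda>n. 1 / real (Suc n)) \<longlonglongrightarrow> 0" using LIMSEQ_inverse_real_of_nat by (simp add: inverse_eq_divide)
    qed
  qed
qed

lemma bochner_actions_borel:
  fixes A :: "'x::{real_normed_vector, second_countable_topology} set"
  assumes g: "g \<in> M \<rightarrow>\<^sub>M borel_of (bochner_actions A)"
  shows "t \<in> space M \<Longrightarrow> g t \<in> A" "g \<in> borel_measurable M"
proof -
  show "g t \<in> A" if "t \<in> space M" using measurable_space[OF g that] by (simp add: bochner_actions_def)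
  show "g \<in> borel_measurable M"
  proof (rule weakly_measurable_imp_borel_measurable)
    fix \<phi> :: "'x \<Rightarrow>\<^sub>L real"
    have "continuous_map (bochner_actions A) euclideanreal (blinfun_apply \<phi>)"
      unfolding bochner_actions_def by (rule continuous_map_from_subtopology[OF weak_continuous_functional])
    from continuous_map_borel_measurable[OF g this] show "(\<lambda>t. blinfun_apply \<phi> (g t)) \<in> borel_measurable M" .
  qed
qed

section \<open>Bochner conditional expectations\<close>

context prob_subalgebra
begin

text \<open>The approximating values are taken from \<open>A\<close> itself, so that averages of
  them stay in the convex hull of \<open>A\<close>.\<close>

lemma simple_norm_approximation:
  fixes g :: "'a \<Rightarrow> 'x::{banach, second_countable_topology}"
  assumes A: "A \<noteq> {}" and R: "\<And>a. a \<in> A \<Longrightarrow> norm a \<le> R" "0 \<le> R"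
    and g: "\<And>t. t \<in> space M \<Longrightarrow> g t \<in> A" "g \<in> borel_measurable M" and e: "e > 0"
  obtains N :: nat and x :: "nat \<Rightarrow> 'x" and S :: "'a \<Rightarrow> nat" where "\<And>i. x i \<in> A" "\<And>t. S t \<le> N"
    "\<And>i. {t\<in>space M. S t = i} \<in> sets M" "(\<lambda>t. x (S t)) \<in> borel_measurable M"
    "(LINT t|M. norm (g t - x (S t))) \<le> e"
proof -
  obtain T where T: "countable T" "T \<subseteq> A" "A \<subseteq> closure T" by (rule separable)
  then have "T \<noteq> {}" using A by auto
  define x where "x = from_nat_into T"
  have rx: "range x = T" unfolding x_def using T(1) \<open>T \<noteq> {}\<close> by (intro range_from_nat_into)
  have xA: "x i \<in> A" for i using rx T(2) by auto
  \<comment> \<open>The error is at most \<open>\<delta>\<close> where the index does not exceed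
    \<open>N\<close>, and increases by at most \<open>2 * R\<close> on the remaining set of measure
    below \<open>\<delta>\<close>; together this gives \<open>e\<close>.\<close>
  define \<delta> where "\<delta> = e / (2 * R + 1)"
  have \<delta>: "\<delta> > 0" using e R(2) by (simp add: \<delta>_def)
  define s where "s t = (LEAST i. norm (g t - x i) \<le> \<delta>)" for t
  have s: "norm (g t - x (s t)) \<le> \<delta>" if "t \<in> space M" for t
  proof -
    have "g t \<in> closure T" using g(1)[OF that] T(3) by auto
    then have "\<exists>y\<in>T. dist y (g t) < \<delta>" using \<delta> by (simp add: closure_approachable)
    then obtain i where "dist (x i) (g t) < \<delta>" using rx by (metis rangeE)
    then have "norm (g t - x i) \<le> \<delta>" by (simp add: dist_norm norm_minus_commute)
    then show ?thesis unfolding s_def by (rule LeastI)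
  qed
  have sM: "s \<in> M \<rightarrow>\<^sub>M count_space UNIV"
    unfolding s_def using g(2) by (intro measurable_Least) measurable
  have sN: "{t\<in>space M. s t > N} \<in> sets M" for N using sM by measurable
  have "(\<lambda>N. measure M {t\<in>space M. s t > N}) \<longlonglongrightarrow> measure M (\<Inter>N. {t\<in>space M. s t > N})"
    using sN by (intro finite_Lim_measure_decseq) (auto simp: decseq_def)
  moreover have "(\<Inter>N. {t\<in>space M. s t > N}) = {}" by auto
  ultimately have "(\<lambda>N. measure M {t\<in>space M. s t > N}) \<longlonglongrightarrow> 0" by simp
  from LIMSEQ_D[OF this \<delta>] obtain N where N: "measure M {t\<in>space M. s t > N} < \<delta>" by auto
  \<comment> \<open>Indices above \<open>N\<close> are replaced by 0, which leaves finitely many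
    values, all of them in \<open>A\<close>.\<close>
  define S where "S t = (if s t > N then 0 else s t)" for t
  have SM: "S \<in> M \<rightarrow>\<^sub>M count_space UNIV" unfolding S_def using sM by measurable
  have gS: "(\<lambda>t. x (S t)) \<in> borel_measurable M"
    by (rule measurable_compose_countable'[where f = "\<lambda>i t. x i" and g = S, OF _ SM]) auto
  have le: "norm (g t - x (S t)) \<le> \<delta> + 2 * R * indicator {t\<in>space M. s t > N} t" if t: "t \<in> space M" for t
  proof (cases "s t > N")
    case True
    have "norm (g t - x 0) \<le> R + R" using R(1)[OF g(1)[OF t]] R(1)[OF xA[of 0]] norm_triangle_ineq4[of "g t" "x 0"] by linarith
    then show ?thesis using True t \<delta> by (simp add: S_def)
  qed (use s[OF t] in \<open>simp add: S_def\<close>)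
  have "(LINT t|M. norm (g t - x (S t))) \<le> (LINT t|M. \<delta> + 2 * R * indicator {t\<in>space M. s t > N} t)"
  proof (rule integral_mono)
    show "integrable M (\<lambda>t. norm (g t - x (S t)))"
    proof (rule integrable_const_bound[of _ "R + R"])
      show "AE t in M. norm (norm (g t - x (S t))) \<le> R + R"
      proof (rule AE_I2)
        fix t assume t: "t \<in> space M"
        show "norm (norm (g t - x (S t))) \<le> R + R"
          using R(1)[OF g(1)[OF t]] R(1)[OF xA[of "S t"]] norm_triangle_ineq4[of "g t" "x (S t)"] by simp
      qed
    qed (use g(2) gS in measurable)
    show "integrable M (\<lambda>t. \<delta> + 2 * R * indicator {t\<in>space M. s t > N} t)"
      using sN[of N] by (intro Bochner_Integration.integrable_add integrable_mult_right) auto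
  qed (rule le)
  also have "\<dots> = \<delta> + 2 * R * measure M {t\<in>space M. s t > N}"
    using sN[of N] prob_space by (simp add: emeasure_eq_measure)
  also have "\<dots> \<le> \<delta> + 2 * R * \<delta>" using N R(2) by (intro add_left_mono mult_left_mono) auto
  also have "\<dots> = \<delta> * (2 * R + 1)" by (simp add: algebra_simps)
  also have "\<dots> = e" using R(2) by (simp add: \<delta>_def)
  finally have le_e: "(LINT t|M. norm (g t - x (S t))) \<le> e" .
  show ?thesis
  proof (rule that[of x S N])
    show "S t \<le> N" for t by (simp add: S_def)
    show "{t\<in>space M. S t = i} \<in> sets M" for i using SM by measurable
  qed (fact xA gS le_e)+
qed


text \<open>A bounded weak* measurable field of functionals on the value space. Integration against
  such fields yields the functionals on the integrable \<open>F\<close>-measurable functions; see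
  \<open>L1_dual_representation\<close>.\<close>

definition F_dual_field :: "('a \<Rightarrow> 'x::real_normed_vector \<Rightarrow> real) \<Rightarrow> real \<Rightarrow> bool" where
  "F_dual_field L K \<longleftrightarrow> (\<forall>t\<in>space M. bounded_linear (L t)) \<and> (\<forall>v. (\<lambda>t. L t v) \<in> borel_measurable F) \<and>
     (\<forall>t\<in>space M. \<forall>v. \<bar>L t v\<bar> \<le> K * norm v)"

lemma F_dual_fieldD:
  assumes "F_dual_field L K"
  shows "t \<in> space M \<Longrightarrow> bounded_linear (L t)" "(\<lambda>t. L t v) \<in> borel_measurable F"
    "(\<lambda>t. L t v) \<in> borel_measurable M" "t \<in> space M \<Longrightarrow> \<bar>L t v\<bar> \<le> K * norm v"
  using assms meas_F by (auto simp: F_dual_field_def)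

lemma F_dual_field_indicator:
  fixes \<phi> :: "'x::real_normed_vector \<Rightarrow>\<^sub>L real"
  assumes B: "B \<in> sets F"
  shows "F_dual_field (\<lambda>t v. indicator B t * blinfun_apply \<phi> v) (norm \<phi>)"
  unfolding F_dual_field_def
proof (intro conjI ballI allI)
  show "bounded_linear (\<lambda>v. indicator B t * blinfun_apply \<phi> v)" for t
    by (intro bounded_linear_const_mult blinfun.bounded_linear_right)
  show "(\<lambda>t. indicator B t * blinfun_apply \<phi> v) \<in> borel_measurable F" for v
    by (intro borel_measurable_times borel_measurable_indicator B borel_measurable_const)
  show "\<bar>indicator B t * blinfun_apply \<phi> v\<bar> \<le> norm \<phi> * norm v" for t v
    using norm_blinfun[of \<phi> v] by (auto simp: indicator_def)
qed

text \<open>For a finitely valued approximation the conditional expectation is explicit: the values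
  averaged with their conditional probabilities. Since an \<open>F_dual_field\<close> is
  \<open>F\<close>-measurable at each value, it may be integrated against conditional probabilities
  in place of indicators.\<close>

lemma finite_valued_cond_exp:
  fixes g :: "'a \<Rightarrow> 'x::{banach, second_countable_topology}"
  assumes A: "A \<noteq> {}" and R: "\<And>a. a \<in> A \<Longrightarrow> norm a \<le> R" "0 \<le> R"
    and g: "\<And>t. t \<in> space M \<Longrightarrow> g t \<in> A" "g \<in> borel_measurable M" and e: "e > 0"
  shows "\<exists>f' g'. f' \<in> borel_measurable F \<and> g' \<in> borel_measurable M \<and> (\<forall>t. f' t \<in> convex hull A) \<and> (\<forall>t. g' t \<in> A) \<and>
    (LINT t|M. norm (g t - g' t)) \<le> e \<and>
    (\<forall>L K. F_dual_field L K \<longrightarrow> (LINT t|M. L t (f' t)) = (LINT t|M. L t (g' t)))"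
proof -
  obtain N :: nat and x :: "nat \<Rightarrow> 'x" and S :: "'a \<Rightarrow> nat" where x: "\<And>i. x i \<in> A" and SN: "\<And>t. S t \<le> N"
    and SM: "\<And>i. {t\<in>space M. S t = i} \<in> sets M" and gM: "(\<lambda>t. x (S t)) \<in> borel_measurable M"
    and le: "(LINT t|M. norm (g t - x (S t))) \<le> e"
    by (rule simple_norm_approximation[OF A R g e]) (assumption | rule that)+
  obtain p :: "nat \<Rightarrow> 'a \<Rightarrow> real" where pF: "\<And>i. p i \<in> borel_measurable F" and p0: "\<And>i t. i \<in> {..N} \<Longrightarrow> 0 \<le> p i t"
    and p1: "\<And>t. (\<Sum>i\<le>N. p i t) = 1" and pI: "\<And>i. i \<in> {..N} \<Longrightarrow> integrable M (p i)"
    and pint: "\<And>i B. i \<in> {..N} \<Longrightarrow> B \<in> sets F \<Longrightarrow> (LINT t:B|M. p i t) = measure M (B \<inter> {t\<in>space M. S t = i})"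
    by (rule finite_valued_conditional_law[of "{..N}" S]) (use SN SM in auto)
  define f' where "f' t = (\<Sum>i\<le>N. p i t *\<^sub>R x i)" for t
  have "f' \<in> borel_measurable F" unfolding f'_def using pF by (intro borel_measurable_sum borel_measurable_scaleR) auto
  moreover have "f' t \<in> convex hull A" for t
    unfolding f'_def using p0 p1 x hull_subset[of A convex] by (intro convex_sum) (auto simp: convex_convex_hull)
  moreover have "(LINT t|M. L t (f' t)) = (LINT t|M. L t (x (S t)))" if L: "F_dual_field L K" for L K
  proof -
    note L = F_dual_fieldD[OF L]
    have LI: "integrable M (\<lambda>t. L t v)" for v
      using L(3,4) by (intro integrable_const_bound[of _ "K * norm v"]) auto
    have i1: "integrable M (\<lambda>t. L t (x i) * p i t)" if "i \<in> {..N}" for i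
    proof (rule Bochner_Integration.integrable_bound[of M "\<lambda>t. K * norm (x i) * p i t"])
      show "AE t in M. norm (L t (x i) * p i t) \<le> norm (K * norm (x i) * p i t)"
      proof (rule AE_I2)
        fix t assume "t \<in> space M"
        then have "\<bar>L t (x i)\<bar> \<le> \<bar>K * norm (x i)\<bar>" using L(4)[of t "x i"] by linarith
        then show "norm (L t (x i) * p i t) \<le> norm (K * norm (x i) * p i t)"
          by (simp only: real_norm_def abs_mult[of _ "p i t"]) (rule mult_right_mono, auto)
      qed
    qed (use pI[OF that] L(3) meas_F[OF pF] in auto)
    have i2: "integrable M (\<lambda>t. L t (x i) * indicator {t\<in>space M. S t = i} t)" for i
      using integrable_mult_indicator[OF SM LI, of i "x i"] by (simp add: mult.commute)
    have "(LINT t|M. L t (f' t)) = (LINT t|M. (\<Sum>i\<le>N. L t (x i) * p i t))"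
    proof (rule Bochner_Integration.integral_cong[OF refl])
      fix t assume "t \<in> space M"
      then interpret bounded_linear "L t" by (rule L(1))
      show "L t (f' t) = (\<Sum>i\<le>N. L t (x i) * p i t)" by (simp add: f'_def sum scaleR mult.commute)
    qed
    also have "\<dots> = (\<Sum>i\<le>N. LINT t|M. L t (x i) * p i t)"
      using i1 by (intro Bochner_Integration.integral_sum) auto
    also have "\<dots> = (\<Sum>i\<le>N. LINT t|M. L t (x i) * indicator {t\<in>space M. S t = i} t)"
    proof (rule sum.cong[OF refl])
      fix i assume i: "i \<in> {..N}"
      show "(LINT t|M. L t (x i) * p i t) = (LINT t|M. L t (x i) * indicator {t\<in>space M. S t = i} t)"
        by (rule integral_indicator_density[OF L(2) L(4) SM pF pI[OF i], symmetric]) (auto simp: pint[OF i])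
    qed
    also have "\<dots> = (LINT t|M. (\<Sum>i\<le>N. L t (x i) * indicator {t\<in>space M. S t = i} t))"
      using i2 by (intro Bochner_Integration.integral_sum[symmetric]) auto
    also have "\<dots> = (LINT t|M. L t (x (S t)))"
    proof (rule Bochner_Integration.integral_cong[OF refl])
      fix t assume t: "t \<in> space M"
      have "(\<Sum>i\<le>N. L t (x i) * indicator {t\<in>space M. S t = i} t) = (\<Sum>i\<le>N. if i = S t then L t (x i) else 0)"
        using t by (intro sum.cong) (auto simp: indicator_def)
      then show "(\<Sum>i\<le>N. L t (x i) * indicator {t\<in>space M. S t = i} t) = L t (x (S t))" using SN[of t] by simp
    qed
    finally show ?thesis .
  qed
  ultimately show ?thesis
    using x gM le by (intro exI[of _ f'] exI[of _ "\<lambda>t. x (S t)"] conjI allI impI) auto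
qed

text \<open>The limit has to exist in the space itself, hence in norm. The profiles
  \<open>gk k\<close> approximate \<open>g\<close> within \<open>1 / 2 ^ k\<close> in the mean, and
  the distance of successive conditional expectations \<open>fk k\<close> is at most the conditional
  mean \<open>c k\<close> of the distance of successive \<open>gk k\<close>. The integrals of the
  \<open>c k\<close> are summable, so almost everywhere the \<open>fk k\<close> form a Cauchy
  sequence.\<close>

lemma bochner_conditional_expectation:
  fixes g :: "'a \<Rightarrow> 'x::{banach, second_countable_topology}"
  assumes A: "A \<noteq> {}" and R: "\<And>a. a \<in> A \<Longrightarrow> norm a \<le> R" "0 \<le> R"
    and g: "\<And>t. t \<in> space M \<Longrightarrow> g t \<in> A" "g \<in> borel_measurable M"
  obtains f where "f \<in> borel_measurable F" "\<And>t. norm (f t) \<le> R"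
    "\<And>t. f t \<in> weak_topology closure_of (convex hull A)"
    "\<And>L K. F_dual_field L K \<Longrightarrow> (LINT t|M. L t (f t)) = (LINT t|M. L t (g t))"
proof -
  define app where "app k fg \<longleftrightarrow> fst fg \<in> borel_measurable F \<and> snd fg \<in> borel_measurable M \<and>
    (\<forall>t. fst fg t \<in> convex hull A) \<and> (\<forall>t. snd fg t \<in> A) \<and> (LINT t|M. norm (g t - snd fg t)) \<le> 1 / 2 ^ k \<and>
    (\<forall>L K. F_dual_field L K \<longrightarrow> (LINT t|M. L t (fst fg t)) = (LINT t|M. L t (snd fg t)))"
    for k :: nat and fg :: "('a \<Rightarrow> 'x) \<times> ('a \<Rightarrow> 'x)"
  have "\<exists>fg. app k fg" for k
  proof -
    have "(0::real) < 1 / 2 ^ k" by simp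
    from finite_valued_cond_exp[OF A R g this] show ?thesis by (auto simp: app_def)
  qed
  then obtain fg where fg: "\<And>k. app k (fg k)" by metis
  define fk where "fk k = fst (fg k)" for k
  define gk where "gk k = snd (fg k)" for k
  have fkF: "fk k \<in> borel_measurable F" and gkM: "gk k \<in> borel_measurable M" and fkh: "fk k t \<in> convex hull A"
    and gkA: "gk k t \<in> A" and gk: "(LINT t|M. norm (g t - gk k t)) \<le> 1 / 2 ^ k"
    and pair: "F_dual_field L K \<Longrightarrow> (LINT t|M. L t (fk k t)) = (LINT t|M. L t (gk k t))" for k t L K
    using fg[of k] by (auto simp: app_def fk_def gk_def)
  have fkM: "fk k \<in> borel_measurable M" for k by (rule meas_F[OF fkF])
  have hullR: "norm a \<le> R" if "a \<in> convex hull A" for a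
  proof -
    have "convex hull A \<subseteq> cball 0 R" using R by (intro hull_minimal) (auto simp: dist_norm)
    then show ?thesis using that by auto
  qed
  have gI: "integrable M g" using g R by (intro integrable_const_bound[of _ R]) auto
  have gkI: "integrable M (gk k)" for k using gkM gkA R by (intro integrable_const_bound[of _ R]) auto
  have fkI: "integrable M (fk k)" for k using fkM hullR[OF fkh] by (intro integrable_const_bound[of _ R]) auto
  obtain \<nu> :: "nat \<Rightarrow> 'x \<Rightarrow>\<^sub>L real" where \<nu>: "\<And>i. norm (\<nu> i) \<le> 1"
    "\<forall>x. \<forall>\<epsilon>>0. \<exists>i. norm x < blinfun_apply (\<nu> i) x + \<epsilon>" using norming_sequence by blast
  have \<nu>n: "blinfun_apply (\<nu> i) x \<le> norm x" for i x
    using norming_sequence_le_iff[OF \<nu>, of x "norm x"] by simp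
  define c where "c k = real_cond_exp M F (\<lambda>t. norm (gk k t - gk (Suc k) t))" for k
  have dI: "integrable M (\<lambda>t. norm (gk k t - gk (Suc k) t))" for k using gkI by auto
  have cI: "integrable M (c k)" "c k \<in> borel_measurable F" "(LINT t|M. c k t) = (LINT t|M. norm (gk k t - gk (Suc k) t))" for k
    unfolding c_def using dI by (auto intro: real_cond_exp_int)
  have cint: "(LINT t:B|M. c k t) = (LINT t:B|M. norm (gk k t - gk (Suc k) t))" if "B \<in> sets F" for B k
    unfolding c_def using real_cond_exp_intA[OF dI that] by simp
  have \<nu>int: "(LINT t:B|M. blinfun_apply (\<nu> i) (fk k t)) = (LINT t:B|M. blinfun_apply (\<nu> i) (gk k t))" if "B \<in> sets F" for B k i
    using pair[OF F_dual_field_indicator[OF that, of "\<nu> i"], of k] by (simp add: set_lebesgue_integral_def)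
  have \<nu>I: "integrable M (\<lambda>t. blinfun_apply (\<nu> i) (u t))" if "integrable M u" for u i
    by (rule integrable_bounded_linear[OF blinfun.bounded_linear_right that])
  \<comment> \<open>The conditional Jensen inequality for the norm, obtained from the countably many
    norming functionals by testing on \<open>F\<close>-sets.\<close>
  have step: "AE t in M. norm (fk k t - fk (Suc k) t) \<le> c k t" for k
  proof -
    have "AE t in M. 0 \<le> c k t - (blinfun_apply (\<nu> i) (fk k t) - blinfun_apply (\<nu> i) (fk (Suc k) t))" for i
    proof (rule AE_nonneg_of_set_integrals)
      have m: "(\<lambda>t. blinfun_apply (\<nu> i) (fk k t)) \<in> borel_measurable F" for k
        by (rule borel_measurable_continuous_on[OF _ fkF]) (intro continuous_intros)
      show "(\<lambda>t. c k t - (blinfun_apply (\<nu> i) (fk k t) - blinfun_apply (\<nu> i) (fk (Suc k) t))) \<in> borel_measurable F"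
        using m cI(2) by (intro borel_measurable_diff)
      show "integrable M (\<lambda>t. c k t - (blinfun_apply (\<nu> i) (fk k t) - blinfun_apply (\<nu> i) (fk (Suc k) t)))"
        using cI(1) \<nu>I[OF fkI] by (intro Bochner_Integration.integrable_diff)
      fix B assume B: "B \<in> sets F"
      have "(LINT t:B|M. c k t - (blinfun_apply (\<nu> i) (fk k t) - blinfun_apply (\<nu> i) (fk (Suc k) t))) =
        (LINT t:B|M. norm (gk k t - gk (Suc k) t)) - ((LINT t:B|M. blinfun_apply (\<nu> i) (gk k t)) - (LINT t:B|M. blinfun_apply (\<nu> i) (gk (Suc k) t)))"
        using set_integrable_F[OF B cI(1)[of k]] set_integrable_F[OF B \<nu>I[OF fkI]]
        by (simp add: set_integral_diff cint[OF B] \<nu>int[OF B])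
      also have "\<dots> = (LINT t:B|M. norm (gk k t - gk (Suc k) t) - (blinfun_apply (\<nu> i) (gk k t) - blinfun_apply (\<nu> i) (gk (Suc k) t)))"
        using set_integrable_F[OF B dI[of k]] set_integrable_F[OF B \<nu>I[OF gkI]] by (simp add: set_integral_diff)
      also have "\<dots> \<ge> 0"
        unfolding set_lebesgue_integral_def using \<nu>n[of i "gk k _ - gk (Suc k) _"]
        by (intro Bochner_Integration.integral_nonneg) (auto simp: indicator_def blinfun.diff_right)
      finally show "0 \<le> (LINT t:B|M. c k t - (blinfun_apply (\<nu> i) (fk k t) - blinfun_apply (\<nu> i) (fk (Suc k) t)))" .
    qed
    then have "AE t in M. \<forall>i. 0 \<le> c k t - (blinfun_apply (\<nu> i) (fk k t) - blinfun_apply (\<nu> i) (fk (Suc k) t))"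
      by (simp add: AE_all_countable)
    then show ?thesis
    proof eventually_elim
      case (elim t)
      show ?case
        by (rule norming_sequence_le_iff[OF \<nu>, THEN iffD2]) (use elim in \<open>auto simp: blinfun.diff_right\<close>)
    qed
  qed
  have cle: "(LINT t|M. c k t) \<le> 2 * (1 / 2) ^ k" for k
  proof -
    have I: "integrable M (\<lambda>t. norm (g t - gk k t))" for k using gI gkI by auto
    have "(LINT t|M. c k t) \<le> (LINT t|M. norm (g t - gk k t) + norm (g t - gk (Suc k) t))"
      unfolding cI(3) using dI I
    proof (intro integral_mono Bochner_Integration.integrable_add)
      fix t
      show "norm (gk k t - gk (Suc k) t) \<le> norm (g t - gk k t) + norm (g t - gk (Suc k) t)"
        using norm_triangle_ineq4[of "g t - gk (Suc k) t" "g t - gk k t"] by (simp add: algebra_simps)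
    qed
    also have "\<dots> = (LINT t|M. norm (g t - gk k t)) + (LINT t|M. norm (g t - gk (Suc k) t))" using I by simp
    also have "\<dots> \<le> 1 / 2 ^ k + 1 / 2 ^ Suc k" by (intro add_mono gk)
    also have "\<dots> \<le> 2 * (1 / 2) ^ k" by (simp add: power_divide field_simps)
    finally show ?thesis .
  qed
  have c0: "AE t in M. \<forall>k. 0 \<le> c k t"
    unfolding AE_all_countable
  proof
    fix k show "AE t in M. 0 \<le> c k t" using step[of k] by eventually_elim (rule order_trans[OF norm_ge_zero])
  qed
  have "AE t in M. summable (\<lambda>k. c k t)"
  proof -
    have cM: "c k \<in> borel_measurable M" for k by (rule meas_F[OF cI(2)])
    have nn: "(\<integral>\<^sup>+t. ennreal (c k t) \<partial>M) = ennreal (LINT t|M. c k t)" for k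
      using c0 by (intro nn_integral_eq_integral cI(1)) (auto elim: eventually_mono)
    have "(\<integral>\<^sup>+t. (\<Sum>k. ennreal (c k t)) \<partial>M) = (\<Sum>k. \<integral>\<^sup>+t. ennreal (c k t) \<partial>M)"
      using cM by (intro nn_integral_suminf) auto
    also have "\<dots> \<le> (\<Sum>k. ennreal (2 * (1 / 2) ^ k))"
      unfolding nn by (intro suminf_le ennreal_leI cle summableI)
    also have "\<dots> = ennreal (\<Sum>k. 2 * (1 / 2) ^ k)"
      by (intro suminf_ennreal2 summable_mult summable_geometric) auto
    also have "\<dots> < \<infinity>" by simp
    finally have fin: "(\<integral>\<^sup>+t. (\<Sum>k. ennreal (c k t)) \<partial>M) \<noteq> \<infinity>" by simp
    have "AE t in M. (\<Sum>k. ennreal (c k t)) \<noteq> \<infinity>"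
      using cM by (intro nn_integral_noteq_infinite fin) measurable
    with c0 show ?thesis
      by eventually_elim (auto intro!: summable_suminf_not_top)
  qed
  then have CauAE: "AE t in M. Cauchy (\<lambda>k. fk k t)"
  proof -
    have "AE t in M. \<forall>k. norm (fk k t - fk (Suc k) t) \<le> c k t" using step by (simp add: AE_all_countable)
    with \<open>AE t in M. summable (\<lambda>k. c k t)\<close> show ?thesis
    proof eventually_elim
      case (elim t)
      have "summable (\<lambda>k. fk (Suc k) t - fk k t)"
        by (rule summable_comparison_test[OF _ elim(1)]) (use elim(2) in \<open>auto simp: norm_minus_commute\<close>)
      then have "convergent (\<lambda>n. \<Sum>k<n. fk (Suc k) t - fk k t)" by (simp add: summable_iff_convergent)
      then have "convergent (\<lambda>n. (\<Sum>k<n. fk (Suc k) t - fk k t) + fk 0 t)" by (intro convergent_add convergent_const)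
      then have "convergent (\<lambda>n. fk n t)" by (simp add: sum_lessThan_telescope[of "\<lambda>k. fk k t"])
      then show ?case by (rule convergent_Cauchy)
    qed
  qed
  obtain a0 where a0: "a0 \<in> A" using A by blast
  \<comment> \<open>The Cauchy condition defines an \<open>F\<close>-set, so the constant value
    outside of it preserves \<open>F\<close>-measurability and keeps all values in the closed convex
    hull.\<close>
  define f where "f t = (if Cauchy (\<lambda>k. fk k t) then lim (\<lambda>k. fk k t) else a0)" for t
  have fF: "f \<in> borel_measurable F"
    unfolding f_def using fkF by measurable
  have flim: "(\<lambda>k. fk k t) \<longlonglongrightarrow> f t" if "Cauchy (\<lambda>k. fk k t)" for t
    using that by (simp add: f_def Cauchy_convergent_iff convergent_LIMSEQ_iff)
  have fR: "norm (f t) \<le> R" for t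
  proof (cases "Cauchy (\<lambda>k. fk k t)")
    case True
    from tendsto_norm[OF flim[OF this]] show ?thesis
      by (rule LIMSEQ_le_const2) (use hullR[OF fkh] in auto)
  qed (use R(1)[OF a0] in \<open>simp add: f_def\<close>)
  have fcl: "f t \<in> weak_topology closure_of (convex hull A)" for t
  proof (cases "Cauchy (\<lambda>k. fk k t)")
    case True
    have "limitin weak_topology (\<lambda>k. fk k t) (f t) sequentially"
      by (rule limitin_weak_topology) (intro tendsto_intros flim True)
    then show ?thesis by (rule limitin_sequence_closure_of) (rule fkh)
  next
    case False
    then have "f t \<in> convex hull A" using a0 hull_inc by (simp add: f_def)
    then show ?thesis using closure_of_subset[of "convex hull A" weak_topology] by auto
  qed
  have "(LINT t|M. L t (f t)) = (LINT t|M. L t (g t))" if L: "F_dual_field L K" for L K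
  proof -
    note LD = F_dual_fieldD[OF L]
    have Lm: "(\<lambda>t. L t (u t)) \<in> borel_measurable M" if "u \<in> borel_measurable M" for u
      by (rule measurable_pairing[OF LD(1,3) that])
    have K0: "\<bar>L t v\<bar> \<le> \<bar>K\<bar> * norm v" if "t \<in> space M" for t v
      using LD(4)[OF that, of v] mult_right_mono[OF abs_ge_self[of K] norm_ge_zero[of v]] by linarith
    have 1: "(\<lambda>k. LINT t|M. L t (fk k t)) \<longlonglongrightarrow> (LINT t|M. L t (f t))"
    proof (rule integral_dominated_convergence[where w = "\<lambda>_. \<bar>K\<bar> * R"])
      show "AE t in M. (\<lambda>k. L t (fk k t)) \<longlonglongrightarrow> L t (f t)"
        using CauAE AE_space by eventually_elim (rule bounded_linear.tendsto[OF LD(1)], auto intro: flim)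
      show "AE t in M. norm (L t (fk k t)) \<le> \<bar>K\<bar> * R" for k
      proof (rule AE_I2)
        fix t assume t: "t \<in> space M"
        have "\<bar>L t (fk k t)\<bar> \<le> \<bar>K\<bar> * norm (fk k t)" by (rule K0[OF t])
        also have "\<dots> \<le> \<bar>K\<bar> * R" by (intro mult_left_mono hullR fkh) auto
        finally show "norm (L t (fk k t)) \<le> \<bar>K\<bar> * R" by simp
      qed
    qed (use Lm[OF fkM] Lm[OF meas_F[OF fF]] in auto)
    have 2: "(\<lambda>k. LINT t|M. L t (gk k t)) \<longlonglongrightarrow> (LINT t|M. L t (g t))"
    proof (rule LIM_zero_cancel, rule Lim_null_comparison)
      have "norm ((LINT t|M. L t (gk k t)) - (LINT t|M. L t (g t))) \<le> \<bar>K\<bar> * (1 / 2) ^ k" for k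
      proof -
        have d: "integrable M (\<lambda>t. gk k t - g t)" using gI gkI by auto
        have i: "integrable M (\<lambda>t. L t (gk k t))" "integrable M (\<lambda>t. L t (g t))"
          by (rule integrable_pairing(1)[OF LD(1,3) K0 gkI] integrable_pairing(1)[OF LD(1,3) K0 gI]; assumption)+
        have "(LINT t|M. L t (gk k t)) - (LINT t|M. L t (g t)) = (LINT t|M. L t (gk k t - g t))"
        proof -
          have "(LINT t|M. L t (gk k t - g t)) = (LINT t|M. L t (gk k t) - L t (g t))"
            by (intro Bochner_Integration.integral_cong refl) (simp add: linear_simps(2)[OF LD(1)])
          then show ?thesis using i by simp
        qed
        also have "norm \<dots> \<le> \<bar>K\<bar> * (LINT t|M. norm (gk k t - g t))"
          using integrable_pairing(2)[OF LD(1,3) K0 d] by simp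
        also have "\<dots> \<le> \<bar>K\<bar> * (1 / 2) ^ k"
          using gk[of k] by (intro mult_left_mono) (auto simp: norm_minus_commute power_divide)
        finally show ?thesis .
      qed
      then show "\<forall>\<^sub>F k in sequentially. norm ((LINT t|M. L t (gk k t)) - (LINT t|M. L t (g t))) \<le> \<bar>K\<bar> * (1 / 2) ^ k"
        by (intro always_eventually allI)
      have "(\<lambda>k. \<bar>K\<bar> * (1 / 2 :: real) ^ k) \<longlonglongrightarrow> \<bar>K\<bar> * 0"
        by (intro tendsto_intros LIMSEQ_realpow_zero) auto
      then show "(\<lambda>k. \<bar>K\<bar> * (1 / 2 :: real) ^ k) \<longlonglongrightarrow> 0" by simp
    qed
    show ?thesis using 1 2 unfolding pair[OF L] by (rule LIMSEQ_unique)
  qed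
  then show ?thesis using that[of f] fF fR fcl by blast
qed

end

section \<open>Functionals on L1 over the sub-\<sigma>-algebra\<close>

lemma L1_dual_bound:
  fixes \<Phi> :: "('b \<Rightarrow> 'x::{banach, second_countable_topology}) \<Rightarrow> real"
  assumes "\<Phi> \<in> L1_dual N"
  obtains K where "0 \<le> K" "\<And>f. integrable N f \<Longrightarrow> \<bar>\<Phi> f\<bar> \<le> K * (LINT t|N. norm (f t))"
proof -
  obtain K where K: "\<And>f. integrable N f \<Longrightarrow> \<bar>\<Phi> f\<bar> \<le> K * (LINT t|N. norm (f t))"
    using assms unfolding L1_dual_def by blast
  have "\<bar>\<Phi> f\<bar> \<le> \<bar>K\<bar> * (LINT t|N. norm (f t))" if "integrable N f" for f
  proof -
    have "0 \<le> (LINT t|N. norm (f t))" by (rule Bochner_Integration.integral_nonneg) simp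
    then show ?thesis using K[OF that] mult_right_mono[OF abs_ge_self[of K]] by (meson order_trans)
  qed
  then show ?thesis using that[of "\<bar>K\<bar>"] by simp
qed

lemma L1_dual_linear:
  assumes "\<Phi> \<in> L1_dual N" "integrable N f" "integrable N h"
  shows "\<Phi> (\<lambda>t. f t + r *\<^sub>R h t) = \<Phi> f + r * \<Phi> h"
proof -
  have "integrable N (\<lambda>t. r *\<^sub>R h t)" using assms(3) by simp
  then have "\<Phi> (\<lambda>t. f t + r *\<^sub>R h t) = \<Phi> f + \<Phi> (\<lambda>t. r *\<^sub>R h t)"
    using assms(1,2) unfolding L1_dual_def by blast
  moreover have "\<Phi> (\<lambda>t. r *\<^sub>R h t) = r * \<Phi> h" using assms(1,3) unfolding L1_dual_def by blast
  ultimately show ?thesis by simp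
qed

context prob_subalgebra
begin

lemma integrable_restr_iff:
  fixes f :: "'a \<Rightarrow> 'x::{banach, second_countable_topology}"
  shows "integrable (restr_to_subalg M F) f \<longleftrightarrow> f \<in> borel_measurable F \<and> integrable M f"
proof
  assume f: "integrable (restr_to_subalg M F) f"
  show "f \<in> borel_measurable F \<and> integrable M f"
    using integrable_from_subalg[OF subalg f] measurable_in_subalg'[OF subalg] borel_measurable_integrable[OF f] by blast
qed (use integrable_in_subalg[OF subalg] in blast)

lemma integral_restr:
  fixes f :: "'a \<Rightarrow> 'x::{banach, second_countable_topology}"
  assumes "f \<in> borel_measurable F"
  shows "(LINT t|restr_to_subalg M F. f t) = (LINT t|M. f t)"
  by (rule integral_subalgebra2[OF subalg assms])

lemma integrable_indicator_restr:
  fixes v :: "'x::{banach, second_countable_topology}"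
  assumes "D \<in> sets F"
  shows "integrable (restr_to_subalg M F) (\<lambda>t. indicator D t *\<^sub>R v)"
  unfolding integrable_restr_iff
proof
  show "(\<lambda>t. indicator D t *\<^sub>R v) \<in> borel_measurable F"
    by (intro borel_measurable_scaleR borel_measurable_indicator assms borel_measurable_const)
  show "integrable M (\<lambda>t. indicator D t *\<^sub>R v)" using integrable_indicator_finite[OF sets_F[OF assms]] by simp
qed

lemma integral_norm_indicator_restr:
  fixes v :: "'x::{banach, second_countable_topology}"
  assumes "D \<in> sets F"
  shows "(LINT t|restr_to_subalg M F. norm (indicator D t *\<^sub>R v)) = norm v * measure M D"
proof -
  have "(\<lambda>t. norm (indicator D t *\<^sub>R v)) \<in> borel_measurable F"
    by (intro borel_measurable_indicator assms borel_measurable_scaleR borel_measurable_const measurable_compose[OF _ borel_measurable_norm])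
  then have "(LINT t|restr_to_subalg M F. norm (indicator D t *\<^sub>R v)) = (LINT t|M. norm v * indicator D t)"
    by (subst integral_restr) (auto intro!: Bochner_Integration.integral_cong simp: indicator_def)
  then show ?thesis using sets_F[OF assms] by simp
qed

text \<open>For each vector \<open>d i\<close> of a dense sequence, the value of
  \<open>\<Phi>\<close> at the indicator of \<open>D\<close> times \<open>d i\<close> is additive in
  \<open>D\<close> and bounded by a multiple of \<open>measure M D\<close>, hence has a density
  \<open>\<phi> i\<close>. The densities inherit the linear relations and the norm bound almost
  everywhere, so that they are the values of one functional \<open>L t\<close> at the
  \<open>d i\<close>.\<close>

lemma L1_dual_representation:
  fixes \<Phi> :: "('a \<Rightarrow> 'x::{banach, second_countable_topology}) \<Rightarrow> real"
  assumes \<Phi>: "\<Phi> \<in> L1_dual (restr_to_subalg M F)"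
  obtains L :: "'a \<Rightarrow> 'x \<Rightarrow>\<^sub>L real" and K where "F_dual_field (\<lambda>t. blinfun_apply (L t)) K"
    "\<And>f. integrable (restr_to_subalg M F) f \<Longrightarrow> \<Phi> f = (LINT t|M. blinfun_apply (L t) (f t))"
proof -
  let ?N = "restr_to_subalg M F"
  obtain K where K: "0 \<le> K" "\<And>f. integrable ?N f \<Longrightarrow> \<bar>\<Phi> f\<bar> \<le> K * (LINT t|?N. norm (f t))"
    using L1_dual_bound[OF \<Phi>] by blast
  note lin = L1_dual_linear[OF \<Phi>]
  obtain d :: "nat \<Rightarrow> 'x" where d: "\<And>x e. e > 0 \<Longrightarrow> \<exists>i. dist (d i) x < e" using dense_sequence_UNIV by blast
  define m where "m i D = \<Phi> (\<lambda>t. indicator D t *\<^sub>R d i)" for i D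
  have mlin: "m i D + r * m j D + - 1 * m k D = \<Phi> (\<lambda>t. indicator D t *\<^sub>R (d i + r *\<^sub>R d j - d k))" if D: "D \<in> sets F" for D i j k r
  proof -
    note I = integrable_indicator_restr[OF D]
    have "integrable ?N (\<lambda>t. indicator D t *\<^sub>R d i + r *\<^sub>R (indicator D t *\<^sub>R d j))"
      by (intro Bochner_Integration.integrable_add integrable_scaleR_right I)
    from lin[OF this I[of "d k"], of "-1"] have
      "\<Phi> (\<lambda>t. indicator D t *\<^sub>R d i + r *\<^sub>R (indicator D t *\<^sub>R d j) + (-1) *\<^sub>R (indicator D t *\<^sub>R d k)) = m i D + r * m j D + - 1 * m k D"
      using lin[OF I I, of "d i" r "d j"] by (simp add: m_def)
    moreover have "(\<lambda>t. indicator D t *\<^sub>R d i + r *\<^sub>R (indicator D t *\<^sub>R d j) + (-1) *\<^sub>R (indicator D t *\<^sub>R d k)) =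
      (\<lambda>t. indicator D t *\<^sub>R (d i + r *\<^sub>R d j - d k))" by (auto simp: indicator_def)
    ultimately show ?thesis by simp
  qed
  have mbound: "\<bar>\<Phi> (\<lambda>t. indicator D t *\<^sub>R v)\<bar> \<le> K * norm v * measure M D" if D: "D \<in> sets F" for D v
    using K(2)[OF integrable_indicator_restr[OF D, of v]] unfolding integral_norm_indicator_restr[OF D] by (simp add: mult.assoc)
  define dens where "dens i \<phi> \<longleftrightarrow> \<phi> \<in> borel_measurable F \<and> (\<forall>t. \<bar>\<phi> t\<bar> \<le> K * norm (d i)) \<and> (\<forall>D\<in>sets F. (LINT t:D|M. \<phi> t) = m i D)"
    for i and \<phi> :: "'a \<Rightarrow> real"
  have "\<exists>\<phi>. dens i \<phi>" for i
  proof -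
    obtain \<phi> where "\<phi> \<in> borel_measurable F" "\<And>t. \<bar>\<phi> t\<bar> \<le> K * norm (d i)" "\<And>D. D \<in> sets F \<Longrightarrow> (LINT t:D|M. \<phi> t) = m i D"
    proof (rule bounded_additive_density[of "m i" "K * norm (d i)"])
      fix A B assume AB: "A \<in> sets F" "B \<in> sets F" "A \<inter> B = {}"
      have "(\<lambda>t. indicator (A \<union> B) t *\<^sub>R d i) = (\<lambda>t. indicator A t *\<^sub>R d i + 1 *\<^sub>R (indicator B t *\<^sub>R d i))"
        using AB(3) by (auto simp: indicator_def fun_eq_iff)
      then show "m i (A \<union> B) = m i A + m i B"
        unfolding m_def using lin[OF integrable_indicator_restr[OF AB(1)] integrable_indicator_restr[OF AB(2)], of "d i" 1 "d i"] by simp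
    qed (use mbound K(1) in \<open>auto simp: m_def\<close>)
    then show ?thesis by (auto simp: dens_def)
  qed
  then obtain \<phi> where \<phi>: "\<And>i. dens i (\<phi> i)" by metis
  have \<phi>F: "\<phi> i \<in> borel_measurable F" and \<phi>b: "\<bar>\<phi> i t\<bar> \<le> K * norm (d i)"
    and \<phi>D: "D \<in> sets F \<Longrightarrow> (LINT t:D|M. \<phi> i t) = m i D" for i t D
    using \<phi>[of i] by (auto simp: dens_def)
  have \<phi>M: "\<phi> i \<in> borel_measurable M" for i by (rule meas_F[OF \<phi>F])
  have \<phi>I: "integrable M (\<phi> i)" for i
    using \<phi>M \<phi>b by (intro integrable_const_bound[of _ "K * norm (d i)"]) auto
  \<comment> \<open>Rational coefficients leave countably many inequalities, so that the exceptional
    set is a null set of \<open>F\<close>; there \<open>L\<close> will be zero.\<close>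
  define P where "P t \<longleftrightarrow> (\<forall>i j k. \<forall>r\<in>\<rat>. \<bar>\<phi> i t + r * \<phi> j t - \<phi> k t\<bar> \<le> K * norm (d i + r *\<^sub>R d j - d k))" for t
  have PF: "{t\<in>space F. P t} \<in> sets F"
    unfolding P_def using \<phi>F countable_rat by measurable
  have PAE: "AE t in M. P t"
  proof -
    have "AE t in M. \<bar>\<phi> i t + r * \<phi> j t - \<phi> k t\<bar> \<le> K * norm (d i + r *\<^sub>R d j - d k)" for i j k r
    proof -
      define n where "n = norm (d i + r *\<^sub>R d j - d k)"
      have "AE t in M. 0 \<le> K * n + s * (\<phi> i t + r * \<phi> j t - \<phi> k t)" if s: "s = 1 \<or> s = -1" for s
      proof (rule AE_nonneg_of_set_integrals)
        show "(\<lambda>t. K * n + s * (\<phi> i t + r * \<phi> j t - \<phi> k t)) \<in> borel_measurable F" using \<phi>F by measurable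
        show "integrable M (\<lambda>t. K * n + s * (\<phi> i t + r * \<phi> j t - \<phi> k t))" using \<phi>I by auto
        fix D assume D: "D \<in> sets F"
        have "(LINT t:D|M. K * n + s * (\<phi> i t + r * \<phi> j t - \<phi> k t)) =
          K * n * measure M D + s * (m i D + r * m j D - m k D)"
        proof -
          have c: "set_integrable M D (\<lambda>t. K * n)" by (rule set_integrable_F[OF D]) simp
          show ?thesis
            using set_integrable_F[OF D \<phi>I] c
            by (simp add: set_integral_add set_integral_diff set_integral_mult_right \<phi>D[OF D] set_integral_const_real[OF sets_F[OF D]])
        qed
        moreover have "\<bar>m i D + r * m j D - m k D\<bar> \<le> K * n * measure M D"
          using mlin[OF D, of i r j k] mbound[OF D, of "d i + r *\<^sub>R d j - d k"] by (simp add: n_def)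
        ultimately show "0 \<le> (LINT t:D|M. K * n + s * (\<phi> i t + r * \<phi> j t - \<phi> k t))" using s by auto
      qed
      then have "AE t in M. 0 \<le> K * n + 1 * (\<phi> i t + r * \<phi> j t - \<phi> k t)" "AE t in M. 0 \<le> K * n + (-1) * (\<phi> i t + r * \<phi> j t - \<phi> k t)"
        by blast+
      then show ?thesis by eventually_elim (simp add: n_def)
    qed
    then show ?thesis unfolding P_def by (simp add: AE_all_countable AE_ball_countable countable_rat)
  qed
  have ex: "\<exists>L::'x \<Rightarrow>\<^sub>L real. norm L \<le> K \<and> (\<forall>i. blinfun_apply L (d i) = \<phi> i t)" if t: "P t" for t
    by (rule functional_from_dense_values[OF d K(1), of "\<lambda>i. \<phi> i t"]) (use t in \<open>auto simp: P_def\<close>)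
  define L where "L t = (if P t then SOME L::'x \<Rightarrow>\<^sub>L real. norm L \<le> K \<and> (\<forall>i. blinfun_apply L (d i) = \<phi> i t) else 0)" for t
  have L: "norm (L t) \<le> K \<and> (\<forall>i. blinfun_apply (L t) (d i) = \<phi> i t)" if "P t" for t
    using someI_ex[OF ex[OF that]] that by (simp add: L_def)
  have L': "blinfun_apply (L t) v = 0" if "\<not> P t" for t v using that by (simp add: L_def)
  have Lnorm: "norm (L t) \<le> K" for t using L[of t] K(1) by (cases "P t") (auto simp: L_def)
  have Lb: "\<bar>blinfun_apply (L t) v\<bar> \<le> K * norm v" for t v
    using norm_blinfun[of "L t" v] mult_right_mono[OF Lnorm norm_ge_zero[of v], of t] by simp
  have LF: "(\<lambda>t. blinfun_apply (L t) v) \<in> borel_measurable F" for v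
  proof -
    define s where "s n = (SOME i. dist (d i) v < 1 / Suc n)" for n
    have s: "dist (d (s n)) v < 1 / Suc n" for n unfolding s_def by (rule someI_ex) (rule d, simp)
    have sv: "(\<lambda>n. d (s n)) \<longlonglongrightarrow> v"
    proof (rule Lim_null_comparison[THEN LIM_zero_cancel])
      show "\<forall>\<^sub>F n in sequentially. norm (d (s n) - v) \<le> 1 / Suc n"
        using s by (intro always_eventually) (simp add: dist_norm less_imp_le)
      show "(\<lambda>n. 1 / real (Suc n)) \<longlonglongrightarrow> 0" using LIMSEQ_inverse_real_of_nat by (simp add: inverse_eq_divide)
    qed
    show ?thesis
    proof (rule borel_measurable_LIMSEQ_real)
      show "(\<lambda>t. if P t then \<phi> (s n) t else 0) \<in> borel_measurable F" for n
        using PF \<phi>F by (intro measurable_If) auto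
      show "(\<lambda>n. if P t then \<phi> (s n) t else 0) \<longlonglongrightarrow> blinfun_apply (L t) v" for t
      proof (cases "P t")
        case True
        have "(\<lambda>n. blinfun_apply (L t) (d (s n))) \<longlonglongrightarrow> blinfun_apply (L t) v" by (intro tendsto_intros sv)
        then show ?thesis using True L[OF True] by simp
      qed (simp add: L')
    qed
  qed
  have fld: "F_dual_field (\<lambda>t. blinfun_apply (L t)) K"
    unfolding F_dual_field_def using LF Lb by (auto intro: blinfun.bounded_linear_right)
  have LI: "integrable M (\<lambda>t. blinfun_apply (L t) (f t))" "\<bar>LINT t|M. blinfun_apply (L t) (f t)\<bar> \<le> K * (LINT t|?N. norm (f t))"
    if f: "integrable ?N f" for f
  proof -
    have fM: "integrable M f" and fF: "f \<in> borel_measurable F" using f by (auto simp: integrable_restr_iff)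
    note p = integrable_pairing[where L = "\<lambda>t. blinfun_apply (L t)", OF blinfun.bounded_linear_right F_dual_fieldD(3)[OF fld] Lb fM]
    show "integrable M (\<lambda>t. blinfun_apply (L t) (f t))" by (rule p(1))
    have "(LINT t|?N. norm (f t)) = (LINT t|M. norm (f t))" using fF by (intro integral_restr) measurable
    then show "\<bar>LINT t|M. blinfun_apply (L t) (f t)\<bar> \<le> K * (LINT t|?N. norm (f t))" using p(2) by simp
  qed
  \<comment> \<open>The difference of both sides is again linear and bounded in the mean. It
    vanishes at indicators times the \<open>d i\<close>, hence by density everywhere.\<close>
  define \<Psi> where "\<Psi> f = \<Phi> f - (LINT t|M. blinfun_apply (L t) (f t))" for f
  have \<Psi>lin: "\<Psi> (\<lambda>t. f t + r *\<^sub>R h t) = \<Psi> f + r * \<Psi> h" if "integrable ?N f" "integrable ?N h" for f h r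
    using lin[OF that, of r] LI(1)[OF that(1)] LI(1)[OF that(2)]
    by (simp add: \<Psi>_def blinfun.add_right blinfun.scaleR_right algebra_simps)
  have \<Psi>b: "\<bar>\<Psi> f\<bar> \<le> 2 * K * (LINT t|?N. norm (f t))" if "integrable ?N f" for f
    using K(2)[OF that] LI(2)[OF that] by (simp add: \<Psi>_def)
  have \<Psi>d: "\<Psi> (\<lambda>t. indicator D t *\<^sub>R d i) = 0" if D: "D \<in> sets F" for D i
  proof -
    have "(LINT t|M. blinfun_apply (L t) (indicator D t *\<^sub>R d i)) = (LINT t:D|M. \<phi> i t)"
      unfolding set_lebesgue_integral_def
    proof (rule integral_cong_AE)
      show "AE t in M. blinfun_apply (L t) (indicator D t *\<^sub>R d i) = indicator D t *\<^sub>R \<phi> i t"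
        using PAE by eventually_elim (simp add: blinfun.scaleR_right L)
      show "(\<lambda>t. blinfun_apply (L t) (indicator D t *\<^sub>R d i)) \<in> borel_measurable M"
        by (rule borel_measurable_integrable[OF LI(1)[OF integrable_indicator_restr[OF D]]])
      show "(\<lambda>t. indicator D t *\<^sub>R \<phi> i t) \<in> borel_measurable M" using \<phi>M sets_F[OF D] by measurable
    qed
    then show ?thesis by (simp add: \<Psi>_def \<phi>D[OF D] m_def)
  qed
  have "\<Psi> f = 0" if "integrable ?N f" for f
    using that
  proof (induction rule: integrable_induct)
    case (base D v)
    then have D: "D \<in> sets F" by (simp add: sets_restr_to_subalg[OF subalg])
    have "\<bar>\<Psi> (\<lambda>t. indicator D t *\<^sub>R v)\<bar> \<le> 0 + e" if e: "e > 0" for e :: real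
    proof -
      obtain i where i: "dist (d i) v < e / (2 * K + 1)" using d[of "e / (2 * K + 1)" v] e K(1) by auto
      have "\<Psi> (\<lambda>t. indicator D t *\<^sub>R v + (-1) *\<^sub>R (indicator D t *\<^sub>R d i)) = \<Psi> (\<lambda>t. indicator D t *\<^sub>R v)"
        using \<Psi>lin[OF integrable_indicator_restr[OF D] integrable_indicator_restr[OF D], of v "-1" "d i"] \<Psi>d[OF D, of i] by simp
      moreover have "(\<lambda>t. indicator D t *\<^sub>R v + (-1) *\<^sub>R (indicator D t *\<^sub>R d i)) = (\<lambda>t. indicator D t *\<^sub>R (v - d i))"
        by (auto simp: indicator_def)
      ultimately have "\<bar>\<Psi> (\<lambda>t. indicator D t *\<^sub>R v)\<bar> \<le> 2 * K * (norm (v - d i) * measure M D)"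
        using \<Psi>b[OF integrable_indicator_restr[OF D, of "v - d i"], unfolded integral_norm_indicator_restr[OF D]] by simp
      also have "\<dots> \<le> (2 * K + 1) * (e / (2 * K + 1) * 1)"
        using i K(1) e by (intro mult_mono) (auto simp: dist_norm norm_minus_commute)
      also have "\<dots> = e" using K(1) by simp
      finally show ?thesis by simp
    qed
    then show ?case using field_le_epsilon[of "\<bar>\<Psi> (\<lambda>t. indicator D t *\<^sub>R v)\<bar>" 0] by auto
  next
    case (add f h)
    then show ?case using \<Psi>lin[OF add.hyps(1,2), of 1] by simp
  next
    case (lim f s)
    have sI: "integrable ?N (s i)" for i using lim by blast
    have fI: "integrable ?N f" using lim by blast
    have slim: "(\<lambda>i. s i t) \<longlonglongrightarrow> f t" "norm (s i t) \<le> 2 * norm (f t)" if "t \<in> space ?N" for t i using lim that by blast+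
    have "\<bar>\<Psi> f\<bar> \<le> 2 * K * (LINT t|?N. norm (f t + (-1) *\<^sub>R s i t))" for i
    proof -
      have "integrable ?N (\<lambda>t. f t + (-1) *\<^sub>R s i t)" using sI fI by auto
      from \<Psi>b[OF this] show ?thesis using \<Psi>lin[OF fI sI, of "-1" i] lim.IH[of i] by simp
    qed
    moreover have "(\<lambda>i. 2 * K * (LINT t|?N. norm (f t + (-1) *\<^sub>R s i t))) \<longlonglongrightarrow> 2 * K * (LINT t|?N. 0)"
    proof (intro tendsto_mult tendsto_const integral_dominated_convergence[where w = "\<lambda>t. 3 * norm (f t)"])
      show "AE t in ?N. (\<lambda>i. norm (f t + (-1) *\<^sub>R s i t)) \<longlonglongrightarrow> 0"
      proof (rule AE_I2)
        fix t assume "t \<in> space ?N"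
        have "(\<lambda>i. norm (f t + (-1) *\<^sub>R s i t)) \<longlonglongrightarrow> norm (f t + (-1) *\<^sub>R f t)"
          by (intro tendsto_intros slim(1)) fact
        then show "(\<lambda>i. norm (f t + (-1) *\<^sub>R s i t)) \<longlonglongrightarrow> 0" by simp
      qed
      show "AE t in ?N. norm (norm (f t + (-1) *\<^sub>R s i t)) \<le> 3 * norm (f t)" for i
      proof (rule AE_I2)
        fix t assume "t \<in> space ?N"
        then show "norm (norm (f t + (-1) *\<^sub>R s i t)) \<le> 3 * norm (f t)"
          using norm_triangle_ineq4[of "f t" "s i t"] slim(2)[of t i] by simp
      qed
    qed (use sI fI in auto)
    ultimately have "\<bar>\<Psi> f\<bar> \<le> 0" by (intro LIMSEQ_le_const[of _ 0]) auto
    then show ?case by simp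
  qed
  then show ?thesis using that[OF fld] by (simp add: \<Psi>_def)
qed

end

lemma topspace_L1_weak_topology [simp]:
  "topspace (L1_weak_topology N) = (L1_space N :: ('t \<Rightarrow> 'x::{banach, second_countable_topology}) set set)"
  unfolding L1_weak_topology_def
proof (rule topspace_initial_topology)
  have "(\<lambda>_. 0) \<in> (L1_dual N :: (('t \<Rightarrow> 'x) \<Rightarrow> real) set)" by (auto simp: L1_dual_def intro: exI[of _ 0])
  then show "{\<lambda>c. \<Phi> (SOME f. f \<in> c) |\<Phi>. \<Phi> \<in> (L1_dual N :: (('t \<Rightarrow> 'x) \<Rightarrow> real) set)} \<noteq> {}" by blast
qed

lemma L1_class_functional:
  assumes "\<Phi> \<in> L1_dual N" "integrable N f"
  shows "\<Phi> (SOME h. h \<in> L1_class N f) = \<Phi> f"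
proof (rule L1_dual_constant_on_class[OF assms])
  have "f \<in> L1_class N f" using assms(2) by (simp add: L1_class_def)
  then show "(SOME h. h \<in> L1_class N f) \<in> L1_class N f" by (rule someI[of "\<lambda>h. h \<in> L1_class N f"])
qed

context prob_subalgebra
begin

context
  fixes A :: "'x::{banach, second_countable_topology} set" and R :: real and g :: "'a \<Rightarrow> 'x"
  assumes A: "A \<noteq> {}" and R: "\<And>a. a \<in> A \<Longrightarrow> norm a \<le> R"
    and g: "g \<in> M \<rightarrow>\<^sub>M borel_of (bochner_actions A)"
begin

text \<open>Identifies the set of all versions with one class in L1 and retains the pairing with
  every \<open>F_dual_field\<close>, the form that functionals on L1 take. Equality of vectors is
  tested by a norming sequence.\<close>

lemma bochner_cond_exp_class:
  obtains f where "integrable (restr_to_subalg M F) f" "\<And>t. f t \<in> weak_topology closure_of (convex hull A)"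
    "bochner_cond_exp M F g = L1_class (restr_to_subalg M F) f"
    "\<And>L K. F_dual_field L K \<Longrightarrow> (LINT t|M. L t (f t)) = (LINT t|M. L t (g t))"
proof -
  let ?N = "restr_to_subalg M F"
  note gA = bochner_actions_borel[OF g]
  have R0: "0 \<le> R" using A R norm_ge_zero order_trans by blast
  obtain f where f: "f \<in> borel_measurable F" "\<And>t. norm (f t) \<le> R"
    "\<And>t. f t \<in> weak_topology closure_of (convex hull A)"
    "\<And>L K. F_dual_field L K \<Longrightarrow> (LINT t|M. L t (f t)) = (LINT t|M. L t (g t))"
    by (rule bochner_conditional_expectation[OF A R R0 gA]) (assumption | rule that)+
  have gI: "integrable M g" using gA R by (intro integrable_const_bound[of _ R]) auto
  have fM: "integrable M f" using meas_F[OF f(1)] f(2) by (intro integrable_const_bound[of _ R]) auto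
  have fI: "integrable ?N f" using fM f(1) by (simp add: integrable_restr_iff)
  obtain \<nu> :: "nat \<Rightarrow> 'x \<Rightarrow>\<^sub>L real" where \<nu>: "\<And>i. norm (\<nu> i) \<le> 1"
    "\<forall>x. \<forall>\<epsilon>>0. \<exists>i. norm x < blinfun_apply (\<nu> i) x + \<epsilon>" using norming_sequence by blast
  have \<nu>I: "integrable M (\<lambda>t. blinfun_apply (\<nu> i) (u t))" if "integrable M u" for u i
    by (rule integrable_bounded_linear[OF blinfun.bounded_linear_right that])
  have \<nu>F: "(\<lambda>t. blinfun_apply (\<nu> i) (u t)) \<in> borel_measurable F" if "u \<in> borel_measurable F" for u i
    by (rule borel_measurable_continuous_on[OF _ that]) (intro continuous_intros)
  have set: "(LINT t:D|M. blinfun_apply (\<nu> i) (u t)) = blinfun_apply (\<nu> i) (LINT t:D|M. u t)"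
    if "integrable M u" "D \<in> sets F" for u i D
  proof -
    have I: "integrable M (\<lambda>t. indicat_real D t *\<^sub>R u t)"
      by (rule integrable_mult_indicator[OF sets_F[OF that(2)] that(1)])
    have "(LINT t:D|M. blinfun_apply (\<nu> i) (u t)) = (LINT t|M. blinfun_apply (\<nu> i) (indicat_real D t *\<^sub>R u t))"
      by (simp add: set_lebesgue_integral_def blinfun.scaleR_right)
    also have "\<dots> = blinfun_apply (\<nu> i) (LINT t|M. indicat_real D t *\<^sub>R u t)"
      by (rule integral_bounded_linear[OF blinfun.bounded_linear_right I])
    finally show ?thesis by (simp add: set_lebesgue_integral_def)
  qed
  have fg: "(LINT t:D|M. f t) = (LINT t:D|M. g t)" if D: "D \<in> sets F" for D
  proof (rule norming_sequence_eqI[OF \<nu>])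
    fix i
    have "(LINT t:D|M. blinfun_apply (\<nu> i) (f t)) = (LINT t:D|M. blinfun_apply (\<nu> i) (g t))"
      using f(4)[OF F_dual_field_indicator[OF D, of "\<nu> i"]] by (simp add: set_lebesgue_integral_def)
    then show "blinfun_apply (\<nu> i) (LINT t:D|M. f t) = blinfun_apply (\<nu> i) (LINT t:D|M. g t)"
      by (simp add: set[OF fM D] set[OF gI D])
  qed
  have cls: "bochner_cond_exp M F g = L1_class ?N f"
  proof (intro subset_antisym subsetI)
    fix h assume "h \<in> bochner_cond_exp M F g"
    then have hI: "integrable ?N h" and hD: "\<And>D. D \<in> sets F \<Longrightarrow> (LINT t:D|M. g t) = (LINT t:D|M. h t)"
      by (auto simp: bochner_cond_exp_def)
    have hF: "h \<in> borel_measurable F" and hM: "integrable M h" using hI by (auto simp: integrable_restr_iff)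
    have "AE t in M. blinfun_apply (\<nu> i) (h t) = blinfun_apply (\<nu> i) (f t)" for i
    proof (rule AE_eq_of_set_integrals[OF \<nu>F[OF hF] \<nu>F[OF f(1)] \<nu>I[OF hM] \<nu>I[OF fM]])
      show "(LINT t:D|M. blinfun_apply (\<nu> i) (h t)) = (LINT t:D|M. blinfun_apply (\<nu> i) (f t))" if D: "D \<in> sets F" for D
        unfolding set[OF hM D] set[OF fM D] using fg[OF D] hD[OF D] by simp
    qed
    then have "AE t in M. \<forall>i. blinfun_apply (\<nu> i) (h t) = blinfun_apply (\<nu> i) (f t)" by (simp add: AE_all_countable)
    then have "AE t in ?N. \<forall>i. blinfun_apply (\<nu> i) (h t) = blinfun_apply (\<nu> i) (f t)"
    proof (rule AE_restr_to_subalg2[OF subalg])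
      show "Measurable.pred F (\<lambda>t. \<forall>i. blinfun_apply (\<nu> i) (h t) = blinfun_apply (\<nu> i) (f t))"
        using \<nu>F[OF hF] \<nu>F[OF f(1)] by measurable
    qed
    then have "AE t in ?N. h t = f t" by eventually_elim (rule norming_sequence_eqI[OF \<nu>], blast)
    then show "h \<in> L1_class ?N f" using hI by (simp add: L1_class_def)
  next
    fix h assume "h \<in> L1_class ?N f"
    then have hI: "integrable ?N h" and hf: "AE t in ?N. h t = f t" by (auto simp: L1_class_def)
    have hF: "h \<in> borel_measurable F" and hM: "integrable M h" using hI by (auto simp: integrable_restr_iff)
    have hfM: "AE t in M. h t = f t" by (rule AE_restr_to_subalg[OF subalg hf])
    have "(LINT t:D|M. g t) = (LINT t:D|M. h t)" if D: "D \<in> sets F" for D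
    proof -
      have "(LINT t:D|M. h t) = (LINT t:D|M. f t)"
        unfolding set_lebesgue_integral_def
      proof (rule integral_cong_AE)
        show "AE t in M. indicator D t *\<^sub>R h t = indicator D t *\<^sub>R f t"
          using hfM by eventually_elim simp
      qed (use hM fM sets_F[OF D] in auto)
      then show ?thesis using fg[OF D] by simp
    qed
    then show "h \<in> bochner_cond_exp M F g" using hI by (simp add: bochner_cond_exp_def)
  qed
  show ?thesis by (rule that[OF fI f(3) cls f(4)])
qed

lemma bochner_cond_exp_aggregate: "bochner_cond_exp M F g \<in> topspace (bochner_aggregates M F A)"
proof -
  let ?N = "restr_to_subalg M F"
  obtain f where f: "integrable ?N f" "\<And>t. f t \<in> weak_topology closure_of (convex hull A)"
    "bochner_cond_exp M F g = L1_class ?N f"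
    using bochner_cond_exp_class by metis
  have "bochner_cond_exp M F g \<in> L1_space ?N"
    unfolding f(3) L1_space_def using f(1) by blast
  moreover have "f \<in> bochner_cond_exp M F g" unfolding f(3) using f(1) by (simp add: L1_class_def)
  ultimately show ?thesis
    unfolding bochner_aggregates_def topspace_subtopology using f(2) by auto
qed

lemma bochner_cond_exp_functional:
  assumes \<Phi>: "\<Phi> \<in> L1_dual (restr_to_subalg M F)" and L: "F_dual_field L K"
    "\<And>f. integrable (restr_to_subalg M F) f \<Longrightarrow> \<Phi> f = (LINT t|M. L t (f t))"
  shows "\<Phi> (SOME f. f \<in> bochner_cond_exp M F g) = (LINT t|M. L t (g t))"
proof -
  let ?N = "restr_to_subalg M F"
  obtain f where f: "integrable ?N f" "bochner_cond_exp M F g = L1_class ?N f"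
    "\<And>L K. F_dual_field L K \<Longrightarrow> (LINT t|M. L t (f t)) = (LINT t|M. L t (g t))"
    by (rule bochner_cond_exp_class) (rule that; assumption)
  show ?thesis using L1_class_functional[OF \<Phi> f(1)] L(2)[OF f(1)] f(3)[OF L(1)] by (simp add: f(2))
qed

end

lemma bochner_equilibrium_exists:
  fixes A :: "'x::{banach, second_countable_topology} set"
  assumes ne: "nowhere_equivalent M F" and cg: "countably_generated F"
    and game: "bochner_large_game M F A G"
  shows "\<exists>g. bochner_nash_equilibrium M F A G g"
proof -
  have A: "A \<noteq> {}" and cA: "compactin weak_topology A"
    and G: "payoff_assignment F (bochner_actions A) (bochner_aggregates M F A) G"
    using game by (auto simp: bochner_large_game_def)
  obtain R where R: "0 \<le> R" "\<And>a. a \<in> A \<Longrightarrow> norm a \<le> R" using weak_compact_bounded[OF cA] by blast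
  have top: "topspace (bochner_actions A) = A" by (simp add: bochner_actions_def)
  obtain \<nu> :: "nat \<Rightarrow> 'x \<Rightarrow>\<^sub>L real" where \<nu>: "\<And>i. norm (\<nu> i) \<le> 1"
    "\<forall>x. \<forall>\<epsilon>>0. \<exists>i. norm x < blinfun_apply (\<nu> i) x + \<epsilon>" using norming_sequence by blast
  show ?thesis
    unfolding bochner_nash_equilibrium_def
  proof (rule nash_equilibrium_exists[OF prob_space_axioms subalg ne cg, where e = "\<lambda>a i. blinfun_apply (\<nu> i) a", OF _ _ _ _ _ _ G])
    show "compact_space (bochner_actions A)"
      unfolding bochner_actions_def by (rule compact_space_subtopology[OF cA])
    show "topspace (bochner_actions A) \<noteq> {}" using A top by simp
    show "continuous_map (bochner_actions A) euclideanreal (\<lambda>a. blinfun_apply (\<nu> i) a)" for i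
      unfolding bochner_actions_def by (rule continuous_map_from_subtopology[OF weak_continuous_functional])
    show "inj_on (\<lambda>a i. blinfun_apply (\<nu> i) a) (topspace (bochner_actions A))"
    proof (rule inj_onI)
      fix a a' assume eq: "(\<lambda>i. blinfun_apply (\<nu> i) a) = (\<lambda>i. blinfun_apply (\<nu> i) a')"
      show "a = a'" by (rule norming_sequence_eqI[OF \<nu>]) (rule fun_cong[OF eq])
    qed
    show "bochner_cond_exp M F g \<in> topspace (bochner_aggregates M F A)" if "g \<in> M \<rightarrow>\<^sub>M borel_of (bochner_actions A)" for g
      by (rule bochner_cond_exp_aggregate[OF A R(2) that])
    show "limitin (bochner_aggregates M F A) (\<lambda>n. bochner_cond_exp M F (g n)) (bochner_cond_exp M F h) sequentially"
      if g: "\<And>n. g n \<in> M \<rightarrow>\<^sub>M borel_of (bochner_actions A)" and h: "h \<in> M \<rightarrow>\<^sub>M borel_of (bochner_actions A)"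
        and conv: "converges_in_law_F M F (bochner_actions A) g h" for g h
    proof -
      let ?N = "restr_to_subalg M F"
      have agg: "bochner_cond_exp M F k \<in> topspace (bochner_aggregates M F A)"
        if "k \<in> M \<rightarrow>\<^sub>M borel_of (bochner_actions A)" for k
        by (rule bochner_cond_exp_aggregate[OF A R(2) that])
      have "limitin (L1_weak_topology ?N) (\<lambda>n. bochner_cond_exp M F (g n)) (bochner_cond_exp M F h) sequentially"
        unfolding L1_weak_topology_def
      proof (rule limitin_initial_topology)
        show "bochner_cond_exp M F (g n) \<in> L1_space ?N" for n
          using agg[OF g] by (simp add: bochner_aggregates_def)
        show "bochner_cond_exp M F h \<in> L1_space ?N"
          using agg[OF h] by (simp add: bochner_aggregates_def)
        have "(\<lambda>_. 0) \<in> (L1_dual ?N :: (('a \<Rightarrow> 'x) \<Rightarrow> real) set)" by (auto simp: L1_dual_def intro: exI[of _ 0])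
        then show "{\<lambda>c. \<Phi> (SOME f. f \<in> c) |\<Phi>. \<Phi> \<in> (L1_dual ?N :: (('a \<Rightarrow> 'x) \<Rightarrow> real) set)} \<noteq> {}" by blast
        fix \<phi> assume "\<phi> \<in> {\<lambda>c. \<Phi> (SOME f. f \<in> c) |\<Phi>. \<Phi> \<in> (L1_dual ?N :: (('a \<Rightarrow> 'x) \<Rightarrow> real) set)}"
        then obtain \<Phi> :: "('a \<Rightarrow> 'x) \<Rightarrow> real" where \<Phi>: "\<Phi> \<in> L1_dual ?N" "\<phi> = (\<lambda>c. \<Phi> (SOME f. f \<in> c))" by blast
        obtain L :: "'a \<Rightarrow> 'x \<Rightarrow>\<^sub>L real" and K where L: "F_dual_field (\<lambda>t. blinfun_apply (L t)) K"
          "\<And>f. integrable ?N f \<Longrightarrow> \<Phi> f = (LINT t|M. blinfun_apply (L t) (f t))"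
          by (rule L1_dual_representation[OF \<Phi>(1)]) (rule that; assumption)
        have "(\<lambda>n. LINT t|M. blinfun_apply (L t) (g n t)) \<longlonglongrightarrow> (LINT t|M. blinfun_apply (L t) (h t))"
        proof (rule conv[unfolded converges_in_law_F_def, rule_format, where B = "\<bar>K\<bar> * R"])
          show "continuous_map (bochner_actions A) euclideanreal (blinfun_apply (L t))" for t
            unfolding bochner_actions_def by (rule continuous_map_from_subtopology[OF weak_continuous_functional])
          show "(\<lambda>t. blinfun_apply (L t) x) \<in> borel_measurable F" for x by (rule F_dual_fieldD(2)[OF L(1)])
          fix t x assume "t \<in> space M" and x: "x \<in> topspace (bochner_actions A)"
          then have "\<bar>blinfun_apply (L t) x\<bar> \<le> K * norm x" using F_dual_fieldD(4)[OF L(1)] by blast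
          also have "\<dots> \<le> \<bar>K\<bar> * R" using R x by (intro mult_mono) (auto simp: top)
          finally show "\<bar>blinfun_apply (L t) x\<bar> \<le> \<bar>K\<bar> * R" .
        qed
        moreover have "\<phi> (bochner_cond_exp M F k) = (LINT t|M. blinfun_apply (L t) (k t))"
          if "k \<in> M \<rightarrow>\<^sub>M borel_of (bochner_actions A)" for k
          unfolding \<Phi>(2) by (rule bochner_cond_exp_functional[OF A R(2) that \<Phi>(1) L])
        ultimately show "(\<lambda>n. \<phi> (bochner_cond_exp M F (g n))) \<longlonglongrightarrow> \<phi> (bochner_cond_exp M F h)"
          using g h by simp
      qed
      then show ?thesis
        using agg[OF g] agg[OF h] unfolding bochner_aggregates_def limitin_subtopology topspace_subtopology by auto
    qed
  qed
qed

end


section \<open>Games without equilibrium\<close>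

text \<open>The ternary digits of \<open>\<theta>\<close> are \<open>0\<close> or \<open>2\<close>, as in the Cantor set, so they can be read off in a measurable way.\<close>

lemma countably_generated_real_generator:
  assumes "countably_generated F"
  obtains \<theta> :: "'a \<Rightarrow> real" where "\<theta> \<in> borel_measurable F" "\<And>t. 0 \<le> \<theta> t"
    "\<And>B. B \<in> sets F \<Longrightarrow> \<exists>Q\<in>sets borel. B = \<theta> -` Q \<inter> space F"
proof -
  obtain C :: "nat \<Rightarrow> 'a set" where C: "\<And>m. C m \<in> sets F" "sets F = sigma_sets (space F) (range C)"
    using countably_generated_sequence[OF assms] by blast
  \<comment> \<open>\<open>th n\<close> is the expansion starting with the digit of
    \<open>C n\<close>. The whole family of shifts is used to pass from one digit to the
    next.\<close>
  define th where "th n t = (\<Sum>k. 2 * (1 / 3) ^ Suc k * indicat_real (C (n + k)) t)" for n t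
  have smm: "summable (\<lambda>k. 2 * (1 / 3 :: real) ^ Suc k)" by (intro summable_mult) (simp add: summable_geometric)
  have sm: "summable (\<lambda>k. 2 * (1 / 3) ^ Suc k * indicat_real (C (n + k)) t)" for n t
    by (rule summable_comparison_test[OF _ smm]) (auto simp: indicator_def)
  have th_Suc: "th n t = 2 / 3 * indicator (C n) t + th (Suc n) t / 3" for n t
  proof -
    have "th n t = (\<Sum>k. 2 * (1 / 3) ^ Suc (Suc k) * indicat_real (C (n + Suc k)) t) + 2 * (1 / 3) ^ Suc 0 * indicator (C (n + 0)) t"
      using suminf_split_head[OF sm[of n t]] unfolding th_def by simp
    also have "(\<Sum>k. 2 * (1 / 3) ^ Suc (Suc k) * indicat_real (C (n + Suc k)) t) = (\<Sum>k. 1 / 3 * (2 * (1 / 3) ^ Suc k * indicat_real (C (Suc n + k)) t))"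
      by (intro suminf_cong) simp
    also have "\<dots> = 1 / 3 * th (Suc n) t" unfolding th_def by (rule suminf_mult[OF sm])
    finally show ?thesis by simp
  qed
  have th0: "0 \<le> th n t" for n t unfolding th_def by (rule suminf_nonneg[OF sm]) simp
  have th1: "th n t \<le> 1" for n t
  proof -
    have "th n t \<le> (\<Sum>k. 2 * (1 / 3) ^ Suc k)"
      unfolding th_def by (rule suminf_le[OF _ sm smm]) (auto simp: indicator_def)
    also have "\<dots> = 2 / 3 * (\<Sum>k. (1 / 3) ^ k)"
      using suminf_mult[of "\<lambda>k. (1 / 3 :: real) ^ k" "2 / 3"] by (simp add: summable_geometric)
    also have "\<dots> = 1" by (simp add: suminf_geometric)
    finally show ?thesis .
  qed
  \<comment> \<open>A leading digit 2 puts \<open>th n\<close> at \<open>2 / 3\<close> or above, a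
    leading digit 0 at \<open>1 / 3\<close> or below, so the threshold \<open>1 / 2\<close> reads
    the digit off.\<close>
  have Cth: "C n = {t\<in>space F. 1 / 2 \<le> th n t}" for n
  proof (intro set_eqI)
    fix t show "t \<in> C n \<longleftrightarrow> t \<in> {t\<in>space F. 1 / 2 \<le> th n t}"
      using th_Suc[of n t] th0[of "Suc n" t] th1[of "Suc n" t] sets.sets_into_space[OF C(1), of n]
      by (cases "t \<in> C n") auto
  qed
  have thF: "th 0 \<in> borel_measurable F" unfolding th_def using C(1) by measurable
  \<comment> \<open>The \<sigma>-algebra generated by \<open>th 0\<close> contains every
    \<open>C n\<close>: reading off and removing the leading digit leads from \<open>th n\<close> to
    \<open>th (Suc n)\<close> measurably.\<close>
  let ?V = "vimage_algebra (space F) (th 0) borel"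
  have thV: "th n \<in> borel_measurable ?V" for n
  proof (induction n)
    case 0 show ?case by (rule measurable_vimage_algebra1) simp
  next
    case (Suc n)
    have "{t\<in>space ?V. 1 / 2 \<le> th n t} \<in> sets ?V" using Suc by measurable
    then have "C n \<in> sets ?V" using Cth[of n] by simp
    then have "(\<lambda>t. 3 * th n t - 2 * indicator (C n) t) \<in> borel_measurable ?V" using Suc by measurable
    moreover have "(\<lambda>t. 3 * th n t - 2 * indicator (C n) t) = th (Suc n)" by (auto simp: th_Suc[of n])
    ultimately show ?case by simp
  qed
  have "C n \<in> sets ?V" for n
  proof -
    have "{t\<in>space ?V. 1 / 2 \<le> th n t} \<in> sets ?V" using thV by measurable
    then show ?thesis using Cth[of n] by simp
  qed
  then have "sigma_sets (space ?V) (range C) \<subseteq> sets ?V" by (intro sets.sigma_sets_subset) auto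
  then have "sets F \<subseteq> sets ?V" using C(2) by simp
  also have "sets ?V = {th 0 -` Q \<inter> space F |Q. Q \<in> sets borel}" by (rule sets_vimage_algebra2) simp
  finally show ?thesis by (intro that[OF thF th0]) auto
qed

section \<open>The obstruction when nowhere equivalence fails\<close>

context prob_subalgebra
begin

lemma distr_restrict_space:
  fixes \<theta> :: "'a \<Rightarrow> real"
  assumes P: "P \<in> sets M" and \<theta>: "\<theta> \<in> borel_measurable M"
  defines "\<rho> \<equiv> distr (restrict_space M P) borel \<theta>"
  shows "finite_borel_measure \<rho>" "Q \<in> sets borel \<Longrightarrow> measure \<rho> Q = measure M (P \<inter> \<theta> -` Q)"
proof -
  have m: "\<theta> \<in> restrict_space M P \<rightarrow>\<^sub>M borel" by (rule measurable_restrict_space1[OF \<theta>])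
  have PS: "P \<inter> space M = P" using sets.sets_into_space[OF P] by auto
  have "finite_measure (restrict_space M P)" by (rule finite_measure_restrict_space[OF _ P]) unfold_locales
  then have "finite_measure \<rho>" unfolding \<rho>_def by (rule finite_measure.finite_measure_distr[OF _ m])
  then show "finite_borel_measure \<rho>"
    by (simp add: finite_borel_measure_def finite_borel_measure_axioms_def \<rho>_def)
  show "measure \<rho> Q = measure M (P \<inter> \<theta> -` Q)" if Q: "Q \<in> sets borel"
  proof -
    have "measure \<rho> Q = measure (restrict_space M P) (\<theta> -` Q \<inter> space (restrict_space M P))"
      unfolding \<rho>_def using m Q by (simp add: measure_distr)
    also have "\<dots> = measure M (\<theta> -` Q \<inter> space (restrict_space M P))"
      using P PS by (intro measure_restrict_space) (auto simp: space_restrict_space)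
    also have "\<theta> -` Q \<inter> space (restrict_space M P) = P \<inter> \<theta> -` Q" using PS by (auto simp: space_restrict_space)
    finally show ?thesis .
  qed
qed

lemma diffuse_law_isCont:
  fixes \<theta> :: "'a \<Rightarrow> real"
  assumes P: "P \<in> sets M" and \<theta>: "\<theta> \<in> borel_measurable M"
    and null: "\<And>x. measure M (P \<inter> \<theta> -` {x}) = 0"
  shows "isCont (\<lambda>x. measure M (P \<inter> \<theta> -` {..x})) x"
proof -
  interpret D: finite_borel_measure "distr (restrict_space M P) borel \<theta>" by (rule distr_restrict_space(1)[OF P \<theta>])
  have "cdf (distr (restrict_space M P) borel \<theta>) = (\<lambda>x. measure M (P \<inter> \<theta> -` {..x}))"
    by (auto simp: cdf_def distr_restrict_space(2)[OF P \<theta>])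
  then show ?thesis using D.isCont_cdf[of x] distr_restrict_space(2)[OF P \<theta>, of "{x}"] null by simp
qed

text \<open>If \<open>H i\<close> exceeds \<open>H j\<close> at \<open>x\<^sub>0\<close>, then beyond the last point \<open>y \<le> x\<^sub>0\<close> with \<open>H i y \<le> H j y\<close>
  nobody chooses \<open>i\<close>, so that \<open>H i\<close> is constant there while \<open>H j\<close> does not decrease.\<close>

lemma balanced_choice:
  fixes \<theta> :: "'a \<Rightarrow> real" and \<iota> :: "'a \<Rightarrow> nat"
  assumes S: "S \<in> sets M" and \<theta>: "\<theta> \<in> borel_measurable M" and \<theta>0: "\<And>t. 0 \<le> \<theta> t"
    and null: "\<And>x. measure M (S \<inter> \<theta> -` {x}) = 0"
    and \<iota>: "\<iota> \<in> M \<rightarrow>\<^sub>M count_space UNIV"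
  defines "H \<equiv> \<lambda>j x. measure M (S \<inter> {s\<in>space M. \<iota> s = j} \<inter> \<theta> -` {..x})"
  assumes best: "AE t in M. t \<in> S \<longrightarrow> (\<forall>j<N. H (\<iota> t) (\<theta> t) \<le> H j (\<theta> t))"
    and j: "j < N"
  shows "H i x \<le> H j x"
proof (rule ccontr)
  assume gt: "\<not> H i x \<le> H j x"
  have P: "S \<inter> {s\<in>space M. \<iota> s = j} \<in> sets M" for j using S \<iota> by measurable
  have Px: "S \<inter> {s\<in>space M. \<iota> s = j} \<inter> \<theta> -` Q \<in> sets M" if "Q \<in> sets borel" for j Q
  proof -
    have "S \<inter> {s\<in>space M. \<iota> s = j} \<inter> \<theta> -` Q = (S \<inter> {s\<in>space M. \<iota> s = j}) \<inter> (\<theta> -` Q \<inter> space M)" by auto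
    then show ?thesis using P[of j] measurable_sets[OF \<theta> that] by simp
  qed
  have cont: "continuous_on UNIV (H j)" for j
  proof -
    have "measure M (S \<inter> {s\<in>space M. \<iota> s = j} \<inter> \<theta> -` {x}) = 0" for x
    proof -
      have "S \<inter> \<theta> -` {x} = S \<inter> (\<theta> -` {x} \<inter> space M)" using sets.sets_into_space[OF S] by auto
      then have "S \<inter> \<theta> -` {x} \<in> sets M" using S measurable_sets[OF \<theta>, of "{x}"] by auto
      then have "measure M (S \<inter> {s\<in>space M. \<iota> s = j} \<inter> \<theta> -` {x}) \<le> measure M (S \<inter> \<theta> -` {x})"
        by (intro finite_measure_mono) auto
      then show ?thesis using null[of x] by (simp add: measure_le_0_iff)
    qed
    then show ?thesis unfolding H_def continuous_on_eq_continuous_at[OF open_UNIV]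
      using diffuse_law_isCont[OF P[of j] \<theta>] by blast
  qed
  \<comment> \<open>\<open>Z\<close> is nonempty because \<open>\<theta>\<close> is nonnegative:
    below 0 no player is counted and both sides vanish. It is closed by continuity and so contains
    its supremum, the last point with the inequality.\<close>
  define Z where "Z = {y. y \<le> x \<and> H i y \<le> H j y}"
  have "closed Z" unfolding Z_def Collect_conj_eq
    by (intro closed_Int closed_Collect_le cont continuous_intros)
  moreover have "Z \<noteq> {}"
  proof -
    have "H k (min x (-1)) = 0" for k
    proof -
      have "t \<notin> S \<inter> {s\<in>space M. \<iota> s = k} \<inter> \<theta> -` {..min x (-1)}" for t using \<theta>0[of t] by auto
      then have "S \<inter> {s\<in>space M. \<iota> s = k} \<inter> \<theta> -` {..min x (-1)} = {}" by blast
      then show ?thesis by (simp add: H_def)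
    qed
    then have "min x (-1) \<in> Z" by (simp add: Z_def)
    then show ?thesis by blast
  qed
  moreover have bdd: "bdd_above Z" by (auto simp: Z_def bdd_above_def)
  ultimately have yZ: "Sup Z \<in> Z" by (intro closed_contains_Sup)
  define y where "y = Sup Z"
  have y: "y \<le> x" "H i y \<le> H j y" using yZ by (auto simp: Z_def y_def)
  have above: "H j z < H i z" if "y < z" "z \<le> x" for z
  proof (rule ccontr)
    assume "\<not> H j z < H i z"
    then have "z \<in> Z" using that by (simp add: Z_def)
    then have "z \<le> y" unfolding y_def using bdd by (rule cSup_upper)
    then show False using that by simp
  qed
  have "H i x = H i y"
  proof -
    have "AE t in M. t \<in> S \<inter> {s\<in>space M. \<iota> s = i} \<inter> \<theta> -` {..x} \<longleftrightarrow> t \<in> S \<inter> {s\<in>space M. \<iota> s = i} \<inter> \<theta> -` {..y}"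
      using best
    proof eventually_elim
      case (elim t)
      show ?case
        using elim above[of "\<theta> t"] j y(1) by (auto simp: not_less[symmetric])
    qed
    then show ?thesis unfolding H_def by (intro finite_measure_eq_AE Px) auto
  qed
  moreover have "H j y \<le> H j x"
    unfolding H_def using y(1) by (intro finite_measure_mono Px) auto
  ultimately show False using gt y(2) by simp
qed


text \<open>Stated for index functions \<open>\<iota>\<close> alone, so that it serves the Bochner
  and the Gel'fand game alike. The condition shown to be impossible is what equilibrium will mean
  there: almost every player of \<open>S\<close> takes an action least used among the players of
  \<open>S\<close> with smaller or equal \<open>\<theta>\<close>.\<close>

lemma not_nowhere_equivalent_obstruction:
  assumes at: "atomless M" and cg: "countably_generated F" and ne: "\<not> nowhere_equivalent M F"
  obtains \<theta> :: "'a \<Rightarrow> real" and S and N :: nat where "\<theta> \<in> borel_measurable F" "S \<in> sets F" "N > 0"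
    "\<And>x. measure M (S \<inter> \<theta> -` {x}) = 0"
    "\<And>\<iota>. \<iota> \<in> M \<rightarrow>\<^sub>M count_space UNIV \<Longrightarrow> \<forall>t\<in>space M. \<iota> t < N \<Longrightarrow>
      \<not> (AE t in M. t \<in> S \<longrightarrow> (\<forall>j<N. measure M (S \<inter> {s\<in>space M. \<iota> s = \<iota> t} \<inter> \<theta> -` {..\<theta> t})
           \<le> measure M (S \<inter> {s\<in>space M. \<iota> s = j} \<inter> \<theta> -` {..\<theta> t})))"
proof -
  define split where "split D \<longleftrightarrow> (\<exists>D0\<in>sets M. D0 \<subseteq> D \<and> (\<forall>D1\<in>{D \<inter> D' |D'. D' \<in> sets F}. measure M (sym_diff D0 D1) > 0))" for D
  have "\<not> (\<forall>D\<in>sets M. measure M D > 0 \<longrightarrow> split D)" using ne unfolding nowhere_equivalent_def split_def .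
  then obtain D where D: "D \<in> sets M" "measure M D > 0" and D0: "\<not> split D" by blast
  have approx: "\<exists>D'\<in>sets F. measure M (D0 - D') = 0 \<and> measure M (D \<inter> D' - D0) = 0" if D0': "D0 \<in> sets M" "D0 \<subseteq> D" for D0
  proof -
    have "\<not> (\<forall>D1\<in>{D \<inter> D' |D'. D' \<in> sets F}. measure M (sym_diff D0 D1) > 0)" using D0 D0' unfolding split_def by (elim contrapos_nn) (intro bexI conjI)
    then obtain D' where D': "D' \<in> sets F" "\<not> measure M (sym_diff D0 (D \<inter> D')) > 0" by auto
    note m = D0'(1) D(1) sets_F[OF D'(1)]
    have "measure M (sym_diff D0 (D \<inter> D')) = 0" using D'(2) by (simp add: not_less measure_le_0_iff)
    moreover have "measure M (D0 - D') \<le> measure M (sym_diff D0 (D \<inter> D'))" "measure M (D \<inter> D' - D0) \<le> measure M (sym_diff D0 (D \<inter> D'))"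
      using m by (auto intro!: finite_measure_mono)
    ultimately show ?thesis using D'(1) by (intro bexI[of _ D'] conjI) (simp_all add: measure_le_0_iff)
  qed
  obtain \<theta> :: "'a \<Rightarrow> real" where \<theta>: "\<theta> \<in> borel_measurable F" and \<theta>0: "\<And>t. 0 \<le> \<theta> t"
    and gen: "\<And>B. B \<in> sets F \<Longrightarrow> \<exists>Q\<in>sets borel. B = \<theta> -` Q \<inter> space F"
    using countably_generated_real_generator[OF cg] by blast
  have \<theta>M: "\<theta> \<in> borel_measurable M" by (rule meas_F[OF \<theta>])
  \<comment> \<open>The conditional probability \<open>E\<close> of \<open>D\<close> has mean
    \<open>2 * \<delta>\<close>, so it reaches \<open>\<delta>\<close> on a set of positive
    measure.\<close>
  define \<delta> where "\<delta> = measure M D / 2"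
  have \<delta>: "\<delta> > 0" using D(2) by (simp add: \<delta>_def)
  define E where "E = real_cond_exp M F (indicator D)"
  have EF: "E \<in> borel_measurable F" unfolding E_def by simp
  have EI: "integrable M E" unfolding E_def using D(1) by (intro real_cond_exp_int) auto
  define S where "S = {t\<in>space F. E t \<ge> \<delta>}"
  have SF: "S \<in> sets F" unfolding S_def using EF by measurable
  note SM = sets_F[OF SF]
  have dens: "\<delta> * measure M B \<le> measure M (B \<inter> D)" if B: "B \<in> sets F" "B \<subseteq> S" for B
  proof -
    have "\<delta> * measure M B = (LINT t:B|M. \<delta>)" by (rule set_integral_const_real[OF sets_F[OF B(1)], symmetric])
    also have "\<dots> \<le> (LINT t:B|M. E t)"
      using B(2) by (intro set_integral_mono set_integrable_F[OF B(1)] EI) (auto simp: S_def)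
    also have "\<dots> = measure M (B \<inter> D)" unfolding E_def by (rule cond_exp_indicator[OF B(1) D(1)])
    finally show ?thesis .
  qed
  have Spos: "measure M S > 0"
  proof (rule ccontr)
    assume "\<not> measure M S > 0"
    then have "S \<in> null_sets M" using SM by (simp add: null_sets_def emeasure_eq_measure not_less measure_le_0_iff)
    then have "AE t in M. t \<notin> S" by (rule AE_not_in)
    then have "AE t in M. E t \<le> \<delta>" using AE_space by eventually_elim (auto simp: S_def space_F)
    then have "(LINT t|M. E t) \<le> (LINT t|M. \<delta>)" by (intro integral_mono_AE EI) simp
    moreover have "(LINT t|M. E t) = measure M D"
    proof -
      have "(LINT t|M. E t) = (LINT t:space M|M. E t)" unfolding set_integral_space[OF EI] ..
      also have "\<dots> = measure M (space F \<inter> D)" unfolding E_def space_F[symmetric] by (rule cond_exp_indicator[OF sets.top D(1)])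
      also have "space F \<inter> D = D" using sets.sets_into_space[OF D(1)] by (auto simp: space_F)
      finally show ?thesis .
    qed
    ultimately show False using D(2) prob_space by (simp add: \<delta>_def)
  qed
  \<comment> \<open>Every \<open>F\<close>-set contains or misses a fibre of
    \<open>\<theta>\<close>. If a fibre had mass in \<open>S\<close>, it would have mass in
    \<open>D\<close> by \<open>dens\<close>; atomlessness would cut a proper part from that
    intersection, and no \<open>F\<close>-set has such a part as its trace on \<open>D\<close> up to
    null sets, contrary to the choice of \<open>D\<close>.\<close>
  have null: "measure M (S \<inter> \<theta> -` {x}) = 0" for x
  proof (rule ccontr)
    define P where "P = S \<inter> \<theta> -` {x}"
    assume "measure M (S \<inter> \<theta> -` {x}) \<noteq> 0"
    then have Ppos: "measure M P > 0" unfolding P_def by (simp add: zero_less_measure_iff)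
    have "P = S \<inter> (\<theta> -` {x} \<inter> space F)" using sets.sets_into_space[OF SF] by (auto simp: P_def)
    then have PF: "P \<in> sets F" using SF measurable_sets[OF \<theta>, of "{x}"] by auto
    have "0 < \<delta> * measure M P" using \<delta> Ppos by simp
    also have "\<dots> \<le> measure M (P \<inter> D)" using dens[OF PF] by (simp add: P_def)
    finally have pos: "0 < measure M (P \<inter> D)" .
    have PD: "P \<inter> D \<in> sets M" using sets_F[OF PF] D(1) by auto
    obtain U where U: "U \<in> sets M" "U \<subseteq> P \<inter> D" "0 < measure M U" "measure M U < measure M (P \<inter> D)"
      using at PD pos unfolding atomless_def by blast
    obtain D' where D': "D' \<in> sets F" "measure M (U - D') = 0" "measure M (D \<inter> D' - U) = 0"
      using approx[OF U(1)] U(2) by blast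
    obtain Q where Q: "D' = \<theta> -` Q \<inter> space F" using gen[OF D'(1)] by blast
    have Psp: "P \<subseteq> space F" using sets.sets_into_space[OF PF] .
    show False
    proof (cases "x \<in> Q")
      case True
      then have "P \<subseteq> D'" using Psp by (auto simp: Q P_def)
      then have "measure M (P \<inter> D - U) \<le> measure M (D \<inter> D' - U)"
        using sets_F[OF D'(1)] D(1) U(1) by (intro finite_measure_mono) auto
      then show False using finite_measure_Diff[OF PD U(1,2)] U(4) D'(3) by simp
    next
      case False
      then have "U - D' = U" using U(2) by (auto simp: Q P_def)
      then show False using D'(2) U(3) by simp
    qed
  qed
  obtain N :: nat where N: "1 / \<delta> < N" using reals_Archimedean2 by blast
  then have N0: "N > 0" using \<delta> by (cases N) (auto simp: divide_less_0_iff)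
  have N1: "1 < \<delta> * N" using N \<delta> by (simp add: field_simps)
  have "False" if \<iota>: "\<iota> \<in> M \<rightarrow>\<^sub>M count_space UNIV" "\<forall>t\<in>space M. \<iota> t < N"
    and best: "AE t in M. t \<in> S \<longrightarrow> (\<forall>j<N. measure M (S \<inter> {s\<in>space M. \<iota> s = \<iota> t} \<inter> \<theta> -` {..\<theta> t})
           \<le> measure M (S \<inter> {s\<in>space M. \<iota> s = j} \<inter> \<theta> -` {..\<theta> t}))" for \<iota> :: "'a \<Rightarrow> nat"
  proof -
    define T where "T j = {s\<in>space M. \<iota> s = j}" for j
    have TM: "T j \<in> sets M" for j unfolding T_def using \<iota>(1) by measurable
    have STM: "S \<inter> T j \<in> sets M" for j using SM TM by auto
    have le: "measure M (S \<inter> T i \<inter> \<theta> -` {..x}) \<le> measure M (S \<inter> T j \<inter> \<theta> -` {..x})" if "j < N" for i j x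
      unfolding T_def by (rule balanced_choice[OF SM \<theta>M \<theta>0 null \<iota>(1) best that])
    \<comment> \<open>The inequalities for both orders of \<open>i\<close> and \<open>j\<close> make
      the distribution functions of \<open>\<theta>\<close> on the two parts equal. The two laws
      then agree on all Borel sets, whose preimages are all of \<open>F\<close>.\<close>
    have eq: "measure M (S \<inter> T i \<inter> B) = measure M (S \<inter> T j \<inter> B)" if ij: "i < N" "j < N" and B: "B \<in> sets F" for i j B
    proof -
      obtain Q where Q: "Q \<in> sets borel" "B = \<theta> -` Q \<inter> space F" using gen[OF B] by blast
      have "cdf (distr (restrict_space M (S \<inter> T i)) borel \<theta>) = cdf (distr (restrict_space M (S \<inter> T j)) borel \<theta>)"
        using le[OF ij(1)] le[OF ij(2)] by (auto simp: cdf_def fun_eq_iff distr_restrict_space(2)[OF STM \<theta>M] intro!: antisym)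
      then have "distr (restrict_space M (S \<inter> T i)) borel \<theta> = distr (restrict_space M (S \<inter> T j)) borel \<theta>"
        by (rule cdf_unique'[OF distr_restrict_space(1)[OF STM \<theta>M] distr_restrict_space(1)[OF STM \<theta>M]])
      then have "measure M (S \<inter> T i \<inter> \<theta> -` Q) = measure M (S \<inter> T j \<inter> \<theta> -` Q)"
        using distr_restrict_space(2)[OF STM \<theta>M Q(1)] by metis
      moreover have "S \<inter> T k \<inter> B = S \<inter> T k \<inter> \<theta> -` Q" for k
        using sets.sets_into_space[OF SF] by (auto simp: Q(2))
      ultimately show ?thesis by simp
    qed
    have part: "measure M C = (\<Sum>j<N. measure M (C \<inter> T j))" if C: "C \<in> sets M" for C
    proof -
      have "measure M (\<Union>j\<in>{..<N}. C \<inter> T j) = (\<Sum>j<N. measure M (C \<inter> T j))"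
        using C TM by (intro finite_measure_finite_Union) (auto simp: disjoint_family_on_def T_def)
      moreover have "(\<Union>j\<in>{..<N}. C \<inter> T j) = C" using sets.sets_into_space[OF C] \<iota>(2) by (auto simp: T_def)
      ultimately show ?thesis by simp
    qed
    have share: "real N * measure M (S \<inter> T j \<inter> B) = measure M (S \<inter> B)" if j: "j < N" and B: "B \<in> sets F" for j B
    proof -
      have "measure M (S \<inter> B) = (\<Sum>i<N. measure M (S \<inter> B \<inter> T i))" using SM sets_F[OF B] by (intro part) auto
      also have "\<dots> = (\<Sum>i<N. measure M (S \<inter> T j \<inter> B))"
        using eq[OF _ j B] by (intro sum.cong refl) (simp add: Int_ac)
      finally show ?thesis by simp
    qed
    \<comment> \<open>Up to null sets \<open>D \<inter> T j\<close> is \<open>D \<inter> D'\<close>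
      for an \<open>F\<close>-set \<open>D'\<close>. On \<open>S \<inter> D'\<close> the players of
      action \<open>j\<close> have the share \<open>1 / N < \<delta>\<close>, but they include
      almost all of \<open>D\<close> there, whose share is at least \<open>\<delta>\<close>. So
      \<open>S \<inter> D'\<close> is null.\<close>
    have zero: "measure M (S \<inter> D \<inter> T j) = 0" if j: "j < N" for j
    proof -
      have DT: "D \<inter> T j \<in> sets M" using D(1) TM by auto
      obtain D' where D': "D' \<in> sets F" "measure M (D \<inter> T j - D') = 0" "measure M (D \<inter> D' - D \<inter> T j) = 0"
        using approx[OF DT] by blast
      note m = SM D(1) TM[of j] sets_F[OF D'(1)]
      have SD': "S \<inter> D' \<in> sets F" using SF D'(1) by auto
      have "\<delta> * measure M (S \<inter> D') \<le> measure M (S \<inter> D' \<inter> D)" by (rule dens[OF SD']) auto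
      also have "\<dots> \<le> measure M ((S \<inter> T j \<inter> D') \<union> (D \<inter> D' - D \<inter> T j))"
        using m by (intro finite_measure_mono) auto
      also have "\<dots> \<le> measure M (S \<inter> T j \<inter> D') + measure M (D \<inter> D' - D \<inter> T j)"
        using m by (intro measure_Un_le) auto
      finally have "\<delta> * measure M (S \<inter> D') \<le> measure M (S \<inter> T j \<inter> D')" using D'(3) by simp
      then have "\<delta> * real N * measure M (S \<inter> D') \<le> real N * measure M (S \<inter> T j \<inter> D')"
        using mult_left_mono[of "\<delta> * measure M (S \<inter> D')" "measure M (S \<inter> T j \<inter> D')" "real N"] by (simp add: mult_ac)
      then have "(\<delta> * real N - 1) * measure M (S \<inter> D') \<le> 0" using share[OF j D'(1)] by (simp add: algebra_simps)
      then have SD0: "measure M (S \<inter> D') = 0" using N1 by (simp add: mult_le_0_iff measure_le_0_iff)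
      have "measure M (S \<inter> D \<inter> T j) \<le> measure M ((D \<inter> T j - D') \<union> (S \<inter> D'))"
        using m by (intro finite_measure_mono) auto
      also have "\<dots> \<le> measure M (D \<inter> T j - D') + measure M (S \<inter> D')"
        using m by (intro measure_Un_le) auto
      finally show ?thesis using D'(2) SD0 by (simp add: measure_le_0_iff)
    qed
    have "\<delta> * measure M S \<le> measure M (S \<inter> D)" using dens[OF SF] by simp
    also have "\<dots> = 0" using part[of "S \<inter> D"] SM D(1) zero by simp
    finally show False using \<delta> Spos by (simp add: mult_le_0_iff)
  qed
  then show ?thesis by (intro that[OF \<theta> SF N0] null notI)
qed


text \<open>Player \<open>t\<close> is penalized by the mass of the players \<open>s \<in> S\<close> with \<open>\<theta> s \<le> \<theta> t\<close> who take the same action.\<close>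

lemma game_without_equilibrium:
  fixes XA :: "'p topology" and X\<Gamma> :: "'c topology" and a :: "nat \<Rightarrow> 'p" and \<phi> :: "nat \<Rightarrow> 'p \<Rightarrow> real"
    and I :: "nat \<Rightarrow> 'a set \<Rightarrow> 'c \<Rightarrow> real" and \<theta> :: "'a \<Rightarrow> real" and N :: nat
  assumes \<theta>: "\<theta> \<in> borel_measurable F" and S: "S \<in> sets F" and null: "\<And>x. measure M (S \<inter> \<theta> -` {x}) = 0"
    and obst: "\<And>\<iota>. \<iota> \<in> M \<rightarrow>\<^sub>M count_space UNIV \<Longrightarrow> \<forall>t\<in>space M. \<iota> t < N \<Longrightarrow>
      \<not> (AE t in M. t \<in> S \<longrightarrow> (\<forall>j<N. measure M (S \<inter> {s\<in>space M. \<iota> s = \<iota> t} \<inter> \<theta> -` {..\<theta> t})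
           \<le> measure M (S \<inter> {s\<in>space M. \<iota> s = j} \<inter> \<theta> -` {..\<theta> t})))"
    and XA: "topspace XA = a ` {..<N}" and \<phi>: "\<And>i. i < N \<Longrightarrow> continuous_map XA euclideanreal (\<phi> i)"
    and \<phi>a: "\<And>i j. i < N \<Longrightarrow> j < N \<Longrightarrow> \<phi> i (a j) = (if i = j then 1 else 0)"
    and I_cont: "\<And>i B. i < N \<Longrightarrow> B \<in> sets F \<Longrightarrow> continuous_map X\<Gamma> euclideanreal (I i B)"
    and I_lip: "\<And>i B B' c. i < N \<Longrightarrow> B \<in> sets F \<Longrightarrow> B' \<in> sets F \<Longrightarrow> c \<in> topspace X\<Gamma> \<Longrightarrow>
      \<bar>I i B c - I i B' c\<bar> \<le> measure M (sym_diff B B')"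
    and I_0: "\<And>i c. i < N \<Longrightarrow> c \<in> topspace X\<Gamma> \<Longrightarrow> I i {} c = 0"
    and E_top: "\<And>g. g \<in> M \<rightarrow>\<^sub>M borel_of XA \<Longrightarrow> E g \<in> topspace X\<Gamma>"
    and I_E: "\<And>g i B. g \<in> M \<rightarrow>\<^sub>M borel_of XA \<Longrightarrow> i < N \<Longrightarrow> B \<in> sets F \<Longrightarrow>
      I i B (E g) = measure M (B \<inter> {t\<in>space M. g t = a i})"
  shows "\<exists>G. payoff_assignment F XA X\<Gamma> G \<and> (\<nexists>g. nash_equilibrium M XA E G g)"
proof -
  let ?X = "prod_topology XA X\<Gamma>"
  define lev where "lev x = S \<inter> \<theta> -` {..x}" for x
  have lev: "lev x \<in> sets F" for x
  proof -
    have "lev x = S \<inter> (\<theta> -` {..x} \<inter> space F)" using sets.sets_into_space[OF S] by (auto simp: lev_def)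
    then show ?thesis using S measurable_sets[OF \<theta>, of "{..x}"] by auto
  qed
  \<comment> \<open>The factor \<open>\<phi> i (fst p)\<close> selects the term of the own action in
    a continuous way.\<close>
  define raw where "raw x p = - (\<Sum>i<N. \<phi> i (fst p) * I i (lev x) (snd p))" for x p
  \<comment> \<open>Members of \<open>cfunspace\<close> are extensional functions, hence the
    restriction.\<close>
  define pay where "pay x = restrict (raw x) (topspace ?X)" for x
  have pay: "pay x (a j, c) = - I j (lev x) c" if "j < N" "c \<in> topspace X\<Gamma>" for x j c
  proof -
    have "(\<Sum>i<N. \<phi> i (a j) * I i (lev x) c) = (\<Sum>i<N. if i = j then I i (lev x) c else 0)"
      by (intro sum.cong) (auto simp: \<phi>a that)
    then show ?thesis using that by (simp add: pay_def raw_def XA)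
  qed
  have top: "\<exists>j c. p = (a j, c) \<and> j < N \<and> c \<in> topspace X\<Gamma>" if "p \<in> topspace ?X" for p
    using that by (auto simp: XA)
  have dist_pay: "dist (pay x p) (pay y p) \<le> \<bar>measure M (lev x) - measure M (lev y)\<bar>" if p: "p \<in> topspace ?X" for x y p
  proof -
    obtain j c where jc: "p = (a j, c)" "j < N" "c \<in> topspace X\<Gamma>" using top[OF p] by blast
    have "dist (pay x p) (pay y p) = \<bar>I j (lev x) c - I j (lev y) c\<bar>"
      by (simp add: jc pay[OF jc(2,3)] dist_real_def abs_minus_commute)
    also have "\<dots> \<le> measure M (sym_diff (lev x) (lev y))" by (rule I_lip[OF jc(2) lev lev jc(3)])
    also have "\<dots> = \<bar>measure M (lev x) - measure M (lev y)\<bar>"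
    proof -
      have *: "measure M (sym_diff (lev x) (lev y)) = measure M (lev y) - measure M (lev x)" if "x \<le> y" for x y
      proof -
        have sub: "lev x \<subseteq> lev y" using that by (auto simp: lev_def)
        then have "sym_diff (lev x) (lev y) = lev y - lev x" by auto
        then show ?thesis using finite_measure_Diff[OF sets_F[OF lev] sets_F[OF lev] sub] by simp
      qed
      have mono: "measure M (lev x) \<le> measure M (lev y)" if "x \<le> y" for x y
        using that by (intro finite_measure_mono sets_F lev) (auto simp: lev_def)
      show ?thesis
      proof (cases "x \<le> y")
        case True then show ?thesis using *[OF True] mono[OF True] by simp
      next
        case False
        then have "y \<le> x" by simp
        then show ?thesis using *[of y x] mono[of y x] by (simp add: Un_commute)
      qed
    qed
    finally show ?thesis .
  qed
  have pay_mem: "pay x \<in> mspace (payoff_functions XA X\<Gamma>)" for x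
  proof -
    have "\<bar>pay x p\<bar> \<le> 1" if p: "p \<in> topspace ?X" for p
    proof -
      obtain j c where jc: "p = (a j, c)" "j < N" "c \<in> topspace X\<Gamma>" using top[OF p] by blast
      have "\<bar>I j (lev x) c - I j {} c\<bar> \<le> measure M (sym_diff (lev x) {})" by (rule I_lip[OF jc(2) lev _ jc(3)]) simp
      also have "\<dots> \<le> 1" by simp
      finally show ?thesis using pay[OF jc(2,3)] I_0[OF jc(2,3)] jc(1) by simp
    qed
    then have "bounded (pay x ` topspace ?X)" unfolding bounded_iff by (intro exI[of _ 1]) auto
    moreover have "continuous_map ?X euclideanreal (pay x)"
    proof (rule continuous_map_eq)
      show "continuous_map ?X euclideanreal (raw x)"
        unfolding raw_def
        by (intro continuous_map_minus continuous_map_sum continuous_map_real_mult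
            continuous_map_compose[OF continuous_map_fst \<phi>, unfolded o_def] continuous_map_compose[OF continuous_map_snd I_cont, unfolded o_def] lev) auto
    qed (simp add: pay_def)
    ultimately show ?thesis
      unfolding payoff_functions_def by (simp add: pay_def)
  qed
  \<comment> \<open>The sets \<open>lev x\<close> are nested, so the distance of two payoff
    functions is at most the difference of the masses, which is continuous in \<open>x\<close>
    because \<open>\<theta>\<close> has no atoms on \<open>S\<close>. Measurability of the
    assignment thus reduces to that of \<open>\<theta>\<close>.\<close>
  have cont: "continuous_map euclideanreal (mtopology_of (payoff_functions XA X\<Gamma>)) pay"
  proof -
    interpret C: Metric_space "mspace (payoff_functions XA X\<Gamma>)" "mdist (payoff_functions XA X\<Gamma>)" by simp
    show ?thesis
      unfolding mtopology_of_def C.continuous_map_to_metric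
    proof (intro ballI allI impI)
      fix x e :: real assume e: "e > 0"
      have "isCont (\<lambda>x. measure M (lev x)) x"
        unfolding lev_def by (rule diffuse_law_isCont[OF sets_F[OF S] meas_F[OF \<theta>] null])
      then obtain d where d: "d > 0" "\<And>y. dist y x < d \<Longrightarrow> dist (measure M (lev y)) (measure M (lev x)) < e"
        unfolding continuous_at_eps_delta using e by blast
      show "\<exists>U. openin euclideanreal U \<and> x \<in> U \<and> (\<forall>y\<in>U. pay y \<in> C.mball (pay x) e)"
      proof (intro exI conjI ballI)
        show "openin euclideanreal (ball x d)" "x \<in> ball x d" using d(1) by auto
        fix y assume "y \<in> ball x d"
        then have "\<bar>measure M (lev x) - measure M (lev y)\<bar> < e" using d(2)[of y] by (simp add: dist_commute dist_real_def abs_minus_commute)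
        moreover have "mdist (payoff_functions XA X\<Gamma>) (pay x) (pay y) \<le> \<bar>measure M (lev x) - measure M (lev y)\<bar>"
          unfolding payoff_functions_def using dist_pay by (intro mdist_cfunspace_le) auto
        ultimately show "pay y \<in> C.mball (pay x) e" using pay_mem by simp
      qed
    qed
  qed
  have G: "payoff_assignment F XA X\<Gamma> (\<lambda>t. pay (\<theta> t))"
    unfolding payoff_assignment_def
  proof (rule measurable_borel_of)
    show "pay (\<theta> t) \<in> topspace (mtopology_of (payoff_functions XA X\<Gamma>))" for t using pay_mem by simp
    fix U assume "openin (mtopology_of (payoff_functions XA X\<Gamma>)) U"
    from openin_continuous_map_preimage[OF cont this] have "open {x. pay x \<in> U}" by simp
    then have "\<theta> -` {x. pay x \<in> U} \<inter> space F \<in> sets F" by (intro measurable_sets[OF \<theta>]) simp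
    moreover have "\<theta> -` {x. pay x \<in> U} \<inter> space F = {t \<in> space F. pay (\<theta> t) \<in> U}" by auto
    ultimately show "{t \<in> space F. pay (\<theta> t) \<in> U} \<in> sets F" by simp
  qed
  have "\<not> nash_equilibrium M XA E (\<lambda>t. pay (\<theta> t)) g" for g
  proof
    assume ne: "nash_equilibrium M XA E (\<lambda>t. pay (\<theta> t)) g"
    then have g: "g \<in> M \<rightarrow>\<^sub>M borel_of XA"
      and eq: "AE t in M. \<forall>p\<in>topspace XA. pay (\<theta> t) (p, E g) \<le> pay (\<theta> t) (g t, E g)"
      by (auto simp: nash_equilibrium_def)
    \<comment> \<open>The index of the action taken, recovered through the functions
      \<open>\<phi> i\<close>; in this form it inherits its measurability from
      \<open>g\<close>.\<close>
    define \<iota> where "\<iota> t = (LEAST i. i < N \<and> \<phi> i (g t) = 1)" for t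
    have \<iota>M: "\<iota> \<in> M \<rightarrow>\<^sub>M count_space UNIV"
      unfolding \<iota>_def
    proof (rule measurable_Least)
      fix i show "Measurable.pred M (\<lambda>t. i < N \<and> \<phi> i (g t) = 1)"
      proof (cases "i < N")
        case True
        have [measurable]: "(\<lambda>t. \<phi> i (g t)) \<in> borel_measurable M"
          by (rule continuous_map_borel_measurable[OF g \<phi>[OF True]])
        show ?thesis by measurable
      qed simp
    qed
    have \<iota>: "\<iota> t < N \<and> g t = a (\<iota> t)" "\<forall>i<N. \<iota> t = i \<longleftrightarrow> g t = a i" if t: "t \<in> space M" for t
    proof -
      obtain j where j: "j < N" "g t = a j" using measurable_space[OF g t] by (auto simp: XA)
      have 1: "\<iota> t = j"
        unfolding \<iota>_def by (rule Least_equality) (use j \<phi>a in \<open>auto split: if_splits\<close>)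
      then show "\<iota> t < N \<and> g t = a (\<iota> t)" using j by simp
      have "g t = a i \<Longrightarrow> i < N \<Longrightarrow> i = j" for i using \<phi>a[of j i] \<phi>a[of j j] j by (auto split: if_splits)
      then show "\<forall>i<N. \<iota> t = i \<longleftrightarrow> g t = a i" using 1 j by auto
    qed
    have H: "I i (lev x) (E g) = measure M (S \<inter> {s\<in>space M. \<iota> s = i} \<inter> \<theta> -` {..x})" if i: "i < N" for i x
    proof -
      have "lev x \<inter> {t\<in>space M. g t = a i} = S \<inter> {s\<in>space M. \<iota> s = i} \<inter> \<theta> -` {..x}"
        using \<iota>(2) i by (auto simp: lev_def)
      then show ?thesis using I_E[OF g i lev] by simp
    qed
    have "AE t in M. t \<in> S \<longrightarrow> (\<forall>j<N. measure M (S \<inter> {s\<in>space M. \<iota> s = \<iota> t} \<inter> \<theta> -` {..\<theta> t})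
           \<le> measure M (S \<inter> {s\<in>space M. \<iota> s = j} \<inter> \<theta> -` {..\<theta> t}))"
      using eq AE_space
    proof eventually_elim
      case (elim t)
      show ?case
      proof (intro impI allI)
        fix j assume j: "j < N"
        have \<iota>t: "\<iota> t < N" "g t = a (\<iota> t)" using \<iota>(1)[OF elim(2)] by auto
        have "pay (\<theta> t) (a j, E g) \<le> pay (\<theta> t) (g t, E g)" using elim(1) j by (auto simp: XA)
        then have "I (\<iota> t) (lev (\<theta> t)) (E g) \<le> I j (lev (\<theta> t)) (E g)"
          unfolding \<iota>t(2) by (simp add: pay[OF j E_top[OF g]] pay[OF \<iota>t(1) E_top[OF g]])
        then show "measure M (S \<inter> {s\<in>space M. \<iota> s = \<iota> t} \<inter> \<theta> -` {..\<theta> t}) \<le> measure M (S \<inter> {s\<in>space M. \<iota> s = j} \<inter> \<theta> -` {..\<theta> t})"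
          by (simp add: H[OF j] H[OF \<iota>t(1)])
      qed
    qed
    then show False using obst[OF \<iota>M] \<iota>(1) by blast
  qed
  with G show ?thesis by blast
qed

end

text \<open>The preimage of \<open>{-1..1}\<close> is closed and convex. The bound will make
  integrals of a coordinate of the aggregate Lipschitz in the set of integration.\<close>

lemma abs_le_1_on_closed_convex_hull:
  fixes \<phi> :: "'z::real_vector \<Rightarrow> real"
  assumes \<phi>: "linear \<phi>" "continuous_map X euclideanreal \<phi>" "topspace X = UNIV"
    and A: "\<And>a. a \<in> A \<Longrightarrow> \<bar>\<phi> a\<bar> \<le> 1" and x: "x \<in> X closure_of (convex hull A)"
  shows "\<bar>\<phi> x\<bar> \<le> 1"
proof -
  have "convex (\<phi> -` {-1..1})" by (rule convex_linear_vimage[OF \<phi>(1)]) simp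
  then have "convex hull A \<subseteq> \<phi> -` {-1..1}" using A by (intro hull_minimal) (auto simp: abs_le_iff minus_le_iff)
  moreover have "closedin X (\<phi> -` {-1..1})"
    using closedin_continuous_map_preimage[OF \<phi>(2), of "{-1..1}"] \<phi>(3) by (simp add: vimage_def)
  ultimately have "X closure_of (convex hull A) \<subseteq> \<phi> -` {-1..1}" by (intro closure_of_minimal)
  then show ?thesis using x by (auto simp: abs_le_iff)
qed

section \<open>The game without equilibrium in the two cases\<close>

context prob_subalgebra
begin

lemma abs_diff_indicator_integrals:
  fixes u :: "'a \<Rightarrow> real"
  assumes u: "u \<in> borel_measurable M" "\<And>t. t \<in> space M \<Longrightarrow> \<bar>u t\<bar> \<le> 1" and B: "B \<in> sets M" "B' \<in> sets M"
  shows "\<bar>(LINT t|M. indicator B t * u t) - (LINT t|M. indicator B' t * u t)\<bar> \<le> measure M (sym_diff B B')"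
proof -
  have I: "integrable M (\<lambda>t. indicator B t * u t)" if "B \<in> sets M" for B
    using that u by (intro integrable_const_bound[of _ 1]) (auto simp: indicator_def)
  have "\<bar>(LINT t|M. indicator B t * u t) - (LINT t|M. indicator B' t * u t)\<bar> = \<bar>LINT t|M. indicator B t * u t - indicator B' t * u t\<bar>"
    using I[OF B(1)] I[OF B(2)] by simp
  also have "\<dots> \<le> (LINT t|M. \<bar>indicator B t * u t - indicator B' t * u t\<bar>)" by (rule integral_abs_bound)
  also have "\<dots> \<le> (LINT t|M. indicator (sym_diff B B') t)"
  proof (rule integral_mono)
    show "integrable M (\<lambda>t. \<bar>indicator B t * u t - indicator B' t * u t\<bar>)" using I[OF B(1)] I[OF B(2)] by auto
    show "integrable M (indicat_real (sym_diff B B'))" using B by (intro integrable_indicator_finite) auto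
  qed (use u(2) in \<open>auto simp: indicator_def\<close>)
  also have "\<dots> = measure M (sym_diff B B')" using B by simp
  finally show ?thesis .
qed

text \<open>The number \<open>N\<close> of actions cannot be bounded in advance, whence infinite
  dimension. A finite action set is weakly compact, and \<open>I i B\<close> integrates the
  \<open>i\<close>-th coordinate of the aggregate over \<open>B\<close>. For the aggregate of a
  profile this is the mass of the players in \<open>B\<close> who take the action
  \<open>a i\<close>.\<close>

lemma bochner_game_without_equilibrium:
  assumes inf: "infinite_dimensional TYPE('x::{banach, second_countable_topology})"
    and at: "atomless M" and cg: "countably_generated F" and ne: "\<not> nowhere_equivalent M F"
  shows "\<exists>(A :: 'x set) G. bochner_large_game M F A G \<and> (\<nexists>g. bochner_nash_equilibrium M F A G g)"
proof -
  let ?N = "restr_to_subalg M F"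
  obtain \<theta> :: "'a \<Rightarrow> real" and S and N :: nat where \<theta>: "\<theta> \<in> borel_measurable F" and S: "S \<in> sets F" and N: "N > 0"
    and null: "\<And>x. measure M (S \<inter> \<theta> -` {x}) = 0"
    and obst: "\<And>\<iota>. \<iota> \<in> M \<rightarrow>\<^sub>M count_space UNIV \<Longrightarrow> \<forall>t\<in>space M. \<iota> t < N \<Longrightarrow>
      \<not> (AE t in M. t \<in> S \<longrightarrow> (\<forall>j<N. measure M (S \<inter> {s\<in>space M. \<iota> s = \<iota> t} \<inter> \<theta> -` {..\<theta> t})
           \<le> measure M (S \<inter> {s\<in>space M. \<iota> s = j} \<inter> \<theta> -` {..\<theta> t})))"
    by (rule not_nowhere_equivalent_obstruction[OF at cg ne]) (rule that; assumption)
  obtain a :: "nat \<Rightarrow> 'x" and f :: "nat \<Rightarrow> 'x \<Rightarrow>\<^sub>L real"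
    where af: "\<And>i j. i < N \<Longrightarrow> j < N \<Longrightarrow> blinfun_apply (f i) (a j) = (if i = j then 1 else 0)"
    using biorthogonal_system[OF inf, of N] by blast
  define A where "A = a ` {..<N}"
  have A: "A \<noteq> {}" using N by (auto simp: A_def)
  have cA: "compactin weak_topology A" by (rule finite_imp_compactin) (auto simp: A_def)
  have top: "topspace (bochner_actions A) = A" by (simp add: bochner_actions_def)
  obtain R where R: "\<And>a. a \<in> A \<Longrightarrow> norm a \<le> R" using weak_compact_bounded[OF cA] by blast
  define \<Phi> where "\<Phi> i B u = (LINT t|M. indicator B t * blinfun_apply (f i) (u t))" for i B and u :: "'a \<Rightarrow> 'x"
  define I where "I i B c = \<Phi> i B (SOME h. h \<in> c)" for i B c
  have \<Phi>I: "integrable M (\<lambda>t. indicator B t * blinfun_apply (f i) (u t))" if "B \<in> sets F" "integrable M u" for i B u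
    using integrable_mult_indicator[OF sets_F[OF that(1)] integrable_bounded_linear[OF blinfun.bounded_linear_right that(2), of "f i"]] by simp
  have \<Phi>D: "\<Phi> i B \<in> L1_dual ?N" if B: "B \<in> sets F" for i B
  proof -
    have 1: "\<Phi> i B (\<lambda>t. u t + v t) = \<Phi> i B u + \<Phi> i B v" if "integrable ?N u" "integrable ?N v" for u v
    proof -
      have uv: "integrable M u" "integrable M v" using that by (auto simp: integrable_restr_iff)
      show ?thesis using \<Phi>I[OF B uv(1), of i] \<Phi>I[OF B uv(2), of i] by (simp add: \<Phi>_def blinfun.add_right algebra_simps)
    qed
    have 2: "\<Phi> i B (\<lambda>t. r *\<^sub>R u t) = r * \<Phi> i B u" for r u
      by (simp add: \<Phi>_def blinfun.scaleR_right algebra_simps)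
    have 3: "\<bar>\<Phi> i B u\<bar> \<le> norm (f i) * (LINT t|?N. norm (u t))" if "integrable ?N u" for u
    proof -
      have u: "integrable M u" "u \<in> borel_measurable F" using that by (auto simp: integrable_restr_iff)
      have "\<bar>\<Phi> i B u\<bar> \<le> norm (f i) * (LINT t|M. norm (u t))"
        unfolding \<Phi>_def
      proof (rule integrable_pairing(2)[where L = "\<lambda>t v. indicator B t * blinfun_apply (f i) v", OF _ _ _ u(1)])
        note d = F_dual_fieldD[OF F_dual_field_indicator[OF B, of "f i"]]
        show "bounded_linear (\<lambda>v. indicator B t * blinfun_apply (f i) v)" if "t \<in> space M" for t by (rule d(1)[OF that])
        show "(\<lambda>t. indicator B t * blinfun_apply (f i) v) \<in> borel_measurable M" for v by (rule d(3))
        show "\<bar>indicator B t * blinfun_apply (f i) v\<bar> \<le> norm (f i) * norm v" if "t \<in> space M" for t v by (rule d(4)[OF that])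
      qed
      also have "(LINT t|M. norm (u t)) = (LINT t|?N. norm (u t))"
        by (rule integral_restr[symmetric], rule measurable_compose[OF u(2) borel_measurable_norm])
      finally show ?thesis .
    qed
    show ?thesis unfolding L1_dual_def using 1 2 3 by blast
  qed
  have "\<exists>G. payoff_assignment F (bochner_actions A) (bochner_aggregates M F A) G \<and>
    (\<nexists>g. nash_equilibrium M (bochner_actions A) (bochner_cond_exp M F) G g)"
  proof (rule game_without_equilibrium[where N = N and a = a and \<phi> = "\<lambda>i. blinfun_apply (f i)" and I = I, OF \<theta> S null obst])
    show "topspace (bochner_actions A) = a ` {..<N}" using top by (simp add: A_def)
    show "continuous_map (bochner_actions A) euclideanreal (blinfun_apply (f i))" for i
      unfolding bochner_actions_def by (rule continuous_map_from_subtopology[OF weak_continuous_functional])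
    show "blinfun_apply (f i) (a j) = (if i = j then 1 else 0)" if "i < N" "j < N" for i j by (rule af[OF that])
    show "continuous_map (bochner_aggregates M F A) euclideanreal (I i B)" if "B \<in> sets F" for i B
      unfolding bochner_aggregates_def L1_weak_topology_def I_def
      by (intro continuous_map_from_subtopology continuous_map_initial_topology) (use \<Phi>D[OF that] in blast)
    show "\<bar>I i B c - I i B' c\<bar> \<le> measure M (sym_diff B B')"
      if i: "i < N" and B: "B \<in> sets F" "B' \<in> sets F" and c: "c \<in> topspace (bochner_aggregates M F A)" for i B B' c
    proof -
      obtain h where h: "integrable ?N h" "c = L1_class ?N h" using c by (auto simp: bochner_aggregates_def L1_space_def)
      obtain \<gamma> where \<gamma>: "\<gamma> \<in> c" "\<gamma> \<in> space M \<rightarrow> weak_topology closure_of (convex hull A)"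
        using c by (auto simp: bochner_aggregates_def)
      have "I i B c = \<Phi> i B \<gamma>" if "B \<in> sets F" for B
        using L1_class_functional[OF \<Phi>D[OF that] h(1)] L1_dual_constant_on_class[OF \<Phi>D[OF that] h(1)] \<gamma>(1) by (simp add: I_def h(2))
      moreover have "\<bar>\<Phi> i B \<gamma> - \<Phi> i B' \<gamma>\<bar> \<le> measure M (sym_diff B B')"
        unfolding \<Phi>_def
      proof (rule abs_diff_indicator_integrals[OF _ _ sets_F[OF B(1)] sets_F[OF B(2)]])
        have "integrable M \<gamma>" using \<gamma>(1) by (auto simp: h(2) L1_class_def integrable_restr_iff)
        from integrable_bounded_linear[OF blinfun.bounded_linear_right this, of "f i"]
        show "(\<lambda>t. blinfun_apply (f i) (\<gamma> t)) \<in> borel_measurable M" by auto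
        show "\<bar>blinfun_apply (f i) (\<gamma> t)\<bar> \<le> 1" if "t \<in> space M" for t
        proof (rule abs_le_1_on_closed_convex_hull[OF _ weak_continuous_functional topspace_weak_topology])
          show "linear (blinfun_apply (f i))" by (rule bounded_linear.linear[OF blinfun.bounded_linear_right])
          show "\<bar>blinfun_apply (f i) x\<bar> \<le> 1" if "x \<in> A" for x using that af i by (auto simp: A_def)
          show "\<gamma> t \<in> weak_topology closure_of (convex hull A)" using \<gamma>(2) that by blast
        qed
      qed
      ultimately show ?thesis using B by simp
    qed
    show "I i {} c = 0" for i c by (simp add: I_def \<Phi>_def)
    show "bochner_cond_exp M F g \<in> topspace (bochner_aggregates M F A)" if "g \<in> M \<rightarrow>\<^sub>M borel_of (bochner_actions A)" for g
      by (rule bochner_cond_exp_aggregate[OF A R that])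
    show "I i B (bochner_cond_exp M F g) = measure M (B \<inter> {t\<in>space M. g t = a i})"
      if g: "g \<in> M \<rightarrow>\<^sub>M borel_of (bochner_actions A)" and i: "i < N" and B: "B \<in> sets F" for g i B
    proof -
      have "I i B (bochner_cond_exp M F g) = (LINT t|M. indicator B t * blinfun_apply (f i) (g t))"
        unfolding I_def
        by (rule bochner_cond_exp_functional[OF A R g \<Phi>D[OF B] F_dual_field_indicator[OF B]]) (assumption | rule \<Phi>_def)+
      also have "\<dots> = (LINT t|M. indicator (B \<inter> {t\<in>space M. g t = a i}) t)"
      proof (rule Bochner_Integration.integral_cong[OF refl])
        fix t assume t: "t \<in> space M"
        obtain j where j: "j < N" "g t = a j" using bochner_actions_borel(1)[OF g t] by (auto simp: A_def)
        have "g t = a i \<longleftrightarrow> i = j" using af[OF i i] af[OF i j(1)] j by (auto split: if_splits)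
        then show "indicator B t * blinfun_apply (f i) (g t) = indicator (B \<inter> {t\<in>space M. g t = a i}) t"
          using t af[OF i j(1)] j(2) by (auto simp: indicator_def)
      qed
      also have "\<dots> = measure M (B \<inter> {t\<in>space M. g t = a i})"
      proof -
        have "{t\<in>space M. g t = a i} \<in> sets M" using bochner_actions_borel(2)[OF g] by measurable
        then show ?thesis using sets_F[OF B] by simp
      qed
      finally show ?thesis .
    qed
  qed
  then show ?thesis
    using A cA unfolding bochner_large_game_def bochner_nash_equilibrium_def by blast
qed

text \<open>The biorthogonal system is taken in the predual with exchanged roles: its functionals
  are the actions, and its vectors \<open>y i\<close> test the aggregate through the integrable
  functions \<open>indicator B t *\<^sub>R y i\<close>, whose pairings are among those defining the
  topology of aggregates.\<close>

lemma gelfand_game_without_equilibrium: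
  assumes inf: "infinite_dimensional TYPE('y::{banach, second_countable_topology})"
    and at: "atomless M" and cg: "countably_generated F" and ne: "\<not> nowhere_equivalent M F"
  shows "\<exists>(A :: ('y \<Rightarrow>\<^sub>L real) set) G. gelfand_large_game M F A G \<and> (\<nexists>g. gelfand_nash_equilibrium M F A G g)"
proof -
  let ?N = "restr_to_subalg M F"
  obtain \<theta> :: "'a \<Rightarrow> real" and S and N :: nat where \<theta>: "\<theta> \<in> borel_measurable F" and S: "S \<in> sets F" and N: "N > 0"
    and null: "\<And>x. measure M (S \<inter> \<theta> -` {x}) = 0"
    and obst: "\<And>\<iota>. \<iota> \<in> M \<rightarrow>\<^sub>M count_space UNIV \<Longrightarrow> \<forall>t\<in>space M. \<iota> t < N \<Longrightarrow>
      \<not> (AE t in M. t \<in> S \<longrightarrow> (\<forall>j<N. measure M (S \<inter> {s\<in>space M. \<iota> s = \<iota> t} \<inter> \<theta> -` {..\<theta> t})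
           \<le> measure M (S \<inter> {s\<in>space M. \<iota> s = j} \<inter> \<theta> -` {..\<theta> t})))"
    by (rule not_nowhere_equivalent_obstruction[OF at cg ne]) (rule that; assumption)
  obtain y :: "nat \<Rightarrow> 'y" and a :: "nat \<Rightarrow> 'y \<Rightarrow>\<^sub>L real"
    where ay: "\<And>i j. i < N \<Longrightarrow> j < N \<Longrightarrow> blinfun_apply (a i) (y j) = (if i = j then 1 else 0)"
    using biorthogonal_system[OF inf, of N] by blast
  define A where "A = a ` {..<N}"
  have A: "A \<noteq> {}" using N by (auto simp: A_def)
  have cA: "compactin weak_star_topology A" by (rule finite_imp_compactin) (auto simp: A_def strong_operator_topology_topspace)
  have top: "topspace (gelfand_actions A) = A" by (simp add: gelfand_actions_def strong_operator_topology_topspace)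
  obtain R where R: "\<And>a. a \<in> A \<Longrightarrow> norm a \<le> R" using weak_star_compact_bounded[OF cA] by blast
  define I where "I i B c = (LINT t|?N. blinfun_apply ((SOME h. h \<in> c) t) (indicator B t *\<^sub>R y i))"
    for i B and c :: "('a \<Rightarrow> 'y \<Rightarrow>\<^sub>L real) set"
  have "\<exists>G. payoff_assignment F (gelfand_actions A) (gelfand_aggregates M F A) G \<and>
    (\<nexists>g. nash_equilibrium M (gelfand_actions A) (gelfand_cond_exp M F) G g)"
  proof (rule game_without_equilibrium[where N = N and a = a and \<phi> = "\<lambda>i x. blinfun_apply x (y i)" and I = I, OF \<theta> S null obst])
    show "topspace (gelfand_actions A) = a ` {..<N}" using top by (simp add: A_def)
    show "continuous_map (gelfand_actions A) euclideanreal (\<lambda>x. blinfun_apply x (y i))" for i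
      unfolding gelfand_actions_def by (rule continuous_map_from_subtopology[OF weak_star_continuous_eval])
    show "blinfun_apply (a j) (y i) = (if i = j then 1 else 0)" if "i < N" "j < N" for i j using ay[OF that(2,1)] by auto
    show "continuous_map (gelfand_aggregates M F A) euclideanreal (I i B)" if "B \<in> sets F" for i B
      unfolding gelfand_aggregates_def Linf_weak_star_topology_def I_def
      by (intro continuous_map_from_subtopology continuous_map_initial_topology CollectI exI[of _ "\<lambda>t. indicator B t *\<^sub>R y i"] conjI refl
          integrable_indicator_restr that)
    show "\<bar>I i B c - I i B' c\<bar> \<le> measure M (sym_diff B B')"
      if i: "i < N" and B: "B \<in> sets F" "B' \<in> sets F" and c: "c \<in> topspace (gelfand_aggregates M F A)" for i B B' c
    proof -
      obtain h where h: "weak_star_measurable ?N h" "c = Linf_star_class ?N h"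
      proof -
        have "topspace (Linf_weak_star_topology ?N) = (Linf_star_space ?N :: ('a \<Rightarrow> 'y \<Rightarrow>\<^sub>L real) set set)"
          unfolding Linf_weak_star_topology_def by (rule topspace_initial_topology) (auto intro!: exI[of _ "\<lambda>_. 0"])
        then show ?thesis using c that by (auto simp: gelfand_aggregates_def Linf_star_space_def)
      qed
      obtain \<gamma> where \<gamma>: "\<gamma> \<in> c" "\<gamma> \<in> space M \<rightarrow> weak_star_topology closure_of (convex hull A)"
        using c by (auto simp: gelfand_aggregates_def)
      have mF: "(\<lambda>t. blinfun_apply (k t) v) \<in> borel_measurable F" if "k \<in> c" for k v
        using that by (auto simp: h(2) Linf_star_class_def weak_star_measurable_def intro: measurable_in_subalg'[OF subalg])
      have I: "I i B c = (LINT t|M. indicator B t * blinfun_apply (\<gamma> t) (y i))" if B: "B \<in> sets F" for B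
      proof -
        define k where "k = (SOME h. h \<in> c)"
        have kc: "k \<in> c" unfolding k_def by (rule someI[of "\<lambda>h. h \<in> c", OF \<gamma>(1)])
        have "AE t in ?N. k t = h t" "AE t in ?N. \<gamma> t = h t" using kc \<gamma>(1) by (auto simp: h(2) Linf_star_class_def)
        then have "AE t in ?N. k t = \<gamma> t" by eventually_elim simp
        then have AE: "AE t in M. k t = \<gamma> t" by (rule AE_restr_to_subalg[OF subalg])
        have m: "(\<lambda>t. indicator B t * blinfun_apply (k t) (y i)) \<in> borel_measurable F" if "k \<in> c" for k
          by (intro borel_measurable_times borel_measurable_indicator B mF that)
        have "I i B c = (LINT t|?N. indicator B t * blinfun_apply (k t) (y i))"
          by (simp add: I_def k_def blinfun.scaleR_right)
        also have "\<dots> = (LINT t|M. indicator B t * blinfun_apply (k t) (y i))" by (rule integral_restr[OF m[OF kc]])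
        also have "\<dots> = (LINT t|M. indicator B t * blinfun_apply (\<gamma> t) (y i))"
        proof (rule integral_cong_AE[OF meas_F[OF m[OF kc]] meas_F[OF m[OF \<gamma>(1)]]])
          show "AE t in M. indicator B t * blinfun_apply (k t) (y i) = indicator B t * blinfun_apply (\<gamma> t) (y i)"
            using AE by eventually_elim simp
        qed
        finally show ?thesis .
      qed
      show ?thesis
        unfolding I[OF B(1)] I[OF B(2)]
      proof (rule abs_diff_indicator_integrals[OF meas_F[OF mF[OF \<gamma>(1)]] _ sets_F[OF B(1)] sets_F[OF B(2)]])
        show "\<bar>blinfun_apply (\<gamma> t) (y i)\<bar> \<le> 1" if "t \<in> space M" for t
        proof (rule abs_le_1_on_closed_convex_hull[where \<phi> = "\<lambda>x. blinfun_apply x (y i)", OF _ weak_star_continuous_eval strong_operator_topology_topspace])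
          show "linear (\<lambda>x. blinfun_apply x (y i))" by (rule bounded_linear.linear[OF blinfun.bounded_linear_left])
          show "\<bar>blinfun_apply x (y i)\<bar> \<le> 1" if "x \<in> A" for x using that ay i by (auto simp: A_def)
          show "\<gamma> t \<in> weak_star_topology closure_of (convex hull A)" using \<gamma>(2) that by blast
        qed
      qed
    qed
    show "I i {} c = 0" for i c by (simp add: I_def)
    show "gelfand_cond_exp M F g \<in> topspace (gelfand_aggregates M F A)" if "g \<in> M \<rightarrow>\<^sub>M borel_of (gelfand_actions A)" for g
      by (rule gelfand_cond_exp_aggregate[OF A R that])
    show "I i B (gelfand_cond_exp M F g) = measure M (B \<inter> {t\<in>space M. g t = a i})"
      if g: "g \<in> M \<rightarrow>\<^sub>M borel_of (gelfand_actions A)" and i: "i < N" and B: "B \<in> sets F" for g i B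
    proof -
      have val: "g t = a i \<longleftrightarrow> blinfun_apply (g t) (y i) = 1" "blinfun_apply (g t) (y i) \<in> {0, 1}" if t: "t \<in> space M" for t
      proof -
        obtain j where j: "j < N" "g t = a j" using gelfand_actions_borel(1)[OF g t] by (auto simp: A_def)
        show "g t = a i \<longleftrightarrow> blinfun_apply (g t) (y i) = 1" "blinfun_apply (g t) (y i) \<in> {0, 1}"
          using ay[OF i i] ay[OF j(1) i] j by (auto split: if_splits)
      qed
      have "I i B (gelfand_cond_exp M F g) = (LINT t|M. blinfun_apply (g t) (indicator B t *\<^sub>R y i))"
        unfolding I_def by (rule gelfand_cond_exp_functional[OF A R g integrable_indicator_restr[OF B]])
      also have "\<dots> = (LINT t|M. indicator (B \<inter> {t\<in>space M. g t = a i}) t)"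
      proof (rule Bochner_Integration.integral_cong[OF refl])
        fix t assume t: "t \<in> space M"
        show "blinfun_apply (g t) (indicator B t *\<^sub>R y i) = indicator (B \<inter> {t\<in>space M. g t = a i}) t"
          using t val[OF t] by (auto simp: indicator_def blinfun.scaleR_right)
      qed
      also have "\<dots> = measure M (B \<inter> {t\<in>space M. g t = a i})"
      proof -
        have "{t\<in>space M. g t = a i} = {t\<in>space M. blinfun_apply (g t) (y i) = 1}" using val(1) by auto
        also have "\<dots> \<in> sets M" using gelfand_actions_borel(2)[OF g, of "y i"] by measurable
        finally show ?thesis using sets_F[OF B] by simp
      qed
      finally show ?thesis .
    qed
  qed
  then show ?thesis
    using A cA unfolding gelfand_large_game_def gelfand_nash_equilibrium_def by blast
qed

end

theorem theorem4:
  fixes M F :: "'t measure"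
  assumes "prob_space M" and "complete_measure M" and "atomless M"
    and "subalgebra M F" and "countably_generated F"
  shows "(infinite_dimensional TYPE('x::{banach, second_countable_topology}) \<longrightarrow>
          radon_nikodym_property TYPE('x \<Rightarrow>\<^sub>L real) \<longrightarrow>
            (nowhere_equivalent M F \<longleftrightarrow>
              (\<forall>(A::'x set) G. bochner_large_game M F A G \<longrightarrow>
                 (\<exists>g. bochner_nash_equilibrium M F A G g)))) \<and>
         (infinite_dimensional TYPE('y::{banach, second_countable_topology}) \<longrightarrow>
            (nowhere_equivalent M F \<longleftrightarrow>
              (\<forall>(A::('y \<Rightarrow>\<^sub>L real) set) G. gelfand_large_game M F A G \<longrightarrow>
                 (\<exists>g. gelfand_nash_equilibrium M F A G g))))"
proof -
  interpret prob_space M by (rule assms(1))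
  interpret prob_subalgebra M F
    by unfold_locales (rule assms(4))
  have "\<exists>g. bochner_nash_equilibrium M F A G g" if "nowhere_equivalent M F" "bochner_large_game M F A G" for A :: "'x set" and G
    by (rule bochner_equilibrium_exists[OF that(1) assms(5) that(2)])
  moreover have "\<exists>g. gelfand_nash_equilibrium M F A G g" if "nowhere_equivalent M F" "gelfand_large_game M F A G"
    for A :: "('y \<Rightarrow>\<^sub>L real) set" and G
    by (rule gelfand_equilibrium_exists[OF that(1) assms(5) that(2)])
  moreover have "\<exists>(A :: 'x set) G. bochner_large_game M F A G \<and> (\<nexists>g. bochner_nash_equilibrium M F A G g)"
    if "infinite_dimensional TYPE('x)" "\<not> nowhere_equivalent M F"
    by (rule bochner_game_without_equilibrium[OF that(1) assms(3,5) that(2)])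
  moreover have "\<exists>(A :: ('y \<Rightarrow>\<^sub>L real) set) G. gelfand_large_game M F A G \<and> (\<nexists>g. gelfand_nash_equilibrium M F A G g)"
    if "infinite_dimensional TYPE('y)" "\<not> nowhere_equivalent M F"
    by (rule gelfand_game_without_equilibrium[OF that(1) assms(3,5) that(2)])
  ultimately show ?thesis by meson
qed

end
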